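(* \textsc{Unweighted Flexible Graph Connectivity} parameterized by the vertex-deletion distance $\ell$ to cluster graphs can be solved in $f(\ell)\cdot n^3$ time for some computable function $f$, where $n=|V|$.
   Context: A graph $G=(V,S,U)$ is an undirected graph on vertex set $V$ whose edge set $S\cup U$ is partitioned into safe edges $S$ and unsafe edges $U$. An edge set $T\subseteq S\cup U$ is an unsafe spanning connected subgraph of $G$ if $(V,T)$ is connected and, for every unsafe edge $e\in T\cap U$, $(V,T\setminus\{e\})$ is connected. \textsc{Unweighted Flexible Graph Connectivity}: given $G=(V,S,U)$ and an integer $k$, decide whether $G$ has an unsafe spanning connected subgraph $T$ with $|T|\le k$. A cluster graph is a graph each of whose connected components is a clique; the vertex-deletion distance to cluster graphs of $G$ is the minimum size of a set $K\subseteq V$ such that $(V,S\cup U)-K$ is a cluster graph. *)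

theory Defs
  imports Complex_Main
begin

section \<open>Graphs with safe and unsafe edges\<close>

text \<open>Undirected simple graphs; an edge is a two-element set of vertices.\<close>

definition su_graph :: "'a set \<Rightarrow> 'a set set \<Rightarrow> 'a set set \<Rightarrow> bool" where
  "su_graph V S U \<longleftrightarrow>
     finite V \<and> S \<union> U \<subseteq> {e. e \<subseteq> V \<and> card e = 2} \<and> S \<inter> U = {}"

definition reach :: "'a set set \<Rightarrow> 'a \<Rightarrow> 'a \<Rightarrow> bool" where
  "reach E u v \<longleftrightarrow> (u, v) \<in> {(x, y). {x, y} \<in> E}\<^sup>*"

definition connected_graph :: "'a set \<Rightarrow> 'a set set \<Rightarrow> bool" where
  "connected_graph V E \<longleftrightarrow> (\<forall>u\<in>V. \<forall>v\<in>V. reach E u v)"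

definition unsafe_spanning_connected ::
    "'a set \<Rightarrow> 'a set set \<Rightarrow> 'a set set \<Rightarrow> 'a set set \<Rightarrow> bool" where
  "unsafe_spanning_connected V S U T \<longleftrightarrow>
     T \<subseteq> S \<union> U \<and> connected_graph V T \<and>
     (\<forall>e \<in> T \<inter> U. connected_graph V (T - {e}))"

definition unweighted_FGC :: "'a set \<Rightarrow> 'a set set \<Rightarrow> 'a set set \<Rightarrow> int \<Rightarrow> bool" where
  "unweighted_FGC V S U k \<longleftrightarrow>
     (\<exists>T. unsafe_spanning_connected V S U T \<and> int (card T) \<le> k)"

definition components_of_graph :: "'a set \<Rightarrow> 'a set set \<Rightarrow> 'a set set" where
  "components_of_graph V E = {{v \<in> V. reach E u v} | u. u \<in> V}"

definition clique :: "'a set set \<Rightarrow> 'a set \<Rightarrow> bool" where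
  "clique E C \<longleftrightarrow> (\<forall>x\<in>C. \<forall>y\<in>C. x \<noteq> y \<longrightarrow> {x, y} \<in> E)"

definition cluster_graph :: "'a set \<Rightarrow> 'a set set \<Rightarrow> bool" where
  "cluster_graph V E \<longleftrightarrow> (\<forall>C \<in> components_of_graph V E. clique E C)"

text \<open>The set of candidate sizes below is nonempty, because \<open>K = V\<close> is admissible.\<close>

definition cluster_distance :: "'a set \<Rightarrow> 'a set set \<Rightarrow> nat" where
  "cluster_distance V E =
     (LEAST l. \<exists>K \<subseteq> V. card K = l \<and> cluster_graph (V - K) {e \<in> E. e \<inter> K = {}})"


section \<open>Random access machine\<close>

text \<open>
  Running times refer to a word RAM, presented as a language of structured programs over
  registers and a random access memory.  Every arithmetic operation, memory access and
  evaluated test costs one step.  \<open>Sub\<close> is truncated subtraction and division by \<open>0\<close> gives \<open>0\<close>.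
\<close>

datatype operand = Imm nat | Reg nat

datatype arith_op = Add | Sub | Mul | Div

datatype test = Eq operand operand | Lt operand operand

datatype prog =
    Skip
  | Arith nat arith_op operand operand
  | Load nat operand
  | Store operand operand
  | Seq prog prog
  | If test prog prog
  | While test prog

type_synonym state = "(nat \<Rightarrow> nat) \<times> (nat \<Rightarrow> nat)" \<comment> \<open>registers and memory\<close>

fun val :: "(nat \<Rightarrow> nat) \<Rightarrow> operand \<Rightarrow> nat" where
  "val R (Imm c) = c"
| "val R (Reg r) = R r"

fun arith :: "arith_op \<Rightarrow> nat \<Rightarrow> nat \<Rightarrow> nat" where
  "arith Add x y = x + y"
| "arith Sub x y = x - y"
| "arith Mul x y = x * y"
| "arith Div x y = x div y"

fun holds :: "(nat \<Rightarrow> nat) \<Rightarrow> test \<Rightarrow> bool" where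
  "holds R (Eq a b) \<longleftrightarrow> val R a = val R b"
| "holds R (Lt a b) \<longleftrightarrow> val R a < val R b"

text \<open>
  \<open>exec W c s t s'\<close>: started in \<open>s\<close>, the program \<open>c\<close> halts in \<open>s'\<close> after exactly \<open>t\<close> steps, and
  every value written on the way is smaller than \<open>W\<close>, i.e. fits into a word of
  \<open>log 2 W\<close> bits.  A write of a larger value blocks the execution; it does not wrap around.
  Without such a bound, unit cost multiplication would be unreasonably powerful.
\<close>

inductive exec :: "nat \<Rightarrow> prog \<Rightarrow> state \<Rightarrow> nat \<Rightarrow> state \<Rightarrow> bool" for W :: nat where
  Skip: "exec W Skip s 1 s"
| Arith: "x = arith f (val R a) (val R b) \<Longrightarrow> x < W \<Longrightarrow>
    exec W (Arith r f a b) (R, M) 1 (R(r := x), M)"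
| Load: "x = M (val R a) \<Longrightarrow> x < W \<Longrightarrow>
    exec W (Load r a) (R, M) 1 (R(r := x), M)"
| Store: "x = val R b \<Longrightarrow> x < W \<Longrightarrow>
    exec W (Store a b) (R, M) 1 (R, M(val R a := x))"
| Seq: "exec W c1 s t1 s1 \<Longrightarrow> exec W c2 s1 t2 s2 \<Longrightarrow>
    exec W (Seq c1 c2) s (t1 + t2) s2"
| IfTrue: "holds (fst s) b \<Longrightarrow> exec W c1 s t s' \<Longrightarrow>
    exec W (If b c1 c2) s (t + 1) s'"
| IfFalse: "\<not> holds (fst s) b \<Longrightarrow> exec W c2 s t s' \<Longrightarrow>
    exec W (If b c1 c2) s (t + 1) s'"
| WhileFalse: "\<not> holds (fst s) b \<Longrightarrow> exec W (While b c) s 1 s"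
| WhileTrue: "holds (fst s) b \<Longrightarrow> exec W c s t1 s1 \<Longrightarrow> exec W (While b c) s1 t2 s2 \<Longrightarrow>
    exec W (While b c) s (t1 + t2 + 1) s2"

inductive_cases exec_elims:
  "exec W Skip s t s'"
  "exec W (Arith r f a b) s t s'"
  "exec W (Load r a) s t s'"
  "exec W (Store a b) s t s'"
  "exec W (Seq c1 c2) s t s'"
  "exec W (If b c1 c2) s t s'"

inductive_cases exec_While: "exec W (While b c) s t s'"

lemma exec_deterministic:
  "exec W c s t s' \<Longrightarrow> exec W' c s u s'' \<Longrightarrow> u = t \<and> s'' = s'"
proof (induction arbitrary: u s'' rule: exec.induct)
  case (WhileFalse s b c)
  from WhileFalse.prems WhileFalse.hyps show ?case by (auto elim: exec_While)
next
  case (WhileTrue s b c t1 s1 t2 s2)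
  from WhileTrue.prems show ?case
    by (rule exec_While) (use WhileTrue in \<open>fastforce+\<close>)
next
  case (Seq c1 s t1 s1 c2 t2 s2)
  from Seq.prems show ?case by (rule exec_elims) (use Seq.IH in \<open>blast\<close>)
next
  case (IfTrue s b c1 t s' c2)
  from IfTrue.prems show ?case by (rule exec_elims) (use IfTrue in \<open>auto\<close>)
next
  case (IfFalse s b c2 t s' c1)
  from IfFalse.prems show ?case by (rule exec_elims) (use IfFalse in \<open>auto\<close>)
qed (auto elim: exec_elims)

text \<open>
  Total computability.  Argument and result are passed in register \<open>0\<close>; no resource
  bound is imposed, since \<open>W\<close> and \<open>t\<close> depend arbitrarily on the argument.
\<close>

definition computable :: "(nat \<Rightarrow> nat) \<Rightarrow> bool" where
  "computable f \<longleftrightarrow>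
     (\<exists>c. \<forall>x. \<exists>W t R M. exec W c ((\<lambda>_. 0)(0 := x), \<lambda>_. 0) t (R, M) \<and> R 0 = f x)"

text \<open>
  An instance with vertex set \<open>{..<n}\<close> is given by \<open>n\<close>, the absolute value and the sign of \<open>k\<close>
  in registers \<open>0\<close>, \<open>1\<close>, \<open>2\<close>, and the adjacency matrix stored row by row in memory
  (\<open>0\<close> for a non-edge, \<open>1\<close> for a safe edge, \<open>2\<close> for an unsafe edge).
\<close>

definition instance_state :: "nat \<Rightarrow> nat set set \<Rightarrow> nat set set \<Rightarrow> int \<Rightarrow> state" where
  "instance_state n S U k =
     ((\<lambda>_. 0)(0 := n, 1 := nat \<bar>k\<bar>, 2 := (if k < 0 then 1 else 0)),
      (\<lambda>a. if a < n * n then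
             (let e = {a div n, a mod n} in if e \<in> S then 1 else if e \<in> U then 2 else 0)
           else 0))"

end

(*
  Label every vertex with its safe component and call an edge safe if its ends have equal labels.
  A set of edges is a solution if every nontrivial cut contains a safe edge or two edges.

  One pass over all triples packs disjoint induced paths on three vertices into a modulator K, so
  that |K| <= 3 * l + 1 and the rest of the graph is a disjoint union of cliques.  Two rules shrink
  the instance.  A vertex of a clique with more than 4 * |K| + 4 twins (equal neighbourhoods in K,
  and equal labels or pairwise different labels that do not occur in K) costs exactly one edge: in
  an optimal solution in which the clique contains a non-bridge, comparing the edges at the twins
  with a Hamiltonian cycle through them produces a twin of degree two, which can be suppressed;
  otherwise a twin can be made a leaf.  Among more than 2 * 2 ^ |K| isomorphic cliques one is not
  needed to connect K, because each of the 2 ^ |K| cuts of K needs at most two of them; deleting it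
  costs the optimum of that clique with K contracted.  Afterwards both the number and the sizes of
  the cliques are bounded in |K|, and exhaustive search finishes.

  The algorithm is written in a language of bounded loops and bounded sums.  Static bounds on the
  numbers of iterations give its running time and the word size after compilation, and the
  parameter dependence stays below an iterated exponential, which is computable.
*)
theory Submission
  imports Defs "HOL-Library.Extended_Nat" "HOL-Combinatorics.Transposition"
begin

section \<open>Cuts and bridges\<close>

text \<open>In terms of bridges the cut condition reads: connected, and every bridge is safe. Safety
  is thus demanded of bridges only. Hence vertices with equal neighbourhoods in K and labels foreign
  to K can be interchanged although their labels differ, once the clique has no bridge inside.
  Without this second kind of twins the number of labels in a clique would not be bounded in |K|.
  The constants come from one replacement: the edges at a part P of a clique that stay inside P and
  K can be traded for |P| + 2 * |K| edges. Time n^3 rules out applying the rules until nothing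
  changes. Both rules compare a vertex or a clique only with earlier ones that were kept, so later
  decisions never spoil what is established and one pass suffices. The budget is not bounded in n;
  costs of subproblems are capped at |k| + 1, so k enters the word size but not the number of steps.
  Vertex 0 always belongs to K: this keeps K nonempty, gives the search a root outside all cuts, and
  is the 1 in 3 * l + 1.\<close>

definition crosses :: "'a set \<Rightarrow> 'a set \<Rightarrow> bool" where
  "crosses X e \<longleftrightarrow> e \<inter> X \<noteq> {} \<and> e - X \<noteq> {}"

definition cut :: "'a set set \<Rightarrow> 'a set \<Rightarrow> 'a set set" where
  "cut T X = {e \<in> T. crosses X e}"

definition conn :: "'a set \<Rightarrow> 'a set set \<Rightarrow> bool" where
  "conn V T \<longleftrightarrow> (\<forall>X. X \<subseteq> V \<longrightarrow> X \<noteq> {} \<longrightarrow> X \<noteq> V \<longrightarrow> (\<exists>e\<in>T. crosses X e))"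

definition safe :: "('a \<Rightarrow> 'b) \<Rightarrow> 'a set \<Rightarrow> bool" where
  "safe lab e \<longleftrightarrow> (\<forall>x\<in>e. \<forall>y\<in>e. lab x = lab y)"

text \<open>A cut violates this exactly if it is empty or consists of one unsafe edge.\<close>

definition okc :: "('a \<Rightarrow> 'b) \<Rightarrow> 'a set set \<Rightarrow> bool" where
  "okc lab D \<longleftrightarrow> (\<exists>e\<in>D. safe lab e) \<or> (\<exists>e\<in>D. \<exists>e'\<in>D. e \<noteq> e')"

definition incident :: "'a set set \<Rightarrow> 'a \<Rightarrow> 'a set set" where
  "incident T v = {e \<in> T. v \<in> e}"

lemma crosses_doubleton [simp]: "crosses X {a, b} \<longleftrightarrow> (a \<in> X) \<noteq> (b \<in> X)"
  by (auto simp: crosses_def)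

lemma in_cut: "e \<in> cut T X \<longleftrightarrow> e \<in> T \<and> crosses X e"
  by (simp add: cut_def)

lemma safe_doubleton [simp]: "safe lab {a, b} \<longleftrightarrow> lab a = lab b"
  by (auto simp: safe_def)

lemma card2E:
  assumes "card e = 2" obtains a b where "e = {a, b}" "a \<noteq> b"
  using assms by (auto simp: card_2_iff)

lemma edge_atE:
  assumes "card e = 2" "q \<in> e" obtains y where "e = {q, y}" "y \<noteq> q"
proof -
  obtain a b where ab: "e = {a, b}" "a \<noteq> b" using assms(1) by (rule card2E)
  show thesis
  proof (cases "q = a")
    case True
    then show ?thesis using that[of b] ab by simp
  next
    case False
    then show ?thesis using that[of a] ab assms(2) by (simp add: insert_commute)
  qed
qed

lemma crosses_symdiff:
  assumes "card e = 2"
  shows "crosses ((X - Y) \<union> (Y - X)) e \<longleftrightarrow> crosses X e \<noteq> crosses Y e"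
  using assms by (elim card2E) auto

lemma crosses_compl: "e \<subseteq> V \<Longrightarrow> crosses (V - X) e \<longleftrightarrow> crosses X e"
  by (auto simp: crosses_def)

lemma okc_mono: "okc lab D \<Longrightarrow> D \<subseteq> D' \<Longrightarrow> okc lab D'"
  unfolding okc_def by blast

lemma okcI1: "e \<in> D \<Longrightarrow> safe lab e \<Longrightarrow> okc lab D"
  unfolding okc_def by blast

lemma okcI2: "e \<in> D \<Longrightarrow> e' \<in> D \<Longrightarrow> e \<noteq> e' \<Longrightarrow> okc lab D"
  unfolding okc_def by blast

lemma okc_nonempty: "okc lab D \<Longrightarrow> \<exists>e. e \<in> D"
  unfolding okc_def by blast

lemma not_okcD: "\<not> okc lab D \<Longrightarrow> e \<in> D \<Longrightarrow> D = {e} \<and> \<not> safe lab e"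
  unfolding okc_def by blast

lemma connE:
  assumes "conn V T" "X \<subseteq> V" "X \<noteq> {}" "X \<noteq> V"
  obtains e where "e \<in> T" "crosses X e"
  using assms unfolding conn_def by blast

lemma connected_graph_iff_conn:
  assumes T: "\<And>e. e \<in> T \<Longrightarrow> card e = 2 \<and> e \<subseteq> V"
  shows "connected_graph V T \<longleftrightarrow> conn V T"
proof
  assume L: "connected_graph V T"
  show "conn V T"
    unfolding conn_def
  proof (intro allI impI)
    fix X assume X: "X \<subseteq> V" "X \<noteq> {}" "X \<noteq> V"
    then obtain u v where u: "u \<in> X" and v: "v \<in> V" "v \<notin> X" by blast
    then have "(u, v) \<in> {(x, y). {x, y} \<in> T}\<^sup>*"
      using L X by (auto simp: connected_graph_def reach_def)
    then have "v \<notin> X \<longrightarrow> (\<exists>e\<in>T. crosses X e)"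
    proof induction
      case base
      then show ?case using u by blast
    next
      case (step y z)
      then have "{y, z} \<in> T" by blast
      moreover have "crosses X {y, z} \<longleftrightarrow> (y \<in> X) \<noteq> (z \<in> X)" by simp
      ultimately show ?case using step.IH by metis
    qed
    then show "\<exists>e\<in>T. crosses X e" using v by blast
  qed
next
  assume R: "conn V T"
  show "connected_graph V T"
    unfolding connected_graph_def
  proof (intro ballI)
    fix u v assume uv: "u \<in> V" "v \<in> V"
    define X where "X = {w \<in> V. reach T u w}"
    have uX: "u \<in> X" using uv by (auto simp: X_def reach_def)
    have "X = V"
    proof (rule ccontr)
      assume "X \<noteq> V"
      then obtain e where e: "e \<in> T" "crosses X e"
        using connE[OF R _ _ \<open>X \<noteq> V\<close>] uX X_def by blast
      then obtain a b where ab: "e = {a, b}" "a \<noteq> b" using T card2E by metis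
      obtain x y where xy: "e = {x, y}" "x \<in> X" "y \<notin> X"
      proof (cases "a \<in> X")
        case True then show ?thesis using that[of a b] e ab by simp
      next
        case False then show ?thesis using that[of b a] e ab by auto
      qed
      have "y \<in> V" using T[OF e(1)] xy by blast
      moreover have "reach T u y"
        using xy e(1) unfolding X_def reach_def
        by (auto intro: rtrancl_into_rtrancl)
      ultimately show False using xy by (simp add: X_def)
    qed
    then show "reach T u v" using uv by (auto simp: X_def)
  qed
qed

text \<open>Parity of cuts under symmetric difference drives all exchanges below: a bridge
  \<open>f\<close> with cut \<open>{f}\<close> at \<open>Y\<close> can be removed from the cut at \<open>X\<close> by passing to the symmetric
  difference of \<open>X\<close> and \<open>Y\<close>.\<close>

lemma bridge_exchange:
  assumes T2: "\<And>e. e \<in> T \<Longrightarrow> card e = 2"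
    and conn: "conn V (T - D)"
    and Y: "Y \<subseteq> V" "cut T Y = {f}"
    and g: "card g = 2" "g \<subseteq> V" "crosses Y g"
  shows "conn V (insert g (T - {f} - D))"
  unfolding conn_def
proof (intro allI impI)
  fix X assume X: "X \<subseteq> V" "X \<noteq> {}" "X \<noteq> V"
  show "\<exists>e\<in>insert g (T - {f} - D). crosses X e"
  proof (cases "crosses X g")
    case False
    obtain e' where e': "e' \<in> T - D" "crosses X e'" using conn X by (elim connE)
    show ?thesis
    proof (cases "e' = f")
      case True
      define Z where "Z = (X - Y) \<union> (Y - X)"
      have Z: "\<And>e. card e = 2 \<Longrightarrow> crosses Z e \<longleftrightarrow> crosses X e \<noteq> crosses Y e"
        unfolding Z_def by (rule crosses_symdiff)
      have "crosses Z g" using Z g False by blast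
      then have "Z \<noteq> {}" "Z \<noteq> V" "Z \<subseteq> V"
        using g(2) X Y unfolding crosses_def Z_def by auto
      then obtain e where e: "e \<in> T - D" "crosses Z e" using conn by (elim connE)
      have fY: "crosses Y f" using Y(2) by (auto simp: cut_def)
      have "e \<noteq> f" using e Z[of e] T2 e'(2) True fY by auto
      then have "\<not> crosses Y e" using Y(2) e by (auto simp: cut_def)
      then have "crosses X e" using e Z[of e] T2 by auto
      then show ?thesis using e \<open>e \<noteq> f\<close> by blast
    qed (use e' in blast)
  qed blast
qed

text \<open>The bridge \<open>f\<close> and an edge {a, b} beyond it are traded for a path from a
  over v to b. If nothing left over crosses X, then \<open>f\<close> does, and v lies on the same
  side of X as one of a, b; hence the symmetric difference of X and Y separates v from that vertex
  and is crossed by an edge that crosses X but not Y. The set \<open>D\<close> serves two purposes: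
  \<open>D = {}\<close> gives connectivity, singletons show that an edge is not a bridge
  afterwards.\<close>

lemma bridge_subdivide:
  assumes T2: "\<And>e. e \<in> T \<Longrightarrow> card e = 2"
    and conn: "conn V (T - D)"
    and Y: "Y \<subseteq> V" "cut T Y = {f}" "f = {z, v}" "v \<in> Y" "z \<notin> Y" "z \<in> V"
    and ab: "a \<notin> Y" "b \<notin> Y" "a \<in> V" "b \<in> V"
    and N: "({v, a} \<in> N \<and> {v, b} \<in> N) \<or> ({a, b} \<in> D \<and> ({v, a} \<in> N \<or> {v, b} \<in> N))"
  shows "conn V ((T - {f, {a, b}} - D) \<union> N)"
  unfolding conn_def
proof (intro allI impI)
  fix X assume X: "X \<subseteq> V" "X \<noteq> {}" "X \<noteq> V"
  show "\<exists>e\<in>(T - {f, {a, b}} - D) \<union> N. crosses X e"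
  proof (rule ccontr)
    assume no: "\<not> ?thesis"
    obtain e' where e': "e' \<in> T - D" "crosses X e'" using conn X by (elim connE)
    have e'2: "e' = f \<or> e' = {a, b}" using no e' by blast
    have noN: "\<And>e. e \<in> N \<Longrightarrow> \<not> crosses X e" using no by blast
    have abX: "e' = {a, b} \<Longrightarrow> False"
      using noN[of "{v, a}"] noN[of "{v, b}"] e' N by auto
    with e'2 have e'f: "e' = f" by blast
    define Z where "Z = (X - Y) \<union> (Y - X)"
    have Z: "\<And>e. card e = 2 \<Longrightarrow> crosses Z e \<longleftrightarrow> crosses X e \<noteq> crosses Y e"
      unfolding Z_def by (rule crosses_symdiff)
    have fX: "crosses X f" using e' e'f by simp
    have fY: "crosses Y f" using Y by auto
    obtain c where c: "c = a \<or> c = b" "{v, c} \<in> N" using N by blast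
    have "(c \<in> X) = (v \<in> X)" using noN[OF c(2)] by auto
    moreover have "(z \<in> X) \<noteq> (v \<in> X)" using fX Y(3) by simp
    moreover have "c \<notin> Y" "c \<in> V" using c ab by auto
    ultimately have "Z \<noteq> {}" "Z \<noteq> V" "Z \<subseteq> V"
      using Y X unfolding Z_def by blast+
    then obtain e where e: "e \<in> T - D" "crosses Z e" using conn by (elim connE)
    have "e \<noteq> f" using e Z[of e] T2 fX fY by auto
    then have nY: "\<not> crosses Y e" using Y(2) e by (auto simp: cut_def)
    then have eX: "crosses X e" using e Z[of e] T2 by auto
    then have "e = {a, b}" using no e \<open>e \<noteq> f\<close> by blast
    then show False using eX e noN[of "{v, a}"] noN[of "{v, b}"] N by auto
  qed
qed

section \<open>Solutions of a labelled graph, their bridges and optimal values\<close>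

locale lgraph =
  fixes E :: "'a set set" and lab :: "'a \<Rightarrow> 'b"
  assumes E2: "e \<in> E \<Longrightarrow> card e = 2"
begin

definition induced :: "'a set \<Rightarrow> 'a set set" where
  "induced V = {e \<in> E. e \<subseteq> V}"

definition sol :: "'a set \<Rightarrow> 'a set set \<Rightarrow> bool" where
  "sol V T \<longleftrightarrow> T \<subseteq> induced V \<and>
     (\<forall>X. X \<subseteq> V \<longrightarrow> X \<noteq> {} \<longrightarrow> X \<noteq> V \<longrightarrow> okc lab (cut T X))"

text \<open>With \<open>R\<close> contracted to a single vertex, only the cuts avoiding \<open>R\<close> remain.\<close>

definition solR :: "'a set \<Rightarrow> 'a set \<Rightarrow> 'a set set \<Rightarrow> bool" where
  "solR V R T \<longleftrightarrow> T \<subseteq> induced V \<and>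
     (\<forall>X. X \<subseteq> V - R \<longrightarrow> X \<noteq> {} \<longrightarrow> okc lab (cut T X))"

text \<open>Values in \<open>enat\<close> make infeasible instances infinite, so the equations of
  the reduction rules hold without assuming that a solution exists.\<close>

definition opt :: "'a set \<Rightarrow> enat" where
  "opt V = (INF T\<in>{T. sol V T}. enat (card T))"

definition optR :: "'a set \<Rightarrow> 'a set \<Rightarrow> enat" where
  "optR V R = (INF T\<in>{T. solR V R T}. enat (card T))"

text \<open>The non-bridges of \<open>T\<close>. Their number is the potential that is maximized
  among minimum solutions.\<close>

definition nb :: "'a set \<Rightarrow> 'a set set \<Rightarrow> 'a set set" where
  "nb V T = {e \<in> T. conn V (T - {e})}"

definition mini :: "'a set \<Rightarrow> 'a set set \<Rightarrow> bool" where
  "mini V T \<longleftrightarrow> sol V T \<and> (\<forall>T'. sol V T' \<longrightarrow> card T \<le> card T')"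

lemma sol_edge: "sol V T \<Longrightarrow> e \<in> T \<Longrightarrow> e \<in> E \<and> e \<subseteq> V \<and> card e = 2"
  using E2 by (auto simp: sol_def induced_def)

lemma sol_finite: "finite V \<Longrightarrow> sol V T \<Longrightarrow> finite T"
  by (rule finite_subset[of T "Pow V"]) (auto simp: sol_def induced_def)

lemma solI:
  assumes "\<And>e. e \<in> T \<Longrightarrow> e \<in> E \<and> e \<subseteq> V"
    and "\<And>X. X \<subseteq> V \<Longrightarrow> X \<noteq> {} \<Longrightarrow> X \<noteq> V \<Longrightarrow> okc lab (cut T X)"
  shows "sol V T"
  using assms by (auto simp: sol_def induced_def)

lemma solD: "sol V T \<Longrightarrow> X \<subseteq> V \<Longrightarrow> X \<noteq> {} \<Longrightarrow> X \<noteq> V \<Longrightarrow> okc lab (cut T X)"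
  by (simp add: sol_def)

lemma sol_conn: "sol V T \<Longrightarrow> conn V T"
  using okc_nonempty unfolding sol_def conn_def by (metis in_cut)

lemma sol_unsafe_nb: "sol V T \<Longrightarrow> e \<in> T \<Longrightarrow> \<not> safe lab e \<Longrightarrow> e \<in> nb V T"
  unfolding nb_def conn_def
proof (intro CollectI conjI allI impI)
  fix X assume *: "sol V T" "e \<in> T" "\<not> safe lab e" "X \<subseteq> V" "X \<noteq> {}" "X \<noteq> V"
  then have "okc lab (cut T X)" by (simp add: solD)
  then consider e' where "e' \<in> cut T X" "safe lab e'"
    | e1 e2 where "e1 \<in> cut T X" "e2 \<in> cut T X" "e1 \<noteq> e2"
    unfolding okc_def by blast
  then show "\<exists>e'\<in>T - {e}. crosses X e'"
    using * by cases (auto simp: in_cut)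
qed simp

text \<open>An edge that is alone in some cut is a bridge. So the condition on cuts splits into
  connectivity and the absence of unsafe bridges, which is the form in which exchanges are
  verified.\<close>

lemma sol_iff:
  "sol V T \<longleftrightarrow> T \<subseteq> induced V \<and> conn V T \<and> (\<forall>e\<in>T. \<not> safe lab e \<longrightarrow> conn V (T - {e}))"
proof
  assume "sol V T"
  then show "T \<subseteq> induced V \<and> conn V T \<and> (\<forall>e\<in>T. \<not> safe lab e \<longrightarrow> conn V (T - {e}))"
    using sol_conn sol_unsafe_nb by (auto simp: sol_def nb_def)
next
  assume R: "T \<subseteq> induced V \<and> conn V T \<and> (\<forall>e\<in>T. \<not> safe lab e \<longrightarrow> conn V (T - {e}))"
  have "okc lab (cut T X)" if X: "X \<subseteq> V" "X \<noteq> {}" "X \<noteq> V" for X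
  proof -
    obtain e where e: "e \<in> T" "crosses X e" using connE[OF _ X] R by blast
    show ?thesis
    proof (cases "safe lab e")
      case True
      then show ?thesis using e by (auto simp: okc_def in_cut)
    next
      case False
      then have "conn V (T - {e})" using R e by blast
      then obtain e' where "e' \<in> T - {e}" "crosses X e'" using X by (elim connE)
      then have "e \<in> cut T X" "e' \<in> cut T X" "e \<noteq> e'" using e by (auto simp: in_cut)
      then show ?thesis unfolding okc_def by blast
    qed
  qed
  then show "sol V T" using R by (simp add: sol_def)
qed

text \<open>A set and its complement have the same cut, so the side containing \<open>v\<close> can
  be chosen.\<close>

lemma bridge_cutE:
  assumes "sol V T" "f \<in> T" "f \<notin> nb V T" "v \<in> V"
  obtains Y where "Y \<subseteq> V" "cut T Y = {f}" "v \<in> Y"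
proof -
  have "\<not> conn V (T - {f})" using assms by (auto simp: nb_def)
  then obtain X where X: "X \<subseteq> V" "X \<noteq> {}" "X \<noteq> V" "\<forall>e\<in>T - {f}. \<not> crosses X e"
    by (auto simp: conn_def)
  obtain e where "e \<in> T" "crosses X e" using sol_conn[OF assms(1)] X by (elim connE)
  with X have c: "cut T X = {f}" by (auto simp: cut_def)
  have "cut T (V - X) = cut T X"
    using sol_edge[OF assms(1)] crosses_compl unfolding cut_def by blast
  with c X assms(4) show thesis
    by (cases "v \<in> X") (auto intro: that[of X] that[of "V - X"])
qed

lemma cut_singleton_notin_nb:
  assumes "sol V T" "Y \<subseteq> V" "cut T Y = {f}"
  shows "f \<in> T" "f \<notin> nb V T"
proof -
  show f: "f \<in> T" using assms by (auto simp: cut_def)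
  have c: "crosses Y f" using assms by (auto simp: cut_def)
  then have "Y \<noteq> {}" "Y \<noteq> V" using sol_edge[OF assms(1) f] by (auto simp: crosses_def)
  moreover have "\<not> (\<exists>e\<in>T - {f}. crosses Y e)" using assms(3) by (auto simp: cut_def)
  ultimately show "f \<notin> nb V T" using assms(2) by (auto simp: nb_def conn_def)
qed

lemma sol_cut_compl: "sol V T \<Longrightarrow> cut T (V - X) = cut T X"
  by (auto simp: cut_def crosses_compl dest: sol_edge)

lemma mini_exists:
  assumes "sol V T" obtains T' where "mini V T'" "card T' \<le> card T"
proof -
  obtain T' where "sol V T'" "\<forall>S. sol V S \<longrightarrow> card T' \<le> card S"
    using exists_least_iff[of "\<lambda>m. \<exists>S. sol V S \<and> card S = m"] assms
    by (metis not_le)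
  then show thesis using that assms by (auto simp: mini_def)
qed

lemma mini_exchange:
  assumes "mini V T" "sol V T'" "card T' \<le> card T"
  shows "mini V T'"
  using assms unfolding mini_def by (meson le_trans)

lemma enat_INF_le_iff:
  fixes h :: "'c \<Rightarrow> nat"
  shows "(INF x\<in>A. enat (h x)) \<le> enat k \<longleftrightarrow> (\<exists>x\<in>A. h x \<le> k)"
proof
  assume L: "(INF x\<in>A. enat (h x)) \<le> enat k"
  show "\<exists>x\<in>A. h x \<le> k"
  proof (rule ccontr)
    assume "\<not> ?thesis"
    then have "enat (Suc k) \<le> (INF x\<in>A. enat (h x))"
      by (intro INF_greatest) (auto simp: not_le Suc_le_eq)
    then have "enat (Suc k) \<le> enat k" using L order_trans by blast
    then show False by simp
  qed
next
  assume "\<exists>x\<in>A. h x \<le> k"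
  then show "(INF x\<in>A. enat (h x)) \<le> enat k"
    by (meson INF_lower2 enat_ord_simps(1))
qed

lemma opt_le_iff: "opt V \<le> enat k \<longleftrightarrow> (\<exists>T. sol V T \<and> card T \<le> k)"
  unfolding opt_def by (subst enat_INF_le_iff) auto

lemma optR_le_iff: "optR V R \<le> enat k \<longleftrightarrow> (\<exists>T. solR V R T \<and> card T \<le> k)"
  unfolding optR_def by (subst enat_INF_le_iff) auto

lemma enat_eq_if_le_iff:
  fixes a b :: enat assumes "\<And>k. a \<le> enat k \<longleftrightarrow> b \<le> enat k" shows "a = b"
  by (metis assms antisym enat_ile enat_ord_code(3) le_cases order_refl enat.exhaust)

lemma opt_eq_plus:
  assumes "\<And>T. sol V T \<Longrightarrow> \<exists>T'. sol V' T' \<and> card T' + c \<le> card T"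
    and "\<And>T'. sol V' T' \<Longrightarrow> \<exists>T. sol V T \<and> card T \<le> card T' + c"
  shows "opt V = opt V' + enat c"
proof (rule enat_eq_if_le_iff)
  fix k
  have "opt V' + enat c \<le> enat k \<longleftrightarrow> c \<le> k \<and> opt V' \<le> enat (k - c)"
    by (cases "opt V'") auto
  moreover have "opt V \<le> enat k \<longleftrightarrow> c \<le> k \<and> opt V' \<le> enat (k - c)"
    unfolding opt_le_iff
  proof
    assume "\<exists>T. sol V T \<and> card T \<le> k"
    then obtain T where "sol V T" "card T \<le> k" by blast
    then show "c \<le> k \<and> (\<exists>T. sol V' T \<and> card T \<le> k - c)"
      using assms(1)[of T] by (metis add_leE le_diff_conv2 le_trans)
  next
    assume "c \<le> k \<and> (\<exists>T. sol V' T \<and> card T \<le> k - c)"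
    then obtain T where "sol V' T" "card T + c \<le> k" by auto
    then show "\<exists>T. sol V T \<and> card T \<le> k"
      using assms(2)[of T] by (meson le_trans)
  qed
  ultimately show "opt V \<le> enat k \<longleftrightarrow> opt V' + enat c \<le> enat k" by simp
qed

text \<open>One of X and its complement avoids \<open>r\<close>, and both have the same cut.
  Therefore the exhaustive search written for contracted instances also solves ordinary ones, with a
  single root vertex.\<close>

lemma opt_eq_optR:
  assumes "r \<in> V" shows "opt V = optR V {r}"
proof -
  have "sol V T \<longleftrightarrow> solR V {r} T" for T
  proof
    assume R: "solR V {r} T"
    have sub: "\<And>e. e \<in> T \<Longrightarrow> e \<subseteq> V" using R by (auto simp: solR_def induced_def)
    have "okc lab (cut T X)" if X: "X \<subseteq> V" "X \<noteq> {}" "X \<noteq> V" for X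
    proof (cases "r \<in> X")
      case True
      have "cut T (V - X) = cut T X" using crosses_compl[OF sub] by (auto simp: cut_def)
      moreover have "okc lab (cut T (V - X))"
        using R X True by (auto simp: solR_def)
      ultimately show ?thesis by simp
    next
      case False
      then show ?thesis using R X by (auto simp: solR_def)
    qed
    then show "sol V T" using R by (auto simp: sol_def solR_def)
  next
    assume "sol V T"
    then show "solR V {r} T" using assms by (auto simp: sol_def solR_def)
  qed
  then show ?thesis by (simp add: opt_def optR_def)
qed

lemma cut_insert: "cut (insert e T) X = (if crosses X e then insert e (cut T X) else cut T X)"
  by (auto simp: cut_def)

text \<open>By \<open>bridge_exchange\<close> non-bridges stay non-bridges. The unsafe edges were
  non-bridges already, and the new edge may be a bridge because it is safe.\<close>

lemma sol_exchange:
  assumes S: "sol V T" and Y: "Y \<subseteq> V" "cut T Y = {f}"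
    and g: "g \<in> E" "g \<subseteq> V" "crosses Y g" "safe lab g"
  shows "sol V (insert g (T - {f}))" "card (insert g (T - {f})) = card T"
    "\<And>e. e \<in> nb V T \<Longrightarrow> e \<in> nb V (insert g (T - {f}))"
proof -
  have ft: "f \<in> T" "f \<notin> nb V T" using cut_singleton_notin_nb[OF S Y] by auto
  have T2: "\<And>e. e \<in> T \<Longrightarrow> card e = 2" using sol_edge[OF S] by blast
  have g2: "card g = 2" using g E2 by blast
  have gT: "g \<in> T \<Longrightarrow> g = f" using Y(2) g(3) by (auto simp: cut_def)
  have ex: "conn V (T - D) \<Longrightarrow> conn V (insert g (T - {f} - D))" for D
    by (rule bridge_exchange[OF T2 _ Y g2 g(2,3)])
  show N: "e \<in> nb V (insert g (T - {f}))" if e: "e \<in> nb V T" for e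
  proof -
    have "e \<noteq> f" "e \<noteq> g" "e \<in> T" using e ft gT by (auto simp: nb_def)
    moreover have "conn V (insert g (T - {f} - {e}))" using ex[of "{e}"] e by (simp add: nb_def)
    ultimately show ?thesis by (auto simp: nb_def insert_Diff_if)
  qed
  show "sol V (insert g (T - {f}))"
    unfolding sol_iff
  proof (intro conjI ballI impI)
    show "insert g (T - {f}) \<subseteq> induced V" using S g by (auto simp: sol_def induced_def)
    show "conn V (insert g (T - {f}))" using ex[of "{}"] sol_conn[OF S] by simp
    fix e assume e: "e \<in> insert g (T - {f})" "\<not> safe lab e"
    then have "e \<in> nb V T" using sol_unsafe_nb[OF S] g by blast
    then show "conn V (insert g (T - {f}) - {e})" using N by (auto simp: nb_def)
  qed
  show "card (insert g (T - {f})) = card T"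
  proof (cases "finite T")
    case True
    then have "card T = Suc (card (T - {f}))" using ft by (metis card_Suc_Diff1)
    moreover have "g \<notin> T - {f}" using gT by blast
    ultimately show ?thesis using True by simp
  next
    case False
    then show ?thesis by simp
  qed
qed

text \<open>Safety has to be preserved on bridges only, by \<open>sol_iff\<close>. This is what
  allows vertices with different labels to be interchanged.\<close>

lemma sol_transport:
  assumes S: "sol V T" and inj: "inj_on \<phi> V" and im: "\<phi> ` V = V'"
    and EE: "\<And>e. e \<in> T \<Longrightarrow> \<phi> ` e \<in> E"
    and sf: "\<And>e. e \<in> T \<Longrightarrow> e \<notin> nb V T \<Longrightarrow> safe lab (\<phi> ` e)"
  shows "sol V' ((`) \<phi> ` T)" "card ((`) \<phi> ` T) = card T"
proof -
  have sub: "\<And>e. e \<in> T \<Longrightarrow> e \<subseteq> V" using sol_edge[OF S] by blast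
  have injT: "inj_on ((`) \<phi>) (Pow V)" using inj by (rule inj_on_image_Pow)
  then have injT': "inj_on ((`) \<phi>) T" by (rule inj_on_subset) (use sub in blast)
  then show "card ((`) \<phi> ` T) = card T" by (rule card_image)
  have tr: "conn V' ((`) \<phi> ` D)" if D: "conn V D" "D \<subseteq> T" for D
    unfolding conn_def
  proof (intro allI impI)
    fix X assume X: "X \<subseteq> V'" "X \<noteq> {}" "X \<noteq> V'"
    define X' where "X' = {v \<in> V. \<phi> v \<in> X}"
    have "X' \<subseteq> V" "X' \<noteq> {}" "X' \<noteq> V" using X im by (auto simp: X'_def)
    then obtain e where e: "e \<in> D" "crosses X' e" using D(1) by (elim connE)
    have "crosses X (\<phi> ` e)" using e sub D(2) by (fastforce simp: crosses_def X'_def)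
    then show "\<exists>e\<in>(`) \<phi> ` D. crosses X e" using e by blast
  qed
  show "sol V' ((`) \<phi> ` T)"
    unfolding sol_iff
  proof (intro conjI ballI impI)
    show "(`) \<phi> ` T \<subseteq> induced V'" using EE sub im by (fastforce simp: induced_def)
    show "conn V' ((`) \<phi> ` T)" using tr[OF sol_conn[OF S]] by simp
    fix e' assume e': "e' \<in> (`) \<phi> ` T" "\<not> safe lab e'"
    then obtain e where e: "e \<in> T" "e' = \<phi> ` e" by blast
    then have "conn V (T - {e})" using sf e' by (auto simp: nb_def)
    then have "conn V' ((`) \<phi> ` (T - {e}))" by (rule tr) simp
    moreover have "(`) \<phi> ` (T - {e}) = (`) \<phi> ` T - {e'}"
      using injT' e by (auto simp: inj_on_def)
    ultimately show "conn V' ((`) \<phi> ` T - {e'})" by simp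
  qed
qed

end

text \<open>All that is used of a cycle is that every set splitting \<open>P\<close> is crossed by
  two of its edges. The induction subdivides one edge {a, b} by the new vertex.\<close>

lemma Hamiltonian_cycle_exists:
  assumes "finite P" "3 \<le> card P"
  shows "\<exists>H. card H = card P \<and> finite H \<and> (\<forall>e\<in>H. e \<subseteq> P \<and> card e = 2) \<and>
    (\<forall>X. P \<inter> X \<noteq> {} \<longrightarrow> P - X \<noteq> {} \<longrightarrow> (\<exists>e\<in>H. \<exists>e'\<in>H. e \<noteq> e' \<and> crosses X e \<and> crosses X e'))"
  using assms
proof (induction "card P" arbitrary: P rule: nat_less_induct)
  case (1 P)
  show ?case
  proof (cases "card P = 3")
    case True
    then obtain a b c where P: "P = {a, b, c}" and d: "a \<noteq> b" "b \<noteq> c" "a \<noteq> c"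
      by (auto simp: card_3_iff)
    have d2: "{a, b} \<noteq> {b, c}" "{a, b} \<noteq> {a, c}" "{b, c} \<noteq> {a, c}"
      using d by (auto simp: doubleton_eq_iff)
    let ?H = "{{a, b}, {b, c}, {a, c}}"
    have "\<exists>e\<in>?H. \<exists>e'\<in>?H. e \<noteq> e' \<and> crosses X e \<and> crosses X e'"
      if X: "P \<inter> X \<noteq> {}" "P - X \<noteq> {}" for X
    proof -
      consider "crosses X {a, b}" "crosses X {b, c}" | "crosses X {a, b}" "crosses X {a, c}"
        | "crosses X {b, c}" "crosses X {a, c}"
        using X that unfolding P crosses_doubleton
        by (cases "a \<in> X"; cases "b \<in> X"; cases "c \<in> X"; simp)
      then show ?thesis
      proof cases
        case 1 then show ?thesis using d2(1) by (meson insertCI)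
      next
        case 2 then show ?thesis using d2(2) by (meson insertCI)
      next
        case 3 then show ?thesis using d2(3) by (meson insertCI)
      qed
    qed
    moreover have "card ?H = 3" using d2 by auto
    ultimately show ?thesis using True d unfolding P
      by (intro exI[of _ ?H]) (auto simp: P)
  next
    case False
    then have "P \<noteq> {}" using 1 by auto
    then obtain v where v: "v \<in> P" by blast
    have cP: "card (P - {v}) < card P" "3 \<le> card (P - {v})" "card P = Suc (card (P - {v}))"
      using 1 False v by (auto simp: card_gt_0_iff)
    then obtain H where H: "card H = card (P - {v})" "finite H"
      "\<And>e. e \<in> H \<Longrightarrow> e \<subseteq> P - {v} \<and> card e = 2"
      "\<And>X. (P - {v}) \<inter> X \<noteq> {} \<Longrightarrow> P - {v} - X \<noteq> {} \<Longrightarrow>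
        \<exists>e\<in>H. \<exists>e'\<in>H. e \<noteq> e' \<and> crosses X e \<and> crosses X e'"
      using 1(1)[rule_format, OF cP(1) refl finite_Diff[OF 1(2)] cP(2)] by blast
    have "H \<noteq> {}" using H cP by auto
    then obtain a b where ab: "{a, b} \<in> H" "a \<noteq> b" using H(3) card2E by (metis ex_in_conv)
    have abP: "a \<in> P" "b \<in> P" "a \<noteq> v" "b \<noteq> v" using H(3)[OF ab(1)] by auto
    define H' where "H' = (H - {{a, b}}) \<union> {{a, v}, {v, b}}"
    have new: "{a, v} \<notin> H" "{v, b} \<notin> H" "{a, v} \<noteq> {v, b}"
      using H(3) ab abP by (auto simp: doubleton_eq_iff)
    then have cH: "card H' = card P"
      using H(1,2) ab cP by (auto simp: H'_def card_insert_if)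
    have "\<exists>e\<in>H'. \<exists>e'\<in>H'. e \<noteq> e' \<and> crosses X e \<and> crosses X e'"
      if X: "P \<inter> X \<noteq> {}" "P - X \<noteq> {}" for X
    proof (cases "(P - {v}) \<inter> X \<noteq> {} \<and> P - {v} - X \<noteq> {}")
      case True
      then obtain e e' where e: "e \<in> H" "e' \<in> H" "e \<noteq> e'" "crosses X e" "crosses X e'"
        using H(4)[of X] by blast
      have sub: "\<exists>g\<in>{{a, v}, {v, b}}. crosses X g" if "crosses X {a, b}"
        using that by auto
      show ?thesis
      proof (cases "e = {a, b} \<or> e' = {a, b}")
        case True
        then obtain g where g: "g \<in> {{a, v}, {v, b}}" "crosses X g" using sub e by blast
        show ?thesis
        proof (cases "e = {a, b}")
          case True
          then have "e' \<in> H'" using e by (auto simp: H'_def)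
          moreover have "g \<in> H'" "g \<noteq> e'" using g e new by (auto simp: H'_def)
          ultimately show ?thesis using g e by metis
        next
          case False
          then have "e \<in> H'" using e by (auto simp: H'_def)
          moreover have "g \<in> H'" "g \<noteq> e" using g e new by (auto simp: H'_def)
          ultimately show ?thesis using g e by metis
        qed
      next
        case False
        then have "e \<in> H'" "e' \<in> H'" using e by (auto simp: H'_def)
        then show ?thesis using e by metis
      qed
    next
      case False
      \<comment> \<open>Here X separates just v from the rest of P, so both new edges cross.\<close>
      then have "crosses X {a, v}" "crosses X {v, b}" using X abP v by auto
      then show ?thesis using new(3)
        by (intro bexI[of _ "{a, v}"] bexI[of _ "{v, b}"] conjI) (simp_all add: H'_def)
    qed
    moreover have "\<forall>e\<in>H'. e \<subseteq> P \<and> card e = 2"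
    proof
      fix e assume "e \<in> H'"
      then consider "e \<in> H" | "e = {a, v}" | "e = {v, b}" by (auto simp: H'_def)
      then show "e \<subseteq> P \<and> card e = 2" using H(3)[of e] abP v by cases auto
    qed
    ultimately show ?thesis using cH H(2) by (intro exI[of _ H']) (auto simp: H'_def)
  qed
qed

section \<open>Deleting a vertex of a large twin class\<close>

text \<open>One safe edge or any two edges witness \<open>okc\<close>; failing both, one edge still
  preserves nonemptiness. This is the origin of the term 2 * |K| in the cost of a
  replacement.\<close>

lemma sparsify:
  "\<exists>J\<subseteq>A. finite J \<and> card J \<le> 2 \<and> (okc lab A \<longrightarrow> okc lab J) \<and> (A \<noteq> {} \<longrightarrow> J \<noteq> {})"
proof -
  consider "A = {}" | e where "e \<in> A" "safe lab e" | e where "e \<in> A" "\<not> okc lab A"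
    | e e' where "e \<in> A" "e' \<in> A" "e \<noteq> e'"
    unfolding okc_def by blast
  then show ?thesis
  proof cases
    case 1 then show ?thesis by (intro exI[of _ "{}"]) auto
  next
    case (2 e) then show ?thesis by (intro exI[of _ "{e}"]) (auto simp: okc_def)
  next
    case (3 e) then show ?thesis by (intro exI[of _ "{e}"]) auto
  next
    case (4 e e')
    then have "okc lab {e, e'}" "card {e, e'} = 2" by (auto simp: okc_def)
    with 4 show ?thesis by (intro exI[of _ "{e, e'}"]) auto
  qed
qed

context lgraph
begin

text \<open>A bridge and one non-bridge disappear, two non-bridges appear, and the other non-bridges
  survive. The size does not grow, so this move strictly improves the potential; labels of the new
  edges need no care because neither is a bridge.\<close>

lemma subdivide_move:
  assumes S: "sol V T" and Y: "Y \<subseteq> V" "cut T Y = {f}" and f: "f = {z, v}" "v \<in> Y" "z \<notin> Y"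
    and ab: "{a, b} \<in> nb V T" "a \<noteq> b" "a \<notin> Y" "b \<notin> Y" and va: "{v, a} \<in> E" "{v, b} \<in> E"
    and T1: "T1 = (T - {f, {a, b}}) \<union> {{v, a}, {v, b}}" and fin: "finite T"
  shows "sol V T1" "card T1 \<le> card T" "card (nb V T) < card (nb V T1)"
    "{v, a} \<in> nb V T1"
proof -
  have ft: "f \<in> T" "f \<notin> nb V T" using cut_singleton_notin_nb[OF S Y] by auto
  have T2: "\<And>e. e \<in> T \<Longrightarrow> card e = 2" using sol_edge[OF S] by blast
  have abT: "{a, b} \<in> T" "{a, b} \<noteq> f" using ab ft by (auto simp: nb_def)
  have V: "z \<in> V" "v \<in> V" "a \<in> V" "b \<in> V"
    using sol_edge[OF S ft(1)] sol_edge[OF S abT(1)] f by auto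
  have isf: "e = f" if "e \<in> T" "crosses Y e" for e using Y(2) that by (auto simp: cut_def)
  have new: "{v, a} \<noteq> {v, b}" using ab by (auto simp: doubleton_eq_iff)
  have vaT: "{v, a} \<in> T \<Longrightarrow> {v, a} = f" "{v, b} \<in> T \<Longrightarrow> {v, b} = f"
    using isf[of "{v, a}"] isf[of "{v, b}"] f ab by auto
  have ex: "conn V (T - D) \<Longrightarrow>
      ({v, a} \<in> N \<and> {v, b} \<in> N) \<or> ({a, b} \<in> D \<and> ({v, a} \<in> N \<or> {v, b} \<in> N)) \<Longrightarrow>
      conn V ((T - {f, {a, b}} - D) \<union> N)" for D N
    by (rule bridge_subdivide[OF T2 _ Y f V(1) ab(3,4) V(3,4)])
  have n1: "e \<in> nb V T1" if e: "e \<in> nb V T" "e \<noteq> {a, b}" for e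
  proof -
    have "e \<in> T" "e \<noteq> f" "e \<noteq> {v, a}" "e \<noteq> {v, b}" using e ft vaT by (auto simp: nb_def)
    moreover have "conn V ((T - {f, {a, b}} - {e}) \<union> {{v, a}, {v, b}})"
      by (rule ex) (use e in \<open>auto simp: nb_def\<close>)
    ultimately show ?thesis using e by (auto simp: nb_def T1 Un_Diff insert_Diff_if)
  qed
  have cab: "conn V (T - {{a, b}})" using ab by (simp add: nb_def)
  have "T1 - {{v, a}} = (T - {f, {a, b}} - {{a, b}}) \<union> {{v, b}}"
    using vaT new by (auto simp: T1)
  then have n2: "{v, a} \<in> nb V T1" using ex[OF cab, of "{{v, b}}"] by (simp add: nb_def T1)
  have "T1 - {{v, b}} = (T - {f, {a, b}} - {{a, b}}) \<union> {{v, a}}"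
    using vaT new by (auto simp: T1)
  then have n3: "{v, b} \<in> nb V T1" using ex[OF cab, of "{{v, a}}"] by (simp add: nb_def T1)
  show "{v, a} \<in> nb V T1" by (fact n2)
  show "sol V T1"
    unfolding sol_iff
  proof (intro conjI ballI impI)
    show "T1 \<subseteq> induced V" using S va V by (auto simp: sol_def induced_def T1)
    show "conn V T1" using ex[of "{}" "{{v, a}, {v, b}}"] sol_conn[OF S] by (simp add: T1)
    fix e assume e: "e \<in> T1" "\<not> safe lab e"
    have "e \<in> nb V T1"
    proof (cases "e = {v, a} \<or> e = {v, b}")
      case False
      then have "e \<in> T" "e \<noteq> {a, b}" using e by (auto simp: T1)
      then show ?thesis using n1 sol_unsafe_nb[OF S] e by blast
    qed (use n2 n3 in auto)
    then show "conn V (T1 - {e})" by (simp add: nb_def)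
  qed
  have c: "card (T - {f, {a, b}}) + 2 = card T"
  proof -
    have "card {f, {a, b}} = 2" using abT by auto
    moreover have "{f, {a, b}} \<subseteq> T" using abT ft by auto
    ultimately show ?thesis using fin card_mono[of T "{f, {a, b}}"] by (simp add: card_Diff_subset)
  qed
  have "card T1 \<le> card (T - {f, {a, b}}) + card {{v, a}, {v, b}}"
    unfolding T1 by (rule card_Un_le)
  also have "\<dots> = card T" using c new by simp
  finally show "card T1 \<le> card T" .
  have finN: "finite (nb V T1)" using fin by (auto simp: nb_def T1)
  have "(nb V T - {{a, b}}) \<union> {{v, a}, {v, b}} \<subseteq> nb V T1" using n1 n2 n3 by auto
  then have "card ((nb V T - {{a, b}}) \<union> {{v, a}, {v, b}}) \<le> card (nb V T1)"
    by (rule card_mono[OF finN])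
  moreover have "card ((nb V T - {{a, b}}) \<union> {{v, a}, {v, b}}) = card (nb V T - {{a, b}}) + 2"
  proof -
    have "{v, a} \<notin> nb V T" "{v, b} \<notin> nb V T" using vaT ft by (auto simp: nb_def)
    moreover have "finite (nb V T)" using fin by (auto simp: nb_def)
    ultimately show ?thesis using new by (subst card_Un_disjoint) auto
  qed
  moreover have "card (nb V T) = Suc (card (nb V T - {{a, b}}))"
    using ab fin by (intro card.remove) (auto simp: nb_def)
  ultimately show "card (nb V T) < card (nb V T1)"
    by linarith
qed

lemma sol_remove_leaf:
  assumes S: "sol V T" and q: "q \<in> V" "incident T q = {f}"
  shows "sol (V - {q}) (T - {f})"
proof -
  have f: "f \<in> T" "q \<in> f" using q by (auto simp: incident_def)
  then obtain y where "f = {q, y}" "y \<noteq> q"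
    using sol_edge[OF S] edge_atE by metis
  then have y: "f = {q, y}" "q \<noteq> y" "y \<in> V" using sol_edge[OF S f(1)] by auto
  show ?thesis
  proof (rule solI)
    fix e assume e: "e \<in> T - {f}"
    then have "e \<notin> incident T q" using q by blast
    then show "e \<in> E \<and> e \<subseteq> V - {q}" using sol_edge[OF S] e by (auto simp: incident_def)
  next
    fix X assume X: "X \<subseteq> V - {q}" "X \<noteq> {}" "X \<noteq> V - {q}"
    \<comment> \<open>The leaf is put on the side of its only neighbour, so its edge does not
      cross.\<close>
    define X' where "X' = (if y \<in> X then insert q X else X)"
    have "X' \<subseteq> V" "X' \<noteq> {}" "X' \<noteq> V" using X q y by (auto simp: X'_def)
    then have "okc lab (cut T X')" by (rule solD[OF S])
    moreover have "cut T X' \<subseteq> cut (T - {f}) X"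
    proof
      fix e assume e: "e \<in> cut T X'"
      then have "e \<noteq> f" using X y by (auto simp: in_cut X'_def split: if_splits)
      moreover have "e \<notin> incident T q" using q \<open>e \<noteq> f\<close> by blast
      then have "q \<notin> e" using e by (auto simp: incident_def in_cut)
      ultimately show "e \<in> cut (T - {f}) X"
        using e by (auto simp: in_cut crosses_def X'_def split: if_splits)
    qed
    ultimately show "okc lab (cut (T - {f}) X)" by (rule okc_mono)
  qed
qed

end

section \<open>A clique C whose outside neighbours all lie in K: replacement and normal form\<close>

locale clique_graph = lgraph E lab for E :: "'a set set" and lab :: "'a \<Rightarrow> 'b" +
  fixes V K C :: "'a set"
  assumes finV: "finite V" and KV: "K \<subseteq> V" and Kne: "K \<noteq> {}"
    and CV: "C \<subseteq> V" and CK: "C \<inter> K = {}"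
    and cl: "a \<in> C \<Longrightarrow> b \<in> C \<Longrightarrow> a \<noteq> b \<Longrightarrow> {a, b} \<in> E"
    and sep: "{a, b} \<in> E \<Longrightarrow> a \<in> C \<Longrightarrow> b \<in> V \<Longrightarrow> b \<in> C \<union> K"
begin

lemma finK: "finite K" and finC: "finite C"
  using finV KV CV finite_subset by blast+

text \<open>The edges inside \<open>P \<union> K\<close> at \<open>P\<close> are replaced by a Hamiltonian cycle on \<open>P\<close> and, for
  every vertex of \<open>K\<close>, at most two of its old edges to \<open>P\<close>.\<close>

lemma replacement:
  assumes S: "sol V T" and P: "P \<subseteq> C" "3 \<le> card P"
  shows "\<exists>T2. sol V T2 \<and>
    card T2 + card {e \<in> T. e \<inter> P \<noteq> {} \<and> e \<subseteq> P \<union> K} \<le> card T + card P + 2 * card K \<and>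
    (\<exists>e\<in>nb V T2. e \<subseteq> P)"
proof -
  have finP: "finite P" using P finC finite_subset by blast
  have finT: "finite T" using sol_finite finV S by blast
  have PK: "P \<inter> K = {}" using P CK by blast
  obtain H where H: "card H = card P \<and> finite H \<and> (\<forall>e\<in>H. e \<subseteq> P \<and> card e = 2) \<and>
    (\<forall>X. P \<inter> X \<noteq> {} \<longrightarrow> P - X \<noteq> {} \<longrightarrow>
      (\<exists>e\<in>H. \<exists>e'\<in>H. e \<noteq> e' \<and> crosses X e \<and> crosses X e'))"
    using Hamiltonian_cycle_exists[OF finP P(2)] by (elim exE) (rule that)
  have Hcard: "card H = card P" and HP: "\<And>e. e \<in> H \<Longrightarrow> e \<subseteq> P" "\<And>e. e \<in> H \<Longrightarrow> card e = 2"
    using H by auto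
  have Hcut: "\<exists>e\<in>H. \<exists>e'\<in>H. e \<noteq> e' \<and> crosses X e \<and> crosses X e'"
    if "P \<inter> X \<noteq> {} \<and> P - X \<noteq> {}" for X
    using H that by simp
  define D where "D = {e \<in> T. e \<inter> P \<noteq> {} \<and> e \<subseteq> P \<union> K}"
  define A where "A x = {e \<in> T. x \<in> e \<and> e \<inter> P \<noteq> {}}" for x
  obtain J where J: "\<And>x. J x \<subseteq> A x" "\<And>x. finite (J x)" "\<And>x. card (J x) \<le> 2"
    "\<And>x. okc lab (A x) \<Longrightarrow> okc lab (J x)" "\<And>x. A x \<noteq> {} \<Longrightarrow> J x \<noteq> {}"
    using sparsify[of "A _" lab] by metis
  define JJ where "JJ = (\<Union>x\<in>K. J x)"
  define T2 where "T2 = (T - D) \<union> H \<union> JJ"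
  have JT: "JJ \<subseteq> T" using J(1) by (auto simp: JJ_def A_def)
  have HE: "e \<in> E \<and> e \<subseteq> V" if e: "e \<in> H" for e
  proof -
    obtain a b where "e = {a, b}" "a \<noteq> b" using HP(2)[OF e] card2E by metis
    then show ?thesis using HP(1)[OF e] P CV cl[of a b] by auto
  qed
  have okT2: "okc lab (cut T2 X)" if X: "X \<subseteq> V" "X \<noteq> {}" "X \<noteq> V" for X
  proof (cases "P \<inter> X \<noteq> {} \<and> P - X \<noteq> {}")
    case True
    then obtain e e' where "e \<in> H" "e' \<in> H" "e \<noteq> e'" "crosses X e" "crosses X e'"
      using Hcut[OF True] by blast
    then have "e \<in> cut T2 X" "e' \<in> cut T2 X" "e \<noteq> e'" by (auto simp: in_cut T2_def)
    then show ?thesis unfolding okc_def by blast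
  next
    case False
    then have side: "P \<subseteq> X \<or> P \<inter> X = {}" by blast
    \<comment> \<open>When X does not split P, an edge of D in the cut leads from P to some x in K,
      and then all edges between x and P are in the cut. So the cut contains all of
      \<open>A x\<close>, hence all of the chosen \<open>J x\<close>.\<close>
    have inD: "\<exists>x\<in>K. e \<in> A x \<and> (\<forall>e'\<in>A x. crosses X e')" if e: "e \<in> cut T X" "e \<in> D" for e
    proof -
      have e2: "e \<in> T" "crosses X e" "card e = 2" using e sol_edge[OF S] by (auto simp: in_cut)
      obtain p where p: "p \<in> e" "p \<in> P" using e by (auto simp: D_def)
      then obtain x where x: "e = {p, x}" "x \<noteq> p" using e2(3) edge_atE by metis
      have pX: "(p \<in> X) \<noteq> (x \<in> X)" using e2(2) x by simp
      then have "x \<notin> P" using side p by blast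
      then have xK: "x \<in> K" using e x by (auto simp: D_def)
      have "crosses X e'" if "e' \<in> A x" for e'
      proof -
        have e': "x \<in> e'" "e' \<inter> P \<noteq> {}" "e' \<in> T" using that by (auto simp: A_def)
        then obtain p' where "p' \<in> e'" "p' \<in> P" by blast
        then show ?thesis using side p pX e' by (auto simp: crosses_def)
      qed
      moreover have "e \<in> A x" using e2 x p by (auto simp: A_def)
      ultimately show ?thesis using xK by blast
    qed
    have Jcut: "J x \<subseteq> cut T2 X" if "x \<in> K" "\<forall>e'\<in>A x. crosses X e'" for x
    proof
      fix j assume "j \<in> J x"
      then show "j \<in> cut T2 X" using that J(1)[of x] by (simp add: in_cut T2_def JJ_def subset_iff) blast
    qed
    \<comment> \<open>Two crossing edges at the same x make \<open>A x\<close>, hence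
      \<open>J x\<close>, satisfy the cut. Otherwise one representative per end in K, or one
      together with an untouched edge, gives two different edges.\<close>
    have two: "okc lab (cut T2 X)" if e: "e1 \<in> cut T X" "e2 \<in> cut T X" "e1 \<noteq> e2" "e1 \<in> D" for e1 e2
    proof -
      obtain x where x: "x \<in> K" "e1 \<in> A x" "\<forall>e'\<in>A x. crosses X e'" using inD e by blast
      show ?thesis
      proof (cases "e2 \<in> A x")
        case True
        then have "okc lab (A x)" using x e unfolding okc_def by blast
        then show ?thesis using J(4) Jcut x okc_mono by blast
      next
        case False
        obtain j where j: "j \<in> J x" using J(5) x by blast
        then have jc: "j \<in> cut T2 X" "j \<in> A x" using Jcut x J(1) by blast+
        show ?thesis
        proof (cases "e2 \<in> D")
          case True
          then obtain y where y: "y \<in> K" "e2 \<in> A y" "\<forall>e'\<in>A y. crosses X e'" using inD e by blast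
          obtain j' where j': "j' \<in> J y" using J(5) y by blast
          then have jc': "j' \<in> cut T2 X" "j' \<in> A y" using Jcut y J(1) by blast+
          have "x \<noteq> y" using False y by blast
          have "j \<noteq> j'"
          proof
            assume "j = j'"
            then have "x \<in> j" "y \<in> j" "j \<inter> P \<noteq> {}" "card j = 2"
              using jc jc' sol_edge[OF S] by (auto simp: A_def)
            then have "j = {x, y}" using \<open>x \<noteq> y\<close> by (auto elim!: edge_atE)
            then show False using \<open>j \<inter> P \<noteq> {}\<close> x y PK by blast
          qed
          then show ?thesis using jc jc' unfolding okc_def by blast
        next
          case F: False
          then have "e2 \<in> cut T2 X" using e by (auto simp: in_cut T2_def)
          moreover have "e2 \<noteq> j" using False jc by blast
          ultimately show ?thesis using jc unfolding okc_def by blast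
        qed
      qed
    qed
    have "okc lab (cut T X)" using solD[OF S] X by blast
    then consider e where "e \<in> cut T X" "safe lab e"
      | e1 e2 where "e1 \<in> cut T X" "e2 \<in> cut T X" "e1 \<noteq> e2"
      unfolding okc_def by blast
    then show ?thesis
    proof cases
      case (1 e)
      show ?thesis
      proof (cases "e \<in> D")
        case True
        then obtain x where x: "x \<in> K" "e \<in> A x" "\<forall>e'\<in>A x. crosses X e'" using inD 1 by blast
        then have "okc lab (A x)" using 1 unfolding okc_def by blast
        then show ?thesis using J(4) Jcut x okc_mono by blast
      next
        case False
        then have "e \<in> cut T2 X" using 1 by (auto simp: in_cut T2_def)
        then show ?thesis using 1 unfolding okc_def by blast
      qed
    next
      case (2 e1 e2)
      show ?thesis
      proof (cases "e1 \<in> D \<or> e2 \<in> D")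
        case True
        then show ?thesis using two[of e1 e2] two[of e2 e1] 2 by blast
      next
        case False
        then have "e1 \<in> cut T2 X" "e2 \<in> cut T2 X" using 2 by (auto simp: in_cut T2_def)
        then show ?thesis using 2 unfolding okc_def by blast
      qed
    qed
  qed
  have sol2: "sol V T2"
  proof (rule solI)
    fix e assume "e \<in> T2"
    then show "e \<in> E \<and> e \<subseteq> V" using HE sol_edge[OF S] JT by (auto simp: T2_def)
  qed (rule okT2)
  have "card T2 \<le> card (T - D) + card H + card JJ"
    unfolding T2_def by (meson add_mono card_Un_le le_refl le_trans)
  moreover have "card JJ \<le> 2 * card K"
  proof -
    have "card JJ \<le> (\<Sum>x\<in>K. card (J x))" unfolding JJ_def by (rule card_UN_le[OF finK])
    also have "\<dots> \<le> (\<Sum>x\<in>K. 2)" by (rule sum_mono) (rule J(3))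
    finally show ?thesis by simp
  qed
  moreover have "card (T - D) + card D = card T"
    using finT card_mono[of T D] by (subst card_Diff_subset) (auto simp: D_def)
  ultimately have cd: "card T2 + card D \<le> card T + card P + 2 * card K" using Hcard by linarith
  obtain h where h: "h \<in> H" using Hcard P by (metis card.empty ex_in_conv not_numeral_le_zero)
  \<comment> \<open>A cut that splits P contains a second edge of the cycle, and h does not cross
    any other cut.\<close>
  have "h \<in> nb V T2"
    unfolding nb_def conn_def
  proof (intro CollectI conjI allI impI)
    show "h \<in> T2" using h by (simp add: T2_def)
    fix X assume X: "X \<subseteq> V" "X \<noteq> {}" "X \<noteq> V"
    show "\<exists>e\<in>T2 - {h}. crosses X e"
    proof (cases "P \<inter> X \<noteq> {} \<and> P - X \<noteq> {}")
      case True
      then obtain e e' where "e \<in> H" "e' \<in> H" "e \<noteq> e'" "crosses X e" "crosses X e'"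
        using Hcut[OF True] by blast
      then show ?thesis by (cases "e = h") (auto simp: T2_def)
    next
      case False
      then have "\<not> crosses X h" using HP(1)[OF h] by (auto simp: crosses_def)
      moreover obtain e where "e \<in> cut T2 X" using okT2[OF X] okc_nonempty by blast
      ultimately show ?thesis by (auto simp: in_cut)
    qed
  qed
  then show ?thesis using sol2 cd HP(1)[OF h] unfolding D_def by blast
qed

text \<open>Take a minimum solution with a non-bridge {a, b} inside C and as many non-bridges as
  possible. A bridge inside C, or the only edge at a vertex of C, has an end v in C on the side away
  from {a, b}; this side exists because the cut of a bridge cannot separate the ends of a
  non-bridge. Then \<open>subdivide_move\<close> would produce more non-bridges.\<close>

lemma normal_form:
  assumes T0: "mini V T0" and e0: "e0 \<in> nb V T0" "e0 \<subseteq> C"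
  obtains T where "mini V T" "\<And>e. e \<in> T \<Longrightarrow> e \<subseteq> C \<Longrightarrow> e \<in> nb V T"
    "\<And>u. u \<in> C \<Longrightarrow> 2 \<le> card (incident T u)"
proof -
  define P where "P T \<longleftrightarrow> mini V T \<and> (\<exists>e\<in>nb V T. e \<subseteq> C)" for T
  have "\<forall>T. P T \<longrightarrow> card (nb V T) < Suc (card T0)"
  proof (intro allI impI)
    fix T assume "P T"
    then have "sol V T" "card T \<le> card T0" using T0 by (auto simp: mini_def P_def)
    then show "card (nb V T) < Suc (card T0)"
      using card_mono[of T "nb V T"] sol_finite[OF finV] by (force simp: nb_def)
  qed
  moreover have "P T0" using T0 e0 by (auto simp: P_def)
  ultimately have "\<exists>T. P T \<and> (\<forall>T'. P T' \<longrightarrow> card (nb V T') \<le> card (nb V T))"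
    by (intro ex_has_greatest_nat)
  then obtain T where PT: "P T" and mx: "\<forall>T'. P T' \<longrightarrow> card (nb V T') \<le> card (nb V T)"
    by blast
  have T: "mini V T \<and> (\<exists>e\<in>nb V T. e \<subseteq> C)" using PT by (simp add: P_def)
  then obtain ab where ab: "ab \<in> nb V T" "ab \<subseteq> C" by blast
  have S: "sol V T" and m: "mini V T" using T by (auto simp: mini_def)
  have finT: "finite T" using S finV sol_finite by blast
  have abT: "ab \<in> T" using ab by (simp add: nb_def)
  obtain a b where ab': "ab = {a, b}" "a \<noteq> b" using sol_edge[OF S abT] card2E by metis
  have no: False if Y: "Y \<subseteq> V" "cut T Y = {f}" "f = {z, v}" "v \<in> Y" "z \<notin> Y" "v \<in> C" "a \<notin> Y"
    "b \<notin> Y" for Y f z v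
  proof -
    have va: "{v, a} \<in> E" "{v, b} \<in> E" using cl Y ab ab' by auto
    define T1 where "T1 = (T - {f, {a, b}}) \<union> {{v, a}, {v, b}}"
    note sm = subdivide_move[OF S Y(1-5) _ ab'(2) Y(7,8) va T1_def finT]
    have "mini V T1" using mini_exchange[OF m] sm ab ab' by blast
    moreover have "{v, a} \<subseteq> C" using Y ab ab' by auto
    ultimately have "P T1" using sm(4) ab ab' unfolding P_def by blast
    then have "card (nb V T1) \<le> card (nb V T)" using mx by blast
    then show False using sm(3) ab ab' by simp
  qed
  have nobr: "e \<in> nb V T" if e: "e \<in> T" "e \<subseteq> C" for e
  proof (rule ccontr)
    assume n: "e \<notin> nb V T"
    have aV: "a \<in> V" using ab ab' CV by auto
    obtain Y where Y: "Y \<subseteq> V" "cut T Y = {e}" "a \<in> Y" using bridge_cutE[OF S e(1) n aV] .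
    have bY: "b \<in> Y"
    proof (rule ccontr)
      assume "b \<notin> Y"
      then have "crosses Y ab" using Y(3) ab' by simp
      then have "ab \<in> cut T Y" using abT by (simp add: in_cut)
      then show False using Y n ab by auto
    qed
    have "cut T (V - Y) = {e}"
      using Y(2) sol_cut_compl[OF S] by simp
    moreover obtain v z where "e = {z, v}" "v \<notin> Y" "z \<in> Y"
    proof -
      obtain x y where xy: "e = {x, y}" using sol_edge[OF S e(1)] card2E by metis
      moreover have "crosses Y e" using Y(2) by (auto simp: cut_def)
      ultimately show thesis using that[of x y] that[of y x] by auto
    qed
    ultimately show False using no[of "V - Y" e z v] e Y bY CV by auto
  qed
  have "2 \<le> card (incident T u)" if u: "u \<in> C" for u
  proof (rule ccontr)
    assume "\<not> 2 \<le> card (incident T u)"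
    then have c: "card (incident T u) \<le> 1" by simp
    have uV: "{u} \<subseteq> V" "{u} \<noteq> {}" "{u} \<noteq> V" using u CV KV Kne CK by auto
    obtain f where f: "f \<in> T" "crosses {u} f" using sol_conn[OF S] uV by (elim connE)
    then have fi: "f \<in> incident T u" by (auto simp: incident_def crosses_def)
    have fini: "finite (incident T u)" using finT by (simp add: incident_def)
    have inc: "incident T u = {f}"
      using fi c card_le_Suc0_iff_eq[OF fini] by auto
    then have cu: "cut T {u} = {f}" using f by (auto simp: incident_def cut_def crosses_def)
    obtain z where z: "f = {z, u}" "z \<noteq> u"
      using sol_edge[OF S f(1)] fi edge_atE[of f u] unfolding incident_def
      by (metis insert_commute mem_Collect_eq)
    have "ab \<noteq> f" using cut_singleton_notin_nb[OF S uV(1) cu] ab by blast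
    then have "u \<notin> ab" using inc abT by (auto simp: incident_def)
    then show False using no[OF uV(1) cu z(1)] u z ab' by auto
  qed
  then show thesis using that m nobr by blast
qed

text \<open>Replacing all edges at C cannot save anything in a minimum solution, so at most |C| + 2
  * |K| edges meet C. A weighted degree count turns this into a vertex of Q with two neighbours,
  both in C.\<close>

lemma normal_form_degree_two:
  assumes m: "mini V T" and deg: "\<And>u. u \<in> C \<Longrightarrow> 2 \<le> card (incident T u)"
    and Q: "Q \<subseteq> C" "4 * card K < card Q"
  obtains q a b where "q \<in> Q" "a \<in> C" "b \<in> C" "a \<noteq> b" "incident T q = {{q, a}, {q, b}}"
proof -
  have S: "sol V T" using m by (simp add: mini_def)
  have finT: "finite T" using S finV sol_finite by blast
  have "1 \<le> card K" using Kne finK by (simp add: Suc_le_eq card_gt_0_iff)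
  then have "3 \<le> card C" using Q card_mono[OF finC Q(1)] by linarith
  then obtain T2 where T2: "sol V T2"
    "card T2 + card {e \<in> T. e \<inter> C \<noteq> {} \<and> e \<subseteq> C \<union> K} \<le> card T + card C + 2 * card K"
    using replacement[OF S order_refl] by blast
  moreover have "card T \<le> card T2" using m T2 by (auto simp: mini_def)
  ultimately have le: "card {e \<in> T. e \<inter> C \<noteq> {} \<and> e \<subseteq> C \<union> K} \<le> card C + 2 * card K" by linarith
  define A where "A = {e \<in> T. e \<subseteq> C}"
  define B where "B = {e \<in> T. e \<inter> C \<noteq> {} \<and> e \<inter> K \<noteq> {}}"
  have fin: "finite A" "finite B" using finT by (auto simp: A_def B_def)
  have AB: "A \<inter> B = {}" using CK by (auto simp: A_def B_def)
  have Ane: "e \<inter> C \<noteq> {}" if "e \<in> A" for e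
    using that sol_edge[OF S] by (force simp: A_def card_2_iff)
  have Bsub: "e \<subseteq> C \<union> K \<and> card {v \<in> C. v \<in> e} = 1" if "e \<in> B" for e
  proof -
    have e: "card e = 2" "e \<inter> C \<noteq> {}" "e \<inter> K \<noteq> {}" using that sol_edge[OF S] by (auto simp: B_def)
    then obtain c x where "c \<in> e" "c \<in> C" "x \<in> e" "x \<in> K" by blast
    note cx = this
    then have "c \<noteq> x" using CK by blast
    then have "e = {c, x}" using e(1) cx by (auto elim!: edge_atE)
    moreover then have "{v \<in> C. v \<in> e} = {c}" using cx CK by auto
    ultimately show ?thesis using cx by auto
  qed
  have "A \<union> B \<subseteq> {e \<in> T. e \<inter> C \<noteq> {} \<and> e \<subseteq> C \<union> K}"
    using Ane Bsub by (auto simp: A_def B_def)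
  then have "card (A \<union> B) \<le> card C + 2 * card K"
    using le finT card_mono[of "{e \<in> T. e \<inter> C \<noteq> {} \<and> e \<subseteq> C \<union> K}" "A \<union> B"] by simp
  then have tot: "card A + card B \<le> card C + 2 * card K" using card_Un_disjoint[OF fin AB] by simp
  have sA: "(\<Sum>v\<in>C. card {e \<in> A. v \<in> e}) = 2 * card A"
  proof (rule sum_multicount[OF finC fin(1)], intro ballI)
    fix e assume "e \<in> A"
    then have "{v \<in> C. v \<in> e} = e" "card e = 2" using sol_edge[OF S] by (auto simp: A_def)
    then show "card {v \<in> C. v \<in> e} = 2" by simp
  qed
  have sB: "(\<Sum>v\<in>C. card {e \<in> B. v \<in> e}) = 1 * card B"
    by (rule sum_multicount[OF finC fin(2)]) (use Bsub in blast)
  have inc: "incident T u = {e \<in> A. u \<in> e} \<union> {e \<in> B. u \<in> e}" if u: "u \<in> C" for u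
  proof -
    have "e \<in> A \<or> e \<in> B" if e: "e \<in> T" "u \<in> e" for e
    proof -
      obtain y where y: "e = {u, y}" using sol_edge[OF S e(1)] e(2) edge_atE by metis
      then have "y \<in> C \<union> K" using sep[of u y] sol_edge[OF S e(1)] u by auto
      then show ?thesis using y u e by (auto simp: A_def B_def)
    qed
    then show ?thesis by (auto simp: incident_def A_def B_def)
  qed
  have inc_card: "card (incident T u) = card {e \<in> A. u \<in> e} + card {e \<in> B. u \<in> e}"
    if u: "u \<in> C" for u
    unfolding inc[OF u] using fin AB by (intro card_Un_disjoint) auto
  \<comment> \<open>An edge inside C is counted at both ends and an edge to K with weight two at its
    end in C, so the weights add up to twice the number of edges at C. Each weight is at least 2,
    hence at most 4 * |K| vertices exceed 2; weight 2 together with degree 2 excludes edges to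
    K.\<close>
  define g where "g v = card {e \<in> A. v \<in> e} + 2 * card {e \<in> B. v \<in> e}" for v
  have sumg: "(\<Sum>v\<in>C. g v) \<le> 2 * card C + 4 * card K"
  proof -
    have "(\<Sum>v\<in>C. g v) = 2 * card A + 2 * card B"
      using sA sB by (simp add: g_def sum.distrib flip: sum_distrib_left)
    then show ?thesis using tot by linarith
  qed
  have "\<exists>q\<in>Q. g q < 3"
  proof (rule ccontr)
    assume "\<not> ?thesis"
    moreover have "2 \<le> g v" if "v \<in> C" for v
      using deg[OF that] inc_card[OF that] unfolding g_def by linarith
    ultimately have "\<And>v. v \<in> C \<Longrightarrow> (if v \<in> Q then 3 else 2) \<le> g v"
      by (simp add: not_less)
    then have "(\<Sum>v\<in>C. if v \<in> Q then 3 else 2) \<le> (\<Sum>v\<in>C. g v)" by (rule sum_mono)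
    moreover have "(\<Sum>v\<in>C. if v \<in> Q then 3 else 2 :: nat) = 3 * card Q + 2 * card (C - Q)"
      using finC Q(1) by (simp add: sum.If_cases Int_absorb1 Diff_eq)
    moreover have "card C = card Q + card (C - Q)"
      using finC Q(1) card_mono[OF finC Q(1)] finite_subset[OF Q(1) finC] by (simp add: card_Diff_subset)
    ultimately show False using sumg Q(2) by linarith
  qed
  then obtain q where q: "q \<in> Q" "g q < 3" by blast
  have qC: "q \<in> C" using q Q by blast
  have "card {e \<in> B. q \<in> e} = 0" and "card {e \<in> A. q \<in> e} = 2"
    using q(2) deg[OF qC] inc_card[OF qC] unfolding g_def by linarith+
  moreover have "finite {e \<in> B. q \<in> e}" using fin by simp
  ultimately have "{e \<in> B. q \<in> e} = {}" "card {e \<in> A. q \<in> e} = 2" using card_0_eq by blast+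
  then have inA: "incident T q = {e \<in> A. q \<in> e}" "card (incident T q) = 2"
    unfolding inc[OF qC] by (metis Un_empty_right)+
  then obtain e1 e2 where e: "incident T q = {e1, e2}" "e1 \<noteq> e2" by (meson card_2_iff)
  have nbr: "\<exists>a\<in>C. e = {q, a}" if "e \<in> incident T q" for e
  proof -
    have e: "e \<in> T" "e \<subseteq> C" "q \<in> e" using that inA by (auto simp: A_def)
    obtain y where "e = {q, y}" using sol_edge[OF S e(1)] e(3) edge_atE by metis
    then show ?thesis using e by blast
  qed
  obtain a b where "a \<in> C" "e1 = {q, a}" "b \<in> C" "e2 = {q, b}"
    using nbr[of e1] nbr[of e2] e(1) by auto
  then show thesis using that[of q a b] q e by auto
qed

end

section \<open>Suppression, leaves, and the two rules that delete a twin\<close>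

context clique_graph
begin

lemma edge_at_C:
  assumes "sol V T" "e \<in> T" "u \<in> e" "u \<in> C"
  obtains y where "e = {u, y}" "y \<noteq> u" "y \<in> C \<union> K"
proof -
  obtain y where y: "e = {u, y}" "y \<noteq> u" using sol_edge[OF assms(1,2)] assms(3) edge_atE by metis
  then have "y \<in> C \<union> K" using sep[of u y] sol_edge[OF assms(1,2)] assms(4) by auto
  then show thesis using that y by blast
qed

text \<open>Normally the path from a over q to b is shortened to {a, b}. Since the graph is simple
  this fails if {a, b} is already present; then one further edge from a third clique vertex z
  repairs all damaged cuts at once, if any.\<close>

lemma suppress:
  assumes S: "sol V T" and q: "q \<in> C" "incident T q = {{q, a}, {q, b}}"
    and ab: "a \<noteq> b" "a \<in> C" "b \<in> C" and z: "z \<in> C" "z \<notin> {q, a, b}"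
  shows "\<exists>T'. sol (V - {q}) T' \<and> card T' + 1 \<le> card T"
proof -
  have finT: "finite T" using S finV sol_finite by blast
  have qT: "{q, a} \<in> T" "{q, b} \<in> T" using q(2) by (auto simp: incident_def)
  then have qab: "q \<noteq> a" "q \<noteq> b" using sol_edge[OF S] by fastforce+
  have dab: "{q, a} \<noteq> {q, b}" using ab by (auto simp: doubleton_eq_iff)
  define T0 where "T0 = T - {{q, a}, {q, b}}"
  have cT0: "card T0 + 2 = card T"
  proof -
    have "card {{q, a}, {q, b}} = 2" using dab by auto
    moreover have "{{q, a}, {q, b}} \<subseteq> T" using qT by auto
    ultimately show ?thesis
      using finT card_mono[of T "{{q, a}, {q, b}}"] by (simp add: card_Diff_subset T0_def)
  qed
  have T0q: "q \<notin> e" if e: "e \<in> T0" for e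
  proof
    assume "q \<in> e"
    then have "e \<in> incident T q" using e by (simp add: incident_def T0_def)
    then show False using e q(2) by (simp add: T0_def)
  qed
  have T0E: "e \<in> E \<and> e \<subseteq> V - {q}" if "e \<in> T0" for e
    using that T0q[OF that] sol_edge[OF S] by (auto simp: T0_def)
  have Teq: "T = insert {q, a} (insert {q, b} T0)" using qT by (auto simp: T0_def)
  have cutins: "cut T0 (insert q X) = cut T0 X" for X
    using T0q unfolding cut_def crosses_def by auto
  have T2: "card e = 2" if "e \<in> T0" for e using that sol_edge[OF S] by (simp add: T0_def)
  have sameside: "okc lab (cut T0 X)"
    if X: "X \<subseteq> V - {q}" "X \<noteq> {}" "X \<noteq> V - {q}" "(a \<in> X) = (b \<in> X)" for X
  proof -
    define X' where "X' = (if a \<in> X then insert q X else X)"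
    have "X' \<subseteq> V" "X' \<noteq> {}" "X' \<noteq> V" using X q CV ab qab by (auto simp: X'_def)
    then have "okc lab (cut T X')" by (rule solD[OF S])
    moreover have "cut T X' = cut T0 X'"
      using X qab unfolding Teq cut_insert by (auto simp: X'_def)
    moreover have "cut T0 X' = cut T0 X" using cutins by (simp add: X'_def)
    ultimately show ?thesis by simp
  qed
  \<comment> \<open>If X separates a from b, then q may be placed on either side, so each of its two
    edges on its own completes the cut.\<close>
  have split1: "okc lab (insert {q, c} (cut T0 X))"
    if X: "X \<subseteq> V - {q}" "(a \<in> X) \<noteq> (b \<in> X)" "c = a \<or> c = b" for X c
  proof -
    define X' where "X' = (if c \<in> X then X else insert q X)"
    have "X' \<subseteq> V" "X' \<noteq> {}" "X' \<noteq> V" using X q CV ab qab by (auto simp: X'_def)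
    then have "okc lab (cut T X')" by (rule solD[OF S])
    moreover have "cut T X' \<subseteq> insert {q, c} (cut T0 X')"
      using X qab unfolding Teq cut_insert by (auto simp: X'_def)
    moreover have "cut T0 X' = cut T0 X" using cutins by (simp add: X'_def)
    ultimately show ?thesis using okc_mono by metis
  qed
  show ?thesis
  proof (cases "{a, b} \<in> T")
    case False
    define T' where "T' = insert {a, b} T0"
    have "sol (V - {q}) T'"
    proof (rule solI)
      fix e assume "e \<in> T'"
      then show "e \<in> E \<and> e \<subseteq> V - {q}" using T0E cl[OF ab(2,3,1)] ab CV qab by (auto simp: T'_def)
    next
      fix X assume X: "X \<subseteq> V - {q}" "X \<noteq> {}" "X \<noteq> V - {q}"
      show "okc lab (cut T' X)"
      proof (cases "(a \<in> X) = (b \<in> X)")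
        case True
        then show ?thesis using sameside[OF X] by (simp add: T'_def cut_insert)
      next
        case s: False
        have c: "cut T' X = insert {a, b} (cut T0 X)" using s by (simp add: T'_def cut_insert)
        show ?thesis
        proof (cases "cut T0 X = {}")
          case True
          \<comment> \<open>With no other edge in the cut, each edge at q satisfies it alone and is
            therefore safe; so {a, b} is safe too.\<close>
          then have "lab q = lab a" "lab q = lab b"
            using split1[OF X(1) s, of a] split1[OF X(1) s, of b] by (simp_all add: okc_def)
          then show ?thesis unfolding c okc_def by auto
        next
          case F: False
          then obtain e where e: "e \<in> cut T0 X" by blast
          then have "e \<noteq> {a, b}" using False by (auto simp: in_cut T0_def)
          then show ?thesis unfolding c by (intro okcI2[of "{a, b}" _ e]) (use e in auto)
        qed
      qed
    qed
    moreover have "card T' + 1 \<le> card T" using cT0 finT by (simp add: T'_def T0_def card_insert_if)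
    ultimately show ?thesis by blast
  next
    case True
    then have abT0: "{a, b} \<in> T0" using qab by (auto simp: T0_def doubleton_eq_iff)
    show ?thesis
    proof (cases "sol (V - {q}) T0")
      case True
      then show ?thesis using cT0 by (intro exI[of _ T0]) simp
    next
      case False
      then obtain X0 where X0: "X0 \<subseteq> V - {q}" "X0 \<noteq> {}" "X0 \<noteq> V - {q}" "\<not> okc lab (cut T0 X0)"
        using solI[of T0 "V - {q}"] T0E by blast
      have s0: "(a \<in> X0) \<noteq> (b \<in> X0)" using sameside[OF X0(1-3)] X0(4) by blast
      then have "{a, b} \<in> cut T0 X0" using abT0 by (simp add: in_cut)
      then have c0: "cut T0 X0 = {{a, b}}" using not_okcD[OF X0(4)] by blast
      \<comment> \<open>The repairing edge has to differ from {a, b}: it joins z to that one of a, b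
        which lies on the other side of X0.\<close>
      obtain y where y: "y \<in> {a, b}" "(z \<in> X0) \<noteq> (y \<in> X0)" using s0 by auto
      define g where "g = {z, y}"
      have g: "g \<in> E" "g \<subseteq> V - {q}" "crosses X0 g" "g \<noteq> {a, b}"
        using y z ab cl[of z y] CV qab by (auto simp: g_def doubleton_eq_iff)
      define T' where "T' = insert g T0"
      have "sol (V - {q}) T'"
      proof (rule solI)
        fix e assume "e \<in> T'"
        then show "e \<in> E \<and> e \<subseteq> V - {q}" using T0E g by (auto simp: T'_def)
      next
        fix X assume X: "X \<subseteq> V - {q}" "X \<noteq> {}" "X \<noteq> V - {q}"
        have sub: "cut T0 X \<subseteq> cut T' X" by (auto simp: T'_def in_cut)
        show "okc lab (cut T' X)"
        proof (cases "okc lab (cut T0 X)")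
          case True
          then show ?thesis using sub okc_mono by blast
        next
          case F: False
          then have sX: "(a \<in> X) \<noteq> (b \<in> X)" using sameside[OF X] by blast
          then have abX: "{a, b} \<in> cut T0 X" using abT0 by (simp add: in_cut)
          then have cX: "cut T0 X = {{a, b}}" using not_okcD[OF F] by blast
          \<comment> \<open>Two violated cuts consist of {a, b} alone, so no edge crosses their
            symmetric difference, which does not separate a from b and hence is trivial. Thus X is
            X0 or its complement, and the edge g crosses it.\<close>
          define Z where "Z = (X - X0) \<union> (X0 - X)"
          have "\<not> crosses Z e" if e: "e \<in> T0" for e
          proof -
            have "crosses Z e \<longleftrightarrow> (e \<in> cut T0 X) \<noteq> (e \<in> cut T0 X0)"
              unfolding Z_def using crosses_symdiff[OF T2[OF e]] e by (simp add: in_cut)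
            then show ?thesis using c0 cX by simp
          qed
          then have "cut T0 Z = {}" by (auto simp: cut_def)
          moreover have "(a \<in> Z) = (b \<in> Z)" "Z \<subseteq> V - {q}"
            using s0 sX X X0 unfolding Z_def by auto
          ultimately have "Z = {} \<or> Z = V - {q}"
            using sameside[of Z] by (auto simp: okc_def)
          then have "crosses X g"
          proof
            assume "Z = {}"
            then have "X = X0" unfolding Z_def by blast
            then show ?thesis using g by simp
          next
            assume "Z = V - {q}"
            then have "\<And>u. u \<in> V - {q} \<Longrightarrow> (u \<in> X) \<noteq> (u \<in> X0)" unfolding Z_def by blast
            then have "(z \<in> X) \<noteq> (z \<in> X0)" "(y \<in> X) \<noteq> (y \<in> X0)" using g(2) by (auto simp: g_def)
            then show ?thesis using g(3) by (auto simp: g_def)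
          qed
          then have "g \<in> cut T' X" by (simp add: T'_def in_cut)
          then show ?thesis using g(4) abX sub by (intro okcI2[of g _ "{a, b}"]) auto
        qed
      qed
      moreover have "card T' + 1 \<le> card T" using cT0 finT by (simp add: T'_def T0_def card_insert_if)
      ultimately show ?thesis by blast
    qed
  qed
qed

text \<open>At least 2 * |P| edges lead from P to K, and the replacement costs at most |P| + 2 *
  |K|. So the solution stays minimum while a cycle of non-bridges appears inside C.\<close>

lemma many_K_edges:
  assumes m: "mini V T" and P: "P \<subseteq> C" "3 \<le> card P" "2 * card K \<le> card P"
    and two: "\<And>q. q \<in> P \<Longrightarrow> \<exists>x\<in>K. \<exists>y\<in>K. x \<noteq> y \<and> {q, x} \<in> T \<and> {q, y} \<in> T"
  shows "\<exists>T2. mini V T2 \<and> (\<exists>e\<in>nb V T2. e \<subseteq> C)"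
proof -
  have S: "sol V T" using m by (simp add: mini_def)
  have finT: "finite T" using S finV sol_finite by blast
  have finP: "finite P" using P finC finite_subset by blast
  define A where "A q = {x \<in> K. {q, x} \<in> T}" for q
  define D where "D = {e \<in> T. e \<inter> P \<noteq> {} \<and> e \<subseteq> P \<union> K}"
  have cA: "2 \<le> card (A q)" if q: "q \<in> P" for q
  proof -
    obtain x y where "{x, y} \<subseteq> A q" "x \<noteq> y" using two[OF q] by (auto simp: A_def)
    then show ?thesis using card_mono[of "A q" "{x, y}"] finK by (simp add: A_def)
  qed
  have inj: "inj_on (\<lambda>(q, x). {q, x}) (Sigma P A)"
    using P CK by (auto simp: inj_on_def A_def doubleton_eq_iff)
  have "(\<lambda>(q, x). {q, x}) ` Sigma P A \<subseteq> D" by (auto simp: A_def D_def)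
  moreover have finD: "finite D" using finT by (simp add: D_def)
  ultimately have "card (Sigma P A) \<le> card D"
    using card_image[OF inj] card_mono by metis
  moreover have "card (Sigma P A) = (\<Sum>q\<in>P. card (A q))"
    using finP finK by (intro card_SigmaI) (auto simp: A_def)
  moreover have "(\<Sum>q\<in>P. 2) \<le> (\<Sum>q\<in>P. card (A q))" using cA by (rule sum_mono)
  ultimately have "2 * card P \<le> card D" by simp
  moreover obtain T2 where T2: "sol V T2" "card T2 + card D \<le> card T + card P + 2 * card K"
    "\<exists>e\<in>nb V T2. e \<subseteq> P"
    using replacement[OF S P(1,2)] unfolding D_def by blast
  ultimately have "card T2 \<le> card T" using P(3) by linarith
  then show ?thesis using mini_exchange[OF m] T2 P(1) by blast
qed

text \<open>All edges inside C are bridges, hence safe. Choose a minimum solution with the largest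
  degree at some q0 in Q; then q0 is the only possible neighbour inside C of the other vertices of
  Q. If there is no leaf, those joined to q0 have private neighbours in K, which makes at most |K|
  of them. The remaining 2 * |K| + 4 or more vertices have two neighbours in K each, which
  contradicts \<open>many_K_edges\<close>.\<close>

lemma leaf_exists:
  assumes T0: "mini V T0" and noA: "\<And>T e. mini V T \<Longrightarrow> e \<in> nb V T \<Longrightarrow> \<not> e \<subseteq> C"
    and Q: "Q \<subseteq> C" "3 * card K + 5 \<le> card Q" and lab: "\<And>q. q \<in> Q \<Longrightarrow> lab q = l"
  obtains T q f where "mini V T" "q \<in> Q" "incident T q = {f}"
proof (rule ccontr)
  assume "\<not> thesis"
  with that have nol: "\<And>T q f. mini V T \<Longrightarrow> q \<in> Q \<Longrightarrow> incident T q \<noteq> {f}" by blast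
  have finQ: "finite Q" using Q finC finite_subset by blast
  obtain q0 where q0: "q0 \<in> Q" using Q by fastforce
  then have q0C: "q0 \<in> C" "q0 \<in> V" using Q CV by auto
  have "\<forall>T. mini V T \<longrightarrow> card (incident T q0) < Suc (card T0)"
  proof (intro allI impI)
    fix T assume "mini V T"
    then have "sol V T" "card T \<le> card T0" using T0 by (auto simp: mini_def)
    then show "card (incident T q0) < Suc (card T0)"
      using card_mono[of T "incident T q0"] sol_finite[OF finV] by (force simp: incident_def)
  qed
  then have "\<exists>T. mini V T \<and> (\<forall>T'. mini V T' \<longrightarrow> card (incident T' q0) \<le> card (incident T q0))"
    using T0 by (intro ex_has_greatest_nat)
  then obtain T where m: "mini V T"
    and mx: "\<And>T'. mini V T' \<Longrightarrow> card (incident T' q0) \<le> card (incident T q0)" by blast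
  have S: "sol V T" using m by (simp add: mini_def)
  have finT: "finite T" using S finV sol_finite by blast
  \<comment> \<open>Otherwise the safe bridge {q, y} could be exchanged for a safe edge at q0, since
    its ends carry the common label of Q; this would raise the degree of q0.\<close>
  have star: "y = q0" if q: "q \<in> Q" "q \<noteq> q0" "{q, y} \<in> T" "y \<in> C" for q y
  proof (rule ccontr)
    assume y: "y \<noteq> q0"
    define e where "e = {q, y}"
    have e: "e \<in> T" "e \<subseteq> C" "q0 \<notin> e" using q Q y by (auto simp: e_def)
    then have n: "e \<notin> nb V T" using noA m by blast
    then have "lab y = lab q" using sol_unsafe_nb[OF S e(1)] by (metis e_def safe_doubleton)
    then have le: "\<And>w. w \<in> e \<Longrightarrow> lab w = lab q0" using lab q q0 by (auto simp: e_def)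
    obtain Y where Y: "Y \<subseteq> V" "cut T Y = {e}" "q0 \<in> Y" using bridge_cutE[OF S e(1) n q0C(2)] .
    then have "crosses Y e" by (auto simp: cut_def)
    then obtain w where w: "w \<in> e" "w \<notin> Y" by (auto simp: crosses_def)
    define g where "g = {q0, w}"
    have g: "g \<in> E" "g \<subseteq> V" "crosses Y g" "safe lab g"
      using w e Y le[of w] cl[of q0 w] q0C CV by (auto simp: g_def)
    have gT: "g \<notin> T"
    proof
      assume "g \<in> T"
      then have "g \<in> cut T Y" using g by (simp add: in_cut)
      then show False using Y(2) e(3) by (auto simp: g_def)
    qed
    note ex = sol_exchange[OF S Y(1,2) g]
    have "mini V (insert g (T - {e}))" using mini_exchange[OF m] ex by simp
    moreover have "incident (insert g (T - {e})) q0 = insert g (incident T q0)"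
      using e by (auto simp: incident_def g_def)
    moreover have "g \<notin> incident T q0" "finite (incident T q0)" using gT finT by (auto simp: incident_def)
    ultimately show False using mx[of "insert g (T - {e})"] by simp
  qed
  have deg: "2 \<le> card (incident T q)" if q: "q \<in> Q" for q
  proof (rule ccontr)
    assume "\<not> ?thesis"
    then have c: "card (incident T q) \<le> 1" by simp
    have "{q} \<subseteq> V" "{q} \<noteq> {}" "{q} \<noteq> V" using q Q CV KV Kne CK by auto
    then obtain f where "f \<in> T" "crosses {q} f" using sol_conn[OF S] by (elim connE)
    then have fi: "f \<in> incident T q" by (auto simp: incident_def crosses_def)
    have "finite (incident T q)" using finT by (simp add: incident_def)
    then have "incident T q = {f}" using fi c card_le_Suc0_iff_eq[of "incident T q"] by auto
    then show False using nol m q by blast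
  qed
  define A where "A q = {x \<in> K. {q, x} \<in> T}" for q
  have inc: "incident T q \<subseteq> (\<lambda>x. {q, x}) ` A q \<union> ({{q, q0}} \<inter> T)" if q: "q \<in> Q" "q \<noteq> q0" for q
  proof
    fix e assume e: "e \<in> incident T q"
    then have eT: "e \<in> T" "q \<in> e" by (auto simp: incident_def)
    have "q \<in> C" using q Q by blast
    then obtain y where y: "e = {q, y}" "y \<noteq> q" "y \<in> C \<union> K" using edge_at_C[OF S eT] by blast
    show "e \<in> (\<lambda>x. {q, x}) ` A q \<union> ({{q, q0}} \<inter> T)"
    proof (cases "y \<in> K")
      case True
      then show ?thesis using y eT by (auto simp: A_def)
    next
      case False
      then have "y = q0" using star q y eT by blast
      then show ?thesis using y eT by auto
    qed
  qed
  have finA: "finite (A q)" for q using finK by (simp add: A_def)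
  define Q1 where "Q1 = {q \<in> Q - {q0}. {q, q0} \<in> T}"
  define Q2 where "Q2 = {q \<in> Q - {q0}. {q, q0} \<notin> T}"
  have A1: "\<exists>x. x \<in> A q" if q: "q \<in> Q1" for q
  proof (rule ccontr)
    assume "\<not> ?thesis"
    then have "incident T q \<subseteq> {{q, q0}}" using inc[of q] q by (auto simp: Q1_def)
    then have "card (incident T q) \<le> 1" using card_mono[of "{{q, q0}}"] by fastforce
    then show False using deg[of q] q by (auto simp: Q1_def)
  qed
  then obtain x where x: "\<And>q. q \<in> Q1 \<Longrightarrow> x q \<in> A q" by metis
  \<comment> \<open>A common neighbour x of q and q' would give a path from q over x and q' to q0
    that bypasses the bridge {q, q0}.\<close>
  have "inj_on x Q1"
  proof (rule inj_onI, rule ccontr)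
    fix q q' assume q: "q \<in> Q1" "q' \<in> Q1" "x q = x q'" "q \<noteq> q'"
    define e where "e = {q, q0}"
    have e: "e \<in> T" "e \<subseteq> C" using q Q q0 by (auto simp: e_def Q1_def)
    then have n: "e \<notin> nb V T" using noA m by blast
    obtain Y where Y: "Y \<subseteq> V" "cut T Y = {e}" "q0 \<in> Y" using bridge_cutE[OF S e(1) n q0C(2)] .
    have nc: "\<not> crosses Y f" if "f \<in> T" "f \<noteq> e" for f using Y(2) that by (auto simp: cut_def)
    have "x q \<in> A q" "x q \<in> A q'" using x[OF q(1)] x[OF q(2)] q(3) by auto
    then have f: "{q, x q} \<in> T" "{q', x q} \<in> T" "{q', q0} \<in> T" "x q \<in> K"
      using q by (auto simp: A_def Q1_def)
    have "x q \<noteq> q0" "x q \<noteq> q" using f q0C CK q Q by (auto simp: Q1_def)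
    then have "{q, x q} \<noteq> e" "{q', x q} \<noteq> e" "{q', q0} \<noteq> e"
      using q by (auto simp: e_def doubleton_eq_iff Q1_def)
    then have "\<not> crosses Y {q, x q}" "\<not> crosses Y {q', x q}" "\<not> crosses Y {q', q0}"
      using nc f by blast+
    then have "(q \<in> Y) = (x q \<in> Y)" "(q' \<in> Y) = (x q \<in> Y)" "(q' \<in> Y) = (q0 \<in> Y)"
      by simp_all
    moreover have "crosses Y e" using Y(2) by (auto simp: cut_def)
    ultimately show False by (auto simp: e_def)
  qed
  moreover have "x ` Q1 \<subseteq> K" using x by (auto simp: A_def)
  ultimately have "card Q1 \<le> card K" using finK card_inj_on_le by blast
  moreover have "card Q \<le> 1 + card Q1 + card Q2"
  proof -
    have "Q \<subseteq> insert q0 (Q1 \<union> Q2)" by (auto simp: Q1_def Q2_def)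
    then have "card Q \<le> card (insert q0 (Q1 \<union> Q2))" using finQ by (intro card_mono) (auto simp: Q1_def Q2_def)
    also have "\<dots> \<le> Suc (card (Q1 \<union> Q2))" by (simp add: card_insert_le_m1 card_insert_if finQ Q1_def Q2_def)
    also have "\<dots> \<le> Suc (card Q1 + card Q2)" using card_Un_le by blast
    finally show ?thesis by simp
  qed
  ultimately have c2: "2 * card K + 4 \<le> card Q2" using Q(2) by linarith
  have "\<exists>x\<in>K. \<exists>y\<in>K. x \<noteq> y \<and> {q, x} \<in> T \<and> {q, y} \<in> T" if q: "q \<in> Q2" for q
  proof -
    have "incident T q \<subseteq> (\<lambda>x. {q, x}) ` A q" using inc[of q] q by (auto simp: Q2_def)
    then have "card (incident T q) \<le> card (A q)"
      using finA card_image_le card_mono finite_imageI le_trans by metis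
    then have "2 \<le> card (A q)" using deg[of q] q by (auto simp: Q2_def)
    then obtain a b where "a \<in> A q" "b \<in> A q" "a \<noteq> b"
      using card_le_Suc0_iff_eq[OF finA, of q] by (metis not_less_eq_eq numeral_2_eq_2)
    then show ?thesis unfolding A_def by blast
  qed
  then have "\<exists>T2. mini V T2 \<and> (\<exists>e\<in>nb V T2. e \<subseteq> C)"
    using many_K_edges[OF m, of Q2] c2 Q by (auto simp: Q2_def)
  then show False using noA by blast
qed

text \<open>Suppose all edges inside C are bridges in all minimum solutions. The vertices of C with
  a given private label are left by an unsafe edge, hence by a non-bridge, which has to go to K.
  Such an edge forces a second edge to K at the same vertex. Different labels give different
  vertices, so \<open>many_K_edges\<close> applies.\<close>

lemma private_forces_nonbridge:
  assumes T0: "mini V T0" and Q: "Q \<subseteq> C" "2 * card K + 3 \<le> card Q" "inj_on lab Q"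
    and pr: "\<And>q x. q \<in> Q \<Longrightarrow> x \<in> K \<Longrightarrow> lab q \<noteq> lab x"
  shows "\<exists>T. mini V T \<and> (\<exists>e\<in>nb V T. e \<subseteq> C)"
proof (rule ccontr)
  assume neg: "\<not> ?thesis"
  then have noA: "\<And>e. e \<in> nb V T0 \<Longrightarrow> \<not> e \<subseteq> C" using T0 by blast
  have S: "sol V T0" using T0 by (simp add: mini_def)
  have "\<exists>d\<in>C. lab d = lab q \<and> (\<exists>x\<in>K. {d, x} \<in> nb V T0)" if q: "q \<in> Q" for q
  proof -
    define D where "D = {u \<in> C. lab u = lab q}"
    have "D \<subseteq> V" "D \<noteq> {}" "D \<noteq> V" using q Q CV CK KV Kne by (auto simp: D_def)
    then obtain e where e: "e \<in> T0" "crosses D e" using sol_conn[OF S] by (elim connE)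
    then obtain d where d: "d \<in> e" "d \<in> D" by (auto simp: crosses_def)
    then have dC: "d \<in> C" "lab d = lab q" by (auto simp: D_def)
    obtain y where y: "e = {d, y}" "y \<in> C \<union> K" using edge_at_C[OF S e(1) d(1) dC(1)] by blast
    have "y \<notin> D" using e d y by simp
    then have "lab y \<noteq> lab d" using y dC pr[OF q, of y] by (auto simp: D_def)
    then have "e \<in> nb V T0" using sol_unsafe_nb[OF S e(1)] y by simp
    moreover then have "y \<in> K" using noA y dC by auto
    ultimately show ?thesis using dC y by blast
  qed
  then obtain d x where d: "\<And>q. q \<in> Q \<Longrightarrow> d q \<in> C \<and> lab (d q) = lab q \<and> x q \<in> K \<and> {d q, x q} \<in> nb V T0"
    by metis
  have two: "\<exists>x\<in>K. \<exists>y\<in>K. x \<noteq> y \<and> {v, x} \<in> T0 \<and> {v, y} \<in> T0"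
    if v: "v \<in> C" "z \<in> K" "{v, z} \<in> nb V T0" for v z
  proof (rule ccontr)
    assume neg: "\<not> ?thesis"
    have vz: "{v, z} \<in> T0" using v by (simp add: nb_def)
    then have only: "\<And>y. y \<in> K \<Longrightarrow> {v, y} \<in> T0 \<Longrightarrow> y = z" using neg v by blast
    define I where "I = {e \<in> T0. v \<in> e \<and> e \<subseteq> C}"
    have "\<exists>W\<subseteq>V. cut T0 W = {e} \<and> v \<notin> W" if e: "e \<in> I" for e
    proof -
      have e': "e \<in> T0" "e \<notin> nb V T0" using e noA by (auto simp: I_def)
      have vV: "v \<in> V" using v CV by blast
      obtain Y where Y: "Y \<subseteq> V" "cut T0 Y = {e}" "v \<in> Y" using bridge_cutE[OF S e' vV] .
      then show ?thesis using sol_cut_compl[OF S] by (intro exI[of _ "V - Y"]) auto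
    qed
    then obtain W where W: "\<And>e. e \<in> I \<Longrightarrow> W e \<subseteq> V \<and> cut T0 (W e) = {e} \<and> v \<notin> W e" by metis
    have Wc: "f = e" if "e \<in> I" "f \<in> T0" "crosses (W e) f" for e f
      using W[OF that(1)] that by (auto simp: cut_def)
    \<comment> \<open>This is v with everything behind the bridges at v inside C. If {v, z} were the
      only edge from v to K, it would be the only edge leaving this set, that is, a bridge.\<close>
    define X where "X = insert v (\<Union>e\<in>I. W e)"
    have zX: "z \<notin> X"
    proof
      assume "z \<in> X"
      then obtain e where e: "e \<in> I" "z \<in> W e" using v CK by (auto simp: X_def)
      then have "crosses (W e) {v, z}" using W[OF e(1)] by simp
      then have "{v, z} = e" using Wc e vz by blast
      then show False using e v CK by (auto simp: I_def)
    qed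
    have "X \<subseteq> V" using W v CV by (auto simp: X_def)
    moreover have "X \<noteq> {}" "X \<noteq> V" using zX v KV by (auto simp: X_def)
    ultimately obtain f where f: "f \<in> T0 - {{v, z}}" "crosses X f"
      using v(3) connE[of V "T0 - {{v, z}}" X] unfolding nb_def by blast
    have f2: "card f = 2" using f sol_edge[OF S] by blast
    obtain s where s: "s \<in> f" "s \<in> X" using f by (auto simp: crosses_def)
    obtain t where t: "f = {s, t}" using edge_atE[OF f2 s(1)] by blast
    have tX: "t \<notin> X" using f s t by simp
    show False
    proof (cases "s = v")
      case True
      then obtain y where y: "f = {v, y}" "y \<in> C \<union> K" using edge_at_C[OF S _ _ v(1)] f s by blast
      show ?thesis
      proof (cases "y \<in> K")
        case True
        then show ?thesis using only y f by blast
      next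
        case False
        then have fI: "f \<in> I" using y f v by (auto simp: I_def)
        then have "crosses (W f) f" using W[OF fI] by (auto simp: cut_def)
        then have "t \<in> W f" using W[OF fI] t \<open>s = v\<close> by simp
        then show ?thesis using tX fI by (auto simp: X_def)
      qed
    next
      case False
      then obtain e where e: "e \<in> I" "s \<in> W e" using s by (auto simp: X_def)
      then have "t \<notin> W e" using tX by (auto simp: X_def)
      then have "f = e" using Wc[OF e(1)] f e t by simp
      then have "v \<in> f" using e by (simp add: I_def)
      then have "t = v" using t False by simp
      then show ?thesis using tX by (simp add: X_def)
    qed
  qed
  have "inj_on d Q"
  proof (rule inj_onI)
    fix p q assume "p \<in> Q" "q \<in> Q" "d p = d q"
    then have "lab p = lab q" using d by metis
    then show "p = q" using Q(3) \<open>p \<in> Q\<close> \<open>q \<in> Q\<close> by (simp add: inj_on_eq_iff)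
  qed
  then have cd: "card (d ` Q) = card Q" by (rule card_image)
  have "\<exists>T2. mini V T2 \<and> (\<exists>e\<in>nb V T2. e \<subseteq> C)"
  proof (rule many_K_edges[OF T0])
    show "d ` Q \<subseteq> C" using d by blast
    show "3 \<le> card (d ` Q)" "2 * card K \<le> card (d ` Q)" using cd Q by auto
    show "\<exists>x\<in>K. \<exists>y\<in>K. x \<noteq> y \<and> {v, x} \<in> T0 \<and> {v, y} \<in> T0" if "v \<in> d ` Q" for v
      using that d two by blast
  qed
  then show False using neg by blast
qed

text \<open>Transposing v and q maps edges to edges: inside C everything is adjacent, and the
  neighbours in K agree. By \<open>sol_transport\<close> only safe bridges have to be checked for
  safety.\<close>

lemma swap:
  assumes S: "sol V T" and vq: "v \<in> C" "q \<in> C"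
    and tw: "\<And>x. x \<in> K \<Longrightarrow> {q, x} \<in> E \<longleftrightarrow> {v, x} \<in> E"
    and sf: "\<And>e. e \<in> T \<Longrightarrow> e \<notin> nb V T \<Longrightarrow> safe lab e \<Longrightarrow> safe lab (transpose v q ` e)"
  defines "T' \<equiv> (`) (transpose v q) ` T"
  shows "sol V T'" "card T' = card T" "incident T' v = (`) (transpose v q) ` incident T q"
proof -
  let ?p = "transpose v q"
  have inj: "inj_on ?p V" by (meson inj_on_subset inj_transpose subset_UNIV)
  have im: "?p ` V = V" using vq CV by (intro transpose_image_eq) auto
  have EE: "?p ` e \<in> E" if e: "e \<in> T" for e
  proof -
    have e2: "e \<in> E" "e \<subseteq> V" "card e = 2" using sol_edge[OF S e] by auto
    consider "v \<notin> e" "q \<notin> e" | "e = {v, q}" | y where "e = {v, y}" "y \<noteq> v" "y \<noteq> q"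
      | y where "e = {q, y}" "y \<noteq> v" "y \<noteq> q"
    proof (cases "v \<in> e")
      case True
      then obtain y where "e = {v, y}" "y \<noteq> v" using e2 edge_atE by metis
      then show ?thesis using that by blast
    next
      case False
      show ?thesis
      proof (cases "q \<in> e")
        case True
        then obtain y where "e = {q, y}" "y \<noteq> q" using e2 edge_atE by metis
        then show ?thesis using that False by blast
      qed (use False that in blast)
    qed
    then show ?thesis
    proof cases
      case 1
      then have "?p ` e = e" by (intro transpose_image_eq) auto
      then show ?thesis using e2 by simp
    next
      case 2
      then show ?thesis using e2 by (simp add: insert_commute)
    next
      case (3 y)
      then have "y \<in> C \<union> K" using sep[of v y] vq e2 by auto
      then show ?thesis using 3 cl[of q y] vq tw[of y] e2 by (auto simp: transpose_apply_other)
    next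
      case (4 y)
      then have "y \<in> C \<union> K" using sep[of q y] vq e2 by auto
      then show ?thesis using 4 cl[of v y] vq tw[of y] e2 by (auto simp: transpose_apply_other)
    qed
  qed
  have sf': "safe lab (?p ` e)" if "e \<in> T" "e \<notin> nb V T" for e
    using that sf sol_unsafe_nb[OF S] by blast
  show "sol V T'" "card T' = card T"
    unfolding T'_def using sol_transport[OF S inj im EE sf'] by auto
  show "incident T' v = (`) ?p ` incident T q"
  proof -
    have "v \<in> ?p ` e \<longleftrightarrow> q \<in> e" for e
      by (metis bij_transpose bij_is_inj inj_image_mem_iff transpose_apply_second)
    then show ?thesis unfolding T'_def incident_def by auto
  qed
qed

text \<open>In the normal form all bridges at C lead to K. So for moving a vertex of degree two to v
  it is enough that labels compare alike with the labels in K, which covers twins with equal labels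
  as well as twins with private labels.\<close>

lemma nonbridge_suppress:
  assumes T0: "mini V T0" "e0 \<in> nb V T0" "e0 \<subseteq> C"
    and v: "v \<in> C" and Q: "Q \<subseteq> C" "4 * card K + 4 \<le> card Q"
    and tw: "\<And>q x. q \<in> Q \<Longrightarrow> x \<in> K \<Longrightarrow> {q, x} \<in> E \<longleftrightarrow> {v, x} \<in> E"
    and lb: "\<And>q x. q \<in> Q \<Longrightarrow> x \<in> K \<Longrightarrow> lab q = lab x \<longleftrightarrow> lab v = lab x"
  shows "\<exists>T'. sol (V - {v}) T' \<and> card T' + 1 \<le> card T0"
proof -
  obtain T where m: "mini V T" and nobr: "\<And>e. e \<in> T \<Longrightarrow> e \<subseteq> C \<Longrightarrow> e \<in> nb V T"
    and deg: "\<And>u. u \<in> C \<Longrightarrow> 2 \<le> card (incident T u)"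
    using normal_form[OF T0] by metis
  have S: "sol V T" using m by (simp add: mini_def)
  have cT: "card T \<le> card T0" using m T0(1) by (simp add: mini_def)
  have Q4: "4 * card K < card Q" using Q by linarith
  obtain q a b where q: "q \<in> Q" "a \<in> C" "b \<in> C" "a \<noteq> b" "incident T q = {{q, a}, {q, b}}"
    using normal_form_degree_two[OF m deg Q(1) Q4] by metis
  have qC: "q \<in> C" using q Q by blast
  let ?p = "transpose v q"
  have sf: "safe lab (?p ` e)" if e: "e \<in> T" "e \<notin> nb V T" "safe lab e" for e
  proof (cases "v \<in> e \<or> q \<in> e")
    case False
    then have "?p ` e = e" by (intro transpose_image_eq) auto
    then show ?thesis using e by simp
  next
    case True
    then obtain u where u: "u \<in> e" "u = v \<or> u = q" by blast
    then have uC: "u \<in> C" using v qC by blast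
    obtain y where y: "e = {u, y}" "y \<noteq> u" "y \<in> C \<union> K" using edge_at_C[OF S e(1) u(1) uC] .
    have yK: "y \<in> K" using nobr[OF e(1)] e(2) y uC by blast
    then have "y \<noteq> v" "y \<noteq> q" using CK v qC by auto
    then show ?thesis using u y e(3) lb[OF q(1) yK] by (auto simp: transpose_apply_other)
  qed
  have pT: "\<And>x. x \<in> K \<Longrightarrow> {q, x} \<in> E \<longleftrightarrow> {v, x} \<in> E" using tw q by blast
  define T' where "T' = (`) ?p ` T"
  note sw = swap[OF S v qC pT sf, folded T'_def]
  have "incident T' v = {{v, ?p a}, {v, ?p b}}" using sw(3) q by simp
  moreover have "?p a \<noteq> ?p b" using q(4) by (metis transpose_involutory)
  moreover have pC: "?p a \<in> C" "?p b \<in> C" using q qC v by (auto simp: transpose_def)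
  moreover obtain z where "z \<in> C" "z \<notin> {v, ?p a, ?p b}"
  proof -
    have "card {v, ?p a, ?p b} \<le> 3" by (simp add: card_insert_if)
    moreover have "1 \<le> card K" using Kne finK by (simp add: Suc_le_eq card_gt_0_iff)
    then have "4 \<le> card C" using Q card_mono[OF finC Q(1)] by linarith
    ultimately have "\<not> C \<subseteq> {v, ?p a, ?p b}"
      using card_mono[of "{v, ?p a, ?p b}" C] by fastforce
    then show thesis using that by blast
  qed
  ultimately have "\<exists>T''. sol (V - {v}) T'' \<and> card T'' + 1 \<le> card T'"
    using suppress[OF sw(1) v] by blast
  then show ?thesis using sw(2) cT by (metis le_trans)
qed

text \<open>The number 4 * |K| + 5 serves both cases: \<open>nonbridge_suppress\<close> asks for 4 *
  |K| + 4 twins and \<open>leaf_exists\<close> for 3 * |K| + 5. The edge at a leaf is a bridge, so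
  carrying a leaf over to v relies on equal labels.\<close>

theorem delete_twin:
  assumes v: "v \<in> C" and Q: "Q \<subseteq> C - {v}" "4 * card K + 5 \<le> card Q"
    and lb: "\<And>q. q \<in> Q \<Longrightarrow> lab q = lab v"
    and tw: "\<And>q x. q \<in> Q \<Longrightarrow> x \<in> K \<Longrightarrow> {q, x} \<in> E \<longleftrightarrow> {v, x} \<in> E"
  shows "opt V = opt (V - {v}) + enat 1"
proof (rule opt_eq_plus)
  fix T assume "sol V T"
  then obtain T0 where T0: "mini V T0" "card T0 \<le> card T" using mini_exists by blast
  have QC: "Q \<subseteq> C" using Q by blast
  have "\<exists>T'. sol (V - {v}) T' \<and> card T' + 1 \<le> card T0"
  proof (cases "\<exists>T1 e. mini V T1 \<and> e \<in> nb V T1 \<and> e \<subseteq> C")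
    case True
    then obtain T1 e where T1: "mini V T1" "e \<in> nb V T1" "e \<subseteq> C" by blast
    have "card T1 \<le> card T0" using T1 T0 by (simp add: mini_def)
    moreover have "\<exists>T'. sol (V - {v}) T' \<and> card T' + 1 \<le> card T1"
      by (rule nonbridge_suppress[OF T1 v QC]) (use Q lb tw in auto)
    ultimately show ?thesis by (meson le_trans)
  next
    case False
    have Q3: "3 * card K + 5 \<le> card Q" using Q by linarith
    obtain T1 q f where T1: "mini V T1" "q \<in> Q" "incident T1 q = {f}"
      using leaf_exists[OF T0(1) _ QC Q3 lb] False by metis
    have S: "sol V T1" using T1 by (simp add: mini_def)
    have qC: "q \<in> C" using T1 QC by blast
    have lp: "lab (transpose v q x) = lab x" for x
      using lb[OF T1(2)] by (simp add: transpose_def)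
    have sf: "safe lab (transpose v q ` e)" if s: "safe lab e" for e
      unfolding safe_def
    proof (intro ballI)
      fix x y assume "x \<in> transpose v q ` e" "y \<in> transpose v q ` e"
      then obtain a b where "x = transpose v q a" "a \<in> e" "y = transpose v q b" "b \<in> e" by blast
      then show "lab x = lab y" using s lp unfolding safe_def by metis
    qed
    have pT: "\<And>x. x \<in> K \<Longrightarrow> {q, x} \<in> E \<longleftrightarrow> {v, x} \<in> E" using tw T1 by blast
    define T' where "T' = (`) (transpose v q) ` T1"
    note sw = swap[OF S v qC pT sf, folded T'_def]
    obtain f' where f': "incident T' v = {f'}" using sw(3) T1(3) by simp
    have "v \<in> V" using v CV by blast
    then have "sol (V - {v}) (T' - {f'})" using sol_remove_leaf[OF sw(1)] f' by blast
    moreover have "f' \<in> T'" using f' by (auto simp: incident_def)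
    then have "card (T' - {f'}) + 1 \<le> card T'"
      using sol_finite[OF finV sw(1)] card.remove by fastforce
    ultimately show ?thesis using sw(2) T1(1) T0(1) unfolding mini_def by (metis le_trans)
  qed
  then show "\<exists>T'. sol (V - {v}) T' \<and> card T' + 1 \<le> card T" using T0(2) by (meson le_trans)
next
  fix T' assume T': "sol (V - {v}) T'"
  obtain q where q: "q \<in> Q" using Q by fastforce
  then have q': "q \<in> C" "q \<noteq> v" "lab q = lab v" using Q lb by auto
  \<comment> \<open>Conversely, v becomes a leaf at its twin q; equal labels make the new bridge
    safe.\<close>
  have "sol V (insert {v, q} T')"
  proof (rule solI)
    fix e assume "e \<in> insert {v, q} T'"
    then show "e \<in> E \<and> e \<subseteq> V" using sol_edge[OF T'] q' v cl[of v q] CV by auto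
  next
    fix X assume X: "X \<subseteq> V" "X \<noteq> {}" "X \<noteq> V"
    show "okc lab (cut (insert {v, q} T') X)"
    proof (cases "X - {v} = {} \<or> X - {v} = V - {v}")
      case True
      have "q \<in> V" using q' CV by blast
      then have "(v \<in> X) \<noteq> (q \<in> X)" using True X q' v CV by blast
      then have "{v, q} \<in> cut (insert {v, q} T') X" by (simp add: in_cut)
      then show ?thesis unfolding okc_def using q' by (intro disjI1 bexI) auto
    next
      case False
      then have "okc lab (cut T' (X - {v}))" using X by (intro solD[OF T']) auto
      moreover have "cut T' (X - {v}) \<subseteq> cut (insert {v, q} T') X"
        using sol_edge[OF T'] by (fastforce simp: cut_def crosses_def)
      ultimately show ?thesis by (rule okc_mono)
    qed
  qed
  moreover have "card (insert {v, q} T') \<le> card T' + 1" by (simp add: card_insert_le_m1 card_insert_if)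
  ultimately show "\<exists>T. sol V T \<and> card T \<le> card T' + 1" by blast
qed

text \<open>Leaves cannot be moved between different labels, so the case without a non-bridge inside
  C has to be excluded beforehand by \<open>private_forces_nonbridge\<close>. The converse direction
  needs a non-bridge inside the clique of the smaller graph, too.\<close>

theorem delete_private:
  assumes v: "v \<in> C" and Q: "Q \<subseteq> C - {v}" "4 * card K + 5 \<le> card Q" "inj_on lab Q"
    and lb: "\<And>q x. q \<in> Q \<Longrightarrow> x \<in> K \<Longrightarrow> lab q \<noteq> lab x" and lv: "\<And>x. x \<in> K \<Longrightarrow> lab v \<noteq> lab x"
    and tw: "\<And>q x. q \<in> Q \<Longrightarrow> x \<in> K \<Longrightarrow> {q, x} \<in> E \<longleftrightarrow> {v, x} \<in> E"
  shows "opt V = opt (V - {v}) + enat 1"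
proof (rule opt_eq_plus)
  fix T assume "sol V T"
  then obtain T0 where T0: "mini V T0" "card T0 \<le> card T" using mini_exists by blast
  have QC: "Q \<subseteq> C" using Q by blast
  have Q2: "2 * card K + 3 \<le> card Q" using Q by linarith
  obtain T1 e where T1: "mini V T1" "e \<in> nb V T1" "e \<subseteq> C"
    using private_forces_nonbridge[OF T0(1) QC Q2 Q(3) lb] by blast
  have "\<exists>T'. sol (V - {v}) T' \<and> card T' + 1 \<le> card T1"
    by (rule nonbridge_suppress[OF T1 v QC]) (use Q lb lv tw in auto)
  moreover have "card T1 \<le> card T" using T1 T0 by (auto simp: mini_def)
  ultimately show "\<exists>T'. sol (V - {v}) T' \<and> card T' + 1 \<le> card T" by (meson le_trans)
next
  fix T' assume "sol (V - {v}) T'"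
  interpret sub: clique_graph E lab "V - {v}" K "C - {v}"
    using finV KV Kne CV CK cl sep v by unfold_locales auto
  obtain T0 where T0: "mini (V - {v}) T0" "card T0 \<le> card T'"
    using mini_exists[OF \<open>sol (V - {v}) T'\<close>] by blast
  have Q2: "2 * card K + 3 \<le> card Q" using Q by linarith
  obtain T1 e where T1: "mini (V - {v}) T1" "e \<in> nb (V - {v}) T1" "e \<subseteq> C - {v}"
    using sub.private_forces_nonbridge[OF T0(1) Q(1) Q2 Q(3) lb] by blast
  have S: "sol (V - {v}) T1" using T1 by (simp add: mini_def)
  have finT: "finite T1" using S finV sol_finite by blast
  have eT: "e \<in> T1" using T1 by (simp add: nb_def)
  obtain a b where ab: "e = {a, b}" "a \<noteq> b" using sol_edge[OF S eT] card2E by metis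
  have abC: "a \<in> C" "b \<in> C" "a \<noteq> v" "b \<noteq> v" using T1 ab by auto
  have T1v: "v \<notin> f" if "f \<in> T1" for f using sol_edge[OF S that] by blast
  \<comment> \<open>A pendant edge at v might be an unsafe bridge. Instead v subdivides the
    non-bridge {a, b}, which also adds one edge and creates no bridge at v.\<close>
  define T where "T = insert {a, v} (insert {v, b} (T1 - {e}))"
  have "sol V T"
  proof (rule solI)
    fix f assume "f \<in> T"
    then show "f \<in> E \<and> f \<subseteq> V" using sol_edge[OF S] abC v cl[of a v] cl[of v b] CV by (auto simp: T_def)
  next
    fix X assume X: "X \<subseteq> V" "X \<noteq> {}" "X \<noteq> V"
    have cr: "crosses (X - {v}) f \<longleftrightarrow> crosses X f" if "f \<in> T1" for f
      using T1v[OF that] by (auto simp: crosses_def)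
    have avb: "{a, v} \<noteq> {v, b}" using ab abC by (auto simp: doubleton_eq_iff)
    show "okc lab (cut T X)"
    proof (cases "X - {v} = {} \<or> X - {v} = V - {v}")
      case True
      have "a \<in> V" "b \<in> V" using abC CV by auto
      then have "crosses X {a, v}" "crosses X {v, b}" using True X abC v CV by auto
      then have "{a, v} \<in> cut T X" "{v, b} \<in> cut T X" by (simp_all add: T_def in_cut)
      then show ?thesis using avb by (rule okcI2)
    next
      case False
      then have nt: "X - {v} \<subseteq> V - {v}" "X - {v} \<noteq> {}" "X - {v} \<noteq> V - {v}" using X by auto
      show ?thesis
      proof (cases "crosses X e")
        case True
        obtain f where "f \<in> T1 - {e}" "crosses (X - {v}) f"
          using T1(2) nt connE[of "V - {v}" "T1 - {e}" "X - {v}"] unfolding nb_def by blast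
        then have f: "f \<in> cut T X" "v \<notin> f" using cr[of f] T1v[of f] by (simp_all add: T_def in_cut)
        have "crosses X {a, v} \<or> crosses X {v, b}" using True ab by auto
        then have "\<exists>g. g \<in> cut T X \<and> v \<in> g"
          unfolding T_def in_cut by (meson insertCI)
        then show ?thesis using f okcI2[of f "cut T X"] by metis
      next
        case False
        have "okc lab (cut T1 (X - {v}))" using nt by (rule solD[OF S])
        moreover have "cut T1 (X - {v}) \<subseteq> cut T X" using cr False by (auto simp: T_def in_cut)
        ultimately show ?thesis by (rule okc_mono)
      qed
    qed
  qed
  moreover have "card T \<le> card T1 + 1"
  proof -
    have "card T \<le> Suc (Suc (card (T1 - {e})))"
      unfolding T_def using finT by (simp add: card_insert_if)
    moreover have "card T1 = Suc (card (T1 - {e}))" using finT eT by (rule card.remove)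
    ultimately show ?thesis by simp
  qed
  moreover have "card T1 \<le> card T'" using T1 T0 by (auto simp: mini_def)
  ultimately show "\<exists>T. sol V T \<and> card T \<le> card T' + 1" by (meson add_le_mono1 le_trans)
qed

end

section \<open>Deleting one of many isomorphic pieces\<close>

context lgraph
begin

text \<open>A piece whose deletion violates a cut is charged to the trace of this cut on \<open>K\<close>; every
  trace is charged at most twice.\<close>

lemma noncritical_piece:
  assumes finV: "finite V" and KV: "K \<subseteq> V" and Kne: "K \<noteq> {}"
    and I: "finite I" "2 * 2 ^ card K < card I"
    and D: "\<And>i. i \<in> I \<Longrightarrow> D i \<subseteq> V - K"
    and disj: "\<And>i j. i \<in> I \<Longrightarrow> j \<in> I \<Longrightarrow> i \<noteq> j \<Longrightarrow> D i \<inter> D j = {}"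
    and sep: "\<And>i a b. i \<in> I \<Longrightarrow> {a, b} \<in> E \<Longrightarrow> a \<in> D i \<Longrightarrow> b \<in> V \<Longrightarrow> b \<in> D i \<union> K"
    and S: "sol V T"
  shows "\<exists>i\<in>I. sol (V - D i) {e \<in> T. e \<inter> D i = {}}"
proof (rule ccontr)
  assume neg: "\<not> ?thesis"
  define R where "R i = {e \<in> T. e \<inter> D i = {}}" for i
  have touch: "e \<subseteq> D i \<union> K" if i: "i \<in> I" and e: "e \<in> T" "e \<inter> D i \<noteq> {}" for i e
  proof -
    obtain a where a: "a \<in> e" "a \<in> D i" using e by blast
    obtain b where b: "e = {a, b}" using sol_edge[OF S e(1)] a edge_atE by metis
    then show ?thesis using sep[OF i, of a b] a sol_edge[OF S e(1)] by auto
  qed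
  have Rsub: "e \<in> E \<and> e \<subseteq> V - D i" if "e \<in> R i" for e i
    using that sol_edge[OF S] by (auto simp: R_def)
  have "\<exists>X\<subseteq>V - D i. X \<noteq> {} \<and> X \<noteq> V - D i \<and> \<not> okc lab (cut (R i) X)" if i: "i \<in> I" for i
  proof (rule ccontr)
    assume "\<not> ?thesis"
    then have "sol (V - D i) (R i)" by (intro solI) (use Rsub in auto)
    then show False using neg i unfolding R_def by blast
  qed
  then obtain X where X: "\<And>i. i \<in> I \<Longrightarrow> X i \<subseteq> V - D i" "\<And>i. i \<in> I \<Longrightarrow> X i \<noteq> {}"
    "\<And>i. i \<in> I \<Longrightarrow> X i \<noteq> V - D i" "\<And>i. i \<in> I \<Longrightarrow> \<not> okc lab (cut (R i) (X i))"
    by metis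
  \<comment> \<open>Cuts away from K survive the deletion of a piece; so a violated cut and its
    complement both meet K.\<close>
  have avoid: "okc lab (cut (R i) Y)" if i: "i \<in> I" and Y: "Y \<subseteq> V - D i" "Y \<noteq> {}" "Y \<inter> K = {}" for i Y
  proof -
    have "okc lab (cut T Y)" using Y KV Kne by (intro solD[OF S]) auto
    moreover have "cut T Y \<subseteq> cut (R i) Y"
    proof
      fix e assume e: "e \<in> cut T Y"
      have "e \<inter> D i = {}"
      proof (rule ccontr)
        assume "e \<inter> D i \<noteq> {}"
        then have "e \<inter> Y = {}" using touch[OF i, of e] e Y by (auto simp: in_cut)
        then show False using e by (simp add: in_cut crosses_def)
      qed
      then show "e \<in> cut (R i) Y" using e by (simp add: in_cut R_def)
    qed
    ultimately show ?thesis by (rule okc_mono)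
  qed
  have tr1: "X i \<inter> K \<noteq> {}" if i: "i \<in> I" for i
    using avoid[OF i X(1,2)[OF i]] X(4)[OF i] by blast
  have tr2: "\<not> K \<subseteq> X i" if i: "i \<in> I" for i
  proof
    assume K: "K \<subseteq> X i"
    have "okc lab (cut (R i) (V - D i - X i))"
      using X(1,3)[OF i] K by (intro avoid[OF i]) auto
    moreover have "cut (R i) (V - D i - X i) = cut (R i) (X i)"
      using Rsub crosses_compl unfolding cut_def by blast
    ultimately show False using X(4)[OF i] by simp
  qed
  have finK: "finite K" using finV KV finite_subset by blast
  \<comment> \<open>With more than 2 * 2 ^ |K| pieces, three of their violated cuts have the same
    trace on K.\<close>
  have "\<exists>Z. 2 < card {i \<in> I. X i \<inter> K = Z}"
  proof (rule ccontr)
    assume "\<not> ?thesis"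
    then have le: "card {i \<in> I. X i \<inter> K = Z} \<le> 2" for Z
      unfolding not_ex not_less by (rule spec)
    have "i \<in> (\<Union>Z\<in>Pow K. {i \<in> I. X i \<inter> K = Z})" if "i \<in> I" for i
      using that by (intro UN_I[of "X i \<inter> K"]) simp_all
    then have "I = (\<Union>Z\<in>Pow K. {i \<in> I. X i \<inter> K = Z})" by (intro equalityI subsetI) (assumption | simp)+
    then have "card I \<le> (\<Sum>Z\<in>Pow K. card {i \<in> I. X i \<inter> K = Z})"
      using card_UN_le[of "Pow K" "\<lambda>Z. {i \<in> I. X i \<inter> K = Z}"] finK by simp
    also have "\<dots> \<le> (\<Sum>Z\<in>Pow K. 2)" by (rule sum_mono) (rule le)
    finally show False using I(2) finK by (simp add: card_Pow)
  qed
  then obtain Z where "3 \<le> card {i \<in> I. X i \<inter> K = Z}" by (auto simp: Suc_le_eq numeral_3_eq_3 numeral_2_eq_2)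
  then obtain J where J: "J \<subseteq> {i \<in> I. X i \<inter> K = Z}" "card J = 3"
    by (meson obtain_subset_with_card_n)
  then obtain p q r where "J = {p, q, r}" and d: "p \<noteq> q" "q \<noteq> r" "p \<noteq> r" by (auto simp: card_3_iff)
  then have pqr: "p \<in> I" "q \<in> I" "r \<in> I" "X p \<inter> K = Z" "X q \<inter> K = Z" "X r \<inter> K = Z"
    using J by auto
  have inRp: "e \<in> cut (R p) (X p)" if "j \<in> I" "j \<noteq> p" "e \<in> T" "e \<inter> D j \<noteq> {}" "crosses (X p) e" for j e
  proof -
    have "e \<inter> D p = {}" using touch[OF that(1,3,4)] disj[OF that(1) pqr(1) that(2)] D[OF pqr(1)] by blast
    then show ?thesis using that by (simp add: in_cut R_def)
  qed
  \<comment> \<open>The cut violated for p contains at most one edge outside the piece of p. So one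
    of the other two pieces has no edge in it.\<close>
  have "\<exists>j\<in>{q, r}. \<forall>e\<in>T. e \<inter> D j \<noteq> {} \<longrightarrow> \<not> crosses (X p) e"
  proof (rule ccontr)
    assume "\<not> ?thesis"
    then have "\<exists>e\<in>T. e \<inter> D q \<noteq> {} \<and> crosses (X p) e" "\<exists>f\<in>T. f \<inter> D r \<noteq> {} \<and> crosses (X p) f"
      by simp_all
    then obtain e f where e: "e \<in> T" "e \<inter> D q \<noteq> {}" "crosses (X p) e"
      and f: "f \<in> T" "f \<inter> D r \<noteq> {}" "crosses (X p) f" by (elim bexE conjE) (rule that)
    have "e \<noteq> f" using touch[OF pqr(2) e(1,2)] f(2) disj[OF pqr(2,3) d(2)] D[OF pqr(3)] by blast
    moreover have "e \<in> cut (R p) (X p)" "f \<in> cut (R p) (X p)"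
      using inRp pqr d e f by metis+
    ultimately show False using X(4)[OF pqr(1)] okcI2 by metis
  qed
  then obtain j where j: "j \<in> I" "X j \<inter> K = Z" and nc: "\<And>e. e \<in> T \<Longrightarrow> e \<inter> D j \<noteq> {} \<Longrightarrow> \<not> crosses (X p) e"
    using pqr by blast
  \<comment> \<open>Equal traces allow the two cuts to be glued: inside piece j the set looks like
    \<open>X p\<close>, elsewhere like \<open>X j\<close>. No edge at piece j crosses it, so it is
    violated already in T.\<close>
  define Y where "Y = X j \<union> (X p \<inter> D j)"
  have "Y \<subseteq> V" using X(1)[OF j(1)] X(1)[OF pqr(1)] by (auto simp: Y_def)
  moreover have "Y \<noteq> {}" using X(2)[OF j(1)] by (simp add: Y_def)
  moreover have "Y \<noteq> V" using tr2[OF j(1)] KV D[OF j(1)] by (auto simp: Y_def)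
  ultimately have "okc lab (cut T Y)" by (rule solD[OF S])
  moreover have "cut T Y \<subseteq> cut (R j) (X j)"
  proof
    fix e assume e: "e \<in> cut T Y"
    then have eT: "e \<in> T" "crosses Y e" by (auto simp: in_cut)
    show "e \<in> cut (R j) (X j)"
    proof (cases "e \<inter> D j = {}")
      case True
      then have "crosses (X j) e" using eT(2) by (auto simp: crosses_def Y_def)
      then show ?thesis using True eT by (simp add: in_cut R_def)
    next
      case False
      have "y \<in> Y \<longleftrightarrow> y \<in> X p" if "y \<in> D j \<union> K" for y
        using that X(1)[OF j(1)] j(2) pqr(4) D[OF j(1)] unfolding Y_def by blast
      then have "crosses (X p) e" using eT(2) touch[OF j(1) eT(1) False] unfolding crosses_def by blast
      then show ?thesis using nc[OF eT(1) False] by blast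
    qed
  qed
  ultimately have "okc lab (cut (R j) (X j))" by (rule okc_mono)
  then show False using X(4)[OF j(1)] by blast
qed

lemma solR_transport:
  assumes S: "solR V R T" and inj: "inj_on \<psi> V" and im: "\<psi> ` V = V'" and R: "R \<subseteq> V" "\<psi> ` R = R'"
    and EE: "\<And>e. e \<in> T \<Longrightarrow> \<psi> ` e \<in> E" and sf: "\<And>e. e \<in> T \<Longrightarrow> safe lab e \<Longrightarrow> safe lab (\<psi> ` e)"
  shows "solR V' R' ((`) \<psi> ` T)" "card ((`) \<psi> ` T) = card T"
proof -
  have sub: "\<And>e. e \<in> T \<Longrightarrow> e \<subseteq> V" using S by (auto simp: solR_def induced_def)
  have "inj_on ((`) \<psi>) (Pow V)" using inj by (rule inj_on_image_Pow)
  then have injT: "inj_on ((`) \<psi>) T" by (rule inj_on_subset) (use sub in blast)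
  then show "card ((`) \<psi> ` T) = card T" by (rule card_image)
  have "okc lab (cut ((`) \<psi> ` T) X')" if X': "X' \<subseteq> V' - R'" "X' \<noteq> {}" for X'
  proof -
    define X where "X = {v \<in> V. \<psi> v \<in> X'}"
    have "X \<subseteq> V - R" "X \<noteq> {}" using X' im R by (auto simp: X_def)
    then have "okc lab (cut T X)" using S by (simp add: solR_def)
    moreover have c: "\<psi> ` e \<in> cut ((`) \<psi> ` T) X'" if "e \<in> cut T X" for e
    proof -
      have e: "e \<in> T" "crosses X e" using that by (auto simp: in_cut)
      then have "crosses X' (\<psi> ` e)" using sub[OF e(1)] by (auto simp: crosses_def X_def)
      then show ?thesis using e by (simp add: in_cut)
    qed
    ultimately consider e where "e \<in> cut T X" "safe lab e"
      | e1 e2 where "e1 \<in> cut T X" "e2 \<in> cut T X" "e1 \<noteq> e2"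
      unfolding okc_def by blast
    then show ?thesis
    proof cases
      case (1 e)
      then show ?thesis using c sf[of e] okcI1 by (metis in_cut)
    next
      case (2 e1 e2)
      then have "\<psi> ` e1 \<noteq> \<psi> ` e2" using injT by (auto simp: in_cut inj_on_eq_iff)
      then show ?thesis using c 2 okcI2 by metis
    qed
  qed
  moreover have "(`) \<psi> ` T \<subseteq> induced V'" using EE sub im by (fastforce simp: induced_def)
  ultimately show "solR V' R' ((`) \<psi> ` T)" by (simp add: solR_def)
qed

text \<open>Labels have to match only in their pattern of equalities, among themselves and with K,
  not in value. Otherwise private labels would make all pieces different.\<close>

definition piece_iso :: "'a set \<Rightarrow> 'a set \<Rightarrow> 'a set \<Rightarrow> ('a \<Rightarrow> 'a) \<Rightarrow> bool" where
  "piece_iso K C D \<phi> \<longleftrightarrow> bij_betw \<phi> C D \<and>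
     (\<forall>a\<in>C. \<forall>x\<in>K. ({\<phi> a, x} \<in> E \<longleftrightarrow> {a, x} \<in> E) \<and> (lab (\<phi> a) = lab x \<longleftrightarrow> lab a = lab x)) \<and>
     (\<forall>a\<in>C. \<forall>b\<in>C. ({\<phi> a, \<phi> b} \<in> E \<longleftrightarrow> {a, b} \<in> E) \<and> (lab (\<phi> a) = lab (\<phi> b) \<longleftrightarrow> lab a = lab b))"

lemma piece_iso_inv:
  assumes "piece_iso K C D \<phi>" shows "piece_iso K D C (inv_into C \<phi>)"
proof -
  let ?g = "inv_into C \<phi>"
  have b: "bij_betw \<phi> C D" using assms by (simp add: piece_iso_def)
  have g: "?g d \<in> C \<and> \<phi> (?g d) = d" if "d \<in> D" for d
    using b that by (metis bij_betw_def f_inv_into_f inv_into_into)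
  show ?thesis
    unfolding piece_iso_def
  proof (intro conjI ballI)
    show "bij_betw ?g D C" using b by (rule bij_betw_inv_into)
  qed (use assms g in \<open>unfold piece_iso_def; metis\<close>)+
qed

lemma piece_iso_edge:
  assumes P: "piece_iso K C D \<phi>" and CK: "C \<inter> K = {}"
    and e: "e \<in> E" "e \<inter> C = {} \<or> e \<subseteq> C \<union> K"
  defines "\<psi> \<equiv> \<lambda>v. if v \<in> C then \<phi> v else v"
  shows "\<psi> ` e \<in> E" "safe lab e \<Longrightarrow> safe lab (\<psi> ` e)"
proof -
  have "\<psi> ` e \<in> E \<and> (safe lab e \<longrightarrow> safe lab (\<psi> ` e))"
  proof (cases "e \<inter> C = {}")
    case True
    then have "\<psi> ` e = e" by (auto simp: \<psi>_def image_iff)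
    then show ?thesis using e by simp
  next
    case False
    then obtain a where a: "a \<in> e" "a \<in> C" by blast
    obtain b where b: "e = {a, b}" using E2[OF e(1)] a edge_atE by metis
    show ?thesis
    proof (cases "b \<in> C")
      case True
      then show ?thesis using P a b e by (auto simp: \<psi>_def piece_iso_def)
    next
      case F: False
      then have "b \<in> K" using e False b by auto
      moreover have "\<psi> ` e = {\<phi> a, b}" using a b F by (auto simp: \<psi>_def)
      ultimately show ?thesis using P a b e unfolding piece_iso_def by auto
    qed
  qed
  then show "\<psi> ` e \<in> E" "safe lab e \<Longrightarrow> safe lab (\<psi> ` e)" by auto
qed

text \<open>The piece that can be spared need not be C itself, so a solution is cut at the spared
  piece \<open>D i\<close>. What remains is moved by an isomorphism that puts \<open>D i\<close> in
  place of C; the edges at \<open>D i\<close> are moved back to C and satisfy every cut inside C,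
  which makes them a solution of C with K contracted.\<close>

theorem delete_piece:
  assumes finV: "finite V" and KV: "K \<subseteq> V" and Kne: "K \<noteq> {}"
    and I: "finite I" "2 * 2 ^ card K < card I"
    and D: "\<And>i. i \<in> I \<Longrightarrow> D i \<subseteq> V - K"
    and disj: "\<And>i j. i \<in> I \<Longrightarrow> j \<in> I \<Longrightarrow> i \<noteq> j \<Longrightarrow> D i \<inter> D j = {}"
    and sep: "\<And>i a b. i \<in> I \<Longrightarrow> {a, b} \<in> E \<Longrightarrow> a \<in> D i \<Longrightarrow> b \<in> V \<Longrightarrow> b \<in> D i \<union> K"
    and i0: "i0 \<in> I" and C: "C = D i0"
    and iso: "\<And>i. i \<in> I \<Longrightarrow> \<exists>\<phi>. piece_iso K C (D i) \<phi>"
  shows "opt V = opt (V - C) + optR (K \<union> C) K"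
proof (rule enat_eq_if_le_iff)
  fix k
  have CV: "C \<subseteq> V" "C \<inter> K = {}" using D[OF i0] C by auto
  have fK: "finite (K \<union> C)" using finV KV CV finite_subset by blast
  show "opt V \<le> enat k \<longleftrightarrow> opt (V - C) + optR (K \<union> C) K \<le> enat k"
  proof
    assume "opt V \<le> enat k"
    then obtain T where S: "sol V T" and Tk: "card T \<le> k" by (auto simp: opt_le_iff)
    have finT: "finite T" using S finV sol_finite by blast
    have "\<exists>i\<in>I. sol (V - D i) {e \<in> T. e \<inter> D i = {}}"
      by (rule noncritical_piece[where D = D, OF finV KV Kne I])
        (erule D | erule (2) disj | erule (3) sep | rule S)+
    then obtain i where i: "i \<in> I" and Si: "sol (V - D i) {e \<in> T. e \<inter> D i = {}}" (is "sol _ ?T0")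
      by blast
    define F where "F = {e \<in> T. e \<inter> D i \<noteq> {}}"
    have DK: "D i \<subseteq> V" "D i \<inter> K = {}" using D[OF i] by auto
    have touch: "e \<subseteq> D i \<union> K" if e: "e \<in> T" "e \<inter> D i \<noteq> {}" for e
    proof -
      obtain a where a: "a \<in> e" "a \<in> D i" using e by blast
      obtain b where b: "e = {a, b}" using sol_edge[OF S e(1)] a edge_atE by metis
      then show ?thesis using sep[OF i, of a b] a sol_edge[OF S e(1)] by auto
    qed
    have touchC: "e \<inter> C = {} \<or> e \<subseteq> C \<union> K" if e: "e \<in> T" for e
    proof (rule disjCI)
      assume "\<not> e \<subseteq> C \<union> K"
      show "e \<inter> C = {}"
      proof (rule ccontr)
        assume "e \<inter> C \<noteq> {}"
        then obtain a where a: "a \<in> e" "a \<in> C" by blast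
        obtain b where b: "e = {a, b}" using sol_edge[OF S e] a edge_atE by metis
        then show False using sep[OF i0, of a b] a sol_edge[OF S e] C \<open>\<not> e \<subseteq> C \<union> K\<close> by auto
      qed
    qed
    have cT: "card T = card ?T0 + card F"
    proof -
      have "T = ?T0 \<union> F" "?T0 \<inter> F = {}" by (auto simp: F_def)
      moreover have "finite ?T0" "finite F" using finT by (auto simp: F_def)
      ultimately show ?thesis using card_Un_disjoint[of ?T0 F] by presburger
    qed
    have SF: "solR (K \<union> D i) K F"
      unfolding solR_def
    proof (intro conjI allI impI)
      show "F \<subseteq> induced (K \<union> D i)"
        using touch sol_edge[OF S] by (auto simp: induced_def F_def)
      fix X assume X: "X \<subseteq> K \<union> D i - K" "X \<noteq> {}"
      then have XD: "X \<subseteq> D i" by auto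
      have "okc lab (cut T X)" using X XD DK KV Kne by (intro solD[OF S]) auto
      moreover have "cut T X \<subseteq> cut F X" using XD unfolding cut_def F_def crosses_def by blast
      ultimately show "okc lab (cut F X)" by (rule okc_mono)
    qed
    obtain \<phi> where \<phi>: "piece_iso K C (D i) \<phi>" using iso[OF i] by blast
    have bij: "bij_betw \<phi> C (D i)" using \<phi> by (simp add: piece_iso_def)
    have "opt (V - C) \<le> enat (card ?T0)"
    proof (cases "i = i0")
      case True
      then show ?thesis using Si C opt_le_iff by blast
    next
      case False
      then have CD: "C \<inter> D i = {}" using disj[OF i0 i] C by simp
      define \<psi> where "\<psi> = (\<lambda>v. if v \<in> C then \<phi> v else v)"
      have injC: "inj_on \<phi> C" and imC: "\<phi> ` C = D i" using bij by (auto simp: bij_betw_def)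
      have \<phi>D: "\<phi> a \<in> D i" if "a \<in> C" for a using imC that by blast
      have inj: "inj_on \<psi> (V - D i)"
      proof (rule inj_onI)
        fix a b assume "a \<in> V - D i" "b \<in> V - D i" "\<psi> a = \<psi> b"
        then show "a = b" using injC \<phi>D[of a] \<phi>D[of b]
          by (cases "a \<in> C"; cases "b \<in> C") (auto simp: \<psi>_def inj_on_eq_iff)
      qed
      have im: "\<psi> ` (V - D i) = V - C"
      proof -
        have "\<psi> ` (V - D i) = \<psi> ` C \<union> \<psi> ` (V - D i - C)" using CV CD by blast
        moreover have "\<psi> ` C = D i" using imC by (simp add: \<psi>_def)
        moreover have "\<psi> ` (V - D i - C) = V - D i - C" by (auto simp: \<psi>_def image_iff)
        moreover have "D i \<union> (V - D i - C) = V - C" using DK CD by blast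
        ultimately show ?thesis by simp
      qed
      have ed: "\<psi> ` e \<in> E" "e \<notin> nb (V - D i) ?T0 \<Longrightarrow> safe lab (\<psi> ` e)" if e: "e \<in> ?T0" for e
      proof -
        have "e \<in> T" "e \<in> E" using e sol_edge[OF S] by auto
        then show "\<psi> ` e \<in> E" using piece_iso_edge(1)[OF \<phi> CV(2)] touchC unfolding \<psi>_def by blast
        assume "e \<notin> nb (V - D i) ?T0"
        then have "safe lab e" using sol_unsafe_nb[OF Si e] by blast
        then show "safe lab (\<psi> ` e)"
          using piece_iso_edge(2)[OF \<phi> CV(2) \<open>e \<in> E\<close>] touchC \<open>e \<in> T\<close> unfolding \<psi>_def by blast
      qed
      show ?thesis
        unfolding opt_le_iff using sol_transport[OF Si inj im ed] by (intro exI) auto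
    qed
    moreover have "optR (K \<union> C) K \<le> enat (card F)"
    proof -
      define g where "g = inv_into C \<phi>"
      have g: "piece_iso K (D i) C g" unfolding g_def using \<phi> by (rule piece_iso_inv)
      define \<psi> where "\<psi> = (\<lambda>v. if v \<in> D i then g v else v)"
      have bg: "inj_on g (D i)" "g ` D i = C" using g by (auto simp: piece_iso_def bij_betw_def)
      have gC: "g a \<in> C" if "a \<in> D i" for a using bg that by blast
      have inj: "inj_on \<psi> (K \<union> D i)"
      proof (rule inj_onI)
        fix a b assume "a \<in> K \<union> D i" "b \<in> K \<union> D i" "\<psi> a = \<psi> b"
        then show "a = b" using bg(1) gC[of a] gC[of b] CV DK
          by (cases "a \<in> D i"; cases "b \<in> D i") (auto simp: \<psi>_def inj_on_eq_iff)
      qed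
      have K: "\<psi> ` K = K" using DK by (force simp: \<psi>_def)
      have im: "\<psi> ` (K \<union> D i) = K \<union> C" using K bg(2) by (auto simp: \<psi>_def image_Un)
      have ed: "\<psi> ` e \<in> E" "safe lab e \<Longrightarrow> safe lab (\<psi> ` e)" if e: "e \<in> F" for e
      proof -
        have e': "e \<in> T" "e \<inter> D i \<noteq> {}" "e \<in> E" using e sol_edge[OF S] by (auto simp: F_def)
        then show "\<psi> ` e \<in> E" using piece_iso_edge(1)[OF g DK(2)] touch unfolding \<psi>_def by blast
        show "safe lab (\<psi> ` e)" if "safe lab e"
          using piece_iso_edge(2)[OF g DK(2) e'(3)] touch[OF e'(1,2)] that unfolding \<psi>_def by blast
      qed
      show ?thesis
        unfolding optR_le_iff using solR_transport[OF SF inj im _ K ed] by (intro exI) auto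
    qed
    ultimately have "opt (V - C) + optR (K \<union> C) K \<le> enat (card ?T0) + enat (card F)" by (rule add_mono)
    also have "\<dots> \<le> enat k" using cT Tk by simp
    finally show "opt (V - C) + optR (K \<union> C) K \<le> enat k" .
  next
    assume le: "opt (V - C) + optR (K \<union> C) K \<le> enat k"
    then obtain a b where ab: "opt (V - C) = enat a" "optR (K \<union> C) K = enat b" "a + b \<le> k"
      by (cases "opt (V - C)"; cases "optR (K \<union> C) K") auto
    have "\<exists>T. sol (V - C) T \<and> card T \<le> a" "\<exists>F. solR (K \<union> C) K F \<and> card F \<le> b"
      using ab opt_le_iff[of "V - C" a] optR_le_iff[of "K \<union> C" K b] by simp_all
    then obtain T F where T: "sol (V - C) T" "card T \<le> a" and F: "solR (K \<union> C) K F" "card F \<le> b"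
      by blast
    have Fsub: "e \<in> E \<and> e \<subseteq> K \<union> C" if "e \<in> F" for e using that F by (auto simp: solR_def induced_def)
    have "sol V (T \<union> F)"
    proof (rule solI)
      fix e assume "e \<in> T \<union> F"
      then show "e \<in> E \<and> e \<subseteq> V" using sol_edge[OF T(1)] Fsub CV KV by blast
    next
      have main: "okc lab (cut (T \<union> F) X)" if X: "X \<subseteq> C" "X \<noteq> {}" for X
      proof -
        have "X \<subseteq> K \<union> C - K" using X CV by blast
        then have "okc lab (cut F X)" using F(1) X(2) by (simp add: solR_def)
        then show ?thesis by (rule okc_mono) (auto simp: in_cut)
      qed
      have EV: "e \<subseteq> V" if "e \<in> T \<union> F" for e using that sol_edge[OF T(1)] Fsub CV KV by blast
      fix X assume X: "X \<subseteq> V" "X \<noteq> {}" "X \<noteq> V"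
      \<comment> \<open>A cut on one side inside C is served by F; every other cut restricts to a
        nontrivial cut of the graph without C and is served by T.\<close>
      consider "X \<subseteq> C" | "V - X \<subseteq> C" | "X - C \<noteq> {}" "X - C \<noteq> V - C" by blast
      then show "okc lab (cut (T \<union> F) X)"
      proof cases
        case 1
        then show ?thesis using main X by blast
      next
        case 2
        have "cut (T \<union> F) (V - X) = cut (T \<union> F) X"
          using crosses_compl[OF EV] by (auto simp: cut_def)
        moreover have "okc lab (cut (T \<union> F) (V - X))" using 2 X by (intro main) auto
        ultimately show ?thesis by simp
      next
        case 3
        then have "okc lab (cut T (X - C))" using X by (intro solD[OF T(1)]) auto
        moreover have "cut T (X - C) \<subseteq> cut (T \<union> F) X"
        proof
          fix e assume "e \<in> cut T (X - C)"
          moreover then have "e \<subseteq> V - C" using sol_edge[OF T(1)] by (auto simp: in_cut)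
          ultimately show "e \<in> cut (T \<union> F) X" by (auto simp: in_cut crosses_def)
        qed
        ultimately show ?thesis by (rule okc_mono)
      qed
    qed
    moreover have "card (T \<union> F) \<le> k" using card_Un_le[of T F] T(2) F(2) ab(3) by linarith
    ultimately show "opt V \<le> enat k" using opt_le_iff by blast
  qed
qed

end

text \<open>An unsafe edge whose ends lie in the same safe component may be treated as safe: as a bridge
  of a solution it can be exchanged for an edge of a safe path joining its ends.\<close>

lemma unweighted_FGC_iff_opt:
  assumes G: "su_graph V S U" and lab: "\<And>u v. u \<in> V \<Longrightarrow> v \<in> V \<Longrightarrow> lab u = lab v \<longleftrightarrow> reach S u v"
  shows "unweighted_FGC V S U (int k) \<longleftrightarrow> lgraph.opt (S \<union> U) lab V \<le> enat k"
proof -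
  have E: "\<And>e. e \<in> S \<union> U \<Longrightarrow> e \<subseteq> V \<and> card e = 2" and SU: "S \<inter> U = {}" and finV: "finite V"
    using G by (auto simp: su_graph_def)
  interpret lgraph "S \<union> U" lab by unfold_locales (use E in blast)
  have safeS: "safe lab e" if e: "e \<in> S" for e
  proof -
    obtain a b where ab: "e = {a, b}" using E[of e] e by (metis UnI1 card2E)
    then have "reach S a b" using e by (auto simp: reach_def)
    moreover have "a \<in> V" "b \<in> V" using E[of e] e ab by auto
    ultimately show ?thesis using lab ab by simp
  qed
  have conn: "connected_graph V T \<longleftrightarrow> conn V T" if "T \<subseteq> S \<union> U" for T
    using connected_graph_iff_conn[of T V] that E by blast
  have usc: "unsafe_spanning_connected V S U T \<longleftrightarrow>
      T \<subseteq> S \<union> U \<and> conn V T \<and> (\<forall>e\<in>T \<inter> U. conn V (T - {e}))" for T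
    unfolding unsafe_spanning_connected_def using conn[of T] conn[of "T - {_}"] by blast
  have ind: "induced V = S \<union> U" using E by (auto simp: induced_def)
  have dir1: "sol V T" if "unsafe_spanning_connected V S U T" for T
    unfolding sol_iff ind using that safeS unfolding usc by blast
  have dir2: "\<exists>T'. unsafe_spanning_connected V S U T' \<and> card T' \<le> card T" if "sol V T" for T
    using that
  \<comment> \<open>Every exchange turns one unsafe edge into a safe one, so this number
    decreases.\<close>
  proof (induction "card (T - S)" arbitrary: T rule: less_induct)
    case less
    have finT: "finite T" using less.prems finV sol_finite by blast
    have T: "T \<subseteq> S \<union> U" using less.prems by (auto simp: sol_def induced_def)
    show ?case
    proof (cases "\<forall>e\<in>T \<inter> U. conn V (T - {e})")
      case True
      then have "unsafe_spanning_connected V S U T"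
        unfolding usc using T sol_conn[OF less.prems] by blast
      then show ?thesis by blast
    next
      case False
      then obtain f where f: "f \<in> T" "f \<in> U" "f \<notin> nb V T" by (auto simp: nb_def)
      then have sf: "safe lab f" using sol_unsafe_nb[OF less.prems] by blast
      obtain u v where uv: "f = {u, v}" "u \<noteq> v" using E[of f] f by (metis UnI2 card2E)
      then have V: "u \<in> V" "v \<in> V" using E[of f] f by auto
      obtain Y where Y: "Y \<subseteq> V" "cut T Y = {f}" "u \<in> Y"
        using bridge_cutE[OF less.prems f(1,3) V(1)] .
      have "crosses Y f" using Y(2) by (auto simp: cut_def)
      then have vY: "v \<notin> Y" using uv Y by simp
      have "reach S u v" using lab[OF V] sf uv by simp
      then have "(u, v) \<in> {(x, y). {x, y} \<in> S}\<^sup>*" by (simp add: reach_def)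
      then have "v \<notin> Y \<longrightarrow> (\<exists>g\<in>S. crosses Y g)"
      proof induction
        case base
        then show ?case using Y by blast
      next
        case (step y z)
        then have "{y, z} \<in> S" by blast
        moreover have "crosses Y {y, z} \<longleftrightarrow> (y \<in> Y) \<noteq> (z \<in> Y)" by simp
        ultimately show ?case using step.IH by metis
      qed
      then obtain g where g: "g \<in> S" "crosses Y g" using vY by blast
      have g': "g \<in> S \<union> U" "g \<subseteq> V" using g E by auto
      note ex = sol_exchange[OF less.prems Y(1,2) g'(1,2) g(2) safeS[OF g(1)]]
      have "f \<notin> S" using f SU by blast
      then have sub: "insert g (T - {f}) - S \<subseteq> T - S - {f}" and fTS: "f \<in> T - S"
        using g(1) f(1) by blast+
      have fin: "finite (T - S)" using finT by simp
      have "card (insert g (T - {f}) - S) \<le> card (T - S - {f})"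
        using sub fin by (meson card_mono finite_Diff)
      also have "\<dots> < card (T - S)" using fin fTS by (rule card_Diff1_less)
      finally have "card (insert g (T - {f}) - S) < card (T - S)" .
      then show ?thesis using less.hyps[OF _ ex(1)] ex(2) by simp
    qed
  qed
  have "unweighted_FGC V S U (int k) \<longleftrightarrow> (\<exists>T. sol V T \<and> card T \<le> k)"
    unfolding unweighted_FGC_def using dir1 dir2 by (metis le_trans of_nat_le_iff)
  then show ?thesis by (simp add: opt_le_iff)
qed

section \<open>Bounds on the reduced instance\<close>

text \<open>A greedy pass keeps an element only while fewer than m earlier ones share its class;
  looking at the largest element of a class bounds the whole class.\<close>

lemma card_le_fibers:
  fixes X :: "nat set"
  assumes fin: "finite X" "finite Y" and f: "\<And>u. u \<in> X \<Longrightarrow> f u \<in> Y"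
    and few: "\<And>v. v \<in> X \<Longrightarrow> card {u \<in> X. u < v \<and> f u = f v} < m"
  shows "card X \<le> m * card Y"
proof -
  have fib: "card {u \<in> X. f u = y} \<le> m" for y
  proof (cases "{u \<in> X. f u = y} = {}")
    case False
    let ?F = "{u \<in> X. f u = y}"
    have finF: "finite ?F" using fin by simp
    define v where "v = Max ?F"
    have v: "v \<in> ?F" unfolding v_def using finF False by (rule Max_in)
    have "?F \<subseteq> insert v {u \<in> X. u < v \<and> f u = f v}"
    proof
      fix u assume u: "u \<in> ?F"
      then have "u \<le> v" unfolding v_def using finF by simp
      then show "u \<in> insert v {u \<in> X. u < v \<and> f u = f v}" using u v by (cases "u = v") simp_all
    qed
    then have "card ?F \<le> card (insert v {u \<in> X. u < v \<and> f u = f v})"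
      using fin by (intro card_mono) auto
    also have "\<dots> \<le> Suc (card {u \<in> X. u < v \<and> f u = f v})"
      using fin by (simp add: card_insert_if)
    also have "\<dots> \<le> m" using few[of v] v by simp
    finally show ?thesis .
  next
    case True
    then show ?thesis by (metis card.empty zero_le)
  qed
  have "card X \<le> (\<Sum>y\<in>Y. card {u \<in> X. f u = y})"
  proof -
    have "X = (\<Union>y\<in>Y. {u \<in> X. f u = y})" using f by auto
    then show ?thesis using card_UN_le[OF fin(2), of "\<lambda>y. {u \<in> X. f u = y}"] by simp
  qed
  also have "\<dots> \<le> (\<Sum>y\<in>Y. m)" by (rule sum_mono) (rule fib)
  finally show ?thesis by (simp add: mult.commute)
qed

text \<open>A cluster graph has no induced path on three vertices, so every deletion set contains a
  vertex of each path, and these are different for disjoint paths.\<close>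

lemma cluster_distance_ge_packing:
  assumes finV: "finite V" and E: "\<And>e. e \<in> E \<Longrightarrow> e \<subseteq> V"
    and PP: "\<And>A. A \<in> PP \<Longrightarrow> \<exists>u v w. A = {u, v, w} \<and> {u, v} \<in> E \<and> {v, w} \<in> E \<and> u \<noteq> w \<and> {u, w} \<notin> E"
    and disj: "\<And>A B. A \<in> PP \<Longrightarrow> B \<in> PP \<Longrightarrow> A \<noteq> B \<Longrightarrow> A \<inter> B = {}"
  shows "card PP \<le> cluster_distance V E"
proof -
  let ?P = "\<lambda>l. \<exists>K \<subseteq> V. card K = l \<and> cluster_graph (V - K) {e \<in> E. e \<inter> K = {}}"
  have "cluster_graph (V - V) {e \<in> E. e \<inter> V = {}}"
    by (simp add: cluster_graph_def components_of_graph_def)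
  then have "?P (card V)" by blast
  then have "?P (cluster_distance V E)" unfolding cluster_distance_def by (rule LeastI)
  then obtain K where K: "K \<subseteq> V" "card K = cluster_distance V E"
    "cluster_graph (V - K) {e \<in> E. e \<inter> K = {}}" by blast
  have hit: "\<exists>x. x \<in> A \<inter> K" if A: "A \<in> PP" for A
  proof (rule ccontr)
    assume n: "\<not> ?thesis"
    obtain u v w where uvw: "A = {u, v, w}" "{u, v} \<in> E" "{v, w} \<in> E" "u \<noteq> w" "{u, w} \<notin> E"
      using PP[OF A] by blast
    let ?E = "{e \<in> E. e \<inter> K = {}}"
    have V: "u \<in> V - K" "v \<in> V - K" "w \<in> V - K" using n uvw(1) E[OF uvw(2)] E[OF uvw(3)] by auto
    then have e: "{u, v} \<in> ?E" "{v, w} \<in> ?E" using uvw by auto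
    then have "reach ?E u v" "reach ?E v w" by (auto simp: reach_def)
    moreover then have "reach ?E u w" unfolding reach_def by (rule rtrancl_trans)
    moreover have "reach ?E u u" by (simp add: reach_def)
    ultimately have uw: "u \<in> {x \<in> V - K. reach ?E u x}" "w \<in> {x \<in> V - K. reach ?E u x}" using V by auto
    have "{x \<in> V - K. reach ?E u x} \<in> components_of_graph (V - K) ?E"
      unfolding components_of_graph_def using V by blast
    then have "clique ?E {x \<in> V - K. reach ?E u x}"
      using K(3) unfolding cluster_graph_def by (rule bspec[rotated])
    then have "{u, w} \<in> ?E" using uw uvw(4) unfolding clique_def by (elim ballE[of _ _ u] ballE[of _ _ w]) simp_all
    then show False using uvw(5) by simp
  qed
  then obtain g where g: "\<And>A. A \<in> PP \<Longrightarrow> g A \<in> A \<and> g A \<in> K" by (metis IntE)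
  have "inj_on g PP"
  proof (rule inj_onI)
    fix A B assume AB: "A \<in> PP" "B \<in> PP" "g A = g B"
    then have "g A \<in> A \<inter> B" using g[OF AB(1)] g[OF AB(2)] by simp
    then show "A = B" using disj[OF AB(1,2)] by blast
  qed
  moreover have "g ` PP \<subseteq> K" using g by blast
  moreover have "finite K" using K(1) finV finite_subset by blast
  ultimately have "card PP \<le> card K" by (metis card_inj_on_le)
  then show ?thesis using K(2) by simp
qed

text \<open>Outside \<open>K\<close> adjacency is transitive, so the components there are cliques.
  Vertex 0 in \<open>K\<close> guarantees that \<open>K\<close> is not empty.\<close>

locale reduction = lgraph E lab for E :: "nat set set" and lab :: "nat \<Rightarrow> nat" +
  fixes n :: nat and K :: "nat set"
  assumes En: "e \<in> E \<Longrightarrow> e \<subseteq> {..<n}"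
    and Kn: "K \<subseteq> {..<n}" and K0: "0 \<in> K"
    and P3_free: "u \<notin> K \<Longrightarrow> v \<notin> K \<Longrightarrow> w \<notin> K \<Longrightarrow> u \<noteq> w \<Longrightarrow> {u, v} \<in> E \<Longrightarrow> {v, w} \<in> E \<Longrightarrow> {u, w} \<in> E"
begin

definition cl :: "nat set \<Rightarrow> nat \<Rightarrow> nat set" where
  "cl Q v = {w \<in> Q. w = v \<or> {v, w} \<in> E}"

definition nbK :: "nat \<Rightarrow> nat set" where
  "nbK u = {x \<in> K. {u, x} \<in> E}"

definition priv :: "nat \<Rightarrow> bool" where
  "priv u \<longleftrightarrow> (\<forall>x\<in>K. lab u \<noteq> lab x)"

text \<open>Only smaller vertices count, in \<open>pfirsts\<close> as well. Vertices kept later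
  therefore leave these sets unchanged, and a decision made in a single pass in increasing order
  remains justified.\<close>

definition twins :: "nat set \<Rightarrow> nat \<Rightarrow> nat set" where
  "twins Q v = {u \<in> Q. u < v \<and> {u, v} \<in> E \<and> lab u = lab v \<and> nbK u = nbK v}"

text \<open>Among vertices with private labels only the first one of each label is counted, which
  makes the labels of the counted vertices pairwise different.\<close>

definition pfirsts :: "nat set \<Rightarrow> nat \<Rightarrow> nat set" where
  "pfirsts Q v = {u \<in> Q. u < v \<and> {u, v} \<in> E \<and> twins Q u = {} \<and> priv u \<and> lab u \<noteq> lab v \<and> nbK u = nbK v}"

definition thr :: nat where "thr = 4 * card K + 5"

definition good :: "nat set \<Rightarrow> bool" where
  "good Q \<longleftrightarrow> Q \<subseteq> {..<n} - K \<and>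
     (\<forall>v\<in>Q. card (twins Q v) < thr \<and> (priv v \<longrightarrow> card (pfirsts Q v) < thr))"

lemma finK: "finite K"
  using Kn finite_subset by blast

lemma cl_eq:
  assumes "Q \<inter> K = {}" "u \<in> Q" "v \<in> cl Q u"
  shows "cl Q v = cl Q u"
proof (cases "u = v")
  case False
  then have uv: "{u, v} \<in> E" "v \<in> Q" using assms(3) by (auto simp: cl_def)
  have vu: "{v, u} \<in> E" using uv(1) by (simp add: insert_commute)
  have nK: "x \<notin> K" if "x \<in> Q" for x using that assms(1) by blast
  have 1: "{v, w} \<in> E" if "w \<in> Q" "{u, w} \<in> E" "w \<noteq> v" for w
    using P3_free[of v u w] nK assms(2) uv vu that by simp
  have 2: "{u, w} \<in> E" if "w \<in> Q" "{v, w} \<in> E" "w \<noteq> u" for w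
    using P3_free[of u v w] nK assms(2) uv that by simp
  show ?thesis using 1 2 uv vu assms(2) by (auto simp: cl_def)
qed simp

lemma clique_graph_cl:
  assumes V: "V \<subseteq> {..<n}" "K \<subseteq> V" and v: "v \<in> V - K"
  shows "clique_graph E V K (cl (V - K) v)"
proof unfold_locales
  show "finite V" using V(1) finite_subset by blast
  show "K \<noteq> {}" using K0 by blast
  show "K \<subseteq> V" by fact
  show "cl (V - K) v \<subseteq> V" "cl (V - K) v \<inter> K = {}" by (auto simp: cl_def)
  show "{a, b} \<in> E" if "a \<in> cl (V - K) v" "b \<in> cl (V - K) v" "a \<noteq> b" for a b
  proof -
    have "cl (V - K) a = cl (V - K) v" using that(1) v by (intro cl_eq) auto
    then show ?thesis using that by (auto simp: cl_def)
  qed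
  show "b \<in> cl (V - K) v \<union> K" if "{a, b} \<in> E" "a \<in> cl (V - K) v" "b \<in> V" for a b
  proof -
    have "cl (V - K) a = cl (V - K) v" using that(2) v by (intro cl_eq) auto
    then show ?thesis using that by (auto simp: cl_def)
  qed
qed

lemma opt_delete_twin:
  assumes V: "V \<subseteq> {..<n}" "K \<subseteq> V" and v: "v \<in> V - K" and Q: "Q \<subseteq> V - K"
    and many: "thr \<le> card (twins Q v)"
  shows "opt V = opt (V - {v}) + enat 1"
proof -
  interpret clique_graph E lab V K "cl (V - K) v" by (rule clique_graph_cl[OF V v])
  show ?thesis
  proof (rule delete_twin)
    show "v \<in> cl (V - K) v" using v by (simp add: cl_def)
    show "twins Q v \<subseteq> cl (V - K) v - {v}" using Q by (auto simp: twins_def cl_def insert_commute)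
    show "4 * card K + 5 \<le> card (twins Q v)" using many by (simp add: thr_def)
    show "lab q = lab v" if "q \<in> twins Q v" for q using that by (simp add: twins_def)
    show "({q, x} \<in> E) = ({v, x} \<in> E)" if "q \<in> twins Q v" "x \<in> K" for q x
      using that by (auto simp: twins_def nbK_def)
  qed
qed

lemma opt_delete_private:
  assumes V: "V \<subseteq> {..<n}" "K \<subseteq> V" and v: "v \<in> V - K" "priv v" and Q: "Q \<subseteq> V - K"
    and many: "thr \<le> card (pfirsts Q v)"
  shows "opt V = opt (V - {v}) + enat 1"
proof -
  interpret clique_graph E lab V K "cl (V - K) v" by (rule clique_graph_cl[OF V v(1)])
  show ?thesis
  proof (rule delete_private)
    show "v \<in> cl (V - K) v" using v by (simp add: cl_def)
    show "pfirsts Q v \<subseteq> cl (V - K) v - {v}" using Q by (auto simp: pfirsts_def cl_def insert_commute)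
    show "4 * card K + 5 \<le> card (pfirsts Q v)" using many by (simp add: thr_def)
    \<comment> \<open>Two counted vertices with equal labels would be twins, so the larger one would
      not be first.\<close>
    have no: False if a: "a \<in> pfirsts Q v" "b \<in> pfirsts Q v" "lab a = lab b" "a < b" for a b
    proof -
      have ab: "a \<in> Q" "b \<in> Q" "{a, v} \<in> E" "{v, b} \<in> E" "nbK a = nbK b" "twins Q b = {}"
        using a by (auto simp: pfirsts_def insert_commute)
      then have "{a, b} \<in> E" using P3_free[of a v b] Q v a(4) by auto
      then have "a \<in> twins Q b" using ab a by (simp add: twins_def)
      then show False using ab by simp
    qed
    show "inj_on lab (pfirsts Q v)"
    proof (rule inj_onI, rule ccontr)
      fix a b assume ab: "a \<in> pfirsts Q v" "b \<in> pfirsts Q v" "lab a = lab b" "a \<noteq> b"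
      then consider "a < b" | "b < a" by linarith
      then show False using no[OF ab(1,2,3)] no[OF ab(2,1) ab(3)[symmetric]] by cases
    qed
    show "lab q \<noteq> lab x" if "q \<in> pfirsts Q v" "x \<in> K" for q x
      using that by (auto simp: pfirsts_def priv_def)
    show "lab v \<noteq> lab x" if "x \<in> K" for x using that v(2) by (auto simp: priv_def)
    show "({q, x} \<in> E) = ({v, x} \<in> E)" if "q \<in> pfirsts Q v" "x \<in> K" for q x
      using that by (auto simp: pfirsts_def nbK_def)
  qed
qed

text \<open>Each class of equal neighbourhood and label has at most \<open>thr\<close> members.
  Classes whose label occurs in K number at most 2 ^ |K| * |K|. Each private class has a first
  member, and for every neighbourhood at most \<open>thr\<close> of those are kept.\<close>

lemma card_clique_le:
  assumes g: "good Q" and v: "v \<in> Q"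
  shows "card (cl Q v) \<le> thr * ((2 ^ card K * card K) + thr * 2 ^ card K)"
proof -
  define X where "X = cl Q v"
  have Q: "Q \<subseteq> {..<n}" "Q \<inter> K = {}" using g by (auto simp: good_def)
  have finX: "finite X" using Q finite_subset unfolding X_def cl_def by fastforce
  have XQ: "X \<subseteq> Q" by (auto simp: X_def cl_def)
  have adj: "{a, b} \<in> E" if "a \<in> X" "b \<in> X" "a \<noteq> b" for a b
  proof -
    have "b \<in> cl Q a" using cl_eq[OF Q(2) v, of a] that by (auto simp: X_def)
    then show ?thesis using that by (auto simp: cl_def)
  qed
  have finQ: "finite Q" using Q finite_subset by blast
  let ?f = "\<lambda>u. (nbK u, lab u)"
  have few: "card {u \<in> X. u < w \<and> ?f u = ?f w} < thr" if w: "w \<in> X" for w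
  proof -
    have "{u \<in> X. u < w \<and> ?f u = ?f w} \<subseteq> twins Q w"
      using adj w XQ by (auto simp: twins_def)
    then have "card {u \<in> X. u < w \<and> ?f u = ?f w} \<le> card (twins Q w)"
      using finQ by (intro card_mono) (auto simp: twins_def)
    then show ?thesis using g w XQ unfolding good_def by (meson le_less_trans subsetD)
  qed
  have "card X \<le> thr * card (?f ` X)"
    by (rule card_le_fibers[OF finX, of _ ?f]) (use finX few in auto)
  moreover have "card (?f ` X) \<le> 2 ^ card K * card K + thr * 2 ^ card K"
  proof -
    define P where "P = {u \<in> X. priv u \<and> twins Q u = {}}"
    have finP: "finite P" using finX by (simp add: P_def)
    have "?f ` X \<subseteq> (Pow K \<times> lab ` K) \<union> ?f ` P"
    proof
      fix y assume "y \<in> ?f ` X"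
      then obtain u where u: "u \<in> X" "y = ?f u" by blast
      show "y \<in> (Pow K \<times> lab ` K) \<union> ?f ` P"
      proof (cases "priv u")
        case False
        then show ?thesis using u by (auto simp: priv_def nbK_def)
      next
        case True
        let ?F = "{w \<in> X. ?f w = ?f u}"
        have fin: "finite ?F" "?F \<noteq> {}" using finX u by auto
        \<comment> \<open>The least member has no earlier twin, so it represents its private class
          in P.\<close>
        define w where "w = Min ?F"
        have w: "w \<in> ?F" unfolding w_def using fin by (rule Min_in)
        have "twins Q w = {}"
        proof (rule ccontr)
          assume "twins Q w \<noteq> {}"
          then obtain z where z: "z \<in> twins Q w" by blast
          then have zz: "z \<in> Q" "z < w" "{w, z} \<in> E" "?f z = ?f w"
            by (auto simp: twins_def insert_commute)
          then have "z \<in> cl Q w" by (simp add: cl_def)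
          then have "z \<in> X" using cl_eq[OF Q(2) v, of w] w by (simp add: X_def)
          then have "z \<in> ?F" using zz w by auto
          then have "w \<le> z" unfolding w_def using fin(1) by simp
          then show False using zz by simp
        qed
        moreover have "priv w" using True w by (simp add: priv_def)
        ultimately have "w \<in> P" using w by (simp add: P_def)
        then show ?thesis using w u by (auto intro!: image_eqI[of _ _ w])
      qed
    qed
    then have "card (?f ` X) \<le> card ((Pow K \<times> lab ` K) \<union> ?f ` P)"
      using finK finP by (intro card_mono) auto
    also have "\<dots> \<le> card (Pow K \<times> lab ` K) + card (?f ` P)" by (rule card_Un_le)
    also have "card (Pow K \<times> lab ` K) \<le> 2 ^ card K * card K"
      using finK card_image_le[OF finK, of lab] by (simp add: card_cartesian_product card_Pow)
    also have "card (?f ` P) \<le> thr * 2 ^ card K"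
    proof -
      have "card P \<le> thr * card (Pow K)"
      proof (rule card_le_fibers[OF finP, of _ nbK])
        fix w assume w: "w \<in> P"
        have "{u \<in> P. u < w \<and> nbK u = nbK w} \<subseteq> pfirsts Q w"
        proof
          fix u assume "u \<in> {u \<in> P. u < w \<and> nbK u = nbK w}"
          then have u: "u \<in> X" "priv u" "twins Q u = {}" "u < w" "nbK u = nbK w" by (auto simp: P_def)
          have e: "{u, w} \<in> E" using adj u w by (auto simp: P_def)
          have "lab u \<noteq> lab w"
          proof
            assume "lab u = lab w"
            then have "u \<in> twins Q w" using u e XQ by (auto simp: twins_def)
            then show False using w by (simp add: P_def)
          qed
          then show "u \<in> pfirsts Q w" using u e XQ by (auto simp: pfirsts_def)
        qed
        then have "card {u \<in> P. u < w \<and> nbK u = nbK w} \<le> card (pfirsts Q w)"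
          using finQ by (intro card_mono) (auto simp: pfirsts_def)
        also have "\<dots> < thr" using g w XQ by (auto simp: good_def P_def)
        finally show "card {u \<in> P. u < w \<and> nbK u = nbK w} < thr" .
      qed (use finK in \<open>auto simp: nbK_def\<close>)
      then show ?thesis using card_image_le[OF finP, of ?f] finK by (simp add: card_Pow)
    qed
    finally show ?thesis by simp
  qed
  ultimately show ?thesis unfolding X_def by (meson le_trans mult_le_mono2)
qed

section \<open>Cliques represented by their least vertices, and similarity of cliques\<close>

definition leaders :: "nat set \<Rightarrow> nat set" where
  "leaders Q = {v \<in> Q. \<forall>u\<in>Q. u < v \<longrightarrow> {u, v} \<notin> E}"

lemma leader_exists:
  assumes Q: "Q \<inter> K = {}" and w: "w \<in> Q" obtains v where "v \<in> leaders Q" "w \<in> cl Q v"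
proof -
  define v where "v = (LEAST v. v \<in> cl Q w)"
  have ww: "w \<in> cl Q w" using w by (simp add: cl_def)
  then have v: "v \<in> cl Q w" unfolding v_def by (rule LeastI)
  have vQ: "v \<in> Q" using v by (simp add: cl_def)
  have eq: "cl Q v = cl Q w" using cl_eq[OF Q w v] .
  have "{u, v} \<notin> E" if "u \<in> Q" "u < v" for u
  proof
    assume "{u, v} \<in> E"
    then have "u \<in> cl Q v" using that by (simp add: cl_def insert_commute)
    then have "u \<in> cl Q w" using eq by simp
    then show False using that(2) unfolding v_def by (metis not_less_Least)
  qed
  then have "v \<in> leaders Q" using vQ by (auto simp: leaders_def)
  then show thesis using that eq ww by simp
qed

lemma leader_disjoint:
  assumes Q: "Q \<inter> K = {}" and uv: "u \<in> leaders Q" "v \<in> leaders Q" "u \<noteq> v"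
  shows "cl Q u \<inter> cl Q v = {}"
proof (rule ccontr)
  assume "cl Q u \<inter> cl Q v \<noteq> {}"
  then obtain w where w: "w \<in> cl Q u" "w \<in> cl Q v" by blast
  have uQ: "u \<in> Q" "v \<in> Q" using uv by (auto simp: leaders_def)
  have "cl Q u = cl Q v" using cl_eq[OF Q uQ(1) w(1)] cl_eq[OF Q uQ(2) w(2)] by simp
  then have "u \<in> cl Q v" using uQ by (auto simp: cl_def)
  then have "{u, v} \<in> E" "{v, u} \<in> E" using uv(3) by (auto simp: cl_def insert_commute)
  then show False using uv uQ unfolding leaders_def by (metis (mono_tags, lifting) linorder_neqE_nat mem_Collect_eq)
qed

text \<open>A testable substitute for \<open>piece_iso\<close>: members are matched by their
  position in given lists instead of searching for a bijection. Some isomorphic cliques may be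
  missed, but the number of classes stays bounded. Adjacency among the members is not compared,
  since both sides are cliques.\<close>

definition similar :: "(nat \<Rightarrow> nat) \<Rightarrow> nat \<Rightarrow> (nat \<Rightarrow> nat) \<Rightarrow> nat \<Rightarrow> bool" where
  "similar f s g t \<longleftrightarrow> s = t \<and>
     (\<forall>i<s. \<forall>x\<in>K. ({f i, x} \<in> E \<longleftrightarrow> {g i, x} \<in> E) \<and> (lab (f i) = lab x \<longleftrightarrow> lab (g i) = lab x)) \<and>
     (\<forall>i<s. \<forall>j<s. lab (f i) = lab (f j) \<longleftrightarrow> lab (g i) = lab (g j))"

lemma similar_piece_iso:
  assumes sim: "similar f s g t" and f: "bij_betw f {..<s} C" and g: "bij_betw g {..<t} D"
    and C: "\<And>a b. a \<in> C \<Longrightarrow> b \<in> C \<Longrightarrow> a \<noteq> b \<Longrightarrow> {a, b} \<in> E"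
    and D: "\<And>a b. a \<in> D \<Longrightarrow> b \<in> D \<Longrightarrow> a \<noteq> b \<Longrightarrow> {a, b} \<in> E"
  shows "\<exists>\<phi>. piece_iso K C D \<phi>"
proof -
  have st: "s = t" using sim by (simp add: similar_def)
  define \<phi> where "\<phi> = g \<circ> inv_into {..<s} f"
  have b: "bij_betw \<phi> C D"
    unfolding \<phi>_def using bij_betw_trans[OF bij_betw_inv_into[OF f]] g st by blast
  have \<phi>: "\<exists>i<s. a = f i \<and> \<phi> a = g i" if "a \<in> C" for a
  proof -
    have "inv_into {..<s} f a < s" "f (inv_into {..<s} f a) = a"
      using f that by (metis bij_betw_def inv_into_into lessThan_iff) (metis bij_betw_def f that f_inv_into_f)
    then show ?thesis by (intro exI[of _ "inv_into {..<s} f a"]) (simp add: \<phi>_def)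
  qed
  have \<phi>D: "\<phi> a \<in> D" if "a \<in> C" for a using b that by (auto simp: bij_betw_def)
  have sing: "{a} \<notin> E" for a using E2[of "{a}"] by auto
  have "({\<phi> a, \<phi> c} \<in> E) = ({a, c} \<in> E)" if "a \<in> C" "c \<in> C" for a c
  proof (cases "a = c")
    case True
    then show ?thesis using sing by simp
  next
    case False
    then have "\<phi> a \<noteq> \<phi> c" using b that by (auto simp: bij_betw_def inj_on_eq_iff)
    then show ?thesis using C[OF that False] D[OF \<phi>D[OF that(1)] \<phi>D[OF that(2)]] by simp
  qed
  moreover have "({\<phi> a, x} \<in> E) = ({a, x} \<in> E) \<and> (lab (\<phi> a) = lab x \<longleftrightarrow> lab a = lab x)"
    if "a \<in> C" "x \<in> K" for a x
    using \<phi>[OF that(1)] sim that(2) unfolding similar_def by metis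
  moreover have "lab (\<phi> a) = lab (\<phi> c) \<longleftrightarrow> lab a = lab c" if "a \<in> C" "c \<in> C" for a c
    using \<phi>[OF that(1)] \<phi>[OF that(2)] sim unfolding similar_def by metis
  ultimately have "piece_iso K C D \<phi>" unfolding piece_iso_def using b by blast
  then show ?thesis by blast
qed

lemma opt_delete_clique:
  assumes Q: "Q \<subseteq> {..<n} - K" and I: "I \<subseteq> leaders Q" and v: "v \<in> leaders Q" "v \<notin> I"
    and V: "V = K \<union> (\<Union>u\<in>I'. cl Q u)" "insert v I \<subseteq> I'" "I' \<subseteq> leaders Q"
    and many: "2 * 2 ^ card K \<le> card I"
    and mem: "\<And>u. u \<in> insert v I \<Longrightarrow> bij_betw (m u) {..<s u} (cl Q u)"
    and sim: "\<And>u. u \<in> I \<Longrightarrow> similar (m v) (s v) (m u) (s u)"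
  shows "opt V = opt (V - cl Q v) + optR (K \<union> cl Q v) K"
proof -
  have QK: "Q \<inter> K = {}" using Q by blast
  have lQ: "\<And>u. u \<in> leaders Q \<Longrightarrow> u \<in> Q" by (simp add: leaders_def)
  have clQ: "\<And>u. cl Q u \<subseteq> Q" by (auto simp: cl_def)
  have finQ: "finite Q" using Q finite_subset by blast
  have finI: "finite I" by (rule finite_subset[OF I]) (use finQ in \<open>simp add: leaders_def\<close>)
  have Vn: "V \<subseteq> {..<n}" using V Kn clQ Q by fastforce
  have adj: "{a, b} \<in> E" if "u \<in> leaders Q" "a \<in> cl Q u" "b \<in> cl Q u" "a \<noteq> b" for u a b
  proof -
    have "b \<in> cl Q a" using cl_eq[OF QK lQ[OF that(1)] that(2)] that by simp
    then show ?thesis using that by (auto simp: cl_def)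
  qed
  show ?thesis
  proof (rule delete_piece[where I = "insert v I" and D = "cl Q" and ?i0.0 = v])
    show "finite V" using Vn finite_subset by blast
    show "K \<subseteq> V" using V by blast
    show "K \<noteq> {}" using K0 by blast
    show "finite (insert v I)" using finI by simp
    show "2 * 2 ^ card K < card (insert v I)" using many finI v(2) by simp
    show "cl Q i \<subseteq> V - K" if "i \<in> insert v I" for i using that V clQ QK by blast
    show "cl Q i \<inter> cl Q j = {}" if "i \<in> insert v I" "j \<in> insert v I" "i \<noteq> j" for i j
      using leader_disjoint[OF QK] that I v by blast
    show "b \<in> cl Q i \<union> K" if "i \<in> insert v I" "{a, b} \<in> E" "a \<in> cl Q i" "b \<in> V" for i a b
    proof (cases "b \<in> K")
      case False
      then have "b \<in> Q" using that(4) V clQ by blast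
      then have "b \<in> cl Q a" using that(2) by (simp add: cl_def)
      moreover have "cl Q a = cl Q i" using cl_eq[OF QK _ that(3)] lQ that(1) I v by blast
      ultimately show ?thesis by simp
    qed simp
    show "\<exists>\<phi>. piece_iso K (cl Q v) (cl Q i) \<phi>" if i: "i \<in> insert v I" for i
    proof (rule similar_piece_iso)
      show "similar (m v) (s v) (m i) (s i)"
        using i sim by (auto simp: similar_def)
      show "bij_betw (m v) {..<s v} (cl Q v)" "bij_betw (m i) {..<s i} (cl Q i)" using mem i by auto
      show "\<And>a b. a \<in> cl Q v \<Longrightarrow> b \<in> cl Q v \<Longrightarrow> a \<noteq> b \<Longrightarrow> {a, b} \<in> E" using adj v by blast
      show "\<And>a b. a \<in> cl Q i \<Longrightarrow> b \<in> cl Q i \<Longrightarrow> a \<noteq> b \<Longrightarrow> {a, b} \<in> E" using adj i v I by blast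
    qed
  qed simp_all
qed

text \<open>Everything that \<open>similar\<close> compares is collected in \<open>code\<close>: a
  size up to G, two relations between positions and K, and one relation between positions. Counting
  these codes gives the bound.\<close>

lemma card_similarity_classes:
  fixes I :: "nat set"
  assumes fin: "finite I" and s: "\<And>u. u \<in> I \<Longrightarrow> s u \<le> G"
    and few: "\<And>v. v \<in> I \<Longrightarrow> card {u \<in> I. u < v \<and> similar (m v) (s v) (m u) (s u)} < h"
  shows "card I \<le> h * ((G + 1) * (2 ^ (G * card K) * (2 ^ (G * card K) * 2 ^ (G * G))))"
proof -
  define code where "code u = (s u, {(i, x). i < s u \<and> x \<in> K \<and> {m u i, x} \<in> E},
    {(i, x). i < s u \<and> x \<in> K \<and> lab (m u i) = lab x},
    {(i, j). i < s u \<and> j < s u \<and> lab (m u i) = lab (m u j)})" for u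
  let ?Y = "{..G} \<times> Pow ({..<G} \<times> K) \<times> Pow ({..<G} \<times> K) \<times> Pow ({..<G} \<times> {..<G})"
  have sim: "similar (m v) (s v) (m u) (s u)" if c: "code u = code v" for u v
  proof -
    have s: "s u = s v" using c by (simp add: code_def)
    have 1: "{m u i, x} \<in> E \<longleftrightarrow> {m v i, x} \<in> E" if "i < s u" "x \<in> K" for i x
    proof -
      have "{(i, x). i < s u \<and> x \<in> K \<and> {m u i, x} \<in> E} =
        {(i, x). i < s v \<and> x \<in> K \<and> {m v i, x} \<in> E}"
        using c unfolding code_def prod.inject by (elim conjE)
      then have "(i, x) \<in> {(i, x). i < s u \<and> x \<in> K \<and> {m u i, x} \<in> E} \<longleftrightarrow>
        (i, x) \<in> {(i, x). i < s v \<and> x \<in> K \<and> {m v i, x} \<in> E}"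
        by (rule arg_cong)
      then show ?thesis using that s by simp
    qed
    have 2: "lab (m u i) = lab x \<longleftrightarrow> lab (m v i) = lab x" if "i < s u" "x \<in> K" for i x
    proof -
      have "{(i, x). i < s u \<and> x \<in> K \<and> lab (m u i) = lab x} =
        {(i, x). i < s v \<and> x \<in> K \<and> lab (m v i) = lab x}"
        using c unfolding code_def prod.inject by (elim conjE)
      then have "(i, x) \<in> {(i, x). i < s u \<and> x \<in> K \<and> lab (m u i) = lab x} \<longleftrightarrow>
        (i, x) \<in> {(i, x). i < s v \<and> x \<in> K \<and> lab (m v i) = lab x}"
        by (rule arg_cong)
      then show ?thesis using that s by simp
    qed
    have 3: "lab (m u i) = lab (m u j) \<longleftrightarrow> lab (m v i) = lab (m v j)" if "i < s u" "j < s u" for i j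
    proof -
      have "{(i, j). i < s u \<and> j < s u \<and> lab (m u i) = lab (m u j)} =
        {(i, j). i < s v \<and> j < s v \<and> lab (m v i) = lab (m v j)}"
        using c unfolding code_def prod.inject by (elim conjE)
      then have "(i, j) \<in> {(i, j). i < s u \<and> j < s u \<and> lab (m u i) = lab (m u j)} \<longleftrightarrow>
        (i, j) \<in> {(i, j). i < s v \<and> j < s v \<and> lab (m v i) = lab (m v j)}"
        by (rule arg_cong)
      then show ?thesis using that s by simp
    qed
    show ?thesis using s 1 2 3 by (simp add: similar_def)
  qed
  have "card I \<le> h * card ?Y"
  proof (rule card_le_fibers[OF fin, of _ code])
    show "finite ?Y" using finK by simp
    show "code u \<in> ?Y" if "u \<in> I" for u using s[OF that] by (auto simp: code_def)
    fix v assume v: "v \<in> I"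
    have "card {u \<in> I. u < v \<and> code u = code v} \<le> card {u \<in> I. u < v \<and> similar (m v) (s v) (m u) (s u)}"
      using sim fin by (intro card_mono) auto
    then show "card {u \<in> I. u < v \<and> code u = code v} < h" using few[OF v] by linarith
  qed
  also have "card ?Y = (G + 1) * (2 ^ (G * card K) * (2 ^ (G * card K) * 2 ^ (G * G)))"
    using finK by (simp add: card_cartesian_product card_Pow)
  finally show ?thesis .
qed

end

section \<open>A language of bounded loops and its compilation\<close>

text \<open>Rounds of \<open>Fr\<close> and ranges of \<open>Sm\<close> are fixed by the value of a
  variable at entry, so the number of steps is bounded by an expression in bounds for the variables.
  \<open>Rd\<close> and \<open>St\<close> access one of 16 arrays; \<open>Inp\<close> reads the
  input, which is never overwritten.\<close>

datatype exp =
    Cn nat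
  | Vr nat
  | Rd nat exp
  | Op arith_op exp exp
  | EqE exp exp
  | LtE exp exp
  | Sm nat nat exp

datatype com =
    Nop
  | Asg nat exp
  | St nat exp exp
  | Inp nat exp
  | Sq com com
  | Cd exp com com
  | Fr nat nat com

type_synonym env = "nat \<Rightarrow> nat"
type_synonym arrays = "nat \<Rightarrow> nat \<Rightarrow> nat"

primrec eval :: "exp \<Rightarrow> env \<Rightarrow> arrays \<Rightarrow> nat" where
  "eval (Cn c) v a = c"
| "eval (Vr r) v a = v r"
| "eval (Rd x e) v a = a x (eval e v a)"
| "eval (Op f e1 e2) v a = arith f (eval e1 v a) (eval e2 v a)"
| "eval (EqE e1 e2) v a = of_bool (eval e1 v a = eval e2 v a)"
| "eval (LtE e1 e2) v a = of_bool (eval e1 v a < eval e2 v a)"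
| "eval (Sm i r e) v a = (\<Sum>j<v r. eval e (v(i := j)) a)"

text \<open>Registers below 50 hold program variables, 50 to 69 the bound variables of sums, 70 the
  base address of the arrays and those from 71 on intermediate results.\<close>

primrec wfe :: "nat set \<Rightarrow> exp \<Rightarrow> bool" where
  "wfe A (Cn c) \<longleftrightarrow> True"
| "wfe A (Vr r) \<longleftrightarrow> r \<in> A"
| "wfe A (Rd x e) \<longleftrightarrow> x < 16 \<and> wfe A e"
| "wfe A (Op f e1 e2) \<longleftrightarrow> wfe A e1 \<and> wfe A e2"
| "wfe A (EqE e1 e2) \<longleftrightarrow> wfe A e1 \<and> wfe A e2"
| "wfe A (LtE e1 e2) \<longleftrightarrow> wfe A e1 \<and> wfe A e2"
| "wfe A (Sm i r e) \<longleftrightarrow> r < 50 \<and> 50 \<le> i \<and> i < 70 \<and> i \<notin> A \<and> wfe (insert i A) e"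

primrec wfc :: "com \<Rightarrow> bool" where
  "wfc Nop \<longleftrightarrow> True"
| "wfc (Asg r e) \<longleftrightarrow> r < 50 \<and> wfe {..<50} e"
| "wfc (St x e1 e2) \<longleftrightarrow> x < 16 \<and> wfe {..<50} e1 \<and> wfe {..<50} e2"
| "wfc (Inp r e) \<longleftrightarrow> r < 50 \<and> wfe {..<50} e"
| "wfc (Sq c1 c2) \<longleftrightarrow> wfc c1 \<and> wfc c2"
| "wfc (Cd e c1 c2) \<longleftrightarrow> wfe {..<50} e \<and> wfc c1 \<and> wfc c2"
| "wfc (Fr i r c) \<longleftrightarrow> i < 50 \<and> r < 50 \<and> wfc c"

abbreviation "Mov r a \<equiv> Arith r Add a (Imm 0)"

text \<open>The 16 arrays are interleaved above the input, so no array needs a length.\<close>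

abbreviation addr_code :: "nat \<Rightarrow> nat \<Rightarrow> prog" where
  "addr_code k x \<equiv> Seq (Arith k Mul (Reg k) (Imm 16))
     (Seq (Arith k Add (Reg k) (Imm x)) (Arith k Add (Reg k) (Reg 70)))"

text \<open>The registers from \<open>k\<close> on act as a stack: the value is left in register
  \<open>k\<close>, and registers from 70 up to \<open>k - 1\<close> keep their contents.\<close>

primrec compile_exp :: "nat \<Rightarrow> exp \<Rightarrow> prog" where
  "compile_exp k (Cn c) = Mov k (Imm c)"
| "compile_exp k (Vr r) = Mov k (Reg r)"
| "compile_exp k (Rd x e) = Seq (compile_exp k e) (Seq (addr_code k x) (Load k (Reg k)))"
| "compile_exp k (Op f e1 e2) =
     Seq (Seq (compile_exp k e1) (compile_exp (k + 1) e2)) (Arith k f (Reg k) (Reg (k + 1)))"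
| "compile_exp k (EqE e1 e2) =
     Seq (Seq (compile_exp k e1) (compile_exp (k + 1) e2))
       (If (Eq (Reg k) (Reg (k + 1))) (Mov k (Imm 1)) (Mov k (Imm 0)))"
| "compile_exp k (LtE e1 e2) =
     Seq (Seq (compile_exp k e1) (compile_exp (k + 1) e2))
       (If (Lt (Reg k) (Reg (k + 1))) (Mov k (Imm 1)) (Mov k (Imm 0)))"
| "compile_exp k (Sm i r e) =
     Seq (Seq (Mov k (Imm 0)) (Mov (k + 1) (Imm 0)))
       (While (Lt (Reg (k + 1)) (Reg r))
         (Seq (Mov i (Reg (k + 1))) (Seq (compile_exp (k + 2) e)
           (Seq (Arith k Add (Reg k) (Reg (k + 2))) (Arith (k + 1) Add (Reg (k + 1)) (Imm 1))))))"

primrec compile :: "nat \<Rightarrow> com \<Rightarrow> prog" where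
  "compile k Nop = Skip"
| "compile k (Asg r e) = Seq (compile_exp k e) (Mov r (Reg k))"
| "compile k (St x e1 e2) = Seq (Seq (compile_exp k e1) (addr_code k x))
     (Seq (compile_exp (k + 1) e2) (Store (Reg k) (Reg (k + 1))))"
| "compile k (Inp r e) = Seq (compile_exp k e) (Load r (Reg k))"
| "compile k (Sq c1 c2) = Seq (compile k c1) (compile k c2)"
| "compile k (Cd e c1 c2) =
     Seq (compile_exp k e) (If (Eq (Reg k) (Imm 0)) (compile k c2) (compile k c1))"
| "compile k (Fr i r c) =
     Seq (Seq (Mov k (Imm 0)) (Mov (k + 1) (Reg r)))
       (While (Lt (Reg k) (Reg (k + 1)))
         (Seq (Mov i (Reg k)) (Seq (compile (k + 2) c) (Arith k Add (Reg k) (Imm 1)))))"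

text \<open>If all stored values are at most \<open>B\<close>, then \<open>B\<close> to the degree bounds all intermediate values.\<close>

primrec deg_exp :: "exp \<Rightarrow> nat" where
  "deg_exp (Cn c) = c + 1"
| "deg_exp (Vr r) = 2"
| "deg_exp (Rd x e) = deg_exp e + 4"
| "deg_exp (Op f e1 e2) = deg_exp e1 + deg_exp e2 + 1"
| "deg_exp (EqE e1 e2) = deg_exp e1 + deg_exp e2 + 1"
| "deg_exp (LtE e1 e2) = deg_exp e1 + deg_exp e2 + 1"
| "deg_exp (Sm i r e) = deg_exp e + 3"

primrec deg :: "com \<Rightarrow> nat" where
  "deg Nop = 1"
| "deg (Asg r e) = deg_exp e + 2"
| "deg (St x e1 e2) = deg_exp e1 + deg_exp e2 + 4"
| "deg (Inp r e) = deg_exp e + 2"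
| "deg (Sq c1 c2) = deg c1 + deg c2"
| "deg (Cd e c1 c2) = deg_exp e + deg c1 + deg c2"
| "deg (Fr i r c) = deg c + 3"

lemma exec_for:
  assumes body: "\<And>j s. j < N \<Longrightarrow> Inv j s \<Longrightarrow> \<exists>t s'. exec W c s t s' \<and> t \<le> tb \<and> Inv (Suc j) s'"
    and tst: "\<And>j s. j \<le> N \<Longrightarrow> Inv j s \<Longrightarrow> holds (fst s) b \<longleftrightarrow> j < N"
    and init: "Inv 0 s"
  shows "\<exists>t s'. exec W (While b c) s t s' \<and> t \<le> N * (tb + 1) + 1 \<and> Inv N s'"
proof -
  have "\<exists>t s'. exec W (While b c) s t s' \<and> t \<le> m * (tb + 1) + 1 \<and> Inv N s'"
    if "m \<le> N" "Inv (N - m) s" for m s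
    using that
  proof (induction m arbitrary: s)
    case 0
    then have "\<not> holds (fst s) b" using tst[of N s] by simp
    then have "exec W (While b c) s 1 s" by (rule exec.WhileFalse)
    then show ?case using 0 by (intro exI[of _ 1] exI[of _ s]) simp
  next
    case (Suc m)
    then have h: "holds (fst s) b" using tst[of "N - Suc m" s] by simp
    have "N - Suc m < N" "Suc (N - Suc m) = N - m" using Suc.prems by auto
    then obtain t1 s1 where 1: "exec W c s t1 s1" "t1 \<le> tb" "Inv (N - m) s1"
      using body Suc.prems by metis
    obtain t2 s2 where 2: "exec W (While b c) s1 t2 s2" "t2 \<le> m * (tb + 1) + 1" "Inv N s2"
      using Suc.IH[OF _ 1(3)] Suc.prems by auto
    have "exec W (While b c) s (t1 + t2 + 1) s2" using h 1 2 by (blast intro: exec.WhileTrue)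
    moreover have "t1 + t2 + 1 \<le> Suc m * (tb + 1) + 1" using 1(2) 2(2) by simp
    ultimately show ?case using 2(3) by blast
  qed
  from this[of N s] init show ?thesis by simp
qed

text \<open>Every variable has its own bound \<open>U r\<close>: loop bounds must be small for the
  running time, while other variables may reach \<open>B\<close>, which will depend on the budget as
  well. The memory below \<open>base\<close> is the input.\<close>

locale program_bounds =
  fixes U :: "nat \<Rightarrow> nat" and B W base :: nat and inp :: "nat \<Rightarrow> nat"
  assumes UB: "r < 50 \<Longrightarrow> U r \<le> B" and baseB: "base \<le> B" and B16: "16 \<le> B"
begin

primrec cost_exp :: "exp \<Rightarrow> nat" where
  "cost_exp (Cn c) = 1"
| "cost_exp (Vr r) = 1"
| "cost_exp (Rd x e) = cost_exp e + 4"
| "cost_exp (Op f e1 e2) = cost_exp e1 + cost_exp e2 + 1"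
| "cost_exp (EqE e1 e2) = cost_exp e1 + cost_exp e2 + 2"
| "cost_exp (LtE e1 e2) = cost_exp e1 + cost_exp e2 + 2"
| "cost_exp (Sm i r e) = U r * (cost_exp e + 4) + 3"

primrec cost :: "com \<Rightarrow> nat" where
  "cost Nop = 1"
| "cost (Asg r e) = cost_exp e + 1"
| "cost (St x e1 e2) = cost_exp e1 + cost_exp e2 + 4"
| "cost (Inp r e) = cost_exp e + 1"
| "cost (Sq c1 c2) = cost c1 + cost c2"
| "cost (Cd e c1 c2) = cost_exp e + cost c1 + cost c2 + 1"
| "cost (Fr i r c) = U r * (cost c + 3) + 3"

text \<open>Folding this over a list of counter values gives the precondition of a loop with these
  rounds. The detour through \<open>foldr\<close> keeps \<open>wp\<close> primitive recursive in the
  command.\<close>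

definition upd_then where
  "upd_then i F j Q v a = F Q (v(i := j)) a" for i j :: nat and v :: env

lemma loop_Cons:
  "foldr (upd_then i F) (j # xs) Q v a = F (foldr (upd_then i F) xs Q) (v(i := j)) a"
  by (simp add: upd_then_def)

text \<open>Weakest precondition of the postcondition \<open>Q\<close> together with the bound \<open>U r\<close> on the values
  written to variable \<open>r\<close> and the bound \<open>B\<close> on those written to arrays.\<close>

primrec wp :: "com \<Rightarrow> (env \<Rightarrow> arrays \<Rightarrow> bool) \<Rightarrow> env \<Rightarrow> arrays \<Rightarrow> bool" where
  "wp Nop Q v a \<longleftrightarrow> Q v a"
| "wp (Asg r e) Q v a \<longleftrightarrow> eval e v a \<le> U r \<and> Q (v(r := eval e v a)) a"
| "wp (St x e1 e2) Q v a \<longleftrightarrow> eval e2 v a \<le> B \<and>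
     Q v (a(x := (a x)(eval e1 v a := eval e2 v a)))"
| "wp (Inp r e) Q v a \<longleftrightarrow> eval e v a < base \<and> inp (eval e v a) \<le> U r \<and>
     Q (v(r := inp (eval e v a))) a"
| "wp (Sq c1 c2) Q v a \<longleftrightarrow> wp c1 (wp c2 Q) v a"
| "wp (Cd e c1 c2) Q v a \<longleftrightarrow> (if eval e v a \<noteq> 0 then wp c1 Q v a else wp c2 Q v a)"
| "wp (Fr i r c) Q v a \<longleftrightarrow> U r \<le> U i \<and>
     foldr (upd_then i (wp c)) [0..<v r] Q v a"

primrec vmod :: "com \<Rightarrow> nat set" where
  "vmod Nop = {}"
| "vmod (Asg r e) = {r}"
| "vmod (St x e1 e2) = {}"
| "vmod (Inp r e) = {r}"
| "vmod (Sq c1 c2) = vmod c1 \<union> vmod c2"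
| "vmod (Cd e c1 c2) = vmod c1 \<union> vmod c2"
| "vmod (Fr i r c) = insert i (vmod c)"

primrec amod :: "com \<Rightarrow> nat set" where
  "amod Nop = {}"
| "amod (Asg r e) = {}"
| "amod (St x e1 e2) = {x}"
| "amod (Inp r e) = {}"
| "amod (Sq c1 c2) = amod c1 \<union> amod c2"
| "amod (Cd e c1 c2) = amod c1 \<union> amod c2"
| "amod (Fr i r c) = amod c"

lemma wp_mono:
  "wp c Q v a \<Longrightarrow> (\<And>v' a'. Q v' a' \<Longrightarrow> Q' v' a') \<Longrightarrow> wp c Q' v a"
proof (induction c arbitrary: Q Q' v a)
  case (Sq c1 c2)
  show ?case using Sq.prems(1) by (auto intro: Sq.IH(1) Sq.IH(2) Sq.prems(2))
next
  case (Cd e c1 c2)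
  then show ?case by (auto split: if_splits)
next
  case (Fr i r c)
  have "foldr (upd_then i (wp c)) xs Q v a \<Longrightarrow>
      foldr (upd_then i (wp c)) xs Q' v a" for xs v a
    by (induction xs arbitrary: v a)
      (simp add: Fr.prems(2), unfold loop_Cons, erule Fr.IH, assumption)
  then show ?case using Fr.prems(1) by auto
qed auto

definition agree :: "nat set \<Rightarrow> nat set \<Rightarrow> env \<Rightarrow> arrays \<Rightarrow> env \<Rightarrow> arrays \<Rightarrow> bool" where
  "agree X Y v a v' a' \<longleftrightarrow> (\<forall>r. r \<notin> X \<longrightarrow> v' r = v r) \<and> (\<forall>x. x \<notin> Y \<longrightarrow> a' x = a x)"

lemma wp_frame_aux:
  "wp c Q v a \<Longrightarrow> vmod c \<subseteq> X \<Longrightarrow> amod c \<subseteq> Y \<Longrightarrow> agree X Y v0 a0 v a \<Longrightarrow>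
    wp c (\<lambda>v' a'. Q v' a' \<and> agree X Y v0 a0 v' a') v a"
proof (induction c arbitrary: Q v a)
  case (Sq c1 c2)
  have "wp c1 (\<lambda>v' a'. wp c2 Q v' a' \<and> agree X Y v0 a0 v' a') v a"
    using Sq.prems by (intro Sq.IH(1)) auto
  then show ?case using Sq.prems by (auto intro: wp_mono Sq.IH(2))
next
  case (Cd e c1 c2)
  then show ?case by auto
next
  case (Fr i r c)
  have "foldr (upd_then i (wp c)) xs Q v a \<Longrightarrow> agree X Y v0 a0 v a \<Longrightarrow>
      foldr (upd_then i (wp c)) xs (\<lambda>v' a'. Q v' a' \<and> agree X Y v0 a0 v' a') v a" for xs v a
  proof (induction xs arbitrary: v a)
    case (Cons j xs)
    have ag: "agree X Y v0 a0 (v(i := j)) a" using Cons.prems(2) Fr.prems by (auto simp: agree_def)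
    have "wp c (\<lambda>v' a'. foldr (upd_then i (wp c)) xs Q v' a' \<and> agree X Y v0 a0 v' a')
        (v(i := j)) a"
    proof (rule Fr.IH)
      show "wp c (foldr (upd_then i (wp c)) xs Q) (v(i := j)) a"
        using Cons.prems(1) by (simp only: loop_Cons)
      show "vmod c \<subseteq> X" "amod c \<subseteq> Y" using Fr.prems by auto
    qed (rule ag)
    then have "wp c (foldr (upd_then i (wp c)) xs (\<lambda>v' a'. Q v' a' \<and> agree X Y v0 a0 v' a'))
        (v(i := j)) a"
      by (rule wp_mono) (auto intro: Cons.IH)
    then show ?case by (simp only: loop_Cons)
  qed simp
  then show ?case using Fr.prems by auto
qed (auto simp: agree_def)

text \<open>Specifications below mention only what a command changes; everything else is recovered
  from \<open>agree\<close> when commands are composed.\<close>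

lemma wp_frame:
  assumes "wp c Q v a"
    and "\<And>v' a'. Q v' a' \<Longrightarrow> agree (vmod c) (amod c) v a v' a' \<Longrightarrow> Q' v' a'"
  shows "wp c Q' v a"
  using wp_mono[OF wp_frame_aux[OF assms(1) order_refl order_refl, of v a]] assms(2)
  by (auto simp: agree_def)

lemma wp_Fr:
  assumes UU: "U r \<le> U i" and init: "Inv 0 v a"
    and step: "\<And>j v' a'. j < v r \<Longrightarrow> Inv j v' a' \<Longrightarrow>
      agree (insert i (vmod c)) (amod c) v a v' a' \<Longrightarrow> wp c (Inv (Suc j)) (v'(i := j)) a'"
    and fin: "\<And>v' a'. Inv (v r) v' a' \<Longrightarrow> agree (insert i (vmod c)) (amod c) v a v' a' \<Longrightarrow> Q v' a'"
  shows "wp (Fr i r c) Q v a"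
proof -
  let ?X = "insert i (vmod c)" and ?Y = "amod c"
  let ?F = "upd_then i (wp c)"
  have "Inv (v r - m) v' a' \<Longrightarrow> agree ?X ?Y v a v' a' \<Longrightarrow> m \<le> v r \<Longrightarrow>
      foldr ?F [v r - m..<v r] Q v' a'" for m v' a'
  proof (induction m arbitrary: v' a')
    case 0
    then show ?case using fin by simp
  next
    case (Suc m)
    let ?j = "v r - Suc m"
    have j: "?j < v r" "Suc ?j = v r - m" using Suc.prems by auto
    have "wp c (Inv (v r - m)) (v'(i := ?j)) a'" using step[OF j(1) Suc.prems(1,2)] j(2) by simp
    then have "wp c (foldr ?F [v r - m..<v r] Q) (v'(i := ?j)) a'"
    proof (rule wp_frame)
      fix v2 a2 assume *: "Inv (v r - m) v2 a2" "agree (vmod c) (amod c) (v'(i := ?j)) a' v2 a2"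
      then have "agree ?X ?Y v a v2 a2" using Suc.prems(2) by (auto simp: agree_def)
      then show "foldr ?F [v r - m..<v r] Q v2 a2" using Suc.IH * Suc.prems(3) by simp
    qed
    moreover have "[?j..<v r] = ?j # [v r - m..<v r]" using j by (simp add: upt_conv_Cons)
    ultimately show ?case by (simp only: loop_Cons)
  qed
  from this[of "v r" v a] init UU show ?thesis by (simp add: agree_def)
qed

definition rel_mem :: "arrays \<Rightarrow> (nat \<Rightarrow> nat) \<Rightarrow> bool" where
  "rel_mem a M \<longleftrightarrow> (\<forall>i<base. M i = inp i) \<and> (\<forall>x<16. \<forall>i. M (base + 16 * i + x) = a x i)"

definition bounded :: "env \<Rightarrow> arrays \<Rightarrow> bool" where
  "bounded v a \<longleftrightarrow> (\<forall>r<50. v r \<le> U r) \<and> (\<forall>x<16. \<forall>i. a x i \<le> B)"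

lemma pow_mono: "i \<le> j \<Longrightarrow> B ^ i \<le> B ^ j"
  using B16 by (intro power_increasing) auto

lemma pow_le: "B ^ j \<le> W \<Longrightarrow> i \<le> j \<Longrightarrow> B ^ i \<le> W"
  using pow_mono le_trans by blast

lemma B_le_pow: "B \<le> B ^ (i + 1)"
  using B16 by (intro self_le_power) auto

lemma pow_Suc: "16 * B ^ i \<le> B ^ (i + 1)"
  using B16 by simp

lemma B_less_W: "B ^ 2 \<le> W \<Longrightarrow> B + 1 < W"
proof -
  assume W: "B ^ 2 \<le> W"
  have "B + 1 < 16 * B" using B16 by linarith
  moreover have "16 * B \<le> B * B" using B16 by simp
  ultimately show ?thesis using W unfolding power2_eq_square by linarith
qed

lemma pow_pos: "1 \<le> B ^ i"
  using B16 by (intro one_le_power) auto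

lemma addr_bound:
  assumes "y < B ^ d" "x < 16"
  shows "y * 16 < B ^ (d + 4)" "y * 16 + x < B ^ (d + 4)" "y * 16 + x + base < B ^ (d + 4)"
proof -
  have "y * 16 + x < 16 * B ^ d" using assms by simp
  also have "\<dots> \<le> B ^ (d + 1)" by (rule pow_Suc)
  finally have 1: "y * 16 + x < B ^ (d + 1)" .
  moreover have "base \<le> B ^ (d + 1)" using baseB B_le_pow le_trans by blast
  ultimately have "y * 16 + x + base < 16 * B ^ (d + 1)" by linarith
  also have "\<dots> \<le> B ^ (d + 1 + 1)" by (rule pow_Suc)
  also have "\<dots> \<le> B ^ (d + 4)" by (rule pow_mono) simp
  finally show "y * 16 + x + base < B ^ (d + 4)" .
  then show "y * 16 < B ^ (d + 4)" "y * 16 + x < B ^ (d + 4)" by auto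
qed

lemma arith_bound:
  assumes "x < B ^ d" "y < B ^ e"
  shows "arith f x y < B ^ (d + e + 1)"
proof -
  have d: "B ^ d \<le> B ^ (d + e)" "B ^ e \<le> B ^ (d + e)" by (auto intro: pow_mono)
  have "x * y < B ^ (d + e)"
    unfolding power_add using assms by (intro mult_strict_mono') auto
  moreover have "x div y \<le> x" by simp
  ultimately have "x + y \<le> 2 * B ^ (d + e)" "x - y \<le> 2 * B ^ (d + e)"
    "x * y \<le> 2 * B ^ (d + e)" "x div y \<le> 2 * B ^ (d + e)"
    using assms d by linarith+
  then have "arith f x y \<le> 2 * B ^ (d + e)" by (cases f) simp_all
  also have "\<dots> < 16 * B ^ (d + e)" using pow_pos[of "d + e"] by linarith
  also have "\<dots> \<le> B ^ (d + e + 1)" by (rule pow_Suc)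
  finally show ?thesis .
qed

section \<open>Execution of compiled expressions and commands\<close>

lemma exec_Mov_Imm: "c < W \<Longrightarrow> exec W (Mov r (Imm c)) (R, M) 1 (R(r := c), M)"
  using exec.Arith[of c Add R "Imm c" "Imm 0" W r M] by simp

lemma exec_Mov_Reg: "R q < W \<Longrightarrow> exec W (Mov r (Reg q)) (R, M) 1 (R(r := R q), M)"
  using exec.Arith[of "R q" Add R "Reg q" "Imm 0" W r M] by simp

lemma exec_addr_code:
  assumes "R k < B ^ d" "x < 16" "B ^ (d + 4) \<le> W" "R 70 = base" "70 < k"
  shows "exec W (addr_code k x) (R, M) 3 (R(k := base + 16 * R k + x), M)"
proof -
  note b = addr_bound[OF assms(1,2)]
  have 1: "exec W (Arith k Mul (Reg k) (Imm 16)) (R, M) 1 (R(k := R k * 16), M)"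
    using b assms(3) by (intro exec.Arith) auto
  have 2: "exec W (Arith k Add (Reg k) (Imm x)) (R(k := R k * 16), M) 1 (R(k := R k * 16 + x), M)"
    using exec.Arith[of "R k * 16 + x" Add "R(k := R k * 16)" "Reg k" "Imm x" W k M] b assms(3) by simp
  have 3: "exec W (Arith k Add (Reg k) (Reg 70)) (R(k := R k * 16 + x), M) 1
      (R(k := base + 16 * R k + x), M)"
    using exec.Arith[of "R k * 16 + x + base" Add "R(k := R k * 16 + x)" "Reg k" "Reg 70" W k M]
      b assms(3-5) by (simp add: ac_simps)
  show ?thesis using exec.Seq[OF 1 exec.Seq[OF 2 3]] by (simp add: numeral_3_eq_3)
qed

lemma exec_test:
  assumes "1 < W"
  shows "exec W (If b (Mov k (Imm 1)) (Mov k (Imm 0))) (R, M) 2 (R(k := of_bool (holds R b)), M)"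
proof (cases "holds R b")
  case True
  then show ?thesis using exec.IfTrue[of "(R, M)" b W _ 1, OF _ exec_Mov_Imm[OF assms]]
    by (simp add: numeral_2_eq_2)
next
  case False
  then show ?thesis using exec.IfFalse[of "(R, M)" b W _ 1, OF _ exec_Mov_Imm[of 0]] assms
    by (simp add: numeral_2_eq_2)
qed

text \<open>Registers 50 to 69 outside \<open>A\<close> may change, because sums inside the
  expression use them as bound variables; those in \<open>A\<close> belong to enclosing sums and are
  kept.\<close>

definition exp_result :: "nat \<Rightarrow> exp \<Rightarrow> env \<Rightarrow> arrays \<Rightarrow> nat set \<Rightarrow> env \<Rightarrow> (nat \<Rightarrow> nat) \<Rightarrow> bool" where
  "exp_result k e v a A R M \<longleftrightarrow> (\<exists>t R'. exec W (compile_exp k e) (R, M) t (R', M) \<and> t \<le> cost_exp e \<and>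
    R' k = eval e v a \<and> eval e v a < B ^ deg_exp e \<and> (\<forall>r<k. r \<in> A \<or> r < 50 \<or> 70 \<le> r \<longrightarrow> R' r = R r))"

lemma exp_resultI:
  assumes "exec W (compile_exp k e) (R, M) t (R', M)" "t \<le> cost_exp e"
    "R' k = eval e v a" "eval e v a < B ^ deg_exp e"
    "\<And>r. r < k \<Longrightarrow> r \<in> A \<or> r < 50 \<or> 70 \<le> r \<Longrightarrow> R' r = R r"
  shows "exp_result k e v a A R M"
  unfolding exp_result_def using assms by blast

lemma compile_exp_correct:
  assumes "wfe A e" "A \<subseteq> {..<70}" "\<forall>r\<in>A. R r = v r \<and> v r \<le> B" "\<forall>r<50. R r = v r \<and> v r \<le> U r"
    "rel_mem a M" "\<forall>x<16. \<forall>i. a x i \<le> B" "R 70 = base" "70 < k" "B ^ deg_exp e \<le> W"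
  shows "exp_result k e v a A R M"
  using assms
proof (induction e arbitrary: A R v k)
  case (Cn c)
  \<comment> \<open>A constant may exceed \<open>B\<close>, so its degree depends on its
    value.\<close>
  have "c < 2 ^ c" by (rule less_exp)
  also have "\<dots> \<le> 2 ^ (c + 1)" by simp
  also have "\<dots> \<le> B ^ (c + 1)" using B16 by (intro power_mono) auto
  finally have c: "c < B ^ (c + 1)" .
  then have "exec W (Mov k (Imm c)) (R, M) 1 (R(k := c), M)"
    using Cn.prems(9) by (intro exec_Mov_Imm) simp
  then show ?case using c by (intro exp_resultI[where R' = "R(k := c)" and t = 1]) auto
next
  case (Vr r)
  have r: "R r = v r" "v r \<le> B" using Vr.prems by auto
  have "B < B ^ 2" using B16 by (simp add: power2_eq_square)
  then have b: "v r < B ^ 2" using r(2) by linarith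
  then have "exec W (Mov k (Reg r)) (R, M) 1 (R(k := v r), M)"
    using Vr.prems(9) r exec_Mov_Reg[of R r k M] by simp
  then show ?case using b by (intro exp_resultI[where R' = "R(k := v r)" and t = 1]) auto
next
  case (Rd x e)
  have W: "B ^ (deg_exp e + 4) \<le> W" using Rd.prems(9) by simp
  have wf: "x < 16" "wfe A e" using Rd.prems(1) by auto
  have le: "B ^ deg_exp e \<le> W" by (rule pow_le[OF W]) simp
  obtain t R1 where 1: "exec W (compile_exp k e) (R, M) t (R1, M)" "t \<le> cost_exp e"
    "R1 k = eval e v a" "eval e v a < B ^ deg_exp e"
    "\<forall>r<k. r \<in> A \<or> r < 50 \<or> 70 \<le> r \<longrightarrow> R1 r = R r"
    using Rd.IH[OF wf(2) Rd.prems(2-8) le]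
      unfolding exp_result_def by blast
  have R70: "R1 70 = base" using 1(5)[rule_format, of 70] Rd.prems(7,8) by auto
  define R2 where "R2 = R1(k := base + 16 * R1 k + x)"
  have 2: "exec W (addr_code k x) (R1, M) 3 (R2, M)"
    unfolding R2_def using 1(3,4) wf W R70 Rd.prems(8) by (intro exec_addr_code) auto
  have ab: "a x (eval e v a) \<le> B" using Rd.prems(6) wf by blast
  have m: "M (R2 k) = a x (eval e v a)" using Rd.prems(5) wf 1(3) by (simp add: R2_def rel_mem_def)
  have "B < B ^ 2" using B16 by (simp add: power2_eq_square)
  also have "B ^ 2 \<le> B ^ (deg_exp e + 4)" by (rule pow_mono) simp
  finally have b: "a x (eval e v a) < B ^ (deg_exp e + 4)" using ab by linarith
  define R3 where "R3 = R2(k := a x (eval e v a))"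
  have 3: "exec W (Load k (Reg k)) (R2, M) 1 (R3, M)"
    unfolding R3_def using b m W by (intro exec.Load) auto
  have "exec W (compile_exp k (Rd x e)) (R, M) (t + (3 + 1)) (R3, M)"
    unfolding compile_exp.simps by (rule exec.Seq[OF 1(1) exec.Seq[OF 2 3]])
  then show ?case
    by (rule exp_resultI) (use 1(2,5) b in \<open>auto simp: R2_def R3_def\<close>)
next
  case (Op f e1 e2)
  have W: "B ^ (deg_exp e1 + deg_exp e2 + 1) \<le> W" using Op.prems(9) by simp
  have wf: "wfe A e1" "wfe A e2" using Op.prems(1) by auto
  have le: "B ^ deg_exp e1 \<le> W" "B ^ deg_exp e2 \<le> W" by (auto intro: pow_le[OF W])
  obtain t1 R1 where 1: "exec W (compile_exp k e1) (R, M) t1 (R1, M)" "t1 \<le> cost_exp e1"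
    "R1 k = eval e1 v a" "eval e1 v a < B ^ deg_exp e1"
    "\<forall>r<k. r \<in> A \<or> r < 50 \<or> 70 \<le> r \<longrightarrow> R1 r = R r"
    using Op.IH(1)[OF wf(1) Op.prems(2-8) le(1)]
      unfolding exp_result_def by blast
  have pr: "\<forall>r\<in>A. R1 r = v r \<and> v r \<le> B" "\<forall>r<50. R1 r = v r \<and> v r \<le> U r" "R1 70 = base"
    "70 < k + 1"
    using 1(5) Op.prems(2,3,4,7,8) by auto
  obtain t2 R2 where 2: "exec W (compile_exp (k + 1) e2) (R1, M) t2 (R2, M)" "t2 \<le> cost_exp e2"
    "R2 (k + 1) = eval e2 v a" "eval e2 v a < B ^ deg_exp e2"
    "\<forall>r<k + 1. r \<in> A \<or> r < 50 \<or> 70 \<le> r \<longrightarrow> R2 r = R1 r"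
    using Op.IH(2)[OF wf(2) Op.prems(2) pr(1,2) Op.prems(5,6) pr(3,4) le(2)]
      unfolding exp_result_def by blast
  have k: "R2 k = eval e1 v a" using 2(5)[rule_format, of k] 1(3) Op.prems(8) by auto
  define x where "x = arith f (eval e1 v a) (eval e2 v a)"
  have b: "x < B ^ (deg_exp e1 + deg_exp e2 + 1)"
    unfolding x_def by (rule arith_bound[OF 1(4) 2(4)])
  define R3 where "R3 = R2(k := x)"
  have 3: "exec W (Arith k f (Reg k) (Reg (k + 1))) (R2, M) 1 (R3, M)"
    unfolding R3_def using b W k 2(3) by (intro exec.Arith) (auto simp: x_def)
  have "exec W (compile_exp k (Op f e1 e2)) (R, M) (t1 + t2 + 1) (R3, M)"
    unfolding compile_exp.simps by (rule exec.Seq[OF exec.Seq[OF 1(1) 2(1)] 3])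
  then show ?case
    by (rule exp_resultI) (use 1(2,5) 2(2,5) b in \<open>auto simp: R3_def x_def\<close>)
next
  case (EqE e1 e2)
  have W: "B ^ (deg_exp e1 + deg_exp e2 + 1) \<le> W" using EqE.prems(9) by simp
  have wf: "wfe A e1" "wfe A e2" using EqE.prems(1) by auto
  have le: "B ^ deg_exp e1 \<le> W" "B ^ deg_exp e2 \<le> W" by (auto intro: pow_le[OF W])
  obtain t1 R1 where 1: "exec W (compile_exp k e1) (R, M) t1 (R1, M)" "t1 \<le> cost_exp e1"
    "R1 k = eval e1 v a" "eval e1 v a < B ^ deg_exp e1"
    "\<forall>r<k. r \<in> A \<or> r < 50 \<or> 70 \<le> r \<longrightarrow> R1 r = R r"
    using EqE.IH(1)[OF wf(1) EqE.prems(2-8) le(1)]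
      unfolding exp_result_def by blast
  have pr: "\<forall>r\<in>A. R1 r = v r \<and> v r \<le> B" "\<forall>r<50. R1 r = v r \<and> v r \<le> U r" "R1 70 = base"
    "70 < k + 1"
    using 1(5) EqE.prems(2,3,4,7,8) by auto
  obtain t2 R2 where 2: "exec W (compile_exp (k + 1) e2) (R1, M) t2 (R2, M)" "t2 \<le> cost_exp e2"
    "R2 (k + 1) = eval e2 v a" "eval e2 v a < B ^ deg_exp e2"
    "\<forall>r<k + 1. r \<in> A \<or> r < 50 \<or> 70 \<le> r \<longrightarrow> R2 r = R1 r"
    using EqE.IH(2)[OF wf(2) EqE.prems(2) pr(1,2) EqE.prems(5,6) pr(3,4) le(2)]
      unfolding exp_result_def by blast
  have k: "R2 k = eval e1 v a" using 2(5)[rule_format, of k] 1(3) EqE.prems(8) by auto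
  define R3 where "R3 = R2(k := of_bool (holds R2 (Eq (Reg k) (Reg (k + 1)))))"
  have BW: "B \<le> B ^ (deg_exp e1 + deg_exp e2 + 1)" by (rule B_le_pow)
  then have B1: "1 < B ^ (deg_exp e1 + deg_exp e2 + 1)" using B16 by linarith
  then have 3: "exec W (If (Eq (Reg k) (Reg (k + 1))) (Mov k (Imm 1)) (Mov k (Imm 0))) (R2, M) 2 (R3, M)"
    unfolding R3_def using W by (intro exec_test) linarith
  have "exec W (compile_exp k (EqE e1 e2)) (R, M) (t1 + t2 + 2) (R3, M)"
    unfolding compile_exp.simps by (rule exec.Seq[OF exec.Seq[OF 1(1) 2(1)] 3])
  then show ?case
    by (rule exp_resultI) (use 1(2,5) 2(2,3,5) k B1 B16 in \<open>auto simp: R3_def\<close>)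
next
  case (LtE e1 e2)
  have W: "B ^ (deg_exp e1 + deg_exp e2 + 1) \<le> W" using LtE.prems(9) by simp
  have wf: "wfe A e1" "wfe A e2" using LtE.prems(1) by auto
  have le: "B ^ deg_exp e1 \<le> W" "B ^ deg_exp e2 \<le> W" by (auto intro: pow_le[OF W])
  obtain t1 R1 where 1: "exec W (compile_exp k e1) (R, M) t1 (R1, M)" "t1 \<le> cost_exp e1"
    "R1 k = eval e1 v a" "eval e1 v a < B ^ deg_exp e1"
    "\<forall>r<k. r \<in> A \<or> r < 50 \<or> 70 \<le> r \<longrightarrow> R1 r = R r"
    using LtE.IH(1)[OF wf(1) LtE.prems(2-8) le(1)]
      unfolding exp_result_def by blast
  have pr: "\<forall>r\<in>A. R1 r = v r \<and> v r \<le> B" "\<forall>r<50. R1 r = v r \<and> v r \<le> U r" "R1 70 = base"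
    "70 < k + 1"
    using 1(5) LtE.prems(2,3,4,7,8) by auto
  obtain t2 R2 where 2: "exec W (compile_exp (k + 1) e2) (R1, M) t2 (R2, M)" "t2 \<le> cost_exp e2"
    "R2 (k + 1) = eval e2 v a" "eval e2 v a < B ^ deg_exp e2"
    "\<forall>r<k + 1. r \<in> A \<or> r < 50 \<or> 70 \<le> r \<longrightarrow> R2 r = R1 r"
    using LtE.IH(2)[OF wf(2) LtE.prems(2) pr(1,2) LtE.prems(5,6) pr(3,4) le(2)]
      unfolding exp_result_def by blast
  have k: "R2 k = eval e1 v a" using 2(5)[rule_format, of k] 1(3) LtE.prems(8) by auto
  define R3 where "R3 = R2(k := of_bool (holds R2 (Lt (Reg k) (Reg (k + 1)))))"
  have BW: "B \<le> B ^ (deg_exp e1 + deg_exp e2 + 1)" by (rule B_le_pow)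
  then have B1: "1 < B ^ (deg_exp e1 + deg_exp e2 + 1)" using B16 by linarith
  then have 3: "exec W (If (Lt (Reg k) (Reg (k + 1))) (Mov k (Imm 1)) (Mov k (Imm 0))) (R2, M) 2 (R3, M)"
    unfolding R3_def using W by (intro exec_test) linarith
  have "exec W (compile_exp k (LtE e1 e2)) (R, M) (t1 + t2 + 2) (R3, M)"
    unfolding compile_exp.simps by (rule exec.Seq[OF exec.Seq[OF 1(1) 2(1)] 3])
  then show ?case
    by (rule exp_resultI) (use 1(2,5) 2(2,3,5) k B1 B16 in \<open>auto simp: R3_def\<close>)
next
  case (Sm i r e)
  let ?d = "deg_exp e"
  have W: "B ^ (?d + 3) \<le> W" using Sm.prems(9) by simp
  have wf: "r < 50" "50 \<le> i" "i < 70" "i \<notin> A" "wfe (insert i A) e" using Sm.prems(1) by auto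
  have le: "B ^ ?d \<le> W" "B ^ (?d + 2) \<le> W" "B ^ 2 \<le> W" by (rule pow_le[OF W], simp)+
  have B2: "B + 1 < W" by (rule B_less_W[OF le(3)])
  define N where "N = v r"
  have N: "N \<le> U r" "N \<le> B" using Sm.prems(4) wf(1) UB[OF wf(1)] by (auto simp: N_def)
  \<comment> \<open>Partial sums: at most B terms below B ^ d stay below B ^ (d + 2), so the
    accumulator never overflows.\<close>
  define P where "P j = (\<Sum>l<j. eval e (v(i := l)) a)" for j
  have A': "insert i A \<subseteq> {..<70}" using wf Sm.prems(2) by auto
  have k2: "70 < k + 2" using Sm.prems(8) by simp
  have summand: "exp_result (k + 2) e (v(i := j)) a (insert i A) R2 M"
    if R2: "j < N" "\<And>r. r < k \<Longrightarrow> r \<in> A \<or> r < 50 \<or> 70 \<le> r \<Longrightarrow> R2 r = R r" "R2 i = j" for j R2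
  proof -
    have "\<forall>r\<in>insert i A. R2 r = (v(i := j)) r \<and> (v(i := j)) r \<le> B"
    proof
      fix r' assume r': "r' \<in> insert i A"
      show "R2 r' = (v(i := j)) r' \<and> (v(i := j)) r' \<le> B"
      proof (cases "r' = i")
        case True
        then show ?thesis using R2 N(2) by simp
      next
        case False
        then have "r' \<in> A" "r' < k" using r' Sm.prems(2,8) by auto
        then show ?thesis using R2(2)[of r'] Sm.prems(3) False by simp
      qed
    qed
    moreover have "\<forall>r<50. R2 r = (v(i := j)) r \<and> (v(i := j)) r \<le> U r"
    proof (intro allI impI)
      fix r' :: nat assume r': "r' < 50"
      then show "R2 r' = (v(i := j)) r' \<and> (v(i := j)) r' \<le> U r'"
        using R2(2)[of r'] Sm.prems(4,8) wf(2) by simp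
    qed
    moreover have "R2 70 = base" using R2(2)[of 70] Sm.prems(7,8) by simp
    ultimately show ?thesis
      using Sm.IH[OF wf(5) A' _ _ Sm.prems(5,6) _ k2 le(1)] by blast
  qed
  have Pb: "P j \<le> j * B ^ ?d" if "j \<le> N" for j
  proof -
    have "P j \<le> (\<Sum>l<j. B ^ ?d)" unfolding P_def
    proof (rule sum_mono)
      fix l assume "l \<in> {..<j}"
      then have "l < N" using that by simp
      moreover have "(R(i := l)) r = R r" if "r \<in> A \<or> r < 50 \<or> 70 \<le> r" for r
        using wf that by auto
      ultimately have "exp_result (k + 2) e (v(i := l)) a (insert i A) (R(i := l)) M"
        by (intro summand) auto
      then show "eval e (v(i := l)) a \<le> B ^ ?d" by (auto simp: exp_result_def)
    qed
    then show ?thesis by simp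
  qed
  have Pb2: "P j < B ^ (?d + 2)" if "j \<le> N" for j
  proof -
    have "j * B ^ ?d \<le> B * B ^ ?d" using that N(2) by (intro mult_le_mono1) simp
    moreover have "B ^ (?d + 1) = B * B ^ ?d" by simp
    ultimately have "P j \<le> B ^ (?d + 1)" using Pb[OF that] by linarith
    also have "\<dots> < 16 * B ^ (?d + 1)" using pow_pos[of "?d + 1"] by linarith
    also have "\<dots> \<le> B ^ (?d + 1 + 1)" by (rule pow_Suc)
    finally show ?thesis by simp
  qed
  define Inv where "Inv j s \<longleftrightarrow> (\<exists>R2. s = (R2, M) \<and> R2 k = P j \<and> R2 (k + 1) = j \<and>
    (\<forall>r<k. r \<in> A \<or> r < 50 \<or> 70 \<le> r \<longrightarrow> R2 r = R r))" for j and s :: state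
  define R0 where "R0 = R(k := 0, k + 1 := 0)"
  have e0: "exec W (Seq (Mov k (Imm 0)) (Mov (k + 1) (Imm 0))) (R, M) (1 + 1) (R0, M)"
    unfolding R0_def using B2 by (intro exec.Seq[OF exec_Mov_Imm exec_Mov_Imm]) auto
  let ?body = "Seq (Mov i (Reg (k + 1))) (Seq (compile_exp (k + 2) e)
           (Seq (Arith k Add (Reg k) (Reg (k + 2))) (Arith (k + 1) Add (Reg (k + 1)) (Imm 1))))"
  have "\<exists>t s'. exec W (While (Lt (Reg (k + 1)) (Reg r)) ?body) (R0, M) t s' \<and>
      t \<le> N * (cost_exp e + 3 + 1) + 1 \<and> Inv N s'"
  proof (rule exec_for)
    show "Inv 0 (R0, M)" by (auto simp: Inv_def R0_def P_def)
    show "holds (fst s) (Lt (Reg (k + 1)) (Reg r)) \<longleftrightarrow> j < N" if "Inv j s" for j s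
      using that Sm.prems(4,8) wf(1) by (auto simp: Inv_def N_def)
    fix j s assume j: "j < N" and I: "Inv j s"
    then obtain R1 where R1: "s = (R1, M)" "R1 k = P j" "R1 (k + 1) = j"
      "\<And>r. r < k \<Longrightarrow> r \<in> A \<or> r < 50 \<or> 70 \<le> r \<Longrightarrow> R1 r = R r" by (auto simp: Inv_def)
    define R2 where "R2 = R1(i := j)"
    have x1: "exec W (Mov i (Reg (k + 1))) (R1, M) 1 (R2, M)"
      using exec_Mov_Reg[of R1 "k + 1" i M] R1(3) j N(2) B2 by (simp add: R2_def)
    have R2': "\<And>r. r < k \<Longrightarrow> r \<in> A \<or> r < 50 \<or> 70 \<le> r \<Longrightarrow> R2 r = R r" "R2 i = j"
      using R1(4) wf by (auto simp: R2_def)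
    obtain t R3 where R3: "exec W (compile_exp (k + 2) e) (R2, M) t (R3, M)" "t \<le> cost_exp e"
      "R3 (k + 2) = eval e (v(i := j)) a"
      "\<forall>r<k + 2. r \<in> insert i A \<or> r < 50 \<or> 70 \<le> r \<longrightarrow> R3 r = R2 r"
      using summand[OF j R2']
      unfolding exp_result_def by blast
    have k3: "R3 k = P j" "R3 (k + 1) = j"
      using R3(4)[rule_format, of k] R3(4)[rule_format, of "k + 1"] R1(2,3) Sm.prems(8) wf by (auto simp: R2_def)
    have PS: "P (Suc j) = P j + eval e (v(i := j)) a" by (simp add: P_def)
    define R4 where "R4 = R3(k := P (Suc j))"
    have "P (Suc j) < W" using Pb2[of "Suc j"] j le(2) by linarith
    then have x3: "exec W (Arith k Add (Reg k) (Reg (k + 2))) (R3, M) 1 (R4, M)"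
      unfolding R4_def using k3 R3(3) PS by (intro exec.Arith) auto
    define R5 where "R5 = R4(k + 1 := Suc j)"
    have x4: "exec W (Arith (k + 1) Add (Reg (k + 1)) (Imm 1)) (R4, M) 1 (R5, M)"
      unfolding R5_def using k3 j N(2) B2 by (intro exec.Arith) (auto simp: R4_def)
    have "exec W ?body s (1 + (t + (1 + 1))) (R5, M)"
      unfolding R1(1) by (intro exec.Seq[OF x1] exec.Seq[OF R3(1)] exec.Seq[OF x3 x4])
    moreover have "Inv (Suc j) (R5, M)"
      unfolding Inv_def
    proof (intro exI conjI allI impI)
      show "R5 k = P (Suc j)" "R5 (k + 1) = Suc j" by (auto simp: R5_def R4_def)
      fix r' assume r': "r' < k" "r' \<in> A \<or> r' < 50 \<or> 70 \<le> r'"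
      then show "R5 r' = R r'" using R3(4)[rule_format, of r'] R2'(1)[of r'] by (auto simp: R5_def R4_def)
    qed simp
    ultimately show "\<exists>t s'. exec W ?body s t s' \<and> t \<le> cost_exp e + 3 \<and> Inv (Suc j) s'"
      using R3(2) by (intro exI[of _ "1 + (t + (1 + 1))"] exI[of _ "(R5, M)"]) auto
  qed
  then obtain t R' where R': "exec W (While (Lt (Reg (k + 1)) (Reg r)) ?body) (R0, M) t (R', M)"
    "t \<le> N * (cost_exp e + 3 + 1) + 1" "R' k = P N"
    "\<And>r. r < k \<Longrightarrow> r \<in> A \<or> r < 50 \<or> 70 \<le> r \<Longrightarrow> R' r = R r"
    by (auto simp: Inv_def)
  have "N * (cost_exp e + 4) \<le> U r * (cost_exp e + 4)" using N(1) by (rule mult_le_mono1)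
  moreover have "cost_exp e + 3 + 1 = cost_exp e + 4" by simp
  ultimately have t: "1 + 1 + t \<le> cost_exp (Sm i r e)"
    using R'(2) unfolding cost_exp.simps by (simp only: )
  have ev: "eval (Sm i r e) v a = P N" by (simp add: P_def N_def)
  have "P N < B ^ deg_exp (Sm i r e)"
    using Pb2[of N] pow_mono[of "?d + 2" "?d + 3"] by simp
  then have b: "eval (Sm i r e) v a < B ^ deg_exp (Sm i r e)" by (simp only: ev)
  have "exec W (compile_exp k (Sm i r e)) (R, M) (1 + 1 + t) (R', M)"
    unfolding compile_exp.simps by (rule exec.Seq[OF e0 R'(1)])
  then show ?case using t
    by (rule exp_resultI) (use R'(3,4) ev b in auto)
qed

definition com_result :: "nat \<Rightarrow> com \<Rightarrow> (env \<Rightarrow> arrays \<Rightarrow> bool) \<Rightarrow> env \<Rightarrow> (nat \<Rightarrow> nat) \<Rightarrow> bool" where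
  "com_result k c Q R M \<longleftrightarrow> (\<exists>t R' M' v' a'. exec W (compile k c) (R, M) t (R', M') \<and> t \<le> cost c \<and>
    Q v' a' \<and> (\<forall>r<50. R' r = v' r) \<and> bounded v' a' \<and> rel_mem a' M' \<and>
    (\<forall>r. 70 \<le> r \<longrightarrow> r < k \<longrightarrow> R' r = R r))"

lemma com_resultI:
  assumes "exec W (compile k c) (R, M) t (R', M')" "t \<le> cost c" "Q v' a'"
    "\<And>r. r < 50 \<Longrightarrow> R' r = v' r" "bounded v' a'" "rel_mem a' M'"
    "\<And>r. 70 \<le> r \<Longrightarrow> r < k \<Longrightarrow> R' r = R r"
  shows "com_result k c Q R M"
  unfolding com_result_def using assms by blast

lemma com_exp:
  assumes "wfe {..<50} e" "\<forall>r<50. R r = v r" "bounded v a" "rel_mem a M" "R 70 = base" "70 < k"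
    "B ^ deg_exp e \<le> W"
  shows "exp_result k e v a {..<50} R M"
proof -
  have "\<forall>r<50. v r \<le> B" using assms(3) UB le_trans unfolding bounded_def by blast
  then show ?thesis
    by (intro compile_exp_correct) (use assms in \<open>auto simp: bounded_def\<close>)
qed

lemma rel_mem_update:
  assumes "rel_mem a M" "x < 16"
  shows "rel_mem (a(x := (a x)(i := y))) (M(base + 16 * i + x := y))"
proof -
  have inj: "x' = x \<and> i' = i" if "base + 16 * i' + x' = base + 16 * i + x" "x' < 16" for x' i'
  proof -
    have eq: "16 * i' + x' = 16 * i + x" using that(1) by linarith
    have "x' = (16 * i' + x') mod 16" "i' = (16 * i' + x') div 16" using that(2) by simp_all
    moreover have "(16 * i + x) mod 16 = x" "(16 * i + x) div 16 = i" using assms(2) by simp_all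
    ultimately show ?thesis unfolding eq by simp
  qed
  show ?thesis
    unfolding rel_mem_def
  proof (intro conjI allI impI)
    fix l assume "l < base"
    then show "(M(base + 16 * i + x := y)) l = inp l" using assms(1) by (simp add: rel_mem_def)
  next
    fix x' i' :: nat assume x': "x' < 16"
    show "(M(base + 16 * i + x := y)) (base + 16 * i' + x') = (a(x := (a x)(i := y))) x' i'"
      using inj[OF _ x', of i'] assms(1) x' by (auto simp: rel_mem_def)
  qed
qed

theorem compile_correct:
  assumes "wfc c" "wp c Q v a" "\<forall>r<50. R r = v r" "bounded v a" "rel_mem a M"
    "R 70 = base" "70 < k" "B ^ deg c \<le> W"
  shows "com_result k c Q R M"
  using assms
proof (induction c arbitrary: Q v a R M k)
  case Nop
  have "exec W (compile k Nop) (R, M) 1 (R, M)" unfolding compile.simps by (rule exec.Skip)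
  then show ?case by (rule com_resultI[where v' = v and a' = a]) (use Nop in auto)
next
  case (Asg r e)
  have W: "B ^ (deg_exp e + 2) \<le> W" using Asg.prems(8) by simp
  have le: "B ^ deg_exp e \<le> W" by (rule pow_le[OF W]) simp
  have wf: "r < 50" "wfe {..<50} e" using Asg.prems(1) by auto
  obtain t R1 where 1: "exec W (compile_exp k e) (R, M) t (R1, M)" "t \<le> cost_exp e"
    "R1 k = eval e v a" "eval e v a < B ^ deg_exp e"
    "\<forall>r<k. r \<in> {..<50} \<or> r < 50 \<or> 70 \<le> r \<longrightarrow> R1 r = R r"
    using com_exp[OF wf(2) Asg.prems(3-7) le] unfolding exp_result_def by blast
  define v' where "v' = v(r := eval e v a)"
  have "exec W (Mov r (Reg k)) (R1, M) 1 (R1(r := eval e v a), M)"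
    using exec_Mov_Reg[of R1 k r M] 1(3,4) le by simp
  then have "exec W (compile k (Asg r e)) (R, M) (t + 1) (R1(r := eval e v a), M)"
    unfolding compile.simps by (rule exec.Seq[OF 1(1)])
  then show ?case
  proof (rule com_resultI[where v' = v' and a' = a])
    show "Q v' a" using Asg.prems(2) by (simp add: v'_def)
    show "bounded v' a" using Asg.prems(2,4) by (auto simp: bounded_def v'_def)
    show "(R1(r := eval e v a)) r' = v' r'" if "r' < 50" for r'
      using that 1(5) Asg.prems(3,7) by (auto simp: v'_def)
    show "(R1(r := eval e v a)) r' = R r'" if "70 \<le> r'" "r' < k" for r'
      using that 1(5) wf by auto
  qed (use 1(2) Asg.prems(5) in auto)
next
  case (St x e1 e2)
  have W: "B ^ (deg_exp e1 + deg_exp e2 + 4) \<le> W" using St.prems(8) by simp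
  have le: "B ^ deg_exp e1 \<le> W" "B ^ (deg_exp e1 + 4) \<le> W" "B ^ deg_exp e2 \<le> W"
    by (rule pow_le[OF W], simp)+
  have wf: "x < 16" "wfe {..<50} e1" "wfe {..<50} e2" using St.prems(1) by auto
  obtain t1 R1 where 1: "exec W (compile_exp k e1) (R, M) t1 (R1, M)" "t1 \<le> cost_exp e1"
    "R1 k = eval e1 v a" "eval e1 v a < B ^ deg_exp e1"
    "\<forall>r<k. r \<in> {..<50} \<or> r < 50 \<or> 70 \<le> r \<longrightarrow> R1 r = R r"
    using com_exp[OF wf(2) St.prems(3-7) le(1)] unfolding exp_result_def by blast
  have R70: "R1 70 = base" using 1(5) St.prems(6,7) by auto
  define R2 where "R2 = R1(k := base + 16 * R1 k + x)"
  have 2: "exec W (addr_code k x) (R1, M) 3 (R2, M)"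
    unfolding R2_def using 1(3,4) wf le(2) R70 St.prems(7) by (intro exec_addr_code) auto
  have R2': "\<forall>r<50. R2 r = v r" "R2 70 = base" "70 < k + 1"
    using 1(5) St.prems(3,6,7) by (auto simp: R2_def)
  obtain t2 R3 where 3: "exec W (compile_exp (k + 1) e2) (R2, M) t2 (R3, M)" "t2 \<le> cost_exp e2"
    "R3 (k + 1) = eval e2 v a" "eval e2 v a < B ^ deg_exp e2"
    "\<forall>r<k + 1. r \<in> {..<50} \<or> r < 50 \<or> 70 \<le> r \<longrightarrow> R3 r = R2 r"
    using com_exp[OF wf(3) R2'(1) St.prems(4,5) R2'(2,3) le(3)] unfolding exp_result_def by blast
  have ad: "R3 k = base + 16 * eval e1 v a + x" using 3(5) St.prems(7) 1(3) by (auto simp: R2_def)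
  define M' where "M' = M(base + 16 * eval e1 v a + x := eval e2 v a)"
  define a' where "a' = a(x := (a x)(eval e1 v a := eval e2 v a))"
  have 4: "exec W (Store (Reg k) (Reg (k + 1))) (R3, M) 1 (R3, M')"
    using exec.Store[of "eval e2 v a" R3 "Reg (k + 1)" W "Reg k" M] 3(3,4) le(3) ad
    by (simp add: M'_def)
  have "exec W (compile k (St x e1 e2)) (R, M) (t1 + 3 + (t2 + 1)) (R3, M')"
    unfolding compile.simps by (rule exec.Seq[OF exec.Seq[OF 1(1) 2] exec.Seq[OF 3(1) 4]])
  then show ?case
  proof (rule com_resultI[where v' = v and a' = a'])
    show "Q v a'" using St.prems(2) by (simp add: a'_def)
    show "bounded v a'" using St.prems(2,4) by (auto simp: bounded_def a'_def)
    show "rel_mem a' M'" unfolding a'_def M'_def using St.prems(5) wf(1) by (rule rel_mem_update)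
    show "R3 r = v r" if "r < 50" for r using that 3(5) R2'(1) St.prems(7) by auto
    show "R3 r = R r" if "70 \<le> r" "r < k" for r using that 3(5) 1(5) by (auto simp: R2_def)
  qed (use 1(2) 3(2) in auto)
next
  case (Inp r e)
  have W: "B ^ (deg_exp e + 2) \<le> W" using Inp.prems(8) by simp
  have le: "B ^ deg_exp e \<le> W" "B ^ 2 \<le> W" by (rule pow_le[OF W], simp)+
  have wf: "r < 50" "wfe {..<50} e" using Inp.prems(1) by auto
  obtain t R1 where 1: "exec W (compile_exp k e) (R, M) t (R1, M)" "t \<le> cost_exp e"
    "R1 k = eval e v a" "eval e v a < B ^ deg_exp e"
    "\<forall>r<k. r \<in> {..<50} \<or> r < 50 \<or> 70 \<le> r \<longrightarrow> R1 r = R r"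
    using com_exp[OF wf(2) Inp.prems(3-7) le(1)] unfolding exp_result_def by blast
  define y where "y = inp (eval e v a)"
  define v' where "v' = v(r := y)"
  have y: "M (R1 k) = y" "y \<le> U r" using Inp.prems(2,5) 1(3) by (auto simp: rel_mem_def y_def)
  have "y < W" using y(2) UB[OF wf(1)] B_less_W[OF le(2)] by linarith
  then have "exec W (Load r (Reg k)) (R1, M) 1 (R1(r := y), M)"
    using y(1) by (intro exec.Load) auto
  then have "exec W (compile k (Inp r e)) (R, M) (t + 1) (R1(r := y), M)"
    unfolding compile.simps by (rule exec.Seq[OF 1(1)])
  then show ?case
  proof (rule com_resultI[where v' = v' and a' = a])
    show "Q v' a" using Inp.prems(2) by (simp add: v'_def y_def)
    show "bounded v' a" using Inp.prems(4) y(2) by (auto simp: bounded_def v'_def)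
    show "(R1(r := y)) r' = v' r'" if "r' < 50" for r'
      using that 1(5) Inp.prems(3,7) by (auto simp: v'_def)
    show "(R1(r := y)) r' = R r'" if "70 \<le> r'" "r' < k" for r'
      using that 1(5) wf by auto
  qed (use 1(2) Inp.prems(5) in auto)
next
  case (Sq c1 c2)
  have W: "B ^ (deg c1 + deg c2) \<le> W" using Sq.prems(8) by simp
  have le: "B ^ deg c1 \<le> W" "B ^ deg c2 \<le> W" by (rule pow_le[OF W], simp)+
  have wf: "wfc c1" "wfc c2" "wp c1 (wp c2 Q) v a" using Sq.prems(1,2) by auto
  obtain t1 R1 M1 v1 a1 where 1: "exec W (compile k c1) (R, M) t1 (R1, M1)" "t1 \<le> cost c1"
    "wp c2 Q v1 a1" "\<forall>r<50. R1 r = v1 r" "bounded v1 a1" "rel_mem a1 M1"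
    "\<forall>r. 70 \<le> r \<longrightarrow> r < k \<longrightarrow> R1 r = R r"
    using Sq.IH(1)[OF wf(1,3) Sq.prems(3-7) le(1)] unfolding com_result_def by blast
  have R70: "R1 70 = base" using 1(7) Sq.prems(6,7) by auto
  obtain t2 R2 M2 v2 a2 where 2: "exec W (compile k c2) (R1, M1) t2 (R2, M2)" "t2 \<le> cost c2"
    "Q v2 a2" "\<forall>r<50. R2 r = v2 r" "bounded v2 a2" "rel_mem a2 M2"
    "\<forall>r. 70 \<le> r \<longrightarrow> r < k \<longrightarrow> R2 r = R1 r"
    using Sq.IH(2)[OF wf(2) 1(3-6) R70 Sq.prems(7) le(2)] unfolding com_result_def by blast
  have "exec W (compile k (Sq c1 c2)) (R, M) (t1 + t2) (R2, M2)"
    unfolding compile.simps by (rule exec.Seq[OF 1(1) 2(1)])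
  then show ?case
    by (rule com_resultI[where v' = v2 and a' = a2]) (use 1(2,7) 2 in auto)
next
  case (Cd e c1 c2)
  have W: "B ^ (deg_exp e + deg c1 + deg c2) \<le> W" using Cd.prems(8) by simp
  have le: "B ^ deg_exp e \<le> W" "B ^ deg c1 \<le> W" "B ^ deg c2 \<le> W" by (rule pow_le[OF W], simp)+
  have wf: "wfe {..<50} e" "wfc c1" "wfc c2" using Cd.prems(1) by auto
  obtain t R1 where 1: "exec W (compile_exp k e) (R, M) t (R1, M)" "t \<le> cost_exp e"
    "R1 k = eval e v a" "eval e v a < B ^ deg_exp e"
    "\<forall>r<k. r \<in> {..<50} \<or> r < 50 \<or> 70 \<le> r \<longrightarrow> R1 r = R r"
    using com_exp[OF wf(1) Cd.prems(3-7) le(1)] unfolding exp_result_def by blast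
  have R1: "\<forall>r<50. R1 r = v r" "R1 70 = base" using 1(5) Cd.prems(3,6,7) by auto
  define c where "c = (if eval e v a = 0 then c2 else c1)"
  have "com_result k c Q R1 M"
    using Cd.IH(1)[OF wf(2) _ R1(1) Cd.prems(4,5) R1(2) Cd.prems(7) le(2)]
      Cd.IH(2)[OF wf(3) _ R1(1) Cd.prems(4,5) R1(2) Cd.prems(7) le(3)] Cd.prems(2)
    by (simp add: c_def split: if_splits)
  then obtain t2 R2 M2 v2 a2 where 2: "exec W (compile k c) (R1, M) t2 (R2, M2)" "t2 \<le> cost c"
    "Q v2 a2" "\<forall>r<50. R2 r = v2 r" "bounded v2 a2" "rel_mem a2 M2"
    "\<forall>r. 70 \<le> r \<longrightarrow> r < k \<longrightarrow> R2 r = R1 r"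
    unfolding com_result_def by blast
  have "exec W (If (Eq (Reg k) (Imm 0)) (compile k c2) (compile k c1)) (R1, M) (t2 + 1) (R2, M2)"
  proof (cases "eval e v a = 0")
    case True
    then show ?thesis using 2(1) 1(3) by (intro exec.IfTrue) (auto simp: c_def)
  next
    case False
    then show ?thesis using 2(1) 1(3) by (intro exec.IfFalse) (auto simp: c_def)
  qed
  then have "exec W (compile k (Cd e c1 c2)) (R, M) (t + (t2 + 1)) (R2, M2)"
    unfolding compile.simps by (rule exec.Seq[OF 1(1)])
  moreover have "cost c \<le> cost c1 + cost c2" by (simp add: c_def)
  then have "t + (t2 + 1) \<le> cost (Cd e c1 c2)" using 1(2) 2(2) by simp
  ultimately show ?case
    by (rule com_resultI[where v' = v2 and a' = a2]) (use 1(5) 2 in auto)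
next
  case (Fr i r c)
  have W: "B ^ (deg c + 3) \<le> W" using Fr.prems(8) by simp
  have le: "B ^ deg c \<le> W" "B ^ 2 \<le> W" by (rule pow_le[OF W], simp)+
  have B2: "B + 1 < W" by (rule B_less_W[OF le(2)])
  have wf: "i < 50" "r < 50" "wfc c" using Fr.prems(1) by auto
  define N where "N = v r"
  have N: "N \<le> U r" "N \<le> B" "U r \<le> U i"
    using Fr.prems(2,4) wf(2) UB[OF wf(2)] by (auto simp: N_def bounded_def)
  \<comment> \<open>The loop invariant is the precondition of the rounds that are still to
    come.\<close>
  define L where "L j = foldr (upd_then i (wp c)) [j..<N] Q" for j
  have L0: "L 0 v a" using Fr.prems(2) by (simp add: L_def N_def)
  have LS: "wp c (L (Suc j)) (v'(i := j)) a'" if "j < N" "L j v' a'" for j v' a'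
  proof -
    have "[j..<N] = j # [Suc j..<N]" using that(1) by (simp add: upt_conv_Cons)
    then show ?thesis using that(2) unfolding L_def by (simp only: loop_Cons)
  qed
  define Inv where "Inv j s \<longleftrightarrow> (\<exists>R2 M2 v2 a2. s = (R2, M2) \<and> R2 k = j \<and> R2 (k + 1) = N \<and>
    L j v2 a2 \<and> (\<forall>r<50. R2 r = v2 r) \<and> bounded v2 a2 \<and> rel_mem a2 M2 \<and>
    (\<forall>r. 70 \<le> r \<longrightarrow> r < k \<longrightarrow> R2 r = R r))" for j and s :: state
  have Rr: "R r = N" using Fr.prems(3) wf(2) by (simp add: N_def)
  define R0 where "R0 = R(k := 0, k + 1 := N)"
  have "exec W (Mov (k + 1) (Reg r)) (R(k := 0), M) 1 (R0, M)"
    using exec_Mov_Reg[of "R(k := 0)" r "k + 1" M] Rr N(2) B2 wf(2) Fr.prems(7) by (simp add: R0_def)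
  then have e0: "exec W (Seq (Mov k (Imm 0)) (Mov (k + 1) (Reg r))) (R, M) (1 + 1) (R0, M)"
    using B2 by (intro exec.Seq[OF exec_Mov_Imm]) auto
  let ?body = "Seq (Mov i (Reg k)) (Seq (compile (k + 2) c) (Arith k Add (Reg k) (Imm 1)))"
  have "\<exists>t s'. exec W (While (Lt (Reg k) (Reg (k + 1))) ?body) (R0, M) t s' \<and>
      t \<le> N * (cost c + 2 + 1) + 1 \<and> Inv N s'"
  proof (rule exec_for)
    show "Inv 0 (R0, M)"
      unfolding Inv_def
      by (rule exI[of _ R0], rule exI[of _ M], rule exI[of _ v], rule exI[of _ a])
        (use L0 Fr.prems(3-5,7) in \<open>auto simp: R0_def\<close>)
    show "holds (fst s) (Lt (Reg k) (Reg (k + 1))) \<longleftrightarrow> j < N" if "Inv j s" for j s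
      using that by (auto simp: Inv_def)
    fix j s assume j: "j < N" and I: "Inv j s"
    then obtain R1 M1 v1 a1 where 1: "s = (R1, M1)" "R1 k = j" "R1 (k + 1) = N"
      "L j v1 a1" "\<forall>r<50. R1 r = v1 r" "bounded v1 a1" "rel_mem a1 M1"
      "\<forall>r. 70 \<le> r \<longrightarrow> r < k \<longrightarrow> R1 r = R r"
      unfolding Inv_def by blast
    define R2 where "R2 = R1(i := j)"
    have x1: "exec W (Mov i (Reg k)) (R1, M1) 1 (R2, M1)"
      using exec_Mov_Reg[of R1 k i M1] 1(2) j N(2) B2 by (simp add: R2_def)
    have p: "\<forall>r<50. R2 r = (v1(i := j)) r" "bounded (v1(i := j)) a1" "R2 70 = base" "70 < k + 2"
      using 1 wf j N(1,3) Fr.prems(6,7) by (auto simp: R2_def bounded_def)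
    obtain t R3 M3 v3 a3 where 3: "exec W (compile (k + 2) c) (R2, M1) t (R3, M3)" "t \<le> cost c"
      "L (Suc j) v3 a3" "\<forall>r<50. R3 r = v3 r" "bounded v3 a3" "rel_mem a3 M3"
      "\<forall>r. 70 \<le> r \<longrightarrow> r < k + 2 \<longrightarrow> R3 r = R2 r"
      using Fr.IH[OF wf(3) LS[OF j 1(4)] p(1,2) 1(7) p(3,4) le(1)] unfolding com_result_def by blast
    have k3: "R3 k = j" "R3 (k + 1) = N" using 3(7) 1(2,3) Fr.prems(7) wf(1) by (auto simp: R2_def)
    define R4 where "R4 = R3(k := Suc j)"
    have x4: "exec W (Arith k Add (Reg k) (Imm 1)) (R3, M3) 1 (R4, M3)"
      unfolding R4_def using k3 j N(2) B2 by (intro exec.Arith) auto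
    have "exec W ?body s (1 + (t + 1)) (R4, M3)"
      unfolding 1(1) by (rule exec.Seq[OF x1 exec.Seq[OF 3(1) x4]])
    moreover have "Inv (Suc j) (R4, M3)"
      unfolding Inv_def
      by (rule exI[of _ R4], rule exI[of _ M3], rule exI[of _ v3], rule exI[of _ a3])
        (use 1 3 k3 wf(1) Fr.prems(7) in \<open>auto simp: R4_def R2_def\<close>)
    ultimately show "\<exists>t s'. exec W ?body s t s' \<and> t \<le> cost c + 2 \<and> Inv (Suc j) s'"
      using 3(2) by (intro exI[of _ "1 + (t + 1)"] exI[of _ "(R4, M3)"]) auto
  qed
  then obtain t s' where s': "exec W (While (Lt (Reg k) (Reg (k + 1))) ?body) (R0, M) t s'"
    "t \<le> N * (cost c + 2 + 1) + 1" "Inv N s'" by blast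
  then obtain R' M' v' a' where R': "s' = (R', M')" "L N v' a'" "\<forall>r<50. R' r = v' r"
    "bounded v' a'" "rel_mem a' M'" "\<forall>r. 70 \<le> r \<longrightarrow> r < k \<longrightarrow> R' r = R r"
    unfolding Inv_def by blast
  have "N * (cost c + 3) \<le> U r * (cost c + 3)" using N(1) by (rule mult_le_mono1)
  moreover have "cost c + 2 + 1 = cost c + 3" by simp
  ultimately have t: "1 + 1 + t \<le> cost (Fr i r c)" using s'(2) unfolding cost.simps by (simp only: )
  have "exec W (compile k (Fr i r c)) (R, M) (1 + 1 + t) (R', M')"
    unfolding compile.simps using exec.Seq[OF e0 s'(1)] R'(1) by simp
  then show ?case using t
    by (rule com_resultI[where v' = v' and a' = a']) (use R' in \<open>auto simp: L_def\<close>)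
qed

end

section \<open>Static cost bounds and elementary functions\<close>

primrec bounds_exp :: "exp \<Rightarrow> nat set" where
  "bounds_exp (Cn c) = {}"
| "bounds_exp (Vr r) = {}"
| "bounds_exp (Rd x e) = bounds_exp e"
| "bounds_exp (Op f e1 e2) = bounds_exp e1 \<union> bounds_exp e2"
| "bounds_exp (EqE e1 e2) = bounds_exp e1 \<union> bounds_exp e2"
| "bounds_exp (LtE e1 e2) = bounds_exp e1 \<union> bounds_exp e2"
| "bounds_exp (Sm i r e) = insert r (bounds_exp e)"

primrec bounds :: "com \<Rightarrow> nat set" where
  "bounds Nop = {}"
| "bounds (Asg r e) = bounds_exp e"
| "bounds (St x e1 e2) = bounds_exp e1 \<union> bounds_exp e2"
| "bounds (Inp r e) = bounds_exp e"
| "bounds (Sq c1 c2) = bounds c1 \<union> bounds c2"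
| "bounds (Cd e c1 c2) = bounds_exp e \<union> bounds c1 \<union> bounds c2"
| "bounds (Fr i r c) = insert r (bounds c)"

text \<open>The exponent of the parameter-dependent factor F in the running time. Once F is at least
  8, one factor F absorbs the additive constants of a construct, and a loop needs a second one for
  its number of rounds.\<close>

primrec factor_exp :: "exp \<Rightarrow> nat" where
  "factor_exp (Cn c) = 1"
| "factor_exp (Vr r) = 1"
| "factor_exp (Rd x e) = factor_exp e + 1"
| "factor_exp (Op f e1 e2) = factor_exp e1 + factor_exp e2 + 1"
| "factor_exp (EqE e1 e2) = factor_exp e1 + factor_exp e2 + 1"
| "factor_exp (LtE e1 e2) = factor_exp e1 + factor_exp e2 + 1"
| "factor_exp (Sm i r e) = factor_exp e + 2"

primrec factor_com :: "com \<Rightarrow> nat" where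
  "factor_com Nop = 1"
| "factor_com (Asg r e) = factor_exp e + 1"
| "factor_com (St x e1 e2) = factor_exp e1 + factor_exp e2 + 1"
| "factor_com (Inp r e) = factor_exp e + 1"
| "factor_com (Sq c1 c2) = factor_com c1 + factor_com c2 + 1"
| "factor_com (Cd e c1 c2) = factor_exp e + factor_com c1 + factor_com c2 + 1"
| "factor_com (Fr i r c) = factor_com c + 2"

text \<open>The exponent of \<open>n\<close> in the running time, if loops over \<open>r\<close> have \<open>O(n ^ \<nu> r)\<close> rounds.\<close>

primrec order_exp :: "(nat \<Rightarrow> nat) \<Rightarrow> exp \<Rightarrow> nat" where
  "order_exp \<nu> (Cn c) = 0"
| "order_exp \<nu> (Vr r) = 0"
| "order_exp \<nu> (Rd x e) = order_exp \<nu> e"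
| "order_exp \<nu> (Op f e1 e2) = max (order_exp \<nu> e1) (order_exp \<nu> e2)"
| "order_exp \<nu> (EqE e1 e2) = max (order_exp \<nu> e1) (order_exp \<nu> e2)"
| "order_exp \<nu> (LtE e1 e2) = max (order_exp \<nu> e1) (order_exp \<nu> e2)"
| "order_exp \<nu> (Sm i r e) = \<nu> r + order_exp \<nu> e"

primrec order_com :: "(nat \<Rightarrow> nat) \<Rightarrow> com \<Rightarrow> nat" where
  "order_com \<nu> Nop = 0"
| "order_com \<nu> (Asg r e) = order_exp \<nu> e"
| "order_com \<nu> (St x e1 e2) = max (order_exp \<nu> e1) (order_exp \<nu> e2)"
| "order_com \<nu> (Inp r e) = order_exp \<nu> e"
| "order_com \<nu> (Sq c1 c2) = max (order_com \<nu> c1) (order_com \<nu> c2)"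
| "order_com \<nu> (Cd e c1 c2) = max (order_exp \<nu> e) (max (order_com \<nu> c1) (order_com \<nu> c2))"
| "order_com \<nu> (Fr i r c) = \<nu> r + order_com \<nu> c"

context program_bounds
begin

context
  fixes F n :: nat and \<nu> :: "nat \<Rightarrow> nat"
  assumes F: "8 \<le> F" and n: "1 \<le> n"
begin

lemma mono_bound: "i \<le> i' \<Longrightarrow> j \<le> j' \<Longrightarrow> F ^ i * n ^ j \<le> F ^ i' * n ^ j'"
  using F n by (intro mult_le_mono power_increasing) auto

lemma bound_ge_1: "1 \<le> F ^ i * n ^ j"
  using F n by simp

lemma bound_Suc: "8 * (F ^ i * n ^ j) \<le> F ^ (i + 1) * n ^ j"
  using F by simp

lemma bound_step:
  assumes "x \<le> 8 * (F ^ i * n ^ j)" "i + 1 \<le> i'" "j \<le> j'"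
  shows "x \<le> F ^ i' * n ^ j'"
  using assms bound_Suc[of i j] mono_bound[of "i + 1" i' j j'] by linarith

lemma bound_add:
  assumes "x \<le> F ^ i * n ^ j" "y \<le> F ^ i' * n ^ j'" "c \<le> 6"
  shows "x + y + c \<le> F ^ (i + i' + 1) * n ^ max j j'"
proof (rule bound_step[of _ "i + i'" "max j j'"])
  have "F ^ i * n ^ j \<le> F ^ (i + i') * n ^ max j j'" "F ^ i' * n ^ j' \<le> F ^ (i + i') * n ^ max j j'"
    by (rule mono_bound; simp)+
  then show "x + y + c \<le> 8 * (F ^ (i + i') * n ^ max j j')"
    using assms bound_ge_1[of "i + i'" "max j j'"] by linarith
qed simp_all

lemma bound_const:
  assumes "x \<le> F ^ i * n ^ j" "c \<le> 6"
  shows "x + c \<le> F ^ (i + 1) * n ^ j"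
  by (rule bound_step[of _ i j]) (use assms bound_ge_1[of i j] in linarith, simp_all)

lemma bound_loop:
  assumes "x \<le> F ^ i * n ^ j" "b \<le> F * n ^ k" "c \<le> 4"
  shows "b * (x + c) + 3 \<le> F ^ (i + 2) * n ^ (k + j)"
proof (rule bound_step[of _ "i + 1" "k + j"])
  have "x + c \<le> 5 * (F ^ i * n ^ j)" using assms(1,3) bound_ge_1[of i j] by linarith
  then have "b * (x + c) \<le> (F * n ^ k) * (5 * (F ^ i * n ^ j))" using assms(2) by (rule mult_le_mono[rotated])
  also have "\<dots> = 5 * (F ^ (i + 1) * n ^ (k + j))" by (simp add: power_add)
  finally show "b * (x + c) + 3 \<le> 8 * (F ^ (i + 1) * n ^ (k + j))"
    using bound_ge_1[of "i + 1" "k + j"] by linarith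
qed simp_all

lemma cost_exp_bound:
  "(\<And>r. r \<in> bounds_exp e \<Longrightarrow> U r \<le> F * n ^ \<nu> r) \<Longrightarrow>
    cost_exp e \<le> F ^ factor_exp e * n ^ order_exp \<nu> e"
proof (induction e)
  case (Op f e1 e2)
  then show ?case using bound_add[of "cost_exp e1" _ _ "cost_exp e2" _ _ 1] by simp
next
  case (EqE e1 e2)
  then show ?case using bound_add[of "cost_exp e1" _ _ "cost_exp e2" _ _ 2] by simp
next
  case (LtE e1 e2)
  then show ?case using bound_add[of "cost_exp e1" _ _ "cost_exp e2" _ _ 2] by simp
next
  case (Rd x e)
  then show ?case using bound_const[of "cost_exp e" _ _ 4] by simp
next
  case (Sm i r e)
  then show ?case using bound_loop[of "cost_exp e" _ _ "U r" "\<nu> r" 4] by simp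
qed (use F in auto)

lemma cost_bound:
  "(\<And>r. r \<in> bounds c \<Longrightarrow> U r \<le> F * n ^ \<nu> r) \<Longrightarrow>
    cost c \<le> F ^ factor_com c * n ^ order_com \<nu> c"
proof (induction c)
  case (Asg r e)
  then show ?case using bound_const[OF cost_exp_bound, of e 1] by simp
next
  case (St x e1 e2)
  then show ?case using bound_add[OF cost_exp_bound cost_exp_bound, of e1 e2 4] by simp
next
  case (Inp r e)
  then show ?case using bound_const[OF cost_exp_bound, of e 1] by simp
next
  case (Sq c1 c2)
  then show ?case using bound_add[of "cost c1" _ _ "cost c2" _ _ 0] by simp
next
  case (Cd e c1 c2)
  let ?i = "factor_exp e + factor_com c1 + factor_com c2"
  let ?j = "max (order_exp \<nu> e) (max (order_com \<nu> c1) (order_com \<nu> c2))"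
  have "F ^ factor_exp e * n ^ order_exp \<nu> e \<le> F ^ ?i * n ^ ?j"
    "F ^ factor_com c1 * n ^ order_com \<nu> c1 \<le> F ^ ?i * n ^ ?j"
    "F ^ factor_com c2 * n ^ order_com \<nu> c2 \<le> F ^ ?i * n ^ ?j"
    by (rule mono_bound; simp)+
  moreover have "cost_exp e \<le> F ^ factor_exp e * n ^ order_exp \<nu> e"
    using Cd.prems by (intro cost_exp_bound) simp
  moreover have "cost c1 \<le> F ^ factor_com c1 * n ^ order_com \<nu> c1"
    "cost c2 \<le> F ^ factor_com c2 * n ^ order_com \<nu> c2"
    using Cd by simp_all
  ultimately have "cost (Cd e c1 c2) \<le> 8 * (F ^ ?i * n ^ ?j)"
    using bound_ge_1[of ?i ?j] unfolding cost.simps by linarith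
  then have "cost (Cd e c1 c2) \<le> F ^ (?i + 1) * n ^ ?j" by (rule bound_step) simp_all
  then show ?case by simp
next
  case (Fr i r c)
  then show ?case using bound_loop[of "cost c" _ _ "U r" "\<nu> r" 3] by simp
qed (use F in auto)

end

end

section \<open>Iterated exponentials as computable bounds\<close>

definition tower :: "nat \<Rightarrow> nat \<Rightarrow> nat" where
  "tower m x = ((\<lambda>y. 2 ^ y) ^^ m) x"

lemma tower_0 [simp]: "tower 0 x = x"
  by (simp add: tower_def)

lemma tower_Suc: "tower (Suc m) x = 2 ^ tower m x"
  by (simp add: tower_def)

lemma tower_Suc': "tower (Suc m) x = tower m (2 ^ x)"
  by (simp only: tower_def funpow_Suc_right comp_def)

lemma tower_mono: "x \<le> y \<Longrightarrow> tower m x \<le> tower m y"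
  by (induction m) (simp_all add: tower_Suc)

lemma le_tower: "x \<le> tower m x"
proof (induction m)
  case (Suc m)
  then show ?case unfolding tower_Suc using less_exp[of "tower m x"] by linarith
qed simp

lemma tower_mono_height: "m \<le> m' \<Longrightarrow> tower m x \<le> tower m' x"
proof (induction m' rule: dec_induct)
  case (step k)
  then show ?case unfolding tower_Suc using less_exp[of "tower k x"] by linarith
qed simp

lemma double_le_exp: "x + x \<le> 2 ^ x" for x :: nat
proof (cases x)
  case (Suc y)
  have "Suc y \<le> 2 ^ y" using less_exp Suc_leI by blast
  then show ?thesis using Suc by simp
qed simp

text \<open>A condition on growth alone. It suffices that the parameter dependence is dominated by
  some \<open>tower\<close> of fixed height, since that function is computed by an explicit program.
  One \<open>m\<close> for height and shift keeps the closure proofs short.\<close>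

definition elementary :: "(nat \<Rightarrow> nat) \<Rightarrow> bool" where
  "elementary g \<longleftrightarrow> (\<exists>m. \<forall>l. g l \<le> tower m (l + m))"

lemma elementary_le: "elementary g \<Longrightarrow> (\<And>l. h l \<le> g l) \<Longrightarrow> elementary h"
  unfolding elementary_def by (meson le_trans)

lemma elementary_id: "elementary (\<lambda>l. l)"
  unfolding elementary_def by (rule exI[of _ 0]) simp

lemma elementary_const: "elementary (\<lambda>l. c)"
  unfolding elementary_def
  by (rule exI[of _ c]) (meson le_add2 le_tower le_trans)

lemma elementary_common:
  assumes "elementary g" "elementary h"
  obtains m where "\<And>l. g l \<le> tower m (l + m)" "\<And>l. h l \<le> tower m (l + m)"
proof -
  obtain m1 m2 where "\<And>l. g l \<le> tower m1 (l + m1)" "\<And>l. h l \<le> tower m2 (l + m2)"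
    using assms unfolding elementary_def by blast
  moreover have "tower m1 (l + m1) \<le> tower (max m1 m2) (l + max m1 m2)"
    "tower m2 (l + m2) \<le> tower (max m1 m2) (l + max m1 m2)" for l
    by (meson tower_mono tower_mono_height le_trans add_le_mono le_refl max.cobounded1 max.cobounded2)+
  ultimately show thesis using that[of "max m1 m2"] le_trans by meson
qed

lemma elementary_tower2:
  assumes "\<And>l. g l \<le> tower k (tower m (l + m))"
  shows "elementary g"
  unfolding elementary_def
proof (intro exI allI)
  fix l
  have "tower k (tower m (l + m)) = tower (k + m) (l + m)" by (simp add: tower_def funpow_add)
  also have "\<dots> \<le> tower (k + m) (l + (k + m))" by (rule tower_mono) simp
  finally show "g l \<le> tower (k + m) (l + (k + m))" using assms[of l] by linarith
qed

text \<open>If both values are at most x, the power is at most 2 ^ (x * x), which three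
  exponentiations of x exceed.\<close>

lemma elementary_power:
  assumes "elementary g" "elementary h" shows "elementary (\<lambda>l. g l ^ h l)"
proof -
  obtain m where m: "\<And>l. g l \<le> tower m (l + m)" "\<And>l. h l \<le> tower m (l + m)"
    using elementary_common[OF assms] by metis
  have sq: "x * x \<le> 2 ^ (2 ^ x)" for x :: nat
  proof -
    have "x * x \<le> 2 ^ x * 2 ^ x" by (intro mult_le_mono less_imp_le less_exp)
    also have "\<dots> = 2 ^ (x + x)" by (simp add: power_add)
    also have "\<dots> \<le> 2 ^ (2 ^ x)" by (intro power_increasing double_le_exp) simp
    finally show ?thesis .
  qed
  have pw: "a ^ b \<le> tower 3 x" if "a \<le> x" "b \<le> x" for a b x :: nat
  proof -
    have "a ^ b \<le> (2 ^ x) ^ b" using le_trans[OF that(1) less_imp_le[OF less_exp]] by (intro power_mono) simp_all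
    also have "\<dots> = 2 ^ (x * b)" by (simp add: power_mult)
    also have "x * b \<le> x * x" using that by simp
    finally have "a ^ b \<le> 2 ^ (x * x)" by simp
    also have "\<dots> \<le> 2 ^ 2 ^ 2 ^ x" using sq[of x] by (intro power_increasing) auto
    also have "\<dots> = tower 3 x" by (simp add: numeral_3_eq_3 tower_Suc)
    finally show ?thesis .
  qed
  show ?thesis by (rule elementary_tower2[of _ 3 m]) (rule pw[OF m])
qed

lemma elementary_add:
  assumes "elementary g" "elementary h" shows "elementary (\<lambda>l. g l + h l)"
proof -
  obtain m where m: "\<And>l. g l \<le> tower m (l + m)" "\<And>l. h l \<le> tower m (l + m)"
    using elementary_common[OF assms] by metis
  have "g l + h l \<le> tower 1 (tower m (l + m))" for l
    using m[of l] double_le_exp[of "tower m (l + m)"] unfolding One_nat_def tower_Suc tower_0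
    by linarith
  then show ?thesis by (rule elementary_tower2)
qed

lemma elementary_mult:
  assumes "elementary g" "elementary h" shows "elementary (\<lambda>l. g l * h l)"
proof (rule elementary_le)
  show "elementary (\<lambda>l. (g l + h l) ^ 2)"
    by (intro elementary_power elementary_add elementary_const assms)
  show "g l * h l \<le> (g l + h l) ^ 2" for l
    by (simp add: power2_eq_square algebra_simps)
qed

lemmas elementary_intros =
  elementary_id elementary_const elementary_add elementary_mult elementary_power

definition tower_step :: com where
  "tower_step = Sq (Asg 1 (Cn 1)) (Sq (Fr 2 0 (Asg 1 (Op Add (Vr 1) (Vr 1)))) (Asg 0 (Vr 1)))"

primrec tower_com :: "nat \<Rightarrow> com" where
  "tower_com 0 = Nop"
| "tower_com (Suc m) = Sq tower_step (tower_com m)"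

lemma wfc_tower_com: "wfc (tower_com m)"
  by (induction m) (auto simp: tower_step_def)

lemma computable_tower: "computable (\<lambda>l. tower m (l + m))"
proof -
  define c where "c = Sq (Asg 0 (Op Add (Vr 0) (Cn m))) (tower_com m)"
  have "\<exists>W t R M. exec W (compile 71 c) ((\<lambda>_. 0)(0 := l), \<lambda>_. 0) t (R, M) \<and> R 0 = tower m (l + m)" for l
  proof -
  define T where "T = tower m (l + m)"
  \<comment> \<open>Computability admits any word size depending on the argument, so the final value
    itself bounds all intermediate ones.\<close>
  define B where "B = T + 16"
  interpret program_bounds "\<lambda>_. B" B "B ^ deg c" 0 "\<lambda>_. 0"
    by unfold_locales (auto simp: B_def)
  have main: "wp (tower_com k) (\<lambda>v a. v 0 = T) v a" if "tower k (v 0) = T" for k v a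
    using that
  proof (induction k arbitrary: v a)
    case 0
    then show ?case by simp
  next
    case (Suc k v a)
    have le: "2 ^ v 0 \<le> B"
      using Suc.prems le_tower[of "2 ^ v 0" k] by (simp add: tower_Suc' B_def)
    have loop: "wp (Fr 2 0 (Asg 1 (Op Add (Vr 1) (Vr 1)))) (\<lambda>v' a. v' 1 = 2 ^ v 0) (v(1 := 1)) a"
    proof (rule wp_Fr[where Inv = "\<lambda>j (v' :: env) a. v' 1 = 2 ^ j"])
      fix j and v' :: env and a' :: arrays
      assume j: "j < (v(1 := 1)) 0" and I: "v' 1 = 2 ^ j"
      have "(2 :: nat) ^ Suc j \<le> 2 ^ v 0" using j by (intro power_increasing) auto
      then show "wp (Asg 1 (Op Add (Vr 1) (Vr 1))) (\<lambda>v' a. v' 1 = 2 ^ Suc j) (v'(2 := j)) a'"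
        using I le by simp
    qed simp_all
    have "wp (Fr 2 0 (Asg 1 (Op Add (Vr 1) (Vr 1))))
        (wp (Asg 0 (Vr 1)) (wp (tower_com k) (\<lambda>v a. v 0 = T))) (v(1 := 1)) a"
    proof (rule wp_mono[OF loop])
      fix v' :: env and a' assume v': "v' 1 = 2 ^ v 0"
      have "wp (tower_com k) (\<lambda>v a. v 0 = T) (v'(0 := 2 ^ v 0)) a'"
        using Suc.prems by (intro Suc.IH) (simp add: tower_Suc')
      then show "wp (Asg 0 (Vr 1)) (wp (tower_com k) (\<lambda>v a. v 0 = T)) v' a'"
        using le v' by simp
    qed
    moreover have "1 \<le> B" by (simp add: B_def)
    ultimately show ?case by (simp add: tower_step_def)
  qed
  have lm: "l + m \<le> B" using le_tower[of "l + m" m] by (simp add: B_def T_def)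
  define v0 :: env where "v0 = (\<lambda>_. 0)(0 := l)"
  have "com_result 71 c (\<lambda>v a. v 0 = T) v0 (\<lambda>_. 0)"
  proof (rule compile_correct[where v = v0 and a = "\<lambda>_ _. 0"])
    show "wfc c" using wfc_tower_com by (simp add: c_def)
    show "wp c (\<lambda>v a. v 0 = T) v0 (\<lambda>_ _. 0)"
      using main[of m "v0(0 := l + m)"] lm by (simp add: c_def v0_def T_def)
  qed (use lm in \<open>auto simp: v0_def bounded_def rel_mem_def\<close>)
  then obtain t R M where "exec (B ^ deg c) (compile 71 c) (v0, \<lambda>_. 0) t (R, M)" "R 0 = T"
    unfolding com_result_def by fastforce
  then show ?thesis by (auto simp: v0_def T_def)
  qed
  then show ?thesis unfolding computable_def by blast
qed

section \<open>The algorithm\<close>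

abbreviation plus_exp (infixl "\<oplus>" 65) where "e1 \<oplus> e2 \<equiv> Op Add e1 e2"
abbreviation minus_exp (infixl "\<ominus>" 65) where "e1 \<ominus> e2 \<equiv> Op Sub e1 e2"
abbreviation times_exp (infixl "\<otimes>" 70) where "e1 \<otimes> e2 \<equiv> Op Mul e1 e2"
abbreviation div_exp (infixl "\<oslash>" 70) where "e1 \<oslash> e2 \<equiv> Op Div e1 e2"
abbreviation mod_exp where "mod_exp e m \<equiv> e \<ominus> (e \<oslash> m) \<otimes> m"
abbreviation not_exp where "not_exp e \<equiv> EqE e (Cn 0)"
abbreviation pos_exp where "pos_exp e \<equiv> LtE (Cn 0) e"
abbreviation seq_com (infixr "\<Zsemi>" 60) where "c1 \<Zsemi> c2 \<equiv> Sq c1 c2"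

text \<open>Variables: 0 number of vertices, 1 absolute value and 2 sign of the budget, 3 \<open>n * n\<close>,
  4 size of the modulator \<open>K\<close>, 5 size of a clique, 6 size of a brute-force instance with
  7 to 9 the numbers of its bits, edge sets and cuts, 17 cost charged so far.
  Arrays: 0 adjacency matrix, 1 safe components, 2 membership in \<open>K\<close>, 3 list of \<open>K\<close>, 4 kept
  vertices, 5 first kept vertices of their twin class, 6 and 7 members and size of the clique of
  a leader, 8 leaders of kept cliques, 9 vertices of the brute-force instance, 10 powers of two.\<close>

abbreviation adj_exp where "adj_exp e1 e2 \<equiv> Rd 0 (e1 \<otimes> Vr 0 \<oplus> e2)"
abbreviation lab_exp where "lab_exp e \<equiv> Rd 1 e"

definition copy_adj :: com where
  "copy_adj = Asg 3 (Vr 0 \<otimes> Vr 0) \<Zsemi> Fr 10 3 (Inp 14 (Vr 10) \<Zsemi> St 0 (Vr 10) (Vr 14))"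

definition relabel :: com where
  "relabel = Fr 13 0 (Cd (EqE (Rd 1 (Vr 13)) (Vr 14)) (St 1 (Vr 13) (Vr 15)) Nop)"

text \<open>Each of the n * n matrix entries triggers at most one relabelling pass over n vertices,
  so merging by brute force is already cubic.\<close>

definition labels :: com where
  "labels = Fr 11 0 (St 1 (Vr 11) (Vr 11)) \<Zsemi>
     Fr 10 3 (Cd (EqE (Rd 0 (Vr 10)) (Cn 1))
       (Asg 14 (Rd 1 (Vr 10 \<oslash> Vr 0)) \<Zsemi> Asg 15 (Rd 1 (mod_exp (Vr 10) (Vr 0))) \<Zsemi> relabel)
       Nop)"

definition P3_exp :: exp where
  "P3_exp = not_exp (Rd 2 (Vr 11) \<oplus> Rd 2 (Vr 12) \<oplus> Rd 2 (Vr 13)) \<otimes>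
     pos_exp (adj_exp (Vr 11) (Vr 12)) \<otimes> pos_exp (adj_exp (Vr 12) (Vr 13)) \<otimes>
     not_exp (adj_exp (Vr 11) (Vr 13)) \<otimes> not_exp (EqE (Vr 11) (Vr 13))"

text \<open>A single counter below n * n * n encodes the triple, so one loop invariant suffices.
  Vertex 0 is inserted first.\<close>

definition pack_P3 :: com where
  "pack_P3 = Asg 21 (Vr 3 \<otimes> Vr 0) \<Zsemi> St 2 (Cn 0) (Cn 1) \<Zsemi>
     Fr 10 21 (Asg 11 (Vr 10 \<oslash> Vr 3) \<Zsemi> Asg 12 (mod_exp (Vr 10 \<oslash> Vr 0) (Vr 0)) \<Zsemi>
       Asg 13 (mod_exp (Vr 10) (Vr 0)) \<Zsemi>
       Cd P3_exp (St 2 (Vr 11) (Cn 1) \<Zsemi> St 2 (Vr 12) (Cn 1) \<Zsemi> St 2 (Vr 13) (Cn 1)) Nop)"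

definition list_K :: com where
  "list_K = Asg 4 (Cn 0) \<Zsemi>
     Fr 12 0 (Cd (Rd 2 (Vr 12)) (St 3 (Vr 4) (Vr 12) \<Zsemi> Asg 4 (Vr 4 \<oplus> Cn 1)) Nop)"

text \<open>The entries 1 and 2 both mean adjacency, so they are compared after testing for
  0.\<close>

definition same_nbK_exp :: "exp \<Rightarrow> exp \<Rightarrow> exp" where
  "same_nbK_exp e1 e2 = not_exp (Sm 53 4 (not_exp (EqE
     (not_exp (adj_exp e1 (Rd 3 (Vr 53)))) (not_exp (adj_exp e2 (Rd 3 (Vr 53)))))))"

definition priv_exp :: "exp \<Rightarrow> exp" where
  "priv_exp e = not_exp (Sm 53 4 (EqE (lab_exp e) (lab_exp (Rd 3 (Vr 53)))))"

definition before_exp :: "nat \<Rightarrow> exp" where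
  "before_exp x = Rd x (Vr 50) \<otimes> LtE (Vr 50) (Vr 12) \<otimes> pos_exp (adj_exp (Vr 50) (Vr 12))"

definition twins_exp :: exp where
  "twins_exp = Sm 50 0 (before_exp 4 \<otimes> EqE (lab_exp (Vr 50)) (lab_exp (Vr 12)) \<otimes>
     same_nbK_exp (Vr 50) (Vr 12))"

definition pfirsts_exp :: exp where
  "pfirsts_exp = priv_exp (Vr 12) \<otimes> Sm 50 0 (before_exp 4 \<otimes> Rd 5 (Vr 50) \<otimes> priv_exp (Vr 50) \<otimes>
     not_exp (EqE (lab_exp (Vr 50)) (lab_exp (Vr 12))) \<otimes> same_nbK_exp (Vr 50) (Vr 12))"

definition prune :: com where
  "prune = Asg 18 (Cn 4 \<otimes> Vr 4 \<oplus> Cn 5) \<Zsemi> Asg 17 (Cn 0) \<Zsemi>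
     Fr 12 0 (Cd (Rd 2 (Vr 12)) Nop
       (Asg 20 twins_exp \<Zsemi> Asg 28 pfirsts_exp \<Zsemi>
        Cd (LtE (Vr 20) (Vr 18) \<otimes> LtE (Vr 28) (Vr 18))
          (St 4 (Vr 12) (Cn 1) \<Zsemi> St 5 (Vr 12) (not_exp (Vr 20)))
          (Asg 17 (Vr 17 \<oplus> Cn 1))))"

definition bit_exp :: "exp \<Rightarrow> exp \<Rightarrow> exp" where
  "bit_exp e i = mod_exp (e \<oslash> Rd 10 i) (Cn 2)"

definition chosen_exp :: exp where
  "chosen_exp = LtE (Vr 51) (Vr 52) \<otimes> bit_exp (Vr 25) (Vr 51 \<otimes> Vr 6 \<oplus> Vr 52) \<otimes>
     pos_exp (adj_exp (Rd 9 (Vr 51)) (Rd 9 (Vr 52)))"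

text \<open>A crossing edge weighs 1 and a safe one 2, so the cut is satisfied iff the total is at
  least 2. Multiplication by the power of two for variable 27 shifts the first listed vertices,
  those to be contracted, out of the cut.\<close>

definition weight_exp :: exp where
  "weight_exp = Sm 51 6 (Sm 52 6 (chosen_exp \<otimes>
     not_exp (EqE (bit_exp (Vr 50 \<otimes> Rd 10 (Vr 27)) (Vr 51)) (bit_exp (Vr 50 \<otimes> Rd 10 (Vr 27)) (Vr 52))) \<otimes>
     (Cn 1 \<oplus> EqE (lab_exp (Rd 9 (Vr 51))) (lab_exp (Rd 9 (Vr 52))))))"

definition powers :: com where
  "powers = Asg 23 (Cn 1) \<Zsemi> Asg 7 (Vr 6 \<otimes> Vr 6 \<oplus> Cn 1) \<Zsemi>
     Fr 22 7 (St 10 (Vr 22) (Vr 23) \<Zsemi> Asg 23 (Vr 23 \<oplus> Vr 23))"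

text \<open>The running minimum starts at budget + 1, which stands for all larger values and for
  infeasibility. The cut 0 is skipped because it is empty.\<close>

definition solve :: com where
  "solve = powers \<Zsemi> Asg 8 (Rd 10 (Vr 6 \<otimes> Vr 6)) \<Zsemi>
     Asg 9 (Rd 10 (Vr 6) \<oslash> Rd 10 (Vr 27)) \<Zsemi> Asg 24 (Vr 1 \<oplus> Cn 1) \<Zsemi>
     Fr 25 8 (Cd (not_exp (Sm 50 9 (pos_exp (Vr 50) \<otimes> LtE weight_exp (Cn 2))))
       (Asg 26 (Sm 51 6 (Sm 52 6 chosen_exp)) \<Zsemi> Cd (LtE (Vr 26) (Vr 24)) (Asg 24 (Vr 26)) Nop)
       Nop)"

definition gather :: com where
  "gather = Asg 5 (Cn 0) \<Zsemi>
     Fr 11 0 (Cd (Rd 4 (Vr 11) \<otimes> pos_exp (EqE (Vr 11) (Vr 12) \<oplus> adj_exp (Vr 12) (Vr 11)))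
       (St 6 (Vr 12 \<otimes> Vr 0 \<oplus> Vr 5) (Vr 11) \<Zsemi> Asg 5 (Vr 5 \<oplus> Cn 1)) Nop) \<Zsemi>
     St 7 (Vr 12) (Vr 5)"

definition member_exp :: "exp \<Rightarrow> exp \<Rightarrow> exp" where
  "member_exp e i = Rd 6 (e \<otimes> Vr 0 \<oplus> i)"

text \<open>Counts the positions at which two member lists disagree. It is meaningful when both
  cliques have as many members as variable 5 says; \<open>similar_exp\<close> tests this by a
  separate factor.\<close>

definition differ_exp :: "exp \<Rightarrow> exp" where
  "differ_exp e = Sm 51 5 (Sm 52 4
       (not_exp (EqE (not_exp (adj_exp (member_exp e (Vr 51)) (Rd 3 (Vr 52))))
          (not_exp (adj_exp (member_exp (Vr 12) (Vr 51)) (Rd 3 (Vr 52))))) \<oplus>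
        not_exp (EqE (EqE (lab_exp (member_exp e (Vr 51))) (lab_exp (Rd 3 (Vr 52))))
          (EqE (lab_exp (member_exp (Vr 12) (Vr 51))) (lab_exp (Rd 3 (Vr 52)))))) \<oplus>
     Sm 53 5 (not_exp (EqE (EqE (lab_exp (member_exp e (Vr 51))) (lab_exp (member_exp e (Vr 53))))
          (EqE (lab_exp (member_exp (Vr 12) (Vr 51))) (lab_exp (member_exp (Vr 12) (Vr 53)))))))"

definition similar_exp :: exp where
  "similar_exp = Sm 50 0 (Rd 8 (Vr 50) \<otimes> LtE (Vr 50) (Vr 12) \<otimes> EqE (Rd 7 (Vr 50)) (Vr 5) \<otimes>
     not_exp (differ_exp (Vr 50)))"

definition push :: "exp \<Rightarrow> com" where
  "push e = St 9 (Vr 6) e \<Zsemi> Asg 6 (Vr 6 \<oplus> Cn 1)"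

definition push_K :: com where
  "push_K = Asg 6 (Cn 0) \<Zsemi> Fr 16 4 (push (Rd 3 (Vr 16)))"

definition push_clique :: com where
  "push_clique = Fr 22 5 (push (member_exp (Vr 12) (Vr 22)))"

text \<open>The deleted clique is solved together with K, listed with K first, and variable 27 set
  to |K| contracts K.\<close>

definition cliques_body :: com where
  "cliques_body = gather \<Zsemi> Asg 20 similar_exp \<Zsemi>
     Cd (LtE (Vr 20) (Vr 19)) (St 8 (Vr 12) (Cn 1))
       (push_K \<Zsemi> push_clique \<Zsemi> Asg 27 (Vr 4) \<Zsemi> solve \<Zsemi> Asg 17 (Vr 17 \<oplus> Vr 24))"

definition cliques :: com where
  "cliques = Asg 19 (Cn 2) \<Zsemi> Fr 22 4 (Asg 19 (Vr 19 \<oplus> Vr 19)) \<Zsemi>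
     Fr 12 0 (Cd (Rd 4 (Vr 12) \<otimes> not_exp (Sm 50 0 (before_exp 4))) cliques_body Nop)"

text \<open>Setting variable 27 to 1 contracts only the first listed vertex, which is vertex 0, so
  an uncontracted instance is solved.\<close>

definition finish :: com where
  "finish = push_K \<Zsemi> Fr 12 0 (Cd (Rd 8 (Vr 12)) (Asg 5 (Rd 7 (Vr 12)) \<Zsemi> push_clique) Nop) \<Zsemi>
     Asg 27 (Cn 1) \<Zsemi> solve \<Zsemi> Asg 17 (Vr 17 \<oplus> Vr 24) \<Zsemi>
     Asg 0 (not_exp (LtE (Vr 1) (Vr 17)) \<otimes> not_exp (Vr 2))"

definition FGC_com :: com where
  "FGC_com = copy_adj \<Zsemi> labels \<Zsemi> pack_P3 \<Zsemi> list_K \<Zsemi> prune \<Zsemi> cliques \<Zsemi> finish"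

lemmas program_defs = copy_adj_def relabel_def labels_def P3_exp_def pack_P3_def list_K_def
  same_nbK_exp_def priv_exp_def before_exp_def twins_exp_def pfirsts_exp_def prune_def bit_exp_def
  chosen_exp_def weight_exp_def powers_def solve_def gather_def member_exp_def differ_exp_def
  similar_exp_def push_def push_K_def push_clique_def cliques_body_def cliques_def finish_def

lemma wfc_FGC_com: "wfc FGC_com"
  by (simp add: FGC_com_def program_defs)

lemma bounds_FGC_com: "bounds FGC_com = {0, 3, 4, 5, 6, 7, 8, 9, 21}"
  by (auto simp: FGC_com_def program_defs)

definition loop_order :: "nat \<Rightarrow> nat" where
  "loop_order r = (if r = 0 then 1 else if r = 3 then 2 else if r = 21 then 3 else 0)"

lemma order_FGC_com: "order_com loop_order FGC_com = 3"
  by (simp add: FGC_com_def program_defs loop_order_def)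

text \<open>The conditions on B stem from the counter of the triples, from one doubling beyond the
  table of powers, and from the total charge: at most n for deleted vertices, and at most
  \<open>kk + 1\<close> for each of up to n deleted cliques and for the final search.\<close>

locale FGC_bounds = program_bounds U B W base inp
  for U :: "nat \<Rightarrow> nat" and B W base :: nat and inp :: "nat \<Rightarrow> nat" +
  fixes n kk F :: nat
  assumes n1: "1 \<le> n"
    and U_n: "U 0 = n" "U 3 = n * n" "U 21 = n * (n * n)"
    and U_F: "4 \<le> r \<Longrightarrow> r \<le> 9 \<Longrightarrow> U r = F"
    and U_B: "r < 50 \<Longrightarrow> r \<notin> {0, 3, 21} \<Longrightarrow> r < 4 \<or> 9 < r \<Longrightarrow> U r = B"
    and base_eq: "base = n * n"
    and inp_le: "p < n * n \<Longrightarrow> inp p \<le> 2"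
    and F16: "16 \<le> F"
    and B_ge: "n * (n * n) \<le> B" "2 * F \<le> B" "n + (n + 1) * (kk + 1) \<le> B"
begin

lemma U_simps [simp]:
  "U 0 = n" "U 3 = n * n" "U 21 = n * (n * n)"
  "U 4 = F" "U 5 = F" "U 6 = F" "U 7 = F" "U 8 = F" "U 9 = F"
  "U 10 = B" "U 11 = B" "U 12 = B" "U 13 = B" "U 14 = B" "U 15 = B" "U 16 = B" "U 17 = B"
  "U 18 = B" "U 19 = B" "U 20 = B" "U 22 = B" "U 23 = B" "U 24 = B" "U 25 = B" "U 26 = B"
  "U 27 = B" "U 28 = B"
  using U_n U_F U_B by simp_all

lemma B_simps: "n \<le> B" "n * n \<le> B" "F \<le> B" "1 \<le> B" "2 \<le> B" "kk + 1 \<le> B" "16 \<le> B"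
proof -
  have "1 * 1 \<le> n * n" "n * 1 \<le> n * n" "1 * (n * n) \<le> n * (n * n)" by (intro mult_le_mono n1 order_refl)+
  then show "n \<le> B" "n * n \<le> B" using B_ge(1) by linarith+
  show "F \<le> B" "1 \<le> B" "2 \<le> B" "16 \<le> B" using B_ge(2) F16 by linarith+
  have "1 * (kk + 1) \<le> (n + 1) * (kk + 1)" by (intro mult_le_mono1) simp
  then show "kk + 1 \<le> B" unfolding mult_1 using add_leD2[OF B_ge(3)] by (rule le_trans)
qed

lemma pair_decode:
  assumes "u < n" "w < n"
  shows "u * n + w < n * n" "(u * n + w) div n = u" "(u * n + w) mod n = w"
proof -
  have "u * n + w < Suc u * n" using assms by simp
  also have "Suc u * n \<le> n * n" using assms by (intro mult_le_mono1) simp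
  finally show "u * n + w < n * n" .
  show "(u * n + w) div n = u" "(u * n + w) mod n = w" using assms by simp_all
qed

lemma div_less_n: "p < n * n \<Longrightarrow> p div n < n"
  by (simp add: less_mult_imp_div_less)

lemma mod_less_n: "p mod n < n"
  using n1 by simp

section \<open>Labels of safe components, packing of paths, and the list of the modulator\<close>

lemma copy_adj_correct:
  assumes "v 0 = n"
  shows "wp copy_adj (\<lambda>v' a'. v' 3 = n * n \<and> (\<forall>p<n * n. a' 0 p = inp p)) v a"
proof -
  have "wp (Fr 10 3 (Inp 14 (Vr 10) \<Zsemi> St 0 (Vr 10) (Vr 14)))
      (\<lambda>v' a'. v' 3 = n * n \<and> (\<forall>p<n * n. a' 0 p = inp p)) (v(3 := n * n)) a"
  proof (rule wp_Fr[where Inv = "\<lambda>j v' a'. \<forall>p<j. a' 0 p = inp p"])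
    show "U 3 \<le> U 10" using B_simps by simp
  next
    fix j and v' :: env and a' :: arrays
    assume j: "j < (v(3 := n * n)) 3" and I: "\<forall>p<j. a' 0 p = inp p"
    have "inp j \<le> B" "j < base" using j inp_le[of j] B_simps by (simp_all add: base_eq)
    then show "wp (Inp 14 (Vr 10) \<Zsemi> St 0 (Vr 10) (Vr 14)) (\<lambda>v' a'. \<forall>p<Suc j. a' 0 p = inp p)
        (v'(10 := j)) a'"
      using I by (auto simp: less_Suc_eq)
  next
    fix v' :: env and a' :: arrays
    assume "\<forall>p<(v(3 := n * n)) 3. a' 0 p = inp p"
      "agree (insert 10 (vmod (Inp 14 (Vr 10) \<Zsemi> St 0 (Vr 10) (Vr 14))))
        (amod (Inp 14 (Vr 10) \<Zsemi> St 0 (Vr 10) (Vr 14))) (v(3 := n * n)) a v' a'"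
    then show "v' 3 = n * n \<and> (\<forall>p<n * n. a' 0 p = inp p)" by (simp add: agree_def)
  qed simp
  then show ?thesis using assms by (simp add: copy_adj_def)
qed

lemma relabel_correct:
  assumes v: "v 0 = n" "v 14 = \<alpha>" "v 15 = \<beta>" "\<beta> \<le> B"
  shows "wp relabel (\<lambda>v' a'. \<forall>x<n. a' 1 x = (if a 1 x = \<alpha> then \<beta> else a 1 x)) v a"
  unfolding relabel_def
proof (rule wp_Fr[where Inv = "\<lambda>j v' a'. \<forall>x<n. a' 1 x = (if x < j \<and> a 1 x = \<alpha> then \<beta> else a 1 x)"])
  let ?c = "Cd (EqE (Rd 1 (Vr 13)) (Vr 14)) (St 1 (Vr 13) (Vr 15)) Nop"
  show "U 0 \<le> U 13" using B_simps by simp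
  fix j and v' :: env and a' :: arrays
  assume j: "j < v 0" and I: "\<forall>x<n. a' 1 x = (if x < j \<and> a 1 x = \<alpha> then \<beta> else a 1 x)"
    and ag: "agree (insert 13 (vmod ?c)) (amod ?c) v a v' a'"
  have "v' 14 = \<alpha>" "v' 15 = \<beta>" using ag v by (auto simp: agree_def)
  moreover have "a' 1 j = a 1 j" using I j v by simp
  ultimately show "wp ?c (\<lambda>v' a'. \<forall>x<n. a' 1 x = (if x < Suc j \<and> a 1 x = \<alpha> then \<beta> else a 1 x))
      (v'(13 := j)) a'"
    using I j v by (auto simp: less_Suc_eq)
qed (use v in auto)

lemma reach_sym: "reach S x y \<Longrightarrow> reach S y x"
proof -
  have "sym {(x, y). {x, y} \<in> S}" by (auto intro: symI simp: insert_commute)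
  then show "reach S x y \<Longrightarrow> reach S y x"
    unfolding reach_def by (metis sym_rtrancl symD)
qed

lemma reach_trans: "reach S x y \<Longrightarrow> reach S y z \<Longrightarrow> reach S x z"
  unfolding reach_def by (rule rtrancl_trans)

lemma labels_correct:
  assumes v: "v 0 = n" "v 3 = n * n" and a: "\<forall>p<n * n. a 0 p = inp p"
    and S: "\<And>x y. x < n \<Longrightarrow> y < n \<Longrightarrow> inp (x * n + y) = 1 \<longleftrightarrow> {x, y} \<in> S"
    and Sn: "\<And>e. e \<in> S \<Longrightarrow> e \<subseteq> {..<n}"
  shows "wp labels (\<lambda>v' a'. \<forall>x<n. \<forall>y<n. a' 1 x = a' 1 y \<longleftrightarrow> reach S x y) v a"
proof -
  define edge where "edge = Asg 14 (Rd 1 (Vr 10 \<oslash> Vr 0)) \<Zsemi>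
    Asg 15 (Rd 1 (mod_exp (Vr 10) (Vr 0))) \<Zsemi> relabel"
  define body where "body = Cd (EqE (Rd 0 (Vr 10)) (Cn 1)) edge Nop"
  \<comment> \<open>That equal labels imply reachability holds throughout; the converse along edges
    is claimed for processed entries only. Relabelling a whole class never separates equal labels,
    so processed entries stay settled.\<close>
  define Inv where "Inv j a' \<longleftrightarrow> (\<forall>x<n. a' 1 x < n) \<and>
    (\<forall>x<n. \<forall>y<n. a' 1 x = a' 1 y \<longrightarrow> reach S x y) \<and>
    (\<forall>p<j. inp p = 1 \<longrightarrow> a' 1 (p div n) = a' 1 (p mod n))" for j and a' :: arrays
  have init: "wp (Fr 11 0 (St 1 (Vr 11) (Vr 11))) (\<lambda>v' a'. \<forall>x<n. a' 1 x = x) v a"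
  proof (rule wp_Fr[where Inv = "\<lambda>j v' a'. \<forall>x<j. a' 1 x = x"])
    show "U 0 \<le> U 11" using B_simps by simp
    show "\<And>j v' a'. j < v 0 \<Longrightarrow> \<forall>x<j. a' 1 x = x \<Longrightarrow>
      wp (St 1 (Vr 11) (Vr 11)) (\<lambda>v' a'. \<forall>x<Suc j. a' 1 x = x) (v'(11 := j)) a'"
      using v B_simps by (auto simp: less_Suc_eq)
  qed (use v in auto)
  have edge: "wp edge (\<lambda>v' a'. Inv (Suc p) a') v' a'"
    if v': "v' 0 = n" "v' 10 = p" and p: "p < n * n" "inp p = 1" and I: "Inv p a'" for v' a' p
  proof -
    define s where "s = p div n"
    define t where "t = p mod n"
    have st: "s < n" "t < n" "s * n + t = p" using div_less_n[OF p(1)] mod_less_n by (auto simp: s_def t_def)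
    then have eS: "{s, t} \<in> S" using S[of s t] p(2) by simp
    then have r: "reach S s t" by (auto simp: reach_def)
    have lt: "a' 1 x < n" if "x < n" for x using I that by (auto simp: Inv_def)
    have lr: "reach S x y" if "x < n" "y < n" "a' 1 x = a' 1 y" for x y
      using I that by (auto simp: Inv_def)
    have le: "a' 1 s \<le> B" "a' 1 t \<le> B" using lt[OF st(1)] lt[OF st(2)] B_simps by linarith+
    have main: "Inv (Suc p) a2"
      if a2: "\<forall>x<n. a2 1 x = (if a' 1 x = a' 1 s then a' 1 t else a' 1 x)" for a2
      unfolding Inv_def
    proof (intro conjI allI impI)
      show "a2 1 x < n" if "x < n" for x using a2 that lt st by simp
      fix x y assume xy: "x < n" "y < n" "a2 1 x = a2 1 y"
      have xt: "reach S x t" if "x < n" "a' 1 x = a' 1 s" for x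
        using reach_trans[OF lr[OF that(1) st(1) that(2)] r] .
      consider "a' 1 x = a' 1 s" "a' 1 y = a' 1 s" | "a' 1 x = a' 1 s" "a' 1 y = a' 1 t"
        | "a' 1 x = a' 1 t" "a' 1 y = a' 1 s" | "a' 1 x = a' 1 y"
        using a2 xy by (auto split: if_splits)
      then show "reach S x y"
      proof cases
        case 1
        then show ?thesis using lr xy by simp
      next
        case 2
        then show ?thesis using reach_trans[OF xt[OF xy(1)] reach_sym[OF lr[OF xy(2) st(2)]]] by simp
      next
        case 3
        then show ?thesis using reach_trans[OF lr[OF xy(1) st(2)] reach_sym[OF xt[OF xy(2)]]] by simp
      next
        case 4
        then show ?thesis using lr xy by simp
      qed
    next
      fix q assume q: "q < Suc p" "inp q = 1"
      have qn: "q < n * n" using q p by simp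
      have d: "q div n < n" "q mod n < n" using div_less_n[OF qn] mod_less_n by auto
      show "a2 1 (q div n) = a2 1 (q mod n)"
      proof (cases "q = p")
        case True
        then show ?thesis using a2 d st by (auto simp: s_def t_def)
      next
        case False
        then have "a' 1 (q div n) = a' 1 (q mod n)" using I q by (auto simp: Inv_def)
        then show ?thesis using a2 d by simp
      qed
    qed
    have "wp relabel (\<lambda>v' a'. Inv (Suc p) a') (v'(14 := a' 1 s, 15 := a' 1 t)) a'"
      by (rule wp_mono[OF relabel_correct[of _ "a' 1 s" "a' 1 t"]]) (use v' le main in auto)
    then show ?thesis
      unfolding edge_def using v' le by (simp add: s_def t_def minus_div_mult_eq_mod)
  qed
  have loop: "wp (Fr 10 3 body) (\<lambda>v' a'. Inv (n * n) a') v' a'"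
    if v': "v' 0 = n" "v' 3 = n * n" and a': "\<forall>p<n * n. a' 0 p = inp p" and I: "Inv 0 a'" for v' a'
  proof (rule wp_Fr[where Inv = "\<lambda>j v' a'. Inv j a'"])
    show "U 3 \<le> U 10" using B_simps by simp
    fix j v2 a2
    assume j: "j < v' 3" and I: "Inv j a2" and ag: "agree (insert 10 (vmod body)) (amod body) v' a' v2 a2"
    have v2: "v2 0 = n" "a2 0 j = inp j"
      using ag v' a' j by (auto simp: agree_def body_def edge_def relabel_def)
    show "wp body (\<lambda>v' a'. Inv (Suc j) a') (v2(10 := j)) a2"
    proof (cases "inp j = 1")
      case True
      have "wp edge (\<lambda>v' a'. Inv (Suc j) a') (v2(10 := j)) a2"
        using v2 j v' True I by (intro edge) auto
      then show ?thesis using True v2 by (simp add: body_def)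
    next
      case False
      then have "Inv (Suc j) a2" using I by (auto simp: Inv_def less_Suc_eq)
      then show ?thesis using False v2 by (simp add: body_def)
    qed
  qed (use v' I in auto)
  have fin: "\<forall>x<n. \<forall>y<n. a' 1 x = a' 1 y \<longleftrightarrow> reach S x y" if I: "Inv (n * n) a'" for a'
  proof (intro allI impI iffI)
    fix x y assume "x < n" "y < n" "a' 1 x = a' 1 y"
    then show "reach S x y" using I by (auto simp: Inv_def)
  next
    fix x y assume xy: "x < n" "y < n" "reach S x y"
    then have "(x, y) \<in> {(x, y). {x, y} \<in> S}\<^sup>*" by (simp add: reach_def)
    then show "a' 1 x = a' 1 y"
    proof induction
      case (step y z)
      then have yz: "{y, z} \<in> S" by blast
      then have l: "y < n" "z < n" using Sn[OF yz] by auto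
      then have "inp (y * n + z) = 1" using S yz by blast
      then have "a' 1 y = a' 1 z" using I pair_decode[OF l] unfolding Inv_def by metis
      then show ?case using step.IH by simp
    qed simp
  qed
  have "wp labels (\<lambda>v' a'. Inv (n * n) a') v a"
    unfolding labels_def wp.simps(5)
  proof (rule wp_frame[OF init])
    fix v' a' assume *: "\<forall>x<n. a' 1 x = x"
      "agree (vmod (Fr 11 0 (St 1 (Vr 11) (Vr 11)))) (amod (Fr 11 0 (St 1 (Vr 11) (Vr 11)))) v a v' a'"
    have "wp (Fr 10 3 body) (\<lambda>v' a'. Inv (n * n) a') v' a'"
      using * v a by (intro loop) (auto simp: agree_def Inv_def reach_def)
    then show "wp (Fr 10 3 (Cd (EqE (Rd 0 (Vr 10)) (Cn 1))
       (Asg 14 (Rd 1 (Vr 10 \<oslash> Vr 0)) \<Zsemi> Asg 15 (Rd 1 (mod_exp (Vr 10) (Vr 0))) \<Zsemi> relabel)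
       Nop)) (\<lambda>v' a'. Inv (n * n) a') v' a'"
      unfolding body_def edge_def .
  qed
  then show ?thesis by (rule wp_mono) (rule fin)
qed

definition P3 :: "nat set set \<Rightarrow> nat \<Rightarrow> nat \<Rightarrow> nat \<Rightarrow> bool" where
  "P3 E u v w \<longleftrightarrow> {u, v} \<in> E \<and> {v, w} \<in> E \<and> u \<noteq> w \<and> {u, w} \<notin> E"

text \<open>The certificate that K is small: disjoint induced paths inside K that cover it up to one
  vertex, namely vertex 0.\<close>

definition packing :: "nat set set \<Rightarrow> nat set \<Rightarrow> bool" where
  "packing E K \<longleftrightarrow> (\<exists>PP. finite PP \<and> (\<forall>A\<in>PP. A \<subseteq> K \<and> (\<exists>u v w. A = {u, v, w} \<and> P3 E u v w)) \<and>
     (\<forall>A\<in>PP. \<forall>A'\<in>PP. A \<noteq> A' \<longrightarrow> A \<inter> A' = {}) \<and> card K \<le> 3 * card PP + 1)"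

lemma packing_insert:
  assumes P: "packing E K" and finK: "finite K" and uvw: "P3 E u v w" "{u, v, w} \<inter> K = {}"
  shows "packing E (K \<union> {u, v, w})"
proof -
  obtain PP where PP: "finite PP" "\<And>A. A \<in> PP \<Longrightarrow> A \<subseteq> K \<and> (\<exists>u v w. A = {u, v, w} \<and> P3 E u v w)"
    "\<And>A A'. A \<in> PP \<Longrightarrow> A' \<in> PP \<Longrightarrow> A \<noteq> A' \<Longrightarrow> A \<inter> A' = {}" "card K \<le> 3 * card PP + 1"
    using P unfolding packing_def by metis
  let ?A = "{u, v, w}"
  have new: "?A \<notin> PP" using PP(2)[of ?A] uvw(2) by blast
  have "card (K \<union> ?A) \<le> card K + card ?A" by (rule card_Un_le)
  also have "card ?A \<le> 3" by (simp add: card_insert_if)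
  finally have size: "card (K \<union> ?A) \<le> 3 * card (insert ?A PP) + 1" using PP(1,4) new by simp
  have disj: "A \<inter> A' = {}" if AA: "A \<in> insert ?A PP" "A' \<in> insert ?A PP" "A \<noteq> A'" for A A'
  proof -
    have new: "B \<inter> ?A = {}" if "B \<in> PP" for B using PP(2)[OF that] uvw(2) by blast
    consider "A \<in> PP" "A' \<in> PP" | "A = ?A" "A' \<in> PP" | "A \<in> PP" "A' = ?A"
      using AA by blast
    then show ?thesis
    proof cases
      case 1 then show ?thesis using PP(3) AA(3) by blast
    next
      case 2 then show ?thesis using new[of A'] by (simp add: Int_commute)
    next
      case 3 then show ?thesis using new[of A] by simp
    qed
  qed
  have "A \<subseteq> K \<union> ?A \<and> (\<exists>u v w. A = {u, v, w} \<and> P3 E u v w)" if "A \<in> insert ?A PP" for A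
    using that PP(2)[of A] uvw(1) by blast
  then have "\<forall>A\<in>insert ?A PP. A \<subseteq> K \<union> ?A \<and> (\<exists>u v w. A = {u, v, w} \<and> P3 E u v w)" by (rule ballI)
  moreover have "\<forall>A\<in>insert ?A PP. \<forall>A'\<in>insert ?A PP. A \<noteq> A' \<longrightarrow> A \<inter> A' = {}"
    by (intro ballI impI disj)
  moreover have "finite (insert ?A PP)" using PP(1) by simp
  ultimately show ?thesis
    unfolding packing_def using size by (intro exI[of _ "insert ?A PP"] conjI)
qed

text \<open>A path that meets K at its turn keeps doing so because K only grows; one that does not
  is added entirely. So a single pass leaves no path outside K.\<close>

lemma pack_P3_correct:
  assumes v: "v 0 = n" "v 3 = n * n" and a: "\<And>x y. x < n \<Longrightarrow> y < n \<Longrightarrow> a 0 (x * n + y) \<noteq> 0 \<longleftrightarrow> {x, y} \<in> E"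
    and a2: "\<And>x. a 2 x = 0"
    and E: "\<And>e. e \<in> E \<Longrightarrow> e \<subseteq> {..<n} \<and> card e = 2"
  shows "wp pack_P3 (\<lambda>v' a'. \<exists>K. (\<forall>x. a' 2 x \<noteq> 0 \<longleftrightarrow> x \<in> K) \<and> K \<subseteq> {..<n} \<and> 0 \<in> K \<and> packing E K \<and>
      (\<forall>u v w. P3 E u v w \<longrightarrow> {u, v, w} \<inter> K \<noteq> {})) v a"
proof -
  \<comment> \<open>The index of (u, v, w) is (u * n + v) * n + w.\<close>
  define tri where "tri p = (p div (n * n), (p div n) mod n, p mod n)" for p
  define Inv where "Inv j a' \<longleftrightarrow> (\<exists>K. (\<forall>x. a' 2 x \<noteq> 0 \<longleftrightarrow> x \<in> K) \<and> K \<subseteq> {..<n} \<and> 0 \<in> K \<and> packing E K \<and>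
      (\<forall>p<j. case tri p of (u, v, w) \<Rightarrow> P3 E u v w \<longrightarrow> {u, v, w} \<inter> K \<noteq> {}))" for j and a' :: arrays
  define hit where "hit = St 2 (Vr 11) (Cn 1) \<Zsemi> St 2 (Vr 12) (Cn 1) \<Zsemi> St 2 (Vr 13) (Cn 1)"
  define body where "body = Asg 11 (Vr 10 \<oslash> Vr 3) \<Zsemi> Asg 12 (mod_exp (Vr 10 \<oslash> Vr 0) (Vr 0)) \<Zsemi>
       Asg 13 (mod_exp (Vr 10) (Vr 0)) \<Zsemi> Cd P3_exp hit Nop"
  have pk0: "packing E {0}" unfolding packing_def by (intro exI[of _ "{}"]) auto
  have loop: "wp (Fr 10 21 body) (\<lambda>v' a'. Inv (n * (n * n)) a') v0 a0"
    if v0: "v0 0 = n" "v0 3 = n * n" "v0 21 = n * (n * n)" and a0: "a0 0 = a 0" and I0: "Inv 0 a0" for v0 a0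
  proof (rule wp_Fr[where Inv = "\<lambda>j v' a'. Inv j a'"])
    show "U 21 \<le> U 10" using B_ge by simp
    fix j v2 a2
    assume j: "j < v0 21" and I: "Inv j a2"
      and ag: "agree (insert 10 (vmod body)) (amod body) v0 a0 v2 a2"
    have v2: "v2 0 = n" "v2 3 = n * n" "a2 0 = a 0" using ag v0 a0 by (auto simp: agree_def body_def hit_def)
    obtain u x w where t: "tri j = (u, x, w)" by (cases "tri j")
    have jn: "j < n * (n * n)" using j v0 by simp
    have uxw: "u = j div (n * n)" "x = (j div n) mod n" "w = j mod n" using t by (auto simp: tri_def)
    have lt: "u < n" "x < n" "w < n"
      using jn n1 by (auto simp: uxw less_mult_imp_div_less)
    obtain K where K: "\<forall>x. a2 2 x \<noteq> 0 \<longleftrightarrow> x \<in> K" "K \<subseteq> {..<n}" "0 \<in> K" "packing E K"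
      "\<forall>p<j. case tri p of (u, v, w) \<Rightarrow> P3 E u v w \<longrightarrow> {u, v, w} \<inter> K \<noteq> {}"
      using I unfolding Inv_def by (elim exE conjE) (rule that, assumption+)
    define v3 where "v3 = v2(10 := j, 11 := u, 12 := x, 13 := w)"
    have ev: "eval P3_exp v3 a2 \<noteq> 0 \<longleftrightarrow> P3 E u x w \<and> {u, x, w} \<inter> K = {}"
      using v2 a[OF lt(1,2)] a[OF lt(2,3)] a[OF lt(1,3)] K(1)[rule_format, of u] K(1)[rule_format, of x] K(1)[rule_format, of w]
      by (auto simp: P3_exp_def P3_def v3_def)
    have "wp (Cd P3_exp hit Nop) (\<lambda>v' a'. Inv (Suc j) a') v3 a2"
    proof (cases "P3 E u x w \<and> {u, x, w} \<inter> K = {}")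
      case True
      define a3 where "a3 = a2(2 := (a2 2)(u := 1, x := 1, w := 1))"
      have "finite K" using K(2) finite_subset by blast
      then have pk: "packing E (K \<union> {u, x, w})" using packing_insert[OF K(4)] True by blast
      have "Inv (Suc j) a3"
        unfolding Inv_def
      proof (intro exI[of _ "K \<union> {u, x, w}"] conjI allI impI)
        show "a3 2 y \<noteq> 0 \<longleftrightarrow> y \<in> K \<union> {u, x, w}" for y using K(1)[rule_format, of y] by (simp add: a3_def)
        show "K \<union> {u, x, w} \<subseteq> {..<n}" using K(2) lt by auto
        show "0 \<in> K \<union> {u, x, w}" using K(3) by simp
        fix p assume "p < Suc j"
        then consider "p < j" | "p = j" by linarith
        then show "case tri p of (u', v', w') \<Rightarrow> P3 E u' v' w' \<longrightarrow> {u', v', w'} \<inter> (K \<union> {u, x, w}) \<noteq> {}"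
        proof cases
          case 1
          then show ?thesis using K(5)[rule_format, OF 1] by (auto split: prod.splits)
        next
          case 2
          then show ?thesis by (simp add: t)
        qed
      qed (rule pk)
      then have "wp hit (\<lambda>v' a'. Inv (Suc j) a') v3 a2"
        using B_simps by (simp add: hit_def v3_def a3_def)
      then show ?thesis using ev True by simp
    next
      case False
      have "Inv (Suc j) a2"
        unfolding Inv_def
      proof (intro exI[of _ K] conjI allI impI)
        fix p assume "p < Suc j"
        then consider "p < j" | "p = j" by linarith
        then show "case tri p of (u', v', w') \<Rightarrow> P3 E u' v' w' \<longrightarrow> {u', v', w'} \<inter> K \<noteq> {}"
        proof cases
          case 1
          then show ?thesis using K(5)[rule_format, OF 1] by blast
        next
          case 2
          then show ?thesis using False by (simp add: t)
        qed
      qed (use K in auto)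
      moreover have "eval P3_exp v3 a2 = 0" using ev False by blast
      ultimately show ?thesis by simp
    qed
    moreover have "u \<le> B" "x \<le> B" "w \<le> B" using lt B_simps by linarith+
    ultimately show "wp body (\<lambda>v' a'. Inv (Suc j) a') (v2(10 := j)) a2"
      using v2 unfolding body_def v3_def by (simp add: uxw minus_div_mult_eq_mod)
  qed (use v0 I0 in auto)
  have fin: "\<exists>K. (\<forall>x. a' 2 x \<noteq> 0 \<longleftrightarrow> x \<in> K) \<and> K \<subseteq> {..<n} \<and> 0 \<in> K \<and> packing E K \<and>
      (\<forall>u v w. P3 E u v w \<longrightarrow> {u, v, w} \<inter> K \<noteq> {})" if I: "Inv (n * (n * n)) a'" for a'
  proof -
    obtain K where K: "\<forall>x. a' 2 x \<noteq> 0 \<longleftrightarrow> x \<in> K" "K \<subseteq> {..<n}" "0 \<in> K" "packing E K"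
      "\<forall>p<n * (n * n). case tri p of (u, v, w) \<Rightarrow> P3 E u v w \<longrightarrow> {u, v, w} \<inter> K \<noteq> {}"
      using I unfolding Inv_def by (elim exE conjE) (rule that, assumption+)
    have "{u, v, w} \<inter> K \<noteq> {}" if P: "P3 E u v w" for u v w
    proof -
      have lt: "u < n" "v < n" "w < n" using P E unfolding P3_def by blast+
      define q where "q = u * n + v"
      note d = pair_decode[OF lt(1,2), folded q_def]
      have "q * n + w < Suc q * n" using lt by simp
      also have "Suc q * n \<le> (n * n) * n" using d(1) by (intro mult_le_mono1) simp
      finally have "q * n + w < n * (n * n)" by (simp add: ac_simps)
      moreover have "(q * n + w) div n = q" "(q * n + w) mod n = w" using lt by simp_all
      then have "tri (q * n + w) = (u, v, w)"
        using d by (simp add: tri_def div_mult2_eq)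
      ultimately show ?thesis using K(5)[rule_format, of "q * n + w"] P by simp
    qed
    then show ?thesis using K by blast
  qed
  define a1 where "a1 = a(2 := (a 2)(0 := 1))"
  have "Inv 0 a1" unfolding Inv_def by (rule exI[of _ "{0}"]) (use a2 n1 pk0 in \<open>auto simp: a1_def\<close>)
  then have "wp (Fr 10 21 body) (\<lambda>v' a'. Inv (n * (n * n)) a') (v(21 := n * (n * n))) a1"
    using v by (intro loop) (auto simp: a1_def)
  then have "wp pack_P3 (\<lambda>v' a'. Inv (n * (n * n)) a') v a"
    using v B_simps unfolding pack_P3_def body_def hit_def by (simp add: a1_def ac_simps)
  then show ?thesis by (rule wp_mono) (rule fin)
qed

text \<open>The list is increasing and K contains 0, so 0 comes first; the final search uses it as
  its root.\<close>

lemma list_K_correct: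
  assumes v: "v 0 = n" and K: "\<And>x. a 2 x \<noteq> 0 \<longleftrightarrow> x \<in> K" "K \<subseteq> {..<n}" "0 \<in> K" and cK: "card K \<le> F"
  shows "wp list_K (\<lambda>v' a'. v' 4 = card K \<and> bij_betw (a' 3) {..<card K} K \<and> a' 3 0 = 0) v a"
proof -
  define Inv where "Inv j v' a' \<longleftrightarrow> v' 4 = card (K \<inter> {..<j}) \<and>
    bij_betw (a' 3) {..<card (K \<inter> {..<j})} (K \<inter> {..<j}) \<and> (0 < j \<longrightarrow> a' 3 0 = 0)"
    for j and v' :: env and a' :: arrays
  let ?b = "Cd (Rd 2 (Vr 12)) (St 3 (Vr 4) (Vr 12) \<Zsemi> Asg 4 (Vr 4 \<oplus> Cn 1)) Nop"
  have finK: "finite K" using K(2) finite_subset by blast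
  have "wp (Fr 12 0 ?b) (\<lambda>v' a'. v' 4 = card K \<and> bij_betw (a' 3) {..<card K} K \<and> a' 3 0 = 0) (v(4 := 0)) a"
  proof (rule wp_Fr[where Inv = Inv])
    show "U 0 \<le> U 12" using B_simps by simp
    show "Inv 0 (v(4 := 0)) a" by (simp add: Inv_def bij_betw_def)
    have Kn: "K \<inter> {..<n} = K" using K(2) by blast
    show "v' 4 = card K \<and> bij_betw (a' 3) {..<card K} K \<and> a' 3 0 = 0"
      if "Inv ((v(4 := 0)) 0) v' a'" for v' a'
      using that v n1 Kn by (simp add: Inv_def)
    fix j v' a'
    assume j: "j < (v(4 := 0)) 0" and I: "Inv j v' a'"
      and ag: "agree (insert 12 (vmod ?b)) (amod ?b) (v(4 := 0)) a v' a'"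
    have a2: "a' 2 j \<noteq> 0 \<longleftrightarrow> j \<in> K" using ag K(1) by (simp add: agree_def)
    show "wp ?b (Inv (Suc j)) (v'(12 := j)) a'"
    proof (cases "j \<in> K")
      case True
      let ?c = "card (K \<inter> {..<j})"
      have S: "K \<inter> {..<Suc j} = insert j (K \<inter> {..<j})" using True by auto
      then have c: "card (K \<inter> {..<Suc j}) = Suc ?c" by simp
      have "Suc ?c \<le> card K" unfolding c[symmetric] using finK by (intro card_mono) auto
      then have le: "Suc ?c \<le> F" using cK by simp
      define g where "g = (a' 3)(?c := j)"
      have "bij_betw g {..<Suc ?c} (insert j (K \<inter> {..<j}))"
      proof -
        have "bij_betw g {..<?c} (K \<inter> {..<j})"
          using I unfolding Inv_def g_def by (subst bij_betw_cong[of _ _ "a' 3"]) auto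
        then have "bij_betw g ({..<?c} \<union> {?c}) ((K \<inter> {..<j}) \<union> {g ?c})"
          by (intro notIn_Un_bij_betw) (auto simp: g_def)
        then show ?thesis by (simp add: lessThan_Suc g_def)
      qed
      moreover have "g 0 = 0"
      proof (cases "j = 0")
        case True
        then show ?thesis by (simp add: g_def)
      next
        case False
        then have "0 \<in> K \<inter> {..<j}" using K(3) by simp
        then have "?c \<noteq> 0" using finK by auto
        then show ?thesis using I False by (simp add: Inv_def g_def)
      qed
      moreover have "j \<le> B" using j v B_simps by simp
      ultimately show ?thesis
        using True a2 I le S c by (simp add: Inv_def g_def)
    next
      case False
      then have "K \<inter> {..<Suc j} = K \<inter> {..<j}" by (auto simp: less_Suc_eq)
      moreover have "0 < j" using False K(3) by (metis neq0_conv)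
      ultimately show ?thesis using False a2 I by (simp add: Inv_def)
    qed
  qed
  then show ?thesis by (simp add: list_K_def)
qed

end

section \<open>Exhaustive search over edge sets and cuts coded by bits\<close>

lemma odd_div_add_power:
  fixes x :: nat
  assumes "i < m" shows "odd ((x + 2 ^ m) div 2 ^ i) \<longleftrightarrow> odd (x div 2 ^ i)"
proof -
  have "(2 :: nat) ^ m = 2 ^ (m - i) * 2 ^ i" using assms by (simp flip: power_add)
  then have "(x + 2 ^ m) div 2 ^ i = x div 2 ^ i + 2 ^ (m - i)" by simp
  moreover have "even ((2 :: nat) ^ (m - i))" using assms by simp
  ultimately show ?thesis by simp
qed

lemma subset_bits:
  "\<exists>x<(2 :: nat) ^ m. \<forall>i<m. bit x i \<longleftrightarrow> i \<in> A"
proof (induction m)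
  case (Suc m)
  then obtain x :: nat where x: "x < 2 ^ m" "\<forall>i<m. bit x i \<longleftrightarrow> i \<in> A" by blast
  show ?case
  proof (cases "m \<in> A")
    case True
    have "bit (x + 2 ^ m) i \<longleftrightarrow> i \<in> A" if "i < Suc m" for i
    proof (cases "i = m")
      case True
      then show ?thesis using x(1) \<open>m \<in> A\<close> by (simp add: bit_iff_odd)
    next
      case False
      then show ?thesis using x(2) that odd_div_add_power[of i m x] by (simp add: bit_iff_odd)
    qed
    then show ?thesis using x(1) by (intro exI[of _ "x + 2 ^ m"]) auto
  next
    case False
    have "\<not> bit x m" using x(1) by (simp add: bit_iff_odd)
    then show ?thesis using x False by (intro exI[of _ x]) (auto simp: less_Suc_eq)
  qed
qed (auto intro: exI[of _ 0])

text \<open>The arithmetic form of \<open>okc\<close>: weight 2 for safe elements, 1 for the others,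
  and threshold 2.\<close>

lemma two_le_sum_iff:
  fixes c :: "'c \<Rightarrow> bool"
  assumes fin: "finite P"
  shows "2 \<le> (\<Sum>p\<in>P. 1 + of_bool (c p) :: nat) \<longleftrightarrow> (\<exists>p\<in>P. c p) \<or> (\<exists>p\<in>P. \<exists>q\<in>P. p \<noteq> q)"
proof
  assume L: "2 \<le> (\<Sum>p\<in>P. 1 + of_bool (c p) :: nat)"
  show "(\<exists>p\<in>P. c p) \<or> (\<exists>p\<in>P. \<exists>q\<in>P. p \<noteq> q)"
  proof (rule ccontr)
    assume n: "\<not> ((\<exists>p\<in>P. c p) \<or> (\<exists>p\<in>P. \<exists>q\<in>P. p \<noteq> q))"
    then have "(\<Sum>p\<in>P. 1 + of_bool (c p) :: nat) = card P" by (simp add: sum.cong)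
    moreover have "card P \<le> 1" using n fin card_le_Suc0_iff_eq[of P] by auto
    ultimately show False using L by simp
  qed
next
  assume "(\<exists>p\<in>P. c p) \<or> (\<exists>p\<in>P. \<exists>q\<in>P. p \<noteq> q)"
  then show "2 \<le> (\<Sum>p\<in>P. 1 + of_bool (c p) :: nat)"
  proof
    assume "\<exists>p\<in>P. c p"
    then obtain p where p: "p \<in> P" "c p" by blast
    have "(\<Sum>p\<in>{p}. 1 + of_bool (c p) :: nat) \<le> (\<Sum>p\<in>P. 1 + of_bool (c p))"
      using p fin by (intro sum_mono2) auto
    then show ?thesis using p by simp
  next
    assume "\<exists>p\<in>P. \<exists>q\<in>P. p \<noteq> q"
    then obtain p q where pq: "{p, q} \<subseteq> P" "p \<noteq> q" by blast
    have "card {p, q} \<le> card P" using pq fin by (intro card_mono) auto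
    also have "card P = (\<Sum>p\<in>P. 1)" by simp
    also have "\<dots> \<le> (\<Sum>p\<in>P. 1 + of_bool (c p))" by (intro sum_mono) simp
    finally show ?thesis using pq(2) by simp
  qed
qed

lemma okc_image:
  assumes "inj_on f P"
  shows "okc lab (f ` P) \<longleftrightarrow> (\<exists>p\<in>P. safe lab (f p)) \<or> (\<exists>p\<in>P. \<exists>q\<in>P. p \<noteq> q)"
  using inj_on_eq_iff[OF assms] unfolding okc_def bex_simps by blast

locale FGC_kernel = FGC_bounds U B W base inp n kk F + reduction E lab n K
  for U :: "nat \<Rightarrow> nat" and B W base :: nat and inp :: "nat \<Rightarrow> nat" and n kk F :: nat
    and E :: "nat set set" and lab :: "nat \<Rightarrow> nat" and K :: "nat set" +
  fixes Kl :: "nat \<Rightarrow> nat"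
  assumes Kl_bij: "bij_betw Kl {..<card K} K" and Kl_0: "Kl 0 = 0"
begin

definition env :: "(nat \<Rightarrow> nat) \<Rightarrow> arrays \<Rightarrow> bool" where
  "env v a \<longleftrightarrow> v 0 = n \<and> v 1 = kk \<and> v 3 = n * n \<and> v 4 = card K \<and>
     (\<forall>x<n. \<forall>y<n. a 0 (x * n + y) \<noteq> 0 \<longleftrightarrow> {x, y} \<in> E) \<and> (\<forall>x<n. a 1 x = lab x) \<and>
     (\<forall>x<n. a 2 x \<noteq> 0 \<longleftrightarrow> x \<in> K) \<and> (\<forall>i<card K. a 3 i = Kl i)"

lemma env_agree:
  "env v a \<Longrightarrow> agree X Y v a v' a' \<Longrightarrow> {0, 1, 3, 4} \<inter> X = {} \<Longrightarrow> {0, 1, 2, 3} \<inter> Y = {} \<Longrightarrow> env v' a'"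
  by (auto simp: env_def agree_def)

lemma env_upd: "env v a \<Longrightarrow> r \<notin> {0, 1, 3, 4} \<Longrightarrow> env (v(r := y)) a"
  by (auto simp: env_def)

lemma Kl_n: "i < card K \<Longrightarrow> Kl i < n"
  using Kl_bij Kn by (auto simp: bij_betw_def)

context
  fixes g :: "nat \<Rightarrow> nat" and s r :: nat
  assumes inj: "inj_on g {..<s}" and gn: "\<And>i. i < s \<Longrightarrow> g i < n" and rs: "r \<le> s"
    and size: "2 ^ (s * s) + s * s + 1 \<le> F"
begin

definition chosen :: "nat \<Rightarrow> nat \<Rightarrow> nat \<Rightarrow> bool" where
  "chosen T i j \<longleftrightarrow> i < j \<and> bit T (i * s + j) \<and> {g i, g j} \<in> E"

definition pairs :: "nat \<Rightarrow> (nat \<times> nat) set" where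
  "pairs T = {(i, j). i < s \<and> j < s \<and> chosen T i j}"

definition edges :: "nat \<Rightarrow> nat set set" where
  "edges T = (\<lambda>(i, j). {g i, g j}) ` pairs T"

text \<open>The first \<open>r\<close> entries of the list \<open>g\<close> are the contracted
  vertices. The shift by \<open>r\<close> keeps them outside, so the numbers below 2 ^ (s - r)
  enumerate exactly the cuts that \<open>solR\<close> asks about.\<close>

definition verts :: "nat \<Rightarrow> nat set" where
  "verts X = {g i | i. i < s \<and> bit (X * 2 ^ r) i}"

lemma finite_pairs: "finite (pairs T)"
  by (rule finite_subset[of _ "{..<s} \<times> {..<s}"]) (auto simp: pairs_def)

lemma g_eq: "i < s \<Longrightarrow> j < s \<Longrightarrow> g i = g j \<longleftrightarrow> i = j"
  using inj by (auto simp: inj_on_def)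

lemma inj_pairs: "inj_on (\<lambda>(i, j). {g i, g j}) (pairs T)"
proof (rule inj_onI, clarify)
  fix i j i' j' assume "(i, j) \<in> pairs T" "(i', j') \<in> pairs T" and eq: "{g i, g j} = {g i', g j'}"
  then have l: "i < s" "j < s" "i' < s" "j' < s" "i < j" "i' < j'" by (auto simp: pairs_def chosen_def)
  from eq have "(g i = g i' \<and> g j = g j') \<or> (g i = g j' \<and> g j = g i')" by (simp add: doubleton_eq_iff)
  then show "i = i' \<and> j = j'" using l by (auto simp: g_eq)
qed

lemma card_edges: "card (edges T) = card (pairs T)"
  unfolding edges_def by (rule card_image[OF inj_pairs])

lemma sum_pairs:
  "(\<Sum>i<s. \<Sum>j<s. of_bool (chosen T i j) * h i j) = (\<Sum>(i, j)\<in>pairs T. h i j)" for h :: "nat \<Rightarrow> nat \<Rightarrow> nat"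
proof -
  have "(\<Sum>i<s. \<Sum>j<s. of_bool (chosen T i j) * h i j)
      = (\<Sum>(i, j)\<in>{..<s} \<times> {..<s}. of_bool (chosen T i j) * h i j)"
    by (rule sum.cartesian_product)
  also have "\<dots> = (\<Sum>(i, j)\<in>pairs T. of_bool (chosen T i j) * h i j)"
    by (rule sum.mono_neutral_right) (auto simp: pairs_def)
  also have "\<dots> = (\<Sum>(i, j)\<in>pairs T. h i j)"
    by (rule sum.cong) (auto simp: pairs_def)
  finally show ?thesis .
qed

lemma in_verts: "i < s \<Longrightarrow> g i \<in> verts X \<longleftrightarrow> bit (X * 2 ^ r) i"
  by (auto simp: verts_def g_eq)

lemma weight_iff:
  "2 \<le> (\<Sum>i<s. \<Sum>j<s. of_bool (chosen T i j) * (of_bool (bit (X * 2 ^ r) i \<noteq> bit (X * 2 ^ r) j) *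
     (1 + of_bool (lab (g i) = lab (g j)))) :: nat) \<longleftrightarrow> okc lab (cut (edges T) (verts X))"
proof -
  define cross where "cross = {(i, j) \<in> pairs T. bit (X * 2 ^ r) i \<noteq> bit (X * 2 ^ r) j}"
  let ?e = "\<lambda>(i, j). {g i, g j}"
  have cut: "cut (edges T) (verts X) = ?e ` cross"
    unfolding cut_def edges_def cross_def by (auto simp: pairs_def in_verts)
  have sub: "cross \<subseteq> pairs T" by (auto simp: cross_def)
  have fin: "finite cross" using sub finite_pairs finite_subset by blast
  have "(\<Sum>i<s. \<Sum>j<s. of_bool (chosen T i j) * (of_bool (bit (X * 2 ^ r) i \<noteq> bit (X * 2 ^ r) j) *
     (1 + of_bool (lab (g i) = lab (g j)))) :: nat)
     = (\<Sum>(i, j)\<in>pairs T. of_bool (bit (X * 2 ^ r) i \<noteq> bit (X * 2 ^ r) j) * (1 + of_bool (lab (g i) = lab (g j))))"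
    by (rule sum_pairs)
  also have "\<dots> = (\<Sum>(i, j)\<in>cross. of_bool (bit (X * 2 ^ r) i \<noteq> bit (X * 2 ^ r) j) *
      (1 + of_bool (lab (g i) = lab (g j))))"
    by (rule sum.mono_neutral_right) (auto simp: cross_def finite_pairs)
  also have "\<dots> = (\<Sum>p\<in>cross. 1 + of_bool (safe lab (?e p)))"
    by (rule sum.cong) (auto simp: cross_def)
  finally have "2 \<le> (\<Sum>i<s. \<Sum>j<s. of_bool (chosen T i j) * (of_bool (bit (X * 2 ^ r) i \<noteq> bit (X * 2 ^ r) j) *
     (1 + of_bool (lab (g i) = lab (g j)))) :: nat) \<longleftrightarrow>
     (\<exists>p\<in>cross. safe lab (?e p)) \<or> (\<exists>p\<in>cross. \<exists>q\<in>cross. p \<noteq> q)"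
    using two_le_sum_iff[OF fin, of "\<lambda>p. safe lab (?e p)"] by simp
  also have "\<dots> \<longleftrightarrow> okc lab (cut (edges T) (verts X))"
    unfolding cut by (rule okc_image[OF inj_on_subset[OF inj_pairs sub], symmetric])
  finally show ?thesis .
qed

lemma index_less: "i < s \<Longrightarrow> j < s \<Longrightarrow> i * s + j < s * s"
proof -
  assume "i < s" "j < s"
  then have "i * s + j < Suc i * s" by simp
  also have "Suc i * s \<le> s * s" using \<open>i < s\<close> by (intro mult_le_mono1) simp
  finally show ?thesis .
qed

lemma edges_surj:
  assumes "A \<subseteq> induced (g ` {..<s})"
  shows "\<exists>T<2 ^ (s * s). edges T = A"
proof -
  define I where "I = {i * s + j | i j. i < j \<and> j < s \<and> {g i, g j} \<in> A}"
  obtain T :: nat where T: "T < 2 ^ (s * s)" "\<forall>p<s * s. bit T p \<longleftrightarrow> p \<in> I"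
    using subset_bits[of "s * s" I] by blast
  have bits: "bit T (i * s + j) \<longleftrightarrow> {g i, g j} \<in> A" if l: "i < j" "j < s" for i j
  proof -
    have "i * s + j \<in> I \<longleftrightarrow> {g i, g j} \<in> A"
    proof
      assume "i * s + j \<in> I"
      then obtain i' j' where h: "i * s + j = i' * s + j'" "i' < j'" "j' < s" "{g i', g j'} \<in> A"
        by (auto simp: I_def)
      have "i = (i * s + j) div s" "j = (i * s + j) mod s" using l by simp_all
      moreover have "(i' * s + j') div s = i'" "(i' * s + j') mod s = j'" using h by simp_all
      ultimately have "i = i'" "j = j'" unfolding h(1) by simp_all
      then show "{g i, g j} \<in> A" using h by simp
    qed (use l in \<open>auto simp: I_def\<close>)
    then show ?thesis using T(2) index_less[of i j] l by simp
  qed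
  have AE: "A \<subseteq> E" using assms by (auto simp: induced_def)
  have "edges T = A"
  proof
    show "edges T \<subseteq> A" using bits by (auto simp: edges_def pairs_def chosen_def)
    show "A \<subseteq> edges T"
    proof
      fix e assume e: "e \<in> A"
      then have "card e = 2" "e \<subseteq> g ` {..<s}" "e \<in> E" using assms E2 by (auto simp: induced_def)
      then obtain x y where xy: "e = {x, y}" "x \<noteq> y" using card2E by metis
      then obtain i j where ij: "x = g i" "y = g j" "i < s" "j < s" using \<open>e \<subseteq> g ` {..<s}\<close> by auto
      have mem: "{g i, g j} \<in> edges T" if "i < j" "i < s" "j < s" "{g i, g j} \<in> A" for i j
      proof -
        have "(i, j) \<in> pairs T" using that bits[of i j] AE by (auto simp: pairs_def chosen_def)
        then show ?thesis unfolding edges_def by (intro image_eqI[of _ _ "(i, j)"]) auto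
      qed
      have "i \<noteq> j" using xy ij by auto
      then consider "i < j" | "j < i" by linarith
      then show "e \<in> edges T"
      proof cases
        case 1
        then show ?thesis using mem[of i j] ij xy e by simp
      next
        case 2
        then show ?thesis using mem[of j i] ij xy e by (simp add: insert_commute)
      qed
    qed
  qed
  then show ?thesis using T(1) by blast
qed

lemma edges_induced: "edges T \<subseteq> induced (g ` {..<s})"
  by (auto simp: edges_def pairs_def chosen_def induced_def)

lemma bit_shift: "bit (X * 2 ^ r) i \<longleftrightarrow> r \<le> i \<and> bit X (i - r)" for X :: nat
  using bit_push_bit_iff_nat[of r X i] by (simp add: push_bit_eq_mult)

lemma verts_sub: "verts X \<subseteq> g ` {..<s} - g ` {..<r}"
proof
  fix x assume "x \<in> verts X"
  then obtain i where i: "x = g i" "i < s" "r \<le> i" by (auto simp: verts_def bit_shift)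
  then have "g i \<noteq> g j" if "j < r" for j using that rs g_eq[of i j] by simp
  then show "x \<in> g ` {..<s} - g ` {..<r}" using i by auto
qed

lemma verts_surj:
  assumes "Y \<subseteq> g ` {..<s} - g ` {..<r}"
  shows "\<exists>X<2 ^ (s - r). verts X = Y"
proof -
  obtain X :: nat where X: "X < 2 ^ (s - r)" "\<forall>i<s - r. bit X i \<longleftrightarrow> i \<in> {i. g (i + r) \<in> Y}"
    using subset_bits[of "s - r" "{i. g (i + r) \<in> Y}"] by blast
  have "verts X = Y"
  proof
    show "verts X \<subseteq> Y"
    proof
      fix x assume "x \<in> verts X"
      then obtain i where i: "x = g i" "i < s" "r \<le> i" "bit X (i - r)" by (auto simp: verts_def bit_shift)
      then have "g (i - r + r) \<in> Y" using X(2) by simp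
      then show "x \<in> Y" using i by simp
    qed
    show "Y \<subseteq> verts X"
    proof
      fix x assume x: "x \<in> Y"
      then obtain i where i: "x = g i" "i < s" using assms by auto
      have "r \<le> i"
      proof (rule ccontr)
        assume "\<not> r \<le> i"
        then have "x \<in> g ` {..<r}" using i by simp
        then show False using assms x by blast
      qed
      moreover have "bit X (i - r)" using X(2) i x calculation by simp
      ultimately show "x \<in> verts X" using i by (auto simp: verts_def bit_shift)
    qed
  qed
  then show ?thesis using X(1) by blast
qed

lemma verts_nonempty:
  assumes "0 < X" "X < 2 ^ (s - r)" shows "verts X \<noteq> {}"
proof -
  obtain i where i: "bit X i" using assms(1) bit_eq_iff[of X 0] by auto
  have "i < s - r"
  proof (rule ccontr)
    assume "\<not> i < s - r"
    then have "(2 :: nat) ^ (s - r) \<le> 2 ^ i" by (intro power_increasing) auto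
    then have "X < 2 ^ i" using assms(2) by linarith
    then show False using i by (simp add: bit_iff_odd)
  qed
  then have "g (i + r) \<in> verts X" using i by (subst in_verts) (auto simp: bit_shift)
  then show ?thesis by blast
qed

lemma verts_0: "verts 0 = {}"
  by (simp add: verts_def)

definition feasible :: "nat \<Rightarrow> bool" where
  "feasible T \<longleftrightarrow> (\<forall>X<2 ^ (s - r). 0 < X \<longrightarrow> okc lab (cut (edges T) (verts X)))"

lemma feasible_iff: "feasible T \<longleftrightarrow> solR (g ` {..<s}) (g ` {..<r}) (edges T)"
proof
  assume f: "feasible T"
  have "okc lab (cut (edges T) Y)" if Y: "Y \<subseteq> g ` {..<s} - g ` {..<r}" "Y \<noteq> {}" for Y
  proof -
    obtain X where X: "X < 2 ^ (s - r)" "verts X = Y" using verts_surj[OF Y(1)] by blast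
    then have "0 < X" using Y(2) verts_0 by (metis gr0I)
    then show ?thesis using f X unfolding feasible_def by blast
  qed
  then show "solR (g ` {..<s}) (g ` {..<r}) (edges T)" using edges_induced by (auto simp: solR_def)
next
  assume "solR (g ` {..<s}) (g ` {..<r}) (edges T)"
  then show "feasible T" using verts_sub verts_nonempty by (auto simp: solR_def feasible_def)
qed

lemma optR_min:
  assumes le: "b \<le> kk + 1" and lower: "\<And>T. T < 2 ^ (s * s) \<Longrightarrow> feasible T \<Longrightarrow> b \<le> card (pairs T)"
    and attained: "b = kk + 1 \<or> (\<exists>T. feasible T \<and> card (pairs T) = b)"
  shows "enat b = min (optR (g ` {..<s}) (g ` {..<r})) (enat (kk + 1))"
proof (rule antisym)
  have "enat b \<le> enat (card A)" if A: "solR (g ` {..<s}) (g ` {..<r}) A" for A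
  proof -
    obtain T where T: "T < 2 ^ (s * s)" "edges T = A"
      using edges_surj[of A] A by (auto simp: solR_def)
    then have "b \<le> card (pairs T)" using lower A feasible_iff by blast
    then show ?thesis using T(2) card_edges[of T] by simp
  qed
  then show "enat b \<le> min (optR (g ` {..<s}) (g ` {..<r})) (enat (kk + 1))"
    using le unfolding optR_def by (auto intro: INF_greatest)
  show "min (optR (g ` {..<s}) (g ` {..<r})) (enat (kk + 1)) \<le> enat b"
    using attained
  proof
    assume "\<exists>T. feasible T \<and> card (pairs T) = b"
    then have "optR (g ` {..<s}) (g ` {..<r}) \<le> enat b"
      unfolding optR_le_iff using feasible_iff card_edges by (metis order_refl)
    then show ?thesis by (rule min.coboundedI1)
  qed simp
qed

lemma eval_bit:
  assumes "a 10 (eval i v a) = 2 ^ eval i v a"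
  shows "eval (bit_exp e i) v a = of_bool (bit (eval e v a) (eval i v a))"
  using assms by (simp add: bit_exp_def minus_div_mult_eq_mod bit_iff_odd mod_2_eq_odd)

lemma eval_chosen:
  assumes v: "v 0 = n" "v 6 = s" "v 51 = i" "v 52 = j" "v 25 = T" "i < s" "j < s"
    and adj: "\<forall>x<n. \<forall>y<n. a 0 (x * n + y) \<noteq> 0 \<longleftrightarrow> {x, y} \<in> E"
    and a: "\<forall>i<s. a 9 i = g i" "\<forall>p\<le>s * s. a 10 p = 2 ^ p"
  shows "eval chosen_exp v a = of_bool (chosen T i j)"
proof -
  have "i * s + j \<le> s * s" using index_less[of i j] v by simp
  then have b: "eval (bit_exp (Vr 25) (Vr 51 \<otimes> Vr 6 \<oplus> Vr 52)) v a = of_bool (bit T (i * s + j))"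
    using v a by (subst eval_bit) auto
  have "(0 < a 0 (g i * n + g j)) \<longleftrightarrow> {g i, g j} \<in> E" using adj gn v by simp
  then show ?thesis using v a b by (simp add: chosen_exp_def chosen_def)
qed

lemma eval_weight:
  assumes v: "v 0 = n" "v 6 = s" "v 27 = r" "v 25 = T" "v 50 = X"
    and adj: "\<forall>x<n. \<forall>y<n. a 0 (x * n + y) \<noteq> 0 \<longleftrightarrow> {x, y} \<in> E" "\<forall>x<n. a 1 x = lab x"
    and a: "\<forall>i<s. a 9 i = g i" "\<forall>p\<le>s * s. a 10 p = 2 ^ p"
  shows "2 \<le> eval weight_exp v a \<longleftrightarrow> okc lab (cut (edges T) (verts X))"
proof -
  have ss: "i \<le> s * s" if "i \<le> s" for i
  proof -
    have "i \<le> s * s \<or> s = 0" using that by (cases s) auto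
    then show ?thesis using that by auto
  qed
  define inner where "inner = chosen_exp \<otimes>
    not_exp (EqE (bit_exp (Vr 50 \<otimes> Rd 10 (Vr 27)) (Vr 51)) (bit_exp (Vr 50 \<otimes> Rd 10 (Vr 27)) (Vr 52))) \<otimes>
    (Cn 1 \<oplus> EqE (lab_exp (Rd 9 (Vr 51))) (lab_exp (Rd 9 (Vr 52))))"
  have inner: "eval inner (v(51 := i, 52 := j)) a = of_bool (chosen T i j) *
      (of_bool (bit (X * 2 ^ r) i \<noteq> bit (X * 2 ^ r) j) * (1 + of_bool (lab (g i) = lab (g j))))"
    if l: "i < s" "j < s" for i j
  proof -
    let ?v = "v(51 := i, 52 := j)"
    have bt: "eval (bit_exp (Vr 50 \<otimes> Rd 10 (Vr 27)) (Vr q)) ?v a = of_bool (bit (X * 2 ^ r) (?v q))"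
      if "?v q < s" for q
      using that v a ss[of r] rs ss[of "?v q"] by (subst eval_bit) auto
    have c: "eval chosen_exp ?v a = of_bool (chosen T i j)"
      using v l adj a by (intro eval_chosen) auto
    show ?thesis using bt[of 51] bt[of 52] c l a adj(2) gn by (simp add: inner_def)
  qed
  have w: "weight_exp = Sm 51 6 (Sm 52 6 inner)" by (simp add: weight_exp_def inner_def)
  have "eval weight_exp v a = (\<Sum>i<s. \<Sum>j<s. of_bool (chosen T i j) *
      (of_bool (bit (X * 2 ^ r) i \<noteq> bit (X * 2 ^ r) j) * (1 + of_bool (lab (g i) = lab (g j)))))"
    unfolding w using v(2) inner by simp
  then show ?thesis using weight_iff[of T X] by simp
qed

lemma powers_correct:
  assumes v: "v 6 = s"
  shows "wp powers (\<lambda>v' a'. \<forall>p\<le>s * s. a' 10 p = 2 ^ p) v a"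
proof -
  let ?c = "St 10 (Vr 22) (Vr 23) \<Zsemi> Asg 23 (Vr 23 \<oplus> Vr 23)"
  have "wp (Fr 22 7 ?c) (\<lambda>v' a'. \<forall>p\<le>s * s. a' 10 p = 2 ^ p) (v(23 := 1, 7 := s * s + 1)) a"
  proof (rule wp_Fr[where Inv = "\<lambda>j v' a'. v' 23 = 2 ^ j \<and> (\<forall>p<j. a' 10 p = 2 ^ p)"])
    fix j and v' :: "nat \<Rightarrow> nat" and a' :: arrays
    assume j: "j < (v(23 := 1, 7 := s * s + 1)) 7" and I: "v' 23 = 2 ^ j \<and> (\<forall>p<j. a' 10 p = 2 ^ p)"
    \<comment> \<open>The last round doubles once more than the table needs; the value 2 ^ (s * s +
      1) is why 2 * F has to fit below B.\<close>
    have "(2 :: nat) ^ Suc j \<le> 2 ^ Suc (s * s)" using j by (intro power_increasing) auto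
    also have "\<dots> \<le> B" using size B_ge(2) by simp
    finally have "2 ^ Suc j \<le> B" .
    then show "wp ?c (\<lambda>v' a'. v' 23 = 2 ^ Suc j \<and> (\<forall>p<Suc j. a' 10 p = 2 ^ p)) (v'(22 := j)) a'"
      using I by (auto simp: less_Suc_eq)
  qed (use B_simps in \<open>auto simp: less_Suc_eq_le\<close>)
  then show ?thesis using v size B_simps by (simp add: powers_def)
qed

lemma solve_correct:
  assumes e: "env v a" and v: "v 6 = s" "v 27 = r" and a: "\<forall>i<s. a 9 i = g i"
  shows "wp solve (\<lambda>v' a'. enat (v' 24) = min (optR (g ` {..<s}) (g ` {..<r})) (enat (kk + 1))) v a"
proof -
  let ?Q = "\<lambda>v' a'. enat (v' 24) = min (optR (g ` {..<s}) (g ` {..<r})) (enat (kk + 1))"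
  define test where "test = not_exp (Sm 50 9 (pos_exp (Vr 50) \<otimes> LtE weight_exp (Cn 2)))"
  define body where "body = Cd test
       (Asg 26 (Sm 51 6 (Sm 52 6 chosen_exp)) \<Zsemi> Cd (LtE (Vr 26) (Vr 24)) (Asg 24 (Vr 26)) Nop) Nop"
  define Inv where "Inv j v' a' \<longleftrightarrow> v' 24 \<le> kk + 1 \<and> (\<forall>T<j. feasible T \<longrightarrow> v' 24 \<le> card (pairs T)) \<and>
    (v' 24 = kk + 1 \<or> (\<exists>T. feasible T \<and> card (pairs T) = v' 24))" for j and v' :: "nat \<Rightarrow> nat" and a' :: arrays
  have loop: "wp (Fr 25 8 body) ?Q v0 a0"
    if v0: "env v0 a0" "v0 6 = s" "v0 27 = r" "v0 8 = 2 ^ (s * s)" "v0 9 = 2 ^ (s - r)" "v0 24 = kk + 1"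
      and a0: "\<forall>i<s. a0 9 i = g i" "\<forall>p\<le>s * s. a0 10 p = 2 ^ p" for v0 a0
  proof (rule wp_Fr[where Inv = Inv])
    show "U 8 \<le> U 25" using B_simps by simp
    show "Inv 0 v0 a0" using v0 by (simp add: Inv_def)
    show "?Q v' a'" if "Inv (v0 8) v' a'" for v' a'
      using that optR_min[of "v' 24"] v0(4) unfolding Inv_def by auto
    fix j v' a'
    assume j: "j < v0 8" and I: "Inv j v' a'"
      and ag: "agree (insert 25 (vmod body)) (amod body) v0 a0 v' a'"
    have ar: "a' = a0" using ag by (auto simp: agree_def body_def)
    have v': "v' 0 = n" "v' 6 = s" "v' 27 = r" "v' 9 = 2 ^ (s - r)" "v' 1 = kk"
      using ag v0 by (auto simp: agree_def body_def env_def)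
    have adj: "\<forall>x<n. \<forall>y<n. a0 0 (x * n + y) \<noteq> 0 \<longleftrightarrow> {x, y} \<in> E" "\<forall>x<n. a0 1 x = lab x"
      using v0(1) by (auto simp: env_def)
    let ?v = "v'(25 := j)"
    have "eval test ?v a0 \<noteq> 0 \<longleftrightarrow> feasible j"
    proof -
      have w: "2 \<le> eval weight_exp (?v(50 := X)) a0 \<longleftrightarrow> okc lab (cut (edges j) (verts X))" for X
        using v' adj a0 by (intro eval_weight) auto
      have "eval test ?v a0 \<noteq> 0 \<longleftrightarrow>
          (\<Sum>X<2 ^ (s - r). of_bool (0 < X) * of_bool (eval weight_exp (?v(50 := X)) a0 < 2)) = (0 :: nat)"
        using v' by (simp add: test_def)
      also have "\<dots> \<longleftrightarrow> (\<forall>X<2 ^ (s - r). 0 < X \<longrightarrow> \<not> eval weight_exp (?v(50 := X)) a0 < 2)"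
        by (subst sum_eq_0_iff) (simp_all add: Ball_def disj_imp)
      also have "\<dots> \<longleftrightarrow> feasible j" unfolding feasible_def not_less w ..
      finally show ?thesis .
    qed
    moreover have co: "eval (Sm 51 6 (Sm 52 6 chosen_exp)) ?v a0 = card (pairs j)"
    proof -
      have c: "eval chosen_exp (?v(51 := i, 52 := l)) a0 = of_bool (chosen j i l)" if "i < s" "l < s" for i l
        using v' adj a0 that by (intro eval_chosen) auto
      have "eval (Sm 51 6 (Sm 52 6 chosen_exp)) ?v a0 = (\<Sum>i<s. \<Sum>l<s. of_bool (chosen j i l) * 1)"
        using v' c by simp
      also have "\<dots> = card (pairs j)" unfolding sum_pairs by simp
      finally show ?thesis .
    qed
    moreover have "card (pairs j) \<le> B"
    proof -
      have "card (pairs j) \<le> card ({..<s} \<times> {..<s})" by (intro card_mono) (auto simp: pairs_def)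
      then have "card (pairs j) \<le> F" using size by (simp add: card_cartesian_product)
      then show ?thesis using B_simps by simp
    qed
    moreover have "Inv (Suc j) v2 a0"
      if v2: "v2 24 = (if feasible j \<and> card (pairs j) < v' 24 then card (pairs j) else v' 24)" for v2
    proof -
      have le: "v2 24 \<le> v' 24" "feasible j \<longrightarrow> v2 24 \<le> card (pairs j)" using v2 by auto
      have "v2 24 \<le> card (pairs T)" if "T < Suc j" "feasible T" for T
      proof (cases "T = j")
        case False
        then have "v' 24 \<le> card (pairs T)" using I that by (simp add: Inv_def)
        then show ?thesis using le(1) by linarith
      qed (use le(2) that in simp)
      moreover have "v2 24 = kk + 1 \<or> (\<exists>T. feasible T \<and> card (pairs T) = v2 24)"
        using I v2 unfolding Inv_def by auto
      ultimately show ?thesis using le(1) I by (simp add: Inv_def)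
    qed
    ultimately show "wp body (Inv (Suc j)) ?v a'"
      unfolding ar body_def by (simp del: eval.simps(7))
  qed
  have pw: "wp powers (\<lambda>v' a'. \<forall>p\<le>s * s. a' 10 p = 2 ^ p) v a" by (rule powers_correct) (rule v(1))
  show ?thesis
    unfolding solve_def wp.simps(5)
  proof (rule wp_frame[OF pw])
    fix v1 a1 assume p: "\<forall>p\<le>s * s. a1 10 p = 2 ^ p" and ag: "agree (vmod powers) (amod powers) v a v1 a1"
    have mods: "vmod powers = {23, 7, 22}" "amod powers = {10}" by (auto simp: powers_def)
    have e1: "env v1 a1" using env_agree[OF e ag] by (auto simp: mods)
    have v1: "v1 6 = s" "v1 27 = r" "v1 1 = kk" "\<forall>i<s. a1 9 i = g i"
      using ag v a e by (auto simp: agree_def mods env_def)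
    have ss: "i \<le> s * s" if "i \<le> s" for i
    proof -
      have "i \<le> s * s \<or> s = 0" using that by (cases s) auto
      then show ?thesis using that by auto
    qed
    have d: "(2 :: nat) ^ s div 2 ^ r = 2 ^ (s - r)" using rs by (simp add: power_diff)
    have F1: "(2 :: nat) ^ (s * s) \<le> F" using size by simp
    have "(2 :: nat) ^ (s - r) \<le> 2 ^ (s * s)" using ss[of "s - r"] by (intro power_increasing) auto
    then have F2: "(2 :: nat) ^ (s - r) \<le> F" by (rule le_trans[OF _ F1])
    have "wp (Fr 25 8 body) ?Q (v1(8 := 2 ^ (s * s), 9 := 2 ^ (s - r), 24 := kk + 1)) a1"
      by (rule loop) (use e1 v1 p in \<open>auto simp: env_def\<close>)
    then show "wp (Asg 8 (Rd 10 (Vr 6 \<otimes> Vr 6))) (wp (Asg 9 (Rd 10 (Vr 6) \<oslash> Rd 10 (Vr 27)))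
      (wp (Asg 24 (Vr 1 \<oplus> Cn 1)) (wp (Fr 25 8 (Cd (not_exp (Sm 50 9 (pos_exp (Vr 50) \<otimes> LtE weight_exp (Cn 2))))
       (Asg 26 (Sm 51 6 (Sm 52 6 chosen_exp)) \<Zsemi> Cd (LtE (Vr 26) (Vr 24)) (Asg 24 (Vr 26)) Nop)
       Nop)) ?Q))) v1 a1"
      unfolding body_def test_def
      using v1 p ss[of s] ss[of r] rs d F1 F2 B_simps by (simp del: wp.simps(7))
  qed
qed

end

end

text \<open>This is the bound of \<open>card_clique_le\<close> for |K| = k.
  \<open>kept_bound\<close> is that of \<open>card_similarity_classes\<close> with threshold 2 * 2 ^
  k, and \<open>kernel_bound\<close> adds K to the kept cliques.\<close>

definition clique_bound :: "nat \<Rightarrow> nat" where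
  "clique_bound k = (4 * k + 5) * ((2 ^ k * k) + (4 * k + 5) * 2 ^ k)"

definition kept_bound :: "nat \<Rightarrow> nat" where
  "kept_bound k = 2 * 2 ^ k * ((clique_bound k + 1) *
     (2 ^ (clique_bound k * k) * (2 ^ (clique_bound k * k) * 2 ^ (clique_bound k * clique_bound k))))"

definition kernel_bound :: "nat \<Rightarrow> nat" where
  "kernel_bound k = k + kept_bound k * clique_bound k"

text \<open>Large enough for every loop of \<open>solve\<close> on at most
  \<open>kernel_bound k\<close> vertices: all edge sets, all cuts, and the table of s * s + 1
  powers.\<close>

definition exhaustive_bound :: "nat \<Rightarrow> nat" where
  "exhaustive_bound k = 2 ^ (kernel_bound k * kernel_bound k) + kernel_bound k * kernel_bound k + 1"

lemma kept_bound_ge: "2 * 2 ^ k \<le> kept_bound k"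
proof -
  have "2 * 2 ^ k * (1 * (1 * (1 * 1))) \<le> kept_bound k"
    unfolding kept_bound_def by (intro mult_le_mono order_refl) simp_all
  then show ?thesis by simp
qed

lemma clique_bound_ge: "4 * k + 5 \<le> clique_bound k"
proof -
  have "1 * 1 \<le> (4 * k + 5) * 2 ^ k" by (intro mult_le_mono) simp_all
  then have "1 \<le> 2 ^ k * k + (4 * k + 5) * 2 ^ k" by linarith
  then have "(4 * k + 5) * 1 \<le> clique_bound k"
    unfolding clique_bound_def by (rule mult_le_mono2)
  then show ?thesis by simp
qed

lemma kernel_bound_ge: "k + clique_bound k \<le> kernel_bound k" "kept_bound k \<le> kernel_bound k"
proof -
  have k1: "1 \<le> kept_bound k" by (rule le_trans[OF _ kept_bound_ge]) simp
  have c1: "1 \<le> clique_bound k" by (rule le_trans[OF _ clique_bound_ge]) simp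
  have "1 * clique_bound k \<le> kept_bound k * clique_bound k" using k1 by (intro mult_le_mono1)
  then show "k + clique_bound k \<le> kernel_bound k" unfolding kernel_bound_def by linarith
  have "kept_bound k * 1 \<le> kept_bound k * clique_bound k" using c1 by (intro mult_le_mono2)
  then show "kept_bound k \<le> kernel_bound k" unfolding kernel_bound_def by linarith
qed

lemma exhaustive_bound_mono:
  assumes "s \<le> kernel_bound k" shows "2 ^ (s * s) + s * s + 1 \<le> exhaustive_bound k"
proof -
  have "s * s \<le> kernel_bound k * kernel_bound k" using assms by (rule mult_le_mono[OF _ assms])
  moreover from this have "(2 :: nat) ^ (s * s) \<le> 2 ^ (kernel_bound k * kernel_bound k)"
    by (intro power_increasing) simp_all
  ultimately show ?thesis unfolding exhaustive_bound_def by linarith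
qed

lemma kernel_bound_le: "kernel_bound k \<le> exhaustive_bound k"
proof -
  have "kernel_bound k \<le> kernel_bound k * kernel_bound k" by (cases "kernel_bound k") auto
  then show ?thesis unfolding exhaustive_bound_def by linarith
qed

section \<open>Correctness of the pass that prunes the cliques\<close>

locale FGC_instance = FGC_kernel U B W base inp n kk F E lab K Kl
  for U :: "nat \<Rightarrow> nat" and B W base :: nat and inp :: "nat \<Rightarrow> nat" and n kk F :: nat
    and E :: "nat set set" and lab :: "nat \<Rightarrow> nat" and K :: "nat set" and Kl :: "nat \<Rightarrow> nat" +
  assumes F_ge: "exhaustive_bound (card K) \<le> F"
begin

lemma kernel_bound_le_B: "kernel_bound (card K) \<le> B"
  using kernel_bound_le[of "card K"] F_ge B_simps(3) by linarith

lemma Kl_all: "(\<forall>i<card K. P (Kl i)) \<longleftrightarrow> (\<forall>x\<in>K. P x)"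
  using Kl_bij unfolding bij_betw_def by (metis (no_types, lifting) imageE image_eqI lessThan_iff)

lemma edge_K: "{u, x} \<in> E \<longleftrightarrow> a 0 (u * n + x) \<noteq> 0" if "env v a" "u < n" "x < n"
  using that by (auto simp: env_def)

lemma eval_same_nbK:
  assumes e: "env v a" and v: "v 50 = x" "v 12 = y" "x < n" "y < n"
  shows "eval (same_nbK_exp (Vr 50) (Vr 12)) v a = of_bool (nbK x = nbK y)"
proof -
  have ed: "a 0 (u * n + Kl i) = 0 \<longleftrightarrow> {u, Kl i} \<notin> E" if "u < n" "i < card K" for u i
    using edge_K[OF e that(1) Kl_n[OF that(2)]] by simp
  have "eval (same_nbK_exp (Vr 50) (Vr 12)) v a =
      of_bool ((\<Sum>i<card K. of_bool ((a 0 (x * n + a 3 i) = 0) \<noteq> (a 0 (y * n + a 3 i) = 0)) :: nat) = 0)"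
    using e v by (simp add: same_nbK_exp_def env_def del: sum_of_bool_eq)
      (rule impI, elim bexE, rule bexI[rotated], assumption, auto)
  also have "(\<Sum>i<card K. of_bool ((a 0 (x * n + a 3 i) = 0) \<noteq> (a 0 (y * n + a 3 i) = 0)) :: nat) =
      (\<Sum>i<card K. of_bool (({x, Kl i} \<in> E) \<noteq> ({y, Kl i} \<in> E)))"
    using e v ed by (intro sum.cong) (auto simp: env_def)
  also have "\<dots> = 0 \<longleftrightarrow> (\<forall>i<card K. {x, Kl i} \<in> E \<longleftrightarrow> {y, Kl i} \<in> E)"
    by (subst sum_eq_0_iff) auto
  also have "\<dots> \<longleftrightarrow> (\<forall>z\<in>K. {x, z} \<in> E \<longleftrightarrow> {y, z} \<in> E)" by (rule Kl_all)
  also have "\<dots> \<longleftrightarrow> nbK x = nbK y" by (auto simp: nbK_def)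
  finally show ?thesis .
qed

lemma eval_priv:
  assumes e: "env v a" and v: "v q < n" "q \<noteq> 53"
  shows "eval (priv_exp (Vr q)) v a = of_bool (priv (v q))"
proof -
  have "eval (priv_exp (Vr q)) v a = of_bool ((\<Sum>i<card K. of_bool (lab (v q) = lab (Kl i)) :: nat) = 0)"
    using e v Kl_n by (simp add: priv_exp_def env_def)
  also have "(\<Sum>i<card K. of_bool (lab (v q) = lab (Kl i)) :: nat) = 0 \<longleftrightarrow>
      (\<forall>i<card K. lab (v q) \<noteq> lab (Kl i))"
    by (subst sum_eq_0_iff) auto
  also have "\<dots> \<longleftrightarrow> (\<forall>x\<in>K. lab (v q) \<noteq> lab x)" by (rule Kl_all)
  finally show ?thesis by (simp add: priv_def)
qed

lemma eval_before:
  assumes e: "env v a" and v: "v 50 = x" "v 12 = y" "x < n" "y < n" and Q: "a 4 x = of_bool (x \<in> Q)"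
  shows "eval (before_exp 4) v a = of_bool (x \<in> Q \<and> x < y \<and> {x, y} \<in> E)"
  using edge_K[OF e v(3,4)] e v Q by (simp add: before_exp_def env_def)

lemma sum_card:
  assumes "\<And>x. x < n \<Longrightarrow> h x = of_bool (P x)" "\<And>x. P x \<Longrightarrow> x < n"
  shows "(\<Sum>x<n. h x) = card {x. P x}"
proof -
  have "(\<Sum>x<n. h x) = (\<Sum>x<n. of_bool (P x))" using assms by (intro sum.cong) auto
  also have "\<dots> = card ({..<n} \<inter> {x. P x})" by (simp add: sum_of_bool_eq)
  also have "{..<n} \<inter> {x. P x} = {x. P x}" using assms(2) by auto
  finally show ?thesis .
qed

lemma eval_twins:
  assumes e: "env v a" and v: "v 12 = y" "y < n" and Q: "\<forall>x. a 4 x = of_bool (x \<in> Q)" "Q \<subseteq> {..<n}"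
  shows "eval twins_exp v a = card (twins Q y)"
proof -
  have "(\<Sum>x<n. eval (before_exp 4 \<otimes> EqE (lab_exp (Vr 50)) (lab_exp (Vr 12)) \<otimes>
      same_nbK_exp (Vr 50) (Vr 12)) (v(50 := x)) a) =
      card {x. x \<in> Q \<and> x < y \<and> {x, y} \<in> E \<and> lab x = lab y \<and> nbK x = nbK y}"
  proof (rule sum_card)
    fix x assume x: "x < n"
    have e': "env (v(50 := x)) a" using e by (rule env_upd) simp
    have "a 1 x = lab x" "a 1 y = lab y" using e v x by (auto simp: env_def)
    then show "eval (before_exp 4 \<otimes> EqE (lab_exp (Vr 50)) (lab_exp (Vr 12)) \<otimes>
      same_nbK_exp (Vr 50) (Vr 12)) (v(50 := x)) a =
      of_bool (x \<in> Q \<and> x < y \<and> {x, y} \<in> E \<and> lab x = lab y \<and> nbK x = nbK y)"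
      using eval_before[OF e', of x y Q] eval_same_nbK[OF e', of x y] v x Q by simp
  qed (use Q in auto)
  moreover have "v 0 = n" using e by (simp add: env_def)
  ultimately show ?thesis by (simp add: twins_exp_def twins_def del: eval.simps(4))
qed

lemma eval_pfirsts:
  assumes e: "env v a" and v: "v 12 = y" "y < n" and Q: "\<forall>x. a 4 x = of_bool (x \<in> Q)" "Q \<subseteq> {..<n}"
    "\<forall>x\<in>Q. a 5 x = of_bool (twins Q x = {})"
  shows "eval pfirsts_exp v a = of_bool (priv y) * card (pfirsts Q y)"
proof -
  let ?i = "before_exp 4 \<otimes> Rd 5 (Vr 50) \<otimes> priv_exp (Vr 50) \<otimes>
     not_exp (EqE (lab_exp (Vr 50)) (lab_exp (Vr 12))) \<otimes> same_nbK_exp (Vr 50) (Vr 12)"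
  have "(\<Sum>x<n. eval ?i (v(50 := x)) a) =
      card {x. x \<in> Q \<and> x < y \<and> {x, y} \<in> E \<and> twins Q x = {} \<and> priv x \<and> lab x \<noteq> lab y \<and> nbK x = nbK y}"
  proof (rule sum_card)
    fix x assume x: "x < n"
    have e': "env (v(50 := x)) a" using e by (rule env_upd) simp
    have l: "a 1 x = lab x" "a 1 y = lab y" using e v x by (auto simp: env_def)
    have p: "eval (priv_exp (Vr 50)) (v(50 := x)) a = of_bool (priv x)"
      using eval_priv[OF e', of 50] x by simp
    show "eval ?i (v(50 := x)) a =
      of_bool (x \<in> Q \<and> x < y \<and> {x, y} \<in> E \<and> twins Q x = {} \<and> priv x \<and> lab x \<noteq> lab y \<and> nbK x = nbK y)"
      using eval_before[OF e', of x y Q] eval_same_nbK[OF e', of x y] v x Q l p by simp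
  qed (use Q in auto)
  moreover have "v 0 = n" using e by (simp add: env_def)
  moreover have "eval (priv_exp (Vr 12)) v a = of_bool (priv y)" using eval_priv[OF e, of 12] v by simp
  moreover have "eval pfirsts_exp v a = eval (priv_exp (Vr 12)) v a * (\<Sum>x<v 0. eval ?i (v(50 := x)) a)"
    by (simp add: pfirsts_exp_def)
  ultimately show ?thesis by (simp add: pfirsts_def)
qed

lemma twins_insert: "v \<le> j \<Longrightarrow> twins (insert j Q) v = twins Q v"
  by (auto simp: twins_def)

lemma pfirsts_insert: "v \<le> j \<Longrightarrow> pfirsts (insert j Q) v = pfirsts Q v"
  using twins_insert[of _ j Q] by (auto simp: pfirsts_def)

text \<open>The current instance consists of K, the kept vertices and everything not yet visited.
  Each dropped vertex costs exactly one edge, so the optimum itself is tracked here.\<close>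

definition prune_inv :: "nat \<Rightarrow> (nat \<Rightarrow> nat) \<Rightarrow> arrays \<Rightarrow> bool" where
  "prune_inv j v a \<longleftrightarrow> (\<exists>Q. Q \<subseteq> {..<j} \<and> good Q \<and> (\<forall>u. a 4 u = of_bool (u \<in> Q)) \<and>
     (\<forall>u\<in>Q. a 5 u = of_bool (twins Q u = {})) \<and> v 17 \<le> j \<and>
     opt {..<n} = enat (v 17) + opt (K \<union> Q \<union> ({j..<n} - K)))"

definition pruned :: "nat set \<Rightarrow> (nat \<Rightarrow> nat) \<Rightarrow> arrays \<Rightarrow> bool" where
  "pruned Q v a \<longleftrightarrow> good Q \<and> (\<forall>u. a 4 u = of_bool (u \<in> Q)) \<and> v 17 \<le> n \<and>
     opt {..<n} = enat (v 17) + opt (K \<union> Q)"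

lemma prune_inv_skip:
  assumes I: "prune_inv j v a" and j: "j \<in> K"
  shows "prune_inv (Suc j) v a"
proof -
  have "{Suc j..<n} - K = {j..<n} - K"
    using j by (auto simp: Suc_le_eq order.strict_iff_order)
  moreover obtain Q where "Q \<subseteq> {..<j}" "good Q" "\<forall>u. a 4 u = of_bool (u \<in> Q)"
    "\<forall>u\<in>Q. a 5 u = of_bool (twins Q u = {})" "v 17 \<le> j"
    "opt {..<n} = enat (v 17) + opt (K \<union> Q \<union> ({j..<n} - K))"
    using I unfolding prune_inv_def by blast
  ultimately show ?thesis
    unfolding prune_inv_def by (intro exI[of _ Q]) (simp, fastforce)
qed

lemma interval_split: "j < n \<Longrightarrow> j \<notin> K \<Longrightarrow> {j..<n} - K = insert j ({Suc j..<n} - K)"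
  by (auto simp: Suc_le_eq order.strict_iff_order)

lemma prune_inv_keep:
  fixes v v' :: "nat \<Rightarrow> nat"
  assumes Q: "Q \<subseteq> {..<j}" "good Q" "\<forall>u. a 4 u = of_bool (u \<in> Q)"
      "\<forall>u\<in>Q. a 5 u = of_bool (twins Q u = {})" "v 17 \<le> j"
      "opt {..<n} = enat (v 17) + opt (K \<union> Q \<union> ({j..<n} - K))"
    and j: "j < n" "j \<notin> K" and few: "card (twins Q j) < thr" "priv j \<longrightarrow> card (pfirsts Q j) < thr"
    and v': "v' 17 = v 17" and a': "a' 4 = (a 4)(j := 1)" "a' 5 = (a 5)(j := of_bool (twins Q j = {}))"
  shows "prune_inv (Suc j) v' a'"
proof -
  have le: "u \<le> j" if "u \<in> insert j Q" for u using that Q(1) by auto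
  have "good (insert j Q)"
    unfolding good_def
  proof (intro conjI ballI)
    show "insert j Q \<subseteq> {..<n} - K" using Q(2) j by (auto simp: good_def)
    fix u assume u: "u \<in> insert j Q"
    show "card (twins (insert j Q) u) < thr"
      using u few Q(2) by (auto simp: twins_insert[OF le[OF u]] good_def)
    show "priv u \<longrightarrow> card (pfirsts (insert j Q) u) < thr"
      using u few Q(2) by (auto simp: pfirsts_insert[OF le[OF u]] good_def)
  qed
  moreover have "\<forall>u. a' 4 u = of_bool (u \<in> insert j Q)" using Q(3) a' by simp
  moreover have "\<forall>u\<in>insert j Q. a' 5 u = of_bool (twins (insert j Q) u = {})"
  proof
    fix u assume u: "u \<in> insert j Q"
    show "a' 5 u = of_bool (twins (insert j Q) u = {})"
      using u Q(4) a' by (auto simp: twins_insert[OF le[OF u]])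
  qed
  moreover have "insert j Q \<subseteq> {..<Suc j}" using Q(1) by auto
  moreover have "K \<union> insert j Q \<union> ({Suc j..<n} - K) = K \<union> Q \<union> ({j..<n} - K)"
    unfolding interval_split[OF j] by auto
  ultimately show ?thesis using Q(5,6) v' unfolding prune_inv_def by (intro exI[of _ "insert j Q"]) simp
qed

lemma prune_inv_drop:
  fixes v v' :: "nat \<Rightarrow> nat"
  assumes Q: "Q \<subseteq> {..<j}" "good Q" "\<forall>u. a 4 u = of_bool (u \<in> Q)"
      "\<forall>u\<in>Q. a 5 u = of_bool (twins Q u = {})" "v 17 \<le> j"
      "opt {..<n} = enat (v 17) + opt (K \<union> Q \<union> ({j..<n} - K))"
    and j: "j < n" "j \<notin> K" and many: "thr \<le> card (twins Q j) \<or> priv j \<and> thr \<le> card (pfirsts Q j)"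
    and v': "v' 17 = v 17 + 1"
  shows "prune_inv (Suc j) v' a"
proof -
  let ?V = "K \<union> Q \<union> ({j..<n} - K)"
  have V: "?V \<subseteq> {..<n}" "K \<subseteq> ?V" "j \<in> ?V - K" "Q \<subseteq> ?V - K" using Kn Q(2) j by (auto simp: good_def)
  have "opt ?V = opt (?V - {j}) + enat 1"
    using many opt_delete_twin[OF V] opt_delete_private[OF V(1-3) _ V(4)] by blast
  moreover have "?V - {j} = K \<union> Q \<union> ({Suc j..<n} - K)"
    using j Q(1) unfolding interval_split[OF j] by auto
  ultimately have "opt {..<n} = enat (v' 17) + opt (K \<union> Q \<union> ({Suc j..<n} - K))"
    using Q(6) v' by (simp add: add.commute[of "opt _"] flip: add.assoc)
  then show ?thesis using Q(1-5) v' unfolding prune_inv_def by (intro exI[of _ Q]) auto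
qed

lemma prune_correct:
  assumes e: "env v a" and a: "\<forall>u. a 4 u = 0"
  shows "wp prune (\<lambda>v' a'. \<exists>Q. pruned Q v' a') v a"
proof -
  define body where "body = Cd (Rd 2 (Vr 12)) Nop
       (Asg 20 twins_exp \<Zsemi> Asg 28 pfirsts_exp \<Zsemi>
        Cd (LtE (Vr 20) (Vr 18) \<otimes> LtE (Vr 28) (Vr 18))
          (St 4 (Vr 12) (Cn 1) \<Zsemi> St 5 (Vr 12) (not_exp (Vr 20)))
          (Asg 17 (Vr 17 \<oplus> Cn 1)))"
  define v0 where "v0 = v(18 := thr, 17 := 0)"
  have e0: "env v0 a" using e by (simp add: v0_def env_def)
  have mods: "vmod body = {20, 28, 17}" "amod body = {4, 5}" by (auto simp: body_def)
  have "wp (Fr 12 0 body) (\<lambda>v' a'. \<exists>Q. pruned Q v' a') v0 a"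
  proof (rule wp_Fr[where Inv = prune_inv])
    show "U 0 \<le> U 12" using B_simps by simp
    have "K \<union> ({0..<n} - K) = {..<n}" using Kn by auto
    then show "prune_inv 0 v0 a"
      unfolding prune_inv_def using a by (intro exI[of _ "{}"]) (auto simp: v0_def good_def enat_0)
    show "\<exists>Q. pruned Q v' a'" if "prune_inv (v0 0) v' a'" for v' a'
      using that e0 unfolding prune_inv_def pruned_def by (auto simp: env_def)
    fix j v' a'
    assume j: "j < v0 0" and I: "prune_inv j v' a'"
      and ag: "agree (insert 12 (vmod body)) (amod body) v0 a v' a'"
    have jn: "j < n" using j e0 by (simp add: env_def)
    have e': "env (v'(12 := j)) a'" using env_upd[OF env_agree[OF e0 ag]] by (simp add: mods)
    have v18: "v' 18 = thr" using ag by (auto simp: agree_def mods v0_def)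
    have K2: "a' 2 j \<noteq> 0 \<longleftrightarrow> j \<in> K" using e' jn by (simp add: env_def)
    show "wp body (prune_inv (Suc j)) (v'(12 := j)) a'"
    proof (cases "j \<in> K")
      case True
      have "prune_inv (Suc j) (v'(12 := j)) a'"
        using prune_inv_skip[OF I True] by (simp add: prune_inv_def)
      then show ?thesis using K2 True by (simp add: body_def)
    next
      case False
      obtain Q where Q: "Q \<subseteq> {..<j}" "good Q" "\<forall>u. a' 4 u = of_bool (u \<in> Q)"
        "\<forall>u\<in>Q. a' 5 u = of_bool (twins Q u = {})" "v' 17 \<le> j"
        "opt {..<n} = enat (v' 17) + opt (K \<union> Q \<union> ({j..<n} - K))"
        using I unfolding prune_inv_def by blast
      have Qn: "Q \<subseteq> {..<n}" using Q(2) by (auto simp: good_def)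
      define t where "t = card (twins Q j)"
      define p where "p = of_bool (priv j) * card (pfirsts Q j)"
      let ?v1 = "v'(12 := j, 20 := t)"
      have t: "eval twins_exp (v'(12 := j)) a' = t"
        unfolding t_def by (rule eval_twins[OF e' _ jn Q(3) Qn]) simp
      have e1: "env ?v1 a'" using env_upd[OF e'] by simp
      have p: "eval pfirsts_exp ?v1 a' = p"
        unfolding p_def by (rule eval_pfirsts[OF e1 _ jn Q(3) Qn Q(4)]) simp
      have fin: "finite Q" using Qn finite_subset by blast
      have "card (twins Q j) \<le> card {..<n}" "card (pfirsts Q j) \<le> card {..<n}"
        using Qn by (intro card_mono; auto simp: twins_def pfirsts_def)+
      then have tn: "t \<le> B" "p \<le> B" using B_simps by (auto simp: t_def p_def)
      have v17: "v' 17 + 1 \<le> B" using Q(5) jn B_simps by linarith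
      have t0: "t = 0 \<longleftrightarrow> twins Q j = {}"
        using fin by (simp add: t_def twins_def card_eq_0_iff)
      let ?v2 = "v'(12 := j, 20 := t, 28 := p)"
      show ?thesis
      proof (cases "t < thr \<and> p < thr")
        case True
        have few: "card (twins Q j) < thr" "priv j \<longrightarrow> card (pfirsts Q j) < thr"
          using True by (auto simp: t_def p_def)
        have "prune_inv (Suc j) ?v2 (a'(4 := (a' 4)(j := 1), 5 := (a' 5)(j := of_bool (t = 0))))"
          by (rule prune_inv_keep[where v = v' and a = a', OF Q jn False few]) (simp_all add: t0)
        then show ?thesis
          using True K2 False t p tn v18 B_simps by (simp add: body_def)
      next
        case many: False
        have "0 < thr" by (simp add: thr_def)
        then have many': "thr \<le> card (twins Q j) \<or> priv j \<and> thr \<le> card (pfirsts Q j)"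
          using many by (cases "priv j") (auto simp: t_def p_def)
        have "prune_inv (Suc j) (?v2(17 := v' 17 + 1)) a'"
          by (rule prune_inv_drop[where v = v' and a = a', OF Q jn False many']) simp
        then show ?thesis
          using many K2 False t p tn v17 v18 B_simps by (simp add: body_def)
      qed
    qed
  qed
  moreover have "thr \<le> B"
    using clique_bound_ge[of "card K"] kernel_bound_ge[of "card K"] kernel_bound_le_B
    unfolding thr_def by linarith
  moreover have "v 4 = card K" using e by (simp add: env_def)
  ultimately show ?thesis unfolding prune_def body_def v0_def by (simp add: thr_def)
qed

end

section \<open>Gathering, comparing and listing cliques\<close>

context FGC_instance
begin

lemma card_K: "1 \<le> card K" "card K \<le> kernel_bound (card K)"
proof -
  have "card K \<noteq> 0" using K0 finK by auto
  then show "1 \<le> card K" by simp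
  show "card K \<le> kernel_bound (card K)" using kernel_bound_ge(1)[of "card K"] by linarith
qed

lemma kernel_bound_le_F: "s \<le> kernel_bound (card K) \<Longrightarrow> s \<le> F"
  using kernel_bound_le[of "card K"] F_ge by linarith

lemma eval_leader:
  assumes e: "env v a" and v: "v 12 = y" "y < n" and Q: "\<forall>u. a 4 u = of_bool (u \<in> Q)" "Q \<subseteq> {..<n}"
  shows "eval (Rd 4 (Vr 12) \<otimes> not_exp (Sm 50 0 (before_exp 4))) v a \<noteq> 0 \<longleftrightarrow> y \<in> leaders Q"
proof -
  have "(\<Sum>x<n. eval (before_exp 4) (v(50 := x)) a) = card {x. x \<in> Q \<and> x < y \<and> {x, y} \<in> E}"
  proof (rule sum_card)
    fix x assume x: "x < n"
    have "env (v(50 := x)) a" using e by (rule env_upd) simp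
    then show "eval (before_exp 4) (v(50 := x)) a = of_bool (x \<in> Q \<and> x < y \<and> {x, y} \<in> E)"
      using eval_before[of "v(50 := x)" a x y Q] x v Q by simp
  qed (use Q in auto)
  moreover have "v 0 = n" using e by (simp add: env_def)
  moreover have "finite {x. x \<in> Q \<and> x < y \<and> {x, y} \<in> E}" by (rule finite_subset[of _ "{..<y}"]) auto
  ultimately show ?thesis using Q v by (auto simp: leaders_def)
qed

definition member :: "arrays \<Rightarrow> nat \<Rightarrow> nat \<Rightarrow> nat" where
  "member a u i = a 6 (u * n + i)"

lemma member_upd: "x \<noteq> 6 \<Longrightarrow> member (a(x := f)) u = member a u"
  by (simp add: member_def fun_eq_iff)

text \<open>The members fill the row of the leader in array 6. The last conjunct protects the rows
  of smaller leaders, which later comparisons read.\<close>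

lemma gather_correct:
  assumes e: "env v a" and v: "v 12 = y" "y < n" and Q: "\<forall>u. a 4 u = of_bool (u \<in> Q)" "Q \<subseteq> {..<n}"
    and y: "y \<in> Q" and small: "card (cl Q y) \<le> F"
  shows "wp gather (\<lambda>v' a'. v' 5 = card (cl Q y) \<and> bij_betw (member a' y) {..<v' 5} (cl Q y) \<and>
     a' 7 = (a 7)(y := card (cl Q y)) \<and> (\<forall>p<y * n. a' 6 p = a 6 p)) v a"
proof -
  define Inv where "Inv j v' a' \<longleftrightarrow> v' 5 = card (cl Q y \<inter> {..<j}) \<and>
    bij_betw (member a' y) {..<card (cl Q y \<inter> {..<j})} (cl Q y \<inter> {..<j}) \<and> (\<forall>p<y * n. a' 6 p = a 6 p)"
    for j and v' :: "nat \<Rightarrow> nat" and a' :: arrays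
  let ?b = "Cd (Rd 4 (Vr 11) \<otimes> pos_exp (EqE (Vr 11) (Vr 12) \<oplus> adj_exp (Vr 12) (Vr 11)))
       (St 6 (Vr 12 \<otimes> Vr 0 \<oplus> Vr 5) (Vr 11) \<Zsemi> Asg 5 (Vr 5 \<oplus> Cn 1)) Nop"
  have fin: "finite (cl Q y)" using Q(2) by (auto simp: cl_def intro: finite_subset)
  have nB: "card (cl Q y) \<le> B" using small B_simps by linarith
  have "wp (Fr 11 0 ?b) (\<lambda>v' a'. v' 5 = card (cl Q y) \<and> bij_betw (member a' y) {..<v' 5} (cl Q y) \<and>
     v' 12 = y \<and> a' 7 = a 7 \<and> (\<forall>p<y * n. a' 6 p = a 6 p)) (v(5 := 0)) a"
  proof (rule wp_Fr[where Inv = Inv])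
    show "U 0 \<le> U 11" using B_simps by simp
    show "Inv 0 (v(5 := 0)) a" by (simp add: Inv_def bij_betw_def)
    have Cn: "cl Q y \<inter> {..<n} = cl Q y" using Q(2) by (auto simp: cl_def)
    show "v' 5 = card (cl Q y) \<and> bij_betw (member a' y) {..<v' 5} (cl Q y) \<and> v' 12 = y \<and> a' 7 = a 7 \<and>
        (\<forall>p<y * n. a' 6 p = a 6 p)"
      if "Inv ((v(5 := 0)) 0) v' a'" "agree (insert 11 (vmod ?b)) (amod ?b) (v(5 := 0)) a v' a'" for v' a'
      using that e v Cn by (simp add: Inv_def env_def agree_def)
    fix j v' a'
    assume j: "j < (v(5 := 0)) 0" and I: "Inv j v' a'"
      and ag: "agree (insert 11 (vmod ?b)) (amod ?b) (v(5 := 0)) a v' a'"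
    have jn: "j < n" using j e by (simp add: env_def)
    have v': "v' 0 = n" "v' 12 = y" "a' 4 j = of_bool (j \<in> Q)" "a' 0 (y * n + j) \<noteq> 0 \<longleftrightarrow> {y, j} \<in> E"
      using ag e v jn Q by (auto simp: env_def agree_def)
    show "wp ?b (Inv (Suc j)) (v'(11 := j)) a'"
    proof (cases "j \<in> cl Q y")
      case True
      let ?c = "card (cl Q y \<inter> {..<j})"
      have S: "cl Q y \<inter> {..<Suc j} = insert j (cl Q y \<inter> {..<j})" using True by auto
      then have c: "card (cl Q y \<inter> {..<Suc j}) = Suc ?c" by simp
      have "Suc ?c \<le> card (cl Q y)" unfolding c[symmetric] using fin by (intro card_mono) auto
      then have le: "Suc ?c \<le> F" using small by simp
      define a2 where "a2 = a'(6 := (a' 6)(y * n + ?c := j))"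
      have "bij_betw (member a2 y) {..<Suc ?c} (insert j (cl Q y \<inter> {..<j}))"
      proof -
        have "bij_betw (member a2 y) {..<?c} (cl Q y \<inter> {..<j})"
          using I unfolding Inv_def a2_def by (subst bij_betw_cong[of _ _ "member a' y"]) (auto simp: member_def)
        then have "bij_betw (member a2 y) ({..<?c} \<union> {?c}) ((cl Q y \<inter> {..<j}) \<union> {member a2 y ?c})"
          by (intro notIn_Un_bij_betw) (auto simp: member_def a2_def)
        then show ?thesis by (simp add: lessThan_Suc member_def a2_def)
      qed
      moreover have "\<forall>p<y * n. a2 6 p = a 6 p" using I by (simp add: Inv_def a2_def)
      ultimately have "Inv (Suc j) (v'(11 := j, 5 := Suc ?c)) a2"
        unfolding Inv_def c S by simp
      moreover have "j \<in> Q" "j = y \<or> a' 0 (y * n + j) \<noteq> 0" using True v'(4) by (auto simp: cl_def)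
      moreover have "j \<le> B" using jn B_simps by simp
      moreover have "v' 5 = ?c" using I by (simp add: Inv_def)
      ultimately show ?thesis using v' le by (auto simp: a2_def)
    next
      case False
      then have "cl Q y \<inter> {..<Suc j} = cl Q y \<inter> {..<j}" by (auto simp: less_Suc_eq)
      then have "Inv (Suc j) (v'(11 := j)) a'" using I by (simp add: Inv_def)
      moreover have "j \<notin> Q \<or> (j \<noteq> y \<and> a' 0 (y * n + j) = 0)" using False v'(4) by (auto simp: cl_def)
      ultimately show ?thesis using v' by auto
    qed
  qed
  then have "wp (Fr 11 0 ?b) (wp (St 7 (Vr 12) (Vr 5)) (\<lambda>v' a'. v' 5 = card (cl Q y) \<and>
     bij_betw (member a' y) {..<v' 5} (cl Q y) \<and> a' 7 = (a 7)(y := card (cl Q y)) \<and>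
     (\<forall>p<y * n. a' 6 p = a 6 p))) (v(5 := 0)) a"
    by (rule wp_mono) (use nB in \<open>auto simp: member_upd\<close>)
  then show ?thesis by (simp add: gather_def)
qed

definition members_ok :: "arrays \<Rightarrow> nat \<Rightarrow> bool" where
  "members_ok a u \<longleftrightarrow> (\<forall>i<a 7 u. member a u i < n)"

lemma eval_differ:
  assumes e: "env v a" and v: "v 50 = u" "v 12 = y" "v 5 = a 7 y" "u < n" "y < n"
    and ok: "members_ok a u" "members_ok a y" and s: "a 7 u = a 7 y"
  shows "eval (differ_exp (Vr 50)) v a = 0 \<longleftrightarrow> similar (member a y) (a 7 y) (member a u) (a 7 u)"
proof -
  let ?c = "a 7 y"
  define e1 where "e1 = not_exp (EqE (not_exp (adj_exp (member_exp (Vr 50) (Vr 51)) (Rd 3 (Vr 52))))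
          (not_exp (adj_exp (member_exp (Vr 12) (Vr 51)) (Rd 3 (Vr 52))))) \<oplus>
        not_exp (EqE (EqE (lab_exp (member_exp (Vr 50) (Vr 51))) (lab_exp (Rd 3 (Vr 52))))
          (EqE (lab_exp (member_exp (Vr 12) (Vr 51))) (lab_exp (Rd 3 (Vr 52)))))"
  define e2 where "e2 = not_exp (EqE (EqE (lab_exp (member_exp (Vr 50) (Vr 51))) (lab_exp (member_exp (Vr 50) (Vr 53))))
          (EqE (lab_exp (member_exp (Vr 12) (Vr 51))) (lab_exp (member_exp (Vr 12) (Vr 53)))))"
  have m: "member a u i < n" "member a y i < n" if "i < ?c" for i
    using ok s that by (auto simp: members_ok_def)
  have v0: "v 0 = n" "v 4 = card K" using e by (auto simp: env_def)
  have e1: "eval e1 (v(51 := i, 52 := k)) a = 0 \<longleftrightarrow>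
      ({member a y i, Kl k} \<in> E \<longleftrightarrow> {member a u i, Kl k} \<in> E) \<and>
      (lab (member a y i) = lab (Kl k) \<longleftrightarrow> lab (member a u i) = lab (Kl k))"
    if ik: "i < ?c" "k < card K" for i k
  proof -
    have l: "a 1 (a 6 (u * n + i)) = lab (member a u i)" "a 1 (a 6 (y * n + i)) = lab (member a y i)"
      "a 1 (a 3 k) = lab (Kl k)"
      using e m[OF ik(1)] Kl_n[OF ik(2)] ik by (auto simp: env_def member_def)
    have ed: "a 0 (a 6 (u * n + i) * n + a 3 k) = 0 \<longleftrightarrow> {member a u i, Kl k} \<notin> E"
      "a 0 (a 6 (y * n + i) * n + a 3 k) = 0 \<longleftrightarrow> {member a y i, Kl k} \<notin> E"
      using edge_K[OF e m(1)[OF ik(1)] Kl_n[OF ik(2)]] edge_K[OF e m(2)[OF ik(1)] Kl_n[OF ik(2)]] e ik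
      by (auto simp: env_def member_def)
    show ?thesis using v v0 by (simp add: e1_def member_exp_def l ed del: One_nat_def)
  qed
  have e2: "eval e2 (v(51 := i, 53 := j)) a = 0 \<longleftrightarrow>
      (lab (member a y i) = lab (member a y j) \<longleftrightarrow> lab (member a u i) = lab (member a u j))"
    if ij: "i < ?c" "j < ?c" for i j
  proof -
    have l: "a 1 (a 6 (u * n + i)) = lab (member a u i)" "a 1 (a 6 (y * n + i)) = lab (member a y i)"
      if "i < ?c" for i
      using e m[OF that] that by (auto simp: env_def member_def)
    show ?thesis using v v0 by (simp add: e2_def member_exp_def l ij del: One_nat_def)
  qed
  have d: "differ_exp (Vr 50) = Sm 51 5 (Sm 52 4 e1 \<oplus> Sm 53 5 e2)"
    by (simp add: differ_exp_def e1_def e2_def)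
  have sums: "eval (differ_exp (Vr 50)) v a =
      (\<Sum>i<?c. (\<Sum>k<card K. eval e1 (v(51 := i, 52 := k)) a) + (\<Sum>j<?c. eval e2 (v(51 := i, 53 := j)) a))"
    unfolding d using v v0 by simp
  have "eval (differ_exp (Vr 50)) v a = 0 \<longleftrightarrow> (\<forall>i<?c. (\<forall>k<card K. eval e1 (v(51 := i, 52 := k)) a = 0) \<and>
      (\<forall>j<?c. eval e2 (v(51 := i, 53 := j)) a = 0))"
    unfolding sums by (simp add: sum_eq_0_iff Ball_def)
  also have "\<dots> \<longleftrightarrow> (\<forall>i<?c. (\<forall>k<card K. ({member a y i, Kl k} \<in> E \<longleftrightarrow> {member a u i, Kl k} \<in> E) \<and>
      (lab (member a y i) = lab (Kl k) \<longleftrightarrow> lab (member a u i) = lab (Kl k))) \<and>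
      (\<forall>j<?c. lab (member a y i) = lab (member a y j) \<longleftrightarrow> lab (member a u i) = lab (member a u j)))"
    by (intro all_cong conj_cong e1 e2) assumption+
  also have "\<dots> \<longleftrightarrow> similar (member a y) ?c (member a u) (a 7 u)"
    unfolding Kl_all[of "\<lambda>x. ({member a y i, x} \<in> E \<longleftrightarrow> {member a u i, x} \<in> E) \<and>
      (lab (member a y i) = lab x \<longleftrightarrow> lab (member a u i) = lab x)" for i]
    using s by (auto simp: similar_def)
  finally show ?thesis .
qed

definition similar_before :: "arrays \<Rightarrow> nat set \<Rightarrow> nat \<Rightarrow> nat set" where
  "similar_before a C y = {u \<in> C. u < y \<and> similar (member a y) (a 7 y) (member a u) (a 7 u)}"

lemma eval_similar:
  assumes e: "env v a" and v: "v 12 = y" "v 5 = a 7 y" "y < n"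
    and C: "\<forall>u. a 8 u = of_bool (u \<in> C)" "C \<subseteq> {..<n}"
    and ok: "\<forall>u\<in>insert y C. members_ok a u"
  shows "eval similar_exp v a = card (similar_before a C y)"
proof -
  let ?i = "Rd 8 (Vr 50) \<otimes> LtE (Vr 50) (Vr 12) \<otimes> EqE (Rd 7 (Vr 50)) (Vr 5) \<otimes> not_exp (differ_exp (Vr 50))"
  have "(\<Sum>u<n. eval ?i (v(50 := u)) a) =
      card {u. u \<in> C \<and> u < y \<and> similar (member a y) (a 7 y) (member a u) (a 7 u)}"
  proof (rule sum_card)
    fix u assume u: "u < n"
    have e': "env (v(50 := u)) a" using e by (rule env_upd) simp
    show "eval ?i (v(50 := u)) a =
        of_bool (u \<in> C \<and> u < y \<and> similar (member a y) (a 7 y) (member a u) (a 7 u))"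
    proof (cases "u \<in> C \<and> a 7 u = a 7 y")
      case True
      then have "eval (differ_exp (Vr 50)) (v(50 := u)) a = 0 \<longleftrightarrow>
          similar (member a y) (a 7 y) (member a u) (a 7 u)"
        using v u ok by (intro eval_differ[OF e']) auto
      then show ?thesis using True C v by (simp add: del: fun_upd_apply) (simp add: v)
    next
      case False
      then show ?thesis using C v by (auto simp: similar_def)
    qed
  qed (use C in auto)
  moreover have "v 0 = n" using e by (simp add: env_def)
  ultimately show ?thesis by (simp add: similar_exp_def similar_before_def)
qed

text \<open>K precedes the other vertices in the fixed order \<open>Kl\<close>. Contracting K, or
  vertex 0 alone, then amounts to excluding an initial segment of the list from the cuts.\<close>

definition listed :: "nat \<Rightarrow> nat set \<Rightarrow> arrays \<Rightarrow> bool" where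
  "listed s X a \<longleftrightarrow> bij_betw (a 9) {..<s} (K \<union> X) \<and> (\<forall>i<card K. a 9 i = Kl i) \<and> card K \<le> s"

lemma listed_card: "listed s X a \<Longrightarrow> s = card (K \<union> X)"
  using bij_betw_same_card[of "a 9" "{..<s}" "K \<union> X"] by (simp add: listed_def)

lemma listed_insert:
  assumes l: "listed s X a" and x: "x \<notin> K \<union> X" and a': "a' 9 = (a 9)(s := x)"
  shows "listed (Suc s) (insert x X) a'"
proof -
  have "bij_betw (a' 9) {..<s} (K \<union> X)"
    using l a' unfolding listed_def by (subst bij_betw_cong[of _ _ "a 9"]) auto
  then have "bij_betw (a' 9) ({..<s} \<union> {s}) (K \<union> X \<union> {a' 9 s})"
    by (rule notIn_Un_bij_betw[rotated 2]) (use x a' in auto)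
  moreover have "K \<union> X \<union> {a' 9 s} = K \<union> insert x X" using a' by auto
  moreover have "{..<s} \<union> {s} = {..<Suc s}" by auto
  ultimately show ?thesis using l a' unfolding listed_def by auto
qed

lemma push_K_correct:
  assumes e: "env v a"
  shows "wp push_K (\<lambda>v' a'. v' 6 = card K \<and> listed (card K) {} a') v a"
proof -
  have "wp (Fr 16 4 (push (Rd 3 (Vr 16)))) (\<lambda>v' a'. v' 6 = card K \<and> listed (card K) {} a') (v(6 := 0)) a"
  proof (rule wp_Fr[where Inv = "\<lambda>j v' a'. v' 6 = j \<and> (\<forall>i<j. a' 9 i = Kl i)"])
    show "U 4 \<le> U 16" using B_simps by simp
    show "v' 6 = card K \<and> listed (card K) {} a'"
      if I: "v' 6 = (v(6 := 0)) 4 \<and> (\<forall>i<(v(6 := 0)) 4. a' 9 i = Kl i)" for v' a'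
    proof -
      have c: "(v(6 := 0)) 4 = card K" using e by (simp add: env_def)
      then have "bij_betw (a' 9) {..<card K} K"
        using Kl_bij I by (subst bij_betw_cong[of _ _ Kl]) auto
      then show ?thesis using I c by (simp add: listed_def)
    qed
    fix j v' a'
    assume j: "j < (v(6 := 0)) 4" and I: "v' 6 = j \<and> (\<forall>i<j. a' 9 i = Kl i)"
      and ag: "agree (insert 16 (vmod (push (Rd 3 (Vr 16))))) (amod (push (Rd 3 (Vr 16)))) (v(6 := 0)) a v' a'"
    have jK: "j < card K" using j e by (simp add: env_def)
    have "a' 3 j = Kl j" using ag e jK by (simp add: agree_def push_def env_def)
    moreover have "Kl j \<le> B" using Kl_n[OF jK] B_simps by linarith
    moreover have "Suc j \<le> F" using jK kernel_bound_le_F[OF card_K(2)] by simp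
    ultimately show "wp (push (Rd 3 (Vr 16))) (\<lambda>v' a'. v' 6 = Suc j \<and> (\<forall>i<Suc j. a' 9 i = Kl i))
        (v'(16 := j)) a'"
      using I by (auto simp: push_def less_Suc_eq)
  qed simp
  then show ?thesis by (simp add: push_K_def)
qed

lemma push_clique_correct:
  assumes e: "env v a" and v: "v 12 = u" "v 5 = c" and m: "bij_betw (member a u) {..<c} C"
    and l: "listed (v 6) X a" and C: "C \<inter> (K \<union> X) = {}" "C \<subseteq> {..<n}" and le: "v 6 + c \<le> F"
  shows "wp push_clique (\<lambda>v' a'. listed (v' 6) (X \<union> C) a') v a"
  unfolding push_clique_def
proof (rule wp_Fr[where Inv = "\<lambda>j v' a'. v' 6 = v 6 + j \<and> listed (v 6 + j) (X \<union> member a u ` {..<j}) a'"])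
  let ?b = "push (member_exp (Vr 12) (Vr 22))"
  show "U 5 \<le> U 22" using B_simps by simp
  show "v 6 = v 6 + 0 \<and> listed (v 6 + 0) (X \<union> member a u ` {..<0}) a" using l by simp
  show "listed (v' 6) (X \<union> C) a'"
    if "v' 6 = v 6 + v 5 \<and> listed (v 6 + v 5) (X \<union> member a u ` {..<v 5}) a'" for v' a'
    using that v m by (simp add: bij_betw_def)
  fix j v' a'
  assume j: "j < v 5" and I: "v' 6 = v 6 + j \<and> listed (v 6 + j) (X \<union> member a u ` {..<j}) a'"
    and ag: "agree (insert 22 (vmod ?b)) (amod ?b) v a v' a'"
  have v': "v' 0 = n" "v' 12 = u" "a' 6 = a 6" using ag e v by (auto simp: agree_def push_def env_def)
  let ?x = "member a u j"
  have jc: "j < c" using j v by simp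
  have xC: "?x \<in> C" using m jc by (auto simp: bij_betw_def)
  have "?x \<notin> member a u ` {..<j}"
    using m jc unfolding bij_betw_def inj_on_def by fastforce
  then have x: "?x \<notin> K \<union> (X \<union> member a u ` {..<j})" using xC C by auto
  have "listed (Suc (v 6 + j)) (insert ?x (X \<union> member a u ` {..<j})) (a'(9 := (a' 9)(v 6 + j := ?x)))"
    by (rule listed_insert[OF conjunct2[OF I] x]) simp
  then have "listed (v 6 + Suc j) (X \<union> member a u ` {..<Suc j}) (a'(9 := (a' 9)(v 6 + j := ?x)))"
    by (simp add: lessThan_Suc)
  moreover have "?x \<le> B" using xC C B_simps by force
  moreover have "Suc (v 6 + j) \<le> F" using jc le by simp
  ultimately show "wp ?b (\<lambda>v' a'. v' 6 = v 6 + Suc j \<and> listed (v 6 + Suc j) (X \<union> member a u ` {..<Suc j}) a')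
      (v'(22 := j)) a'"
    using v' I by (simp add: push_def member_exp_def member_def)
qed

lemma solve_listed:
  assumes e: "env v a" and l: "listed (v 6) X a" and X: "X \<subseteq> {..<n}"
    and le: "v 6 \<le> kernel_bound (card K)" and r: "v 27 = r" "r \<le> card K"
  shows "wp solve (\<lambda>v' a'. enat (v' 24) = min (optR (K \<union> X) (Kl ` {..<r})) (enat (kk + 1))) v a"
proof -
  have b: "a 9 ` {..<v 6} = K \<union> X" "inj_on (a 9) {..<v 6}" "card K \<le> v 6"
    using l by (auto simp: listed_def bij_betw_def)
  have "a 9 ` {..<r} = Kl ` {..<r}" using l r(2) by (intro image_cong) (auto simp: listed_def)
  moreover have "wp solve (\<lambda>v' a'. enat (v' 24) = min (optR (a 9 ` {..<v 6}) (a 9 ` {..<r})) (enat (kk + 1))) v a"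
  proof (rule solve_correct)
    show "a 9 i < n" if "i < v 6" for i
    proof -
      have "a 9 i \<in> K \<union> X" using b(1) that by blast
      then show ?thesis using X Kn by auto
    qed
    show "2 ^ (v 6 * v 6) + v 6 * v 6 + 1 \<le> F" using exhaustive_bound_mono[OF le] F_ge by (rule le_trans)
  qed (use b r e in auto)
  ultimately show ?thesis using b(1) by simp
qed

end

text \<open>A summand beyond k already makes the total too large, so capping at k + 1 never changes
  the answer. It replaces infinity by a number that fits into a word.\<close>

lemma add_capped_le_iff:
  fixes x y :: enat
  assumes "enat c = min x (enat (k + 1))"
  shows "enat t + (y + x) \<le> enat k \<longleftrightarrow> enat (t + c) + y \<le> enat k"
  using assms by (cases x; cases y) (auto simp: min_def split: if_splits)

section \<open>The pass over the cliques and the final decision\<close>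

context FGC_instance
begin

lemma mods:
  "vmod gather = {5, 11}" "amod gather = {6, 7}"
  "vmod push_K = {6, 16}" "amod push_K = {9}"
  "vmod push_clique = {22, 6}" "amod push_clique = {9}"
  "vmod solve = {23, 7, 22, 8, 9, 24, 25, 26}" "amod solve = {10}"
  "vmod cliques_body = {5, 11, 20, 6, 16, 22, 27, 23, 7, 8, 9, 24, 25, 26, 17}"
  "amod cliques_body = {6, 7, 8, 9, 10}"
  by (auto simp: program_defs)

definition kernel :: "nat set \<Rightarrow> nat set \<Rightarrow> nat set" where
  "kernel Q C = K \<union> (\<Union>u\<in>C. cl Q u)"

lemma goodD: "good Q \<Longrightarrow> Q \<subseteq> {..<n} - K" "good Q \<Longrightarrow> Q \<inter> K = {}" "good Q \<Longrightarrow> Q \<subseteq> {..<n}"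
  by (auto simp: good_def)

lemma leaders_sub: "leaders Q \<subseteq> Q" and cl_sub: "cl Q u \<subseteq> Q"
  by (auto simp: leaders_def cl_def)

lemma card_cl_le: "good Q \<Longrightarrow> u \<in> Q \<Longrightarrow> card (cl Q u) \<le> clique_bound (card K)"
  using card_clique_le[of Q u] by (simp add: clique_bound_def thr_def)

lemma card_cl_le_n: "good Q \<Longrightarrow> card (cl Q u) \<le> n"
proof -
  assume "good Q"
  then have "cl Q u \<subseteq> {..<n}" using cl_sub[of Q u] goodD(3)[of Q] by blast
  then have "card (cl Q u) \<le> card {..<n}" by (intro card_mono) auto
  then show ?thesis by simp
qed

lemma card_cl_le_F: "good Q \<Longrightarrow> u \<in> Q \<Longrightarrow> card (cl Q u) \<le> F"
  using card_cl_le[of Q u] kernel_bound_ge(1)[of "card K"] by (intro kernel_bound_le_F) linarith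

lemma finite_cl: "good Q \<Longrightarrow> finite (cl Q u)"
  using goodD(3) cl_sub finite_subset by (metis finite_lessThan)

lemma kernel_leaders:
  assumes "good Q" shows "kernel Q (leaders Q) = K \<union> Q"
proof -
  have "w \<in> (\<Union>u\<in>leaders Q. cl Q u)" if "w \<in> Q" for w
    using leader_exists[OF goodD(2)[OF assms] that] by blast
  then show ?thesis using cl_sub by (auto simp: kernel_def)
qed

definition recorded :: "nat set \<Rightarrow> nat \<Rightarrow> arrays \<Rightarrow> bool" where
  "recorded Q j a \<longleftrightarrow> (\<forall>u\<in>leaders Q. u < j \<longrightarrow>
     a 7 u = card (cl Q u) \<and> bij_betw (member a u) {..<a 7 u} (cl Q u))"

lemma recorded_members: "recorded Q j a \<Longrightarrow> good Q \<Longrightarrow> u \<in> leaders Q \<Longrightarrow> u < j \<Longrightarrow> members_ok a u"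
  using cl_sub goodD(3) unfolding recorded_def members_ok_def bij_betw_def by blast

lemma recorded_upd: "x \<notin> {6, 7} \<Longrightarrow> recorded Q j (a(x := f)) = recorded Q j a"
  by (simp add: recorded_def member_upd)

lemma similar_before_upd: "x \<notin> {6, 7} \<Longrightarrow> similar_before (a(x := f)) C y = similar_before a C y"
  by (simp add: similar_before_def member_upd)

lemma similar_cong:
  "(\<And>i. i < s \<Longrightarrow> f i = f' i) \<Longrightarrow> (\<And>i. i < t \<Longrightarrow> g i = g' i) \<Longrightarrow> similar f s g t = similar f' s g' t"
  unfolding similar_def by (intro conj_cong all_cong ball_cong refl) simp_all

lemma similar_before_cong:
  assumes "\<And>u. u \<in> C \<Longrightarrow> a 7 u = a' 7 u" "\<And>u i. u \<in> C \<Longrightarrow> i < a' 7 u \<Longrightarrow> member a u i = member a' u i"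
    and "y \<in> C"
  shows "similar_before a C y = similar_before a' C y"
proof -
  have "similar (member a y) (a 7 y) (member a u) (a 7 u) = similar (member a' y) (a' 7 y) (member a' u) (a' 7 u)"
    if "u \<in> C" for u
    unfolding assms(1)[OF that] assms(1)[OF assms(3)]
    by (rule similar_cong) (simp_all add: assms(2,3) that)
  then show ?thesis by (auto simp: similar_before_def)
qed

abbreviation "many \<equiv> 2 * 2 ^ card K :: nat"

definition few_similar :: "nat set \<Rightarrow> arrays \<Rightarrow> bool" where
  "few_similar C a \<longleftrightarrow> (\<forall>y\<in>C. card (similar_before a C y) < many)"

lemma card_kernel:
  assumes g: "good Q" and C: "C \<subseteq> leaders Q" and few: "few_similar C a"
    and s: "\<And>u. u \<in> C \<Longrightarrow> a 7 u = card (cl Q u)"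
  shows "card (kernel Q C) \<le> kernel_bound (card K)"
proof -
  let ?G = "clique_bound (card K)"
  have CQ: "C \<subseteq> Q" using C leaders_sub by blast
  have finC: "finite C" using CQ goodD(3)[OF g] finite_subset by (metis finite_lessThan)
  have G: "card (cl Q u) \<le> ?G" if "u \<in> C" for u using card_cl_le[OF g] CQ that by blast
  have "card C \<le> kept_bound (card K)"
    unfolding kept_bound_def
  proof (rule card_similarity_classes[where m = "member a" and s = "a 7"])
    show "a 7 u \<le> ?G" if "u \<in> C" for u using s G that by simp
    show "card {u \<in> C. u < v \<and> similar (member a v) (a 7 v) (member a u) (a 7 u)} < many"
      if "v \<in> C" for v
      using few that by (simp add: few_similar_def similar_before_def)
  qed (rule finC)
  then have c: "card C * ?G \<le> kept_bound (card K) * ?G" by (rule mult_le_mono1)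
  have "card (\<Union>u\<in>C. cl Q u) \<le> (\<Sum>u\<in>C. card (cl Q u))" by (rule card_UN_le[OF finC])
  also have "\<dots> \<le> card C * ?G" using sum_bounded_above[of C "\<lambda>u. card (cl Q u)" ?G] G by simp
  finally have "card (\<Union>u\<in>C. cl Q u) \<le> kept_bound (card K) * ?G" using c by linarith
  then show ?thesis
    using card_Un_le[of K "\<Union>u\<in>C. cl Q u"] unfolding kernel_def kernel_bound_def by linarith
qed

definition later :: "nat set \<Rightarrow> nat \<Rightarrow> nat set" where
  "later Q j = {u \<in> leaders Q. j \<le> u}"

text \<open>Charges are capped now, so what is preserved is only the comparison of the optimum with
  the budget. The current instance consists of K, the kept cliques C and the cliques not yet
  visited.\<close>

definition cliques_inv :: "nat set \<Rightarrow> nat \<Rightarrow> (nat \<Rightarrow> nat) \<Rightarrow> arrays \<Rightarrow> bool" where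
  "cliques_inv Q j v a \<longleftrightarrow> recorded Q j a \<and> v 17 \<le> n + j * (kk + 1) \<and>
     (\<exists>C. C \<subseteq> leaders Q \<inter> {..<j} \<and> (\<forall>u. a 8 u = of_bool (u \<in> C)) \<and> few_similar C a \<and>
       (opt {..<n} \<le> enat kk \<longleftrightarrow> enat (v 17) + opt (kernel Q (C \<union> later Q j)) \<le> enat kk))"

lemma cliques_inv_skip:
  assumes "cliques_inv Q j v a" "j \<notin> leaders Q" "v' 17 = v 17"
  shows "cliques_inv Q (Suc j) v' a"
proof -
  have "later Q (Suc j) = later Q j"
    using assms(2) by (auto simp: later_def Suc_le_eq order.strict_iff_order)
  moreover have "recorded Q (Suc j) a"
    using assms by (auto simp: cliques_inv_def recorded_def less_Suc_eq)
  moreover obtain C where "C \<subseteq> leaders Q \<inter> {..<j}" "\<forall>u. a 8 u = of_bool (u \<in> C)" "few_similar C a"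
    "opt {..<n} \<le> enat kk \<longleftrightarrow> enat (v 17) + opt (kernel Q (C \<union> later Q j)) \<le> enat kk"
    using assms(1) unfolding cliques_inv_def by blast
  moreover have "v' 17 \<le> n + Suc j * (kk + 1)" using assms by (simp add: cliques_inv_def)
  ultimately show ?thesis
    unfolding cliques_inv_def assms(3) by (intro conjI exI[of _ C]) auto
qed

lemma later_split: "j \<in> leaders Q \<Longrightarrow> later Q j = insert j (later Q (Suc j))"
  by (auto simp: later_def Suc_le_eq order.strict_iff_order)

lemma gather_recorded:
  assumes g: "good Q" and rec: "recorded Q j a" and j: "j \<in> leaders Q"
    and b: "bij_betw (member a1 j) {..<card (cl Q j)} (cl Q j)"
    and a1: "a1 7 = (a 7)(j := card (cl Q j))" "\<forall>p<j * n. a1 6 p = a 6 p"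
  shows "recorded Q (Suc j) a1"
    "\<And>u i. u \<in> leaders Q \<Longrightarrow> u < j \<Longrightarrow> i < a 7 u \<Longrightarrow> member a1 u i = member a u i"
proof -
  show same: "member a1 u i = member a u i" if u: "u \<in> leaders Q" "u < j" "i < a 7 u" for u i
  proof -
    \<comment> \<open>A clique has at most n members, so the rows of different leaders do not
      overlap.\<close>
    have "i < n" using rec u card_cl_le_n[OF g, of u] by (simp add: recorded_def)
    then have "u * n + i < Suc u * n" by simp
    also have "\<dots> \<le> j * n" using u by (intro mult_le_mono1) simp
    finally show ?thesis using a1(2) by (simp add: member_def)
  qed
  show "recorded Q (Suc j) a1"
    unfolding recorded_def
  proof (intro ballI impI)
    fix u assume u: "u \<in> leaders Q" "u < Suc j"
    show "a1 7 u = card (cl Q u) \<and> bij_betw (member a1 u) {..<a1 7 u} (cl Q u)"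
    proof (cases "u = j")
      case True
      then show ?thesis using a1(1) b by simp
    next
      case False
      then have uj: "u < j" using u by simp
      then have r: "a 7 u = card (cl Q u)" "bij_betw (member a u) {..<a 7 u} (cl Q u)"
        using rec u by (auto simp: recorded_def)
      have "bij_betw (member a1 u) {..<a 7 u} (cl Q u)"
        using r(2) by (subst bij_betw_cong[of _ _ "member a u"]) (auto simp: same u(1) uj)
      then show ?thesis using r(1) a1(1) False by simp
    qed
  qed
qed

lemma opt_delete_recorded:
  assumes g: "good Q" and rec: "recorded Q (Suc j) a" and j: "j \<in> leaders Q"
    and C: "C \<subseteq> leaders Q \<inter> {..<j}" and m: "many \<le> card (similar_before a C j)"
  shows "opt (kernel Q (C \<union> later Q j)) = opt (kernel Q (C \<union> later Q (Suc j))) + optR (K \<union> cl Q j) K"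
proof -
  let ?I = "similar_before a C j" and ?I' = "C \<union> later Q j"
  have I: "?I \<subseteq> C" by (auto simp: similar_before_def)
  have "opt (kernel Q ?I') = opt (kernel Q ?I' - cl Q j) + optR (K \<union> cl Q j) K"
  proof (rule opt_delete_clique[where m = "member a" and s = "a 7" and I = ?I and I' = ?I'])
    show "Q \<subseteq> {..<n} - K" using goodD(1)[OF g] .
    show "?I \<subseteq> leaders Q" "j \<notin> ?I" "insert j ?I \<subseteq> ?I'" "?I' \<subseteq> leaders Q"
      using I C j by (auto simp: later_def)
    show "bij_betw (member a u) {..<a 7 u} (cl Q u)" if "u \<in> insert j ?I" for u
    proof -
      have "u \<in> leaders Q" "u < Suc j" using that I C j by auto
      then show ?thesis using rec unfolding recorded_def by blast
    qed
    show "similar (member a j) (a 7 j) (member a u) (a 7 u)" if "u \<in> ?I" for u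
      using that by (simp add: similar_before_def)
  qed (use j m in \<open>auto simp: kernel_def\<close>)
  moreover have "kernel Q ?I' - cl Q j = kernel Q (C \<union> later Q (Suc j))"
  proof -
    have disj: "cl Q u \<inter> cl Q j = {}" if "u \<in> C \<union> later Q (Suc j)" for u
      using that C j by (intro leader_disjoint[OF goodD(2)[OF g]]) (auto simp: later_def)
    have "K \<inter> cl Q j = {}" using goodD(2)[OF g] cl_sub by blast
    let ?D = "C \<union> later Q (Suc j)"
    have "kernel Q ?D \<inter> cl Q j = {}" using \<open>K \<inter> cl Q j = {}\<close> disj unfolding kernel_def by blast
    moreover have "kernel Q ({j} \<union> ?D) = kernel Q ?D \<union> cl Q j" by (auto simp: kernel_def)
    ultimately have "kernel Q ({j} \<union> ?D) - cl Q j = kernel Q ?D"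
      by (simp add: Un_Diff Diff_triv)
    moreover have "?I' = {j} \<union> (C \<union> later Q (Suc j))" unfolding later_split[OF j] by blast
    ultimately show ?thesis by simp
  qed
  ultimately show ?thesis by simp
qed

lemma cliques_body_correct:
  assumes e: "env v a" and v: "v 12 = j" "j < n" "v 19 = many" and j: "j \<in> leaders Q" and g: "good Q"
    and a4: "\<forall>u. a 4 u = of_bool (u \<in> Q)" and I: "cliques_inv Q j v a"
  shows "wp cliques_body (cliques_inv Q (Suc j)) v a"
proof -
  obtain C where C: "C \<subseteq> leaders Q \<inter> {..<j}" "\<forall>u. a 8 u = of_bool (u \<in> C)" "few_similar C a"
    "opt {..<n} \<le> enat kk \<longleftrightarrow> enat (v 17) + opt (kernel Q (C \<union> later Q j)) \<le> enat kk"
    using I unfolding cliques_inv_def by blast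
  have rec: "recorded Q j a" and v17: "v 17 \<le> n + j * (kk + 1)" using I by (auto simp: cliques_inv_def)
  have jQ: "j \<in> Q" using j leaders_sub by blast
  have Cn: "C \<subseteq> {..<n}" using C(1) v by auto
  let ?c = "card (cl Q j)"
  show ?thesis
    unfolding cliques_body_def wp.simps(5)
  proof (rule wp_frame[OF gather_correct[OF e v(1,2) a4 goodD(3)[OF g] jQ card_cl_le_F[OF g jQ]]])
    fix v1 a1
    assume *: "v1 5 = ?c \<and> bij_betw (member a1 j) {..<v1 5} (cl Q j) \<and> a1 7 = (a 7)(j := ?c) \<and>
        (\<forall>p<j * n. a1 6 p = a 6 p)"
      and ag: "agree (vmod gather) (amod gather) v a v1 a1"
    have e1: "env v1 a1" using env_agree[OF e ag] by (simp add: mods)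
    have v1: "v1 12 = j" "v1 19 = many" "v1 17 = v 17" "a1 8 = a 8"
      using ag v by (auto simp: agree_def mods)
    have b: "bij_betw (member a1 j) {..<?c} (cl Q j)" using * by metis
    have a17: "a1 7 = (a 7)(j := ?c)" "\<forall>p<j * n. a1 6 p = a 6 p" using * by blast+
    note rec1 = gather_recorded[OF g rec j b a17]
    have s1: "similar_before a1 C y = similar_before a C y" if "y \<in> C" for y
      using that C(1) a17(1) by (intro similar_before_cong) (auto intro: rec1(2))
    have few1: "few_similar C a1" using C(3) s1 by (simp add: few_similar_def)
    define t where "t = card (similar_before a1 C j)"
    have ok: "\<forall>u\<in>insert j C. members_ok a1 u"
      using recorded_members[OF rec1(1) g] C(1) j by (auto simp: less_Suc_eq)
    have t: "eval similar_exp v1 a1 = t"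
      unfolding t_def using * v1 C(2) Cn ok v(2) by (intro eval_similar[OF e1]) auto
    have "t \<le> card {..<n}" unfolding t_def using Cn by (intro card_mono) (auto simp: similar_before_def)
    then have tB: "t \<le> B" using B_simps by simp
    show "wp (Asg 20 similar_exp) (wp (Cd (LtE (Vr 20) (Vr 19)) (St 8 (Vr 12) (Cn 1))
       (push_K \<Zsemi> push_clique \<Zsemi> Asg 27 (Vr 4) \<Zsemi> solve \<Zsemi> Asg 17 (Vr 17 \<oplus> Vr 24)))
       (cliques_inv Q (Suc j))) v1 a1"
    proof (cases "t < many")
      case True
      let ?a2 = "a1(8 := (a1 8)(j := 1))"
      have "few_similar (insert j C) ?a2"
        unfolding few_similar_def
      proof
        fix y assume y: "y \<in> insert j C"
        then have "y \<le> j" using C(1) by auto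
        \<comment> \<open>Every kept leader is at most j, and only smaller ones are counted, so
          keeping j leaves the earlier counts as they are.\<close>
        then have "similar_before a1 (insert j C) y = similar_before a1 C y" by (auto simp: similar_before_def)
        then show "card (similar_before ?a2 (insert j C) y) < many"
          using y few1 True by (auto simp: similar_before_upd few_similar_def t_def)
      qed
      moreover have "insert j C \<union> later Q (Suc j) = C \<union> later Q j" using later_split[OF j] by simp
      moreover have "recorded Q (Suc j) ?a2" using rec1(1) by (simp add: recorded_upd)
      moreover have "\<forall>u. ?a2 8 u = of_bool (u \<in> insert j C)" using C(2) v1 by simp
      moreover have "insert j C \<subseteq> leaders Q \<inter> {..<Suc j}" using C(1) j by auto
      ultimately have "cliques_inv Q (Suc j) (v1(20 := t)) ?a2"
        unfolding cliques_inv_def using C(4) v17 v1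
        by (intro conjI exI[of _ "insert j C"]) simp_all
      then show ?thesis using True t tB v1 B_simps by simp
    next
      case False
      let ?v1 = "v1(20 := t)"
      let ?R = "cliques_inv Q (Suc j)"
      have e1': "env ?v1 a1" using env_upd[OF e1] by simp
      have "wp (push_K \<Zsemi> push_clique \<Zsemi> Asg 27 (Vr 4) \<Zsemi> solve \<Zsemi> Asg 17 (Vr 17 \<oplus> Vr 24)) ?R ?v1 a1"
        unfolding wp.simps(5)
      proof (rule wp_frame[OF push_K_correct[OF e1']])
        fix v2 a2
        assume p: "v2 6 = card K \<and> listed (card K) {} a2" and ag2: "agree (vmod push_K) (amod push_K) ?v1 a1 v2 a2"
        have e2: "env v2 a2" using env_agree[OF e1' ag2] by (simp add: mods)
        have v2: "v2 12 = j" "v2 5 = ?c" "v2 17 = v 17" "a2 6 = a1 6" "a2 7 = a1 7" "a2 8 = a 8"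
          using ag2 v1 * by (auto simp: agree_def mods)
        have b2: "bij_betw (member a2 j) {..<?c} (cl Q j)" using b v2 by (simp add: member_def[abs_def])
        have le: "v2 6 + ?c \<le> kernel_bound (card K)"
          using p card_cl_le[OF g jQ] kernel_bound_ge(1)[of "card K"] by simp
        have cln: "cl Q j \<subseteq> {..<n}" "cl Q j \<inter> K = {}" using cl_sub goodD[OF g] by blast+
        have "wp push_clique (\<lambda>v' a'. listed (v' 6) ({} \<union> cl Q j) a') v2 a2"
        proof (rule push_clique_correct[OF e2 v2(1,2) b2])
          show "listed (v2 6) {} a2" using p by simp
          show "v2 6 + ?c \<le> F" using le by (rule kernel_bound_le_F)
        qed (use cln in auto)
        then show "wp push_clique (wp (Asg 27 (Vr 4)) (wp solve (wp (Asg 17 (Vr 17 \<oplus> Vr 24)) ?R))) v2 a2"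
        proof (rule wp_frame)
          fix v3 a3
          assume l: "listed (v3 6) ({} \<union> cl Q j) a3" and ag3: "agree (vmod push_clique) (amod push_clique) v2 a2 v3 a3"
          have e3: "env v3 a3" using env_agree[OF e2 ag3] by (simp add: mods)
          have v3: "v3 17 = v 17" "a3 6 = a1 6" "a3 7 = a1 7" "a3 8 = a 8"
            using ag3 v2 by (auto simp: agree_def mods)
          have v34: "v3 4 = card K" using e3 by (simp add: env_def)
          let ?v3 = "v3(27 := card K)"
          have e3': "env ?v3 a3" using env_upd[OF e3] by simp
          have le3: "v3 6 \<le> kernel_bound (card K)"
          proof -
            have "v3 6 = card (K \<union> ({} \<union> cl Q j))" using listed_card[OF l] .
            also have "\<dots> \<le> card K + ?c" using card_Un_le[of K "cl Q j"] by simp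
            finally show ?thesis using le p by simp
          qed
          have sv: "wp solve (\<lambda>v' a'. enat (v' 24) = min (optR (K \<union> ({} \<union> cl Q j)) (Kl ` {..<card K})) (enat (kk + 1))) ?v3 a3"
            by (rule solve_listed[OF e3']) (use l le3 cln in auto)
          have "wp solve (wp (Asg 17 (Vr 17 \<oplus> Vr 24)) ?R) ?v3 a3"
          proof (rule wp_frame[OF sv])
            fix v4 a4
            assume s: "enat (v4 24) = min (optR (K \<union> ({} \<union> cl Q j)) (Kl ` {..<card K})) (enat (kk + 1))"
              and ag4: "agree (vmod solve) (amod solve) ?v3 a3 v4 a4"
            have v4: "v4 17 = v 17" "a4 6 = a1 6" "a4 7 = a1 7" "a4 8 = a 8"
              using ag4 v3 by (auto simp: agree_def mods)
            have s': "enat (v4 24) = min (optR (K \<union> cl Q j) K) (enat (kk + 1))"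
              using s Kl_bij by (simp add: bij_betw_def)
            have "enat (v4 24) \<le> enat (kk + 1)" unfolding s' by simp
            then have w: "v 17 + v4 24 \<le> n + Suc j * (kk + 1)" using v17 by simp
            have "n + Suc j * (kk + 1) \<le> n + (n + 1) * (kk + 1)" using v(2) by (intro add_left_mono mult_le_mono1) simp
            then have wB: "v 17 + v4 24 \<le> B" using w B_ge(3) by linarith
            have m4: "member a4 = member a1" using v4(2) by (simp add: member_def fun_eq_iff)
            have "few_similar C a4" using few1 v4 by (simp add: few_similar_def similar_before_def m4)
            moreover have "recorded Q (Suc j) a4" using rec1(1) unfolding recorded_def m4 v4 .
            moreover have "\<forall>u. a4 8 u = of_bool (u \<in> C)" using C(2) v4 by simp
            moreover have "C \<subseteq> leaders Q \<inter> {..<Suc j}" using C(1) by auto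
            moreover have "opt {..<n} \<le> enat kk \<longleftrightarrow>
                enat (v 17 + v4 24) + opt (kernel Q (C \<union> later Q (Suc j))) \<le> enat kk"
              unfolding C(4) opt_delete_recorded[OF g rec1(1) j C(1) False[unfolded t_def not_less]]
              by (rule add_capped_le_iff[OF s'])
            ultimately have "?R (v4(17 := v 17 + v4 24)) a4"
              unfolding cliques_inv_def using w by (intro conjI exI[of _ C]) simp_all
            then show "wp (Asg 17 (Vr 17 \<oplus> Vr 24)) ?R v4 a4" using v4 wB by simp
          qed
          then show "wp (Asg 27 (Vr 4)) (wp solve (wp (Asg 17 (Vr 17 \<oplus> Vr 24)) ?R)) v3 a3"
            using v34 kernel_bound_le_B card_K(2) by simp
        qed
      qed
      then show ?thesis using False t tB v1 by simp
    qed
  qed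
qed

lemma cliques_correct:
  assumes e: "env v a" and p: "pruned Q v a" and a8: "\<forall>u. a 8 u = 0"
  shows "wp cliques (cliques_inv Q n) v a"
proof -
  have g: "good Q" and a4: "\<forall>u. a 4 u = of_bool (u \<in> Q)" using p by (auto simp: pruned_def)
  let ?l = "Rd 4 (Vr 12) \<otimes> not_exp (Sm 50 0 (before_exp 4))"
  define body where "body = Cd ?l cliques_body Nop"
  define double where "double = Fr 22 4 (Asg 19 (Vr 19 \<oplus> Vr 19))"
  have mb: "vmod body = vmod cliques_body" "amod body = amod cliques_body" by (simp_all add: body_def)
  have md: "vmod double = {22, 19}" "amod double = {}" by (simp_all add: double_def)
  have c: "v 4 = card K" using e by (simp add: env_def)
  have manyB: "many \<le> B"
    using kept_bound_ge[of "card K"] kernel_bound_ge(2)[of "card K"] kernel_bound_le_B by linarith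
  have dbl: "wp double (\<lambda>v' a'. v' 19 = many) (v(19 := 2)) a"
    unfolding double_def
  proof (rule wp_Fr[where Inv = "\<lambda>j v' a'. (v' :: nat \<Rightarrow> nat) 19 = 2 * 2 ^ j"])
    show "U 4 \<le> U 22" using B_simps by simp
    fix j and v' :: "nat \<Rightarrow> nat" and a' :: arrays
    assume j: "j < (v(19 := 2)) 4" and I: "v' 19 = 2 * 2 ^ j"
    have "2 * 2 ^ Suc j \<le> many" using j c by (intro mult_le_mono2 power_increasing) auto
    then have "v' 19 + v' 19 \<le> B" using I manyB by simp
    then show "wp (Asg 19 (Vr 19 \<oplus> Vr 19)) (\<lambda>v' a'. v' 19 = 2 * 2 ^ Suc j) (v'(22 := j)) a'"
      using I by simp
  qed (use c in auto)
  have "wp double (wp (Fr 12 0 body) (cliques_inv Q n)) (v(19 := 2)) a"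
  proof (rule wp_frame[OF dbl])
    fix v1 a1 assume v19: "v1 19 = many" and ag: "agree (vmod double) (amod double) (v(19 := 2)) a v1 a1"
    have a1: "a1 = a" using ag by (auto simp: agree_def md)
    have e1: "env v1 a1" using env_agree[OF env_upd[OF e] ag] by (simp add: md)
    have v17: "v1 17 = v 17" using ag by (simp add: agree_def md)
    show "wp (Fr 12 0 body) (cliques_inv Q n) v1 a1"
    proof (rule wp_Fr[where Inv = "cliques_inv Q"])
      show "U 0 \<le> U 12" using B_simps by simp
      have "later Q 0 = leaders Q" by (auto simp: later_def)
      then have "opt {..<n} = enat (v 17) + opt (kernel Q ({} \<union> later Q 0))"
        using p kernel_leaders[OF g] by (simp add: pruned_def)
      then show "cliques_inv Q 0 v1 a1"
        unfolding cliques_inv_def using p a8 v17 a1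
        by (intro conjI exI[of _ "{}"]) (auto simp: recorded_def few_similar_def pruned_def)
      show "cliques_inv Q n v' a'" if "cliques_inv Q (v1 0) v' a'" for v' a'
        using that e1 by (simp add: env_def)
      fix j v' a'
      assume j: "j < v1 0" and I: "cliques_inv Q j v' a'"
        and ag': "agree (insert 12 (vmod body)) (amod body) v1 a1 v' a'"
      have jn: "j < n" using j e1 by (simp add: env_def)
      have e': "env (v'(12 := j)) a'"
        using env_upd[OF env_agree[OF e1 ag']] by (simp add: mb mods)
      have v': "v' 19 = many" "\<forall>u. a' 4 u = of_bool (u \<in> Q)"
        using ag' v19 a1 a4 by (auto simp: agree_def mb mods)
      have l: "eval ?l (v'(12 := j)) a' \<noteq> 0 \<longleftrightarrow> j \<in> leaders Q"
        by (rule eval_leader[OF e' _ jn v'(2) goodD(3)[OF g]]) simp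
      show "wp body (cliques_inv Q (Suc j)) (v'(12 := j)) a'"
      proof (cases "j \<in> leaders Q")
        case True
        have "cliques_inv Q j (v'(12 := j)) a'" using I by (simp add: cliques_inv_def)
        then have "wp cliques_body (cliques_inv Q (Suc j)) (v'(12 := j)) a'"
          using jn v' True by (intro cliques_body_correct[OF e' _ _ _ _ g]) auto
        then show ?thesis unfolding body_def wp.simps(6) using l True by simp
      next
        case False
        then have "cliques_inv Q (Suc j) (v'(12 := j)) a'" by (intro cliques_inv_skip[OF I]) auto
        then show ?thesis unfolding body_def wp.simps(6) using l False by simp
      qed
    qed
  qed
  then show ?thesis using B_simps unfolding cliques_def body_def double_def by simp
qed

lemma finish_correct:
  assumes e: "env v a" and g: "good Q" and I: "cliques_inv Q n v a"
  shows "wp finish (\<lambda>v' a'. v' 0 = of_bool (opt {..<n} \<le> enat kk \<and> v 2 = 0)) v a"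
proof -
  let ?R = "\<lambda>v' a'. v' 0 = of_bool (opt {..<n} \<le> enat kk \<and> v 2 = 0)"
  have "later Q n = {}" using leaders_sub goodD(3)[OF g] by (force simp: later_def)
  then obtain C where C: "C \<subseteq> leaders Q \<inter> {..<n}" "\<forall>u. a 8 u = of_bool (u \<in> C)" "few_similar C a"
    "opt {..<n} \<le> enat kk \<longleftrightarrow> enat (v 17) + opt (kernel Q C) \<le> enat kk"
    using I unfolding cliques_inv_def by auto
  have rec: "recorded Q n a" and v17: "v 17 \<le> n + n * (kk + 1)" using I by (auto simp: cliques_inv_def)
  have size: "card (kernel Q C) \<le> kernel_bound (card K)"
    by (rule card_kernel[OF g _ C(3)]) (use C(1) rec in \<open>auto simp: recorded_def\<close>)
  have kn: "kernel Q C \<subseteq> {..<n}" using Kn cl_sub goodD(3)[OF g] by (force simp: kernel_def)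
  define X where "X j = (\<Union>u\<in>C \<inter> {..<j}. cl Q u)" for j
  have KX: "K \<union> X j \<subseteq> kernel Q C" for j by (auto simp: X_def kernel_def)
  let ?b = "Cd (Rd 8 (Vr 12)) (Asg 5 (Rd 7 (Vr 12)) \<Zsemi> push_clique) Nop"
  have mb: "vmod ?b = {5, 22, 6}" "amod ?b = {9}" by (auto simp: mods)
  have loop: "wp (Fr 12 0 ?b) (\<lambda>v' a'. listed (v' 6) (X n) a') v1 a1"
    if e1: "env v1 a1" and l1: "listed (v1 6) {} a1" and a1: "a1 6 = a 6" "a1 7 = a 7" "a1 8 = a 8" for v1 a1
  proof (rule wp_Fr[where Inv = "\<lambda>j v' a'. listed (v' 6) (X j) a'"])
    show "U 0 \<le> U 12" using B_simps by simp
    show "listed (v1 6) (X 0) a1" using l1 by (simp add: X_def)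
    show "listed (v' 6) (X n) a'" if "listed (v' 6) (X (v1 0)) a'" for v' a'
      using that e1 by (simp add: env_def)
    fix j v' a'
    assume j: "j < v1 0" and l: "listed (v' 6) (X j) a'"
      and ag: "agree (insert 12 (vmod ?b)) (amod ?b) v1 a1 v' a'"
    have jn: "j < n" using j e1 by (simp add: env_def)
    have a': "a' 6 = a 6" "a' 7 = a 7" "a' 8 = a 8" using ag a1 by (auto simp: agree_def mods)
    show "wp ?b (\<lambda>v' a'. listed (v' 6) (X (Suc j)) a') (v'(12 := j)) a'"
    proof (cases "j \<in> C")
      case True
      then have jl: "j \<in> leaders Q" using C(1) by auto
      then have jQ: "j \<in> Q" using leaders_sub by blast
      let ?c = "card (cl Q j)"
      have r: "a 7 j = ?c" "bij_betw (member a j) {..<?c} (cl Q j)"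
        using rec jl jn by (auto simp: recorded_def)
      have XS: "X (Suc j) = X j \<union> cl Q j" using True by (auto simp: X_def less_Suc_eq)
      have "env v' a'" by (rule env_agree[OF e1 ag]) (simp_all add: mods)
      then have e': "env (v'(12 := j, 5 := ?c)) a'" by (simp add: env_def)
      have "cl Q u \<inter> cl Q j = {}" if "u \<in> C \<inter> {..<j}" for u
        using that C(1) jl by (intro leader_disjoint[OF goodD(2)[OF g]]) auto
      then have disj: "cl Q j \<inter> (K \<union> X j) = {}"
        using goodD(2)[OF g] cl_sub[of Q j] unfolding X_def by blast
      have fin: "finite (K \<union> X j)" using KX kn finite_subset by (meson finite_lessThan)
      have "v' 6 + ?c = card (K \<union> X j \<union> cl Q j)"
        unfolding listed_card[OF l] using disj fin finite_cl[OF g]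
        by (subst card_Un_disjoint) auto
      also have "\<dots> \<le> card (kernel Q C)"
        using KX[of "Suc j"] kn finite_subset[OF kn] unfolding XS by (intro card_mono) auto
      finally have le: "v' 6 + ?c \<le> F" using size kernel_bound_le_F by simp
      have "wp push_clique (\<lambda>v' a'. listed (v' 6) (X j \<union> cl Q j) a') (v'(12 := j, 5 := ?c)) a'"
      proof (rule push_clique_correct[OF e', where u = j and c = ?c])
        show "bij_betw (member a' j) {..<?c} (cl Q j)" using r(2) a' by (simp add: member_def[abs_def])
        show "cl Q j \<subseteq> {..<n}" using cl_sub goodD(3)[OF g] by blast
      qed (use l le disj in auto)
      then show ?thesis
        using True C(2) a' r(1) card_cl_le_F[OF g jQ] unfolding XS by simp
    next
      case False
      then have "X (Suc j) = X j" by (auto simp: X_def less_Suc_eq)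
      then show ?thesis using False l C(2) a' by simp
    qed
  qed
  show ?thesis
    unfolding finish_def wp.simps(5)
  proof (rule wp_frame[OF push_K_correct[OF e]])
    fix v1 a1
    assume p: "v1 6 = card K \<and> listed (card K) {} a1" and ag1: "agree (vmod push_K) (amod push_K) v a v1 a1"
    have e1: "env v1 a1" using env_agree[OF e ag1] by (simp add: mods)
    have v1: "v1 17 = v 17" "v1 2 = v 2" "a1 6 = a 6" "a1 7 = a 7" "a1 8 = a 8"
      using ag1 by (auto simp: agree_def mods)
    have l: "wp (Fr 12 0 ?b) (\<lambda>v' a'. listed (v' 6) (X n) a') v1 a1"
      using p v1 by (intro loop[OF e1]) auto
    show "wp (Fr 12 0 ?b) (wp (Asg 27 (Cn 1)) (wp solve (wp (Asg 17 (Vr 17 \<oplus> Vr 24))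
        (wp (Asg 0 (not_exp (LtE (Vr 1) (Vr 17)) \<otimes> not_exp (Vr 2))) ?R)))) v1 a1"
    proof (rule wp_frame[OF l])
      fix v2 a2
      assume l2: "listed (v2 6) (X n) a2" and ag2: "agree (vmod (Fr 12 0 ?b)) (amod (Fr 12 0 ?b)) v1 a1 v2 a2"
      have e2: "env v2 a2" using env_agree[OF e1 ag2] by (simp add: mods)
      have v2: "v2 17 = v 17" "v2 2 = v 2" using ag2 v1 by (auto simp: agree_def mods)
      let ?v2 = "v2(27 := 1)"
      have e2': "env ?v2 a2" using env_upd[OF e2] by simp
      have Kn': "K \<union> X n = kernel Q C" using C(1) by (auto simp: X_def kernel_def)
      have le: "v2 6 \<le> kernel_bound (card K)" using listed_card[OF l2] size Kn' by simp
      \<comment> \<open>The contracted set is the single vertex 0, so by \<open>opt_eq_optR\<close>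
        the search returns the capped optimum of the kernel.\<close>
      have r0: "Kl ` {..<1} = {0}" using Kl_0 by auto
      have "wp solve (\<lambda>v' a'. enat (v' 24) = min (optR (K \<union> X n) (Kl ` {..<1})) (enat (kk + 1))) ?v2 a2"
        by (rule solve_listed[OF e2']) (use l2 le card_K KX kn in auto)
      then have sv: "wp solve (\<lambda>v' a'. enat (v' 24) = min (opt (kernel Q C)) (enat (kk + 1))) ?v2 a2"
        unfolding Kn' r0 using opt_eq_optR[of 0 "kernel Q C"] K0 by (simp add: kernel_def)
      have "wp solve (wp (Asg 17 (Vr 17 \<oplus> Vr 24))
        (wp (Asg 0 (not_exp (LtE (Vr 1) (Vr 17)) \<otimes> not_exp (Vr 2))) ?R)) ?v2 a2"
      proof (rule wp_frame[OF sv])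
        fix v3 a3
        assume s: "enat (v3 24) = min (opt (kernel Q C)) (enat (kk + 1))"
          and ag3: "agree (vmod solve) (amod solve) ?v2 a2 v3 a3"
        have e3: "env v3 a3" using env_agree[OF e2' ag3] by (simp add: mods)
        have v3: "v3 17 = v 17" "v3 2 = v 2" "v3 1 = kk" using ag3 v2 e3 by (auto simp: agree_def mods env_def)
        have "enat (v3 24) \<le> enat (kk + 1)" unfolding s by simp
        then have "v 17 + v3 24 \<le> n + (n + 1) * (kk + 1)" using v17 by simp
        then have wB: "v 17 + v3 24 \<le> B" using B_ge(3) by linarith
        have "opt {..<n} \<le> enat kk \<longleftrightarrow> enat (v 17 + v3 24) + 0 \<le> enat kk"
          unfolding C(4) using add_capped_le_iff[OF s, of "v 17" 0] by simp
        then have "opt {..<n} \<le> enat kk \<longleftrightarrow> \<not> kk < v 17 + v3 24" by auto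
        then show "wp (Asg 17 (Vr 17 \<oplus> Vr 24))
            (wp (Asg 0 (not_exp (LtE (Vr 1) (Vr 17)) \<otimes> not_exp (Vr 2))) ?R) v3 a3"
          using v3 wB n1 by simp
      qed
      then show "wp (Asg 27 (Cn 1)) (wp solve (wp (Asg 17 (Vr 17 \<oplus> Vr 24))
        (wp (Asg 0 (not_exp (LtE (Vr 1) (Vr 17)) \<otimes> not_exp (Vr 2))) ?R))) v2 a2"
        using B_simps by simp
    qed
  qed
qed

end

lemma exhaustive_bound_mono_arg: "k \<le> l \<Longrightarrow> exhaustive_bound k \<le> exhaustive_bound l"
proof -
  assume kl: "k \<le> l"
  have p: "(2 :: nat) ^ x \<le> 2 ^ y" if "x \<le> y" for x y :: nat using that by (intro power_increasing) simp_all
  have c: "clique_bound k \<le> clique_bound l"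
    unfolding clique_bound_def by (intro mult_le_mono add_le_mono p kl order_refl)
  have "kept_bound k \<le> kept_bound l"
    unfolding kept_bound_def by (intro mult_le_mono add_le_mono p kl c order_refl)
  then have "kernel_bound k \<le> kernel_bound l"
    unfolding kernel_bound_def by (intro mult_le_mono add_le_mono kl c)
  then show ?thesis unfolding exhaustive_bound_def by (intro mult_le_mono add_le_mono p order_refl)
qed

section \<open>Composition of the phases, word size and running time\<close>

context FGC_bounds
begin

lemma FGC_mods:
  "vmod copy_adj = {3, 10, 14}" "amod copy_adj = {0}"
  "vmod labels = {10, 11, 13, 14, 15}" "amod labels = {1}"
  "vmod pack_P3 = {10, 11, 12, 13, 21}" "amod pack_P3 = {2}"
  "vmod list_K = {4, 12}" "amod list_K = {3}"
  "vmod prune = {12, 17, 18, 20, 28}" "amod prune = {4, 5}"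
  "vmod cliques = {19, 22, 12, 5, 11, 20, 6, 16, 27, 23, 7, 8, 9, 24, 25, 26, 17}"
  "amod cliques = {6, 7, 8, 9, 10}"
  by (auto simp: program_defs)

lemma kernelize_correct:
  assumes G: "su_graph {..<n} S T"
    and F: "exhaustive_bound (3 * cluster_distance {..<n} (S \<union> T) + 1) \<le> F"
    and v: "v 0 = n" "v 1 = kk" "v 3 = n * n" "v 4 = card K"
    and a0: "\<And>x y. x < n \<Longrightarrow> y < n \<Longrightarrow> a 0 (x * n + y) \<noteq> 0 \<longleftrightarrow> {x, y} \<in> S \<union> T"
    and a1: "\<forall>x<n. \<forall>y<n. a 1 x = a 1 y \<longleftrightarrow> reach S x y"
    and a2: "\<forall>x. a 2 x \<noteq> 0 \<longleftrightarrow> x \<in> K" and a3: "bij_betw (a 3) {..<card K} K" "a 3 0 = 0"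
    and a48: "\<forall>u. a 4 u = 0" "\<forall>u. a 8 u = 0"
    and K: "K \<subseteq> {..<n}" "0 \<in> K" "card K \<le> 3 * cluster_distance {..<n} (S \<union> T) + 1"
      "\<forall>u v w. P3 (S \<union> T) u v w \<longrightarrow> {u, v, w} \<inter> K \<noteq> {}"
  shows "wp (prune \<Zsemi> cliques \<Zsemi> finish)
    (\<lambda>v' a'. v' 0 = of_bool (unweighted_FGC {..<n} S T (int kk) \<and> v 2 = 0)) v a"
proof -
  let ?E = "S \<union> T"
  interpret I: FGC_instance U B W base inp n kk F ?E "a 1" K "a 3"
  proof unfold_locales
    show "card e = 2" "e \<subseteq> {..<n}" if "e \<in> ?E" for e using G that by (auto simp: su_graph_def)
    show "{u, w} \<in> ?E" if "u \<notin> K" "v \<notin> K" "w \<notin> K" "u \<noteq> w" "{u, v} \<in> ?E" "{v, w} \<in> ?E" for u v w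
    proof (rule ccontr)
      assume "{u, w} \<notin> ?E"
      then have "P3 ?E u v w" using that by (simp add: P3_def)
      then show False using K(4) that by blast
    qed
    show "exhaustive_bound (card K) \<le> F" using exhaustive_bound_mono_arg[OF K(3)] F by (rule le_trans)
  qed (use K a3 in auto)
  have e: "I.env v a" using v a0 a2 unfolding I.env_def by blast
  have fgc: "unweighted_FGC {..<n} S T (int kk) \<longleftrightarrow> I.opt {..<n} \<le> enat kk"
    using a1 by (intro unweighted_FGC_iff_opt[OF G]) auto
  show ?thesis
    unfolding wp.simps(5)
  proof (rule wp_frame[OF I.prune_correct[OF e a48(1)]])
    fix v1 a1 assume "\<exists>Q. I.pruned Q v1 a1" and ag: "agree (vmod prune) (amod prune) v a v1 a1"
    then obtain Q where Q: "I.pruned Q v1 a1" by blast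
    have e1: "I.env v1 a1" by (rule I.env_agree[OF e ag]) (simp_all add: FGC_mods)
    have v1: "v1 2 = v 2" "\<forall>u. a1 8 u = 0" using ag a48 by (auto simp: agree_def FGC_mods)
    show "wp cliques (wp finish (\<lambda>v' a'. v' 0 = of_bool (unweighted_FGC {..<n} S T (int kk) \<and> v 2 = 0))) v1 a1"
    proof (rule wp_frame[OF I.cliques_correct[OF e1 Q v1(2)]])
      fix v2 a2 assume c: "I.cliques_inv Q n v2 a2" and ag2: "agree (vmod cliques) (amod cliques) v1 a1 v2 a2"
      have e2: "I.env v2 a2" by (rule I.env_agree[OF e1 ag2]) (simp_all add: FGC_mods)
      have "v2 2 = v 2" using ag2 v1 by (auto simp: agree_def FGC_mods)
      moreover have "I.good Q" using Q unfolding I.pruned_def by blast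
      ultimately show "wp finish (\<lambda>v' a'. v' 0 = of_bool (unweighted_FGC {..<n} S T (int kk) \<and> v 2 = 0)) v2 a2"
        using I.finish_correct[OF e2 _ c] unfolding fgc by simp
    qed
  qed
qed

lemma packing_card_le:
  assumes G: "su_graph {..<n} S T" and P: "packing (S \<union> T) K"
  shows "card K \<le> 3 * cluster_distance {..<n} (S \<union> T) + 1"
proof -
  obtain PP where PP: "finite PP" "\<And>A. A \<in> PP \<Longrightarrow> \<exists>u v w. A = {u, v, w} \<and> P3 (S \<union> T) u v w"
    "\<And>A A'. A \<in> PP \<Longrightarrow> A' \<in> PP \<Longrightarrow> A \<noteq> A' \<Longrightarrow> A \<inter> A' = {}" "card K \<le> 3 * card PP + 1"
    using P unfolding packing_def by metis
  have "card PP \<le> cluster_distance {..<n} (S \<union> T)"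
  proof (rule cluster_distance_ge_packing)
    show "e \<subseteq> {..<n}" if "e \<in> S \<union> T" for e using G that by (auto simp: su_graph_def)
  qed (use PP in \<open>auto simp: P3_def\<close>)
  then show ?thesis using PP(4) by linarith
qed

lemma FGC_com_correct:
  assumes G: "su_graph {..<n} S T"
    and F: "exhaustive_bound (3 * cluster_distance {..<n} (S \<union> T) + 1) \<le> F"
    and inp: "\<And>p. p < n * n \<Longrightarrow> inp p = (let e = {p div n, p mod n} in if e \<in> S then 1 else if e \<in> T then 2 else 0)"
    and v: "v 0 = n" "v 1 = kk"
  shows "wp FGC_com (\<lambda>v' a'. v' 0 = of_bool (unweighted_FGC {..<n} S T (int kk) \<and> v 2 = 0)) v (\<lambda>_ _. 0)"
proof -
  let ?E = "S \<union> T" and ?a = "\<lambda>_ _. 0 :: nat"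
  define R where "R v' a' \<longleftrightarrow> v' 0 = of_bool (unweighted_FGC {..<n} S T (int kk) \<and> v 2 = 0)"
    for v' :: "nat \<Rightarrow> nat" and a' :: arrays
  have inp1: "inp (x * n + y) = 1 \<longleftrightarrow> {x, y} \<in> S" "inp (x * n + y) \<noteq> 0 \<longleftrightarrow> {x, y} \<in> ?E"
    if "x < n" "y < n" for x y
    using inp[of "x * n + y"] pair_decode[OF that] by (auto simp: Let_def)
  have En: "e \<subseteq> {..<n} \<and> card e = 2" if "e \<in> ?E" for e using G that by (auto simp: su_graph_def)
  have "wp FGC_com R v ?a"
    unfolding FGC_com_def wp.simps(5)
  proof (rule wp_frame[OF copy_adj_correct[of v ?a, OF v(1)]])
    fix v1 a1
    assume c: "v1 3 = n * n \<and> (\<forall>p<n * n. a1 0 p = inp p)" and ag1: "agree (vmod copy_adj) (amod copy_adj) v ?a v1 a1"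
    have v1: "v1 0 = n" "v1 1 = kk" "v1 2 = v 2" "\<And>x. x \<noteq> 0 \<Longrightarrow> a1 x = (\<lambda>_. 0)"
      using ag1 v by (auto simp: agree_def FGC_mods)
    have l: "wp labels (\<lambda>v' a'. \<forall>x<n. \<forall>y<n. a' 1 x = a' 1 y \<longleftrightarrow> reach S x y) v1 a1"
      by (rule labels_correct) (use v1 c inp1(1) En in auto)
    show "wp labels (wp pack_P3 (wp list_K (wp prune (wp cliques (wp finish R))))) v1 a1"
    proof (rule wp_frame[OF l])
      fix v2 a2
      assume l2: "\<forall>x<n. \<forall>y<n. a2 1 x = a2 1 y \<longleftrightarrow> reach S x y" and ag2: "agree (vmod labels) (amod labels) v1 a1 v2 a2"
      have v2: "v2 0 = n" "v2 1 = kk" "v2 2 = v 2" "v2 3 = n * n" "a2 0 = a1 0" "\<And>x. 1 < x \<Longrightarrow> a2 x = (\<lambda>_. 0)"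
        using ag2 v1 c by (auto simp: agree_def FGC_mods)
      have adj: "a2 0 (x * n + y) \<noteq> 0 \<longleftrightarrow> {x, y} \<in> ?E" if "x < n" "y < n" for x y
        using inp1(2)[OF that] pair_decode(1)[OF that] c v2(5) by simp
      have p: "wp pack_P3 (\<lambda>v' a'. \<exists>K. (\<forall>x. a' 2 x \<noteq> 0 \<longleftrightarrow> x \<in> K) \<and> K \<subseteq> {..<n} \<and> 0 \<in> K \<and> packing ?E K \<and>
          (\<forall>u v w. P3 ?E u v w \<longrightarrow> {u, v, w} \<inter> K \<noteq> {})) v2 a2"
        by (rule pack_P3_correct) (use v2 adj En in auto)
      show "wp pack_P3 (wp list_K (wp prune (wp cliques (wp finish R)))) v2 a2"
      proof (rule wp_frame[OF p])
        fix v3 a3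
        assume "\<exists>K. (\<forall>x. a3 2 x \<noteq> 0 \<longleftrightarrow> x \<in> K) \<and> K \<subseteq> {..<n} \<and> 0 \<in> K \<and> packing ?E K \<and>
          (\<forall>u v w. P3 ?E u v w \<longrightarrow> {u, v, w} \<inter> K \<noteq> {})"
          and ag3: "agree (vmod pack_P3) (amod pack_P3) v2 a2 v3 a3"
        then obtain K where K: "\<forall>x. a3 2 x \<noteq> 0 \<longleftrightarrow> x \<in> K" "K \<subseteq> {..<n}" "0 \<in> K" "packing ?E K"
          "\<forall>u v w. P3 ?E u v w \<longrightarrow> {u, v, w} \<inter> K \<noteq> {}" by blast
        have v3: "v3 0 = n" "v3 1 = kk" "v3 2 = v 2" "v3 3 = n * n" "a3 0 = a2 0" "a3 1 = a2 1"
          "\<And>x. 2 < x \<Longrightarrow> a3 x = (\<lambda>_. 0)"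
          using ag3 v2 by (auto simp: agree_def FGC_mods)
        have cK: "card K \<le> 3 * cluster_distance {..<n} ?E + 1" by (rule packing_card_le[OF G K(4)])
        have "card K \<le> kernel_bound (card K)" using kernel_bound_ge(1)[of "card K"] by linarith
        then have "card K \<le> F"
          using kernel_bound_le[of "card K"] exhaustive_bound_mono_arg[OF cK] F by linarith
        then have li: "wp list_K (\<lambda>v' a'. v' 4 = card K \<and> bij_betw (a' 3) {..<card K} K \<and> a' 3 0 = 0) v3 a3"
          using K v3(1) by (intro list_K_correct) auto
        show "wp list_K (wp prune (wp cliques (wp finish R))) v3 a3"
        proof (rule wp_frame[OF li])
          fix v4 a4
          assume b: "v4 4 = card K \<and> bij_betw (a4 3) {..<card K} K \<and> a4 3 0 = 0"
            and ag4: "agree (vmod list_K) (amod list_K) v3 a3 v4 a4"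
          have v4: "v4 0 = n" "v4 1 = kk" "v4 2 = v 2" "v4 3 = n * n" "a4 0 = a2 0" "a4 1 = a2 1" "a4 2 = a3 2"
            "\<And>x. 3 < x \<Longrightarrow> a4 x = (\<lambda>_. 0)"
            using ag4 v3 by (auto simp: agree_def FGC_mods)
          have "wp (prune \<Zsemi> cliques \<Zsemi> finish)
            (\<lambda>v' a'. v' 0 = of_bool (unweighted_FGC {..<n} S T (int kk) \<and> v4 2 = 0)) v4 a4"
            by (rule kernelize_correct[OF G F, where K = K]) (use v4 b K l2 adj cK in auto)
          then show "wp prune (wp cliques (wp finish R)) v4 a4"
            unfolding v4(3) R_def wp.simps(5) .
        qed
      qed
    qed
  qed
  then show ?thesis by (rule wp_mono) (simp add: R_def)
qed

end

definition FGC_factor :: "nat \<Rightarrow> nat" where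
  "FGC_factor l = 16 + exhaustive_bound (3 * l + 1)"

text \<open>The first instruction sets the base address of the arrays to n * n, directly behind the
  adjacency matrix.\<close>

definition FGC_prog :: prog where
  "FGC_prog = Seq (Arith 70 Mul (Reg 0) (Reg 0)) (compile 71 FGC_com)"

lemma FGC_prog_exec:
  assumes n1: "1 \<le> n" and G: "su_graph {..<n} S T"
    and F: "F = FGC_factor (cluster_distance {..<n} (S \<union> T))"
    and B: "B = 4 * F * (n + nat \<bar>k\<bar> + 1) ^ 3" and W: "B ^ (deg FGC_com + 1) \<le> W"
  shows "\<exists>t R M. exec W FGC_prog (instance_state n S T k) t (R, M) \<and>
    t \<le> (F ^ factor_com FGC_com + 1) * n ^ 3 \<and> R 0 = (if unweighted_FGC {..<n} S T k then 1 else 0)"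
proof -
  define kk where "kk = nat \<bar>k\<bar>"
  define N where "N = n + kk + 1"
  define U where "U r = (if r = 0 then n else if r = 3 then n * n else if r = 21 then n * (n * n)
    else if 4 \<le> r \<and> r \<le> 9 then F else B)" for r :: nat
  define inp where "inp = snd (instance_state n S T k)"
  define R0 where "R0 = fst (instance_state n S T k)"
  have F16: "16 \<le> F" by (simp add: F FGC_factor_def)
  \<comment> \<open>With N = n + |k| + 1 the cube N * N * N dominates n * n * n and (n + 1) * (|k| +
    1), and the factor 4 * F leaves room for the sums and for 2 * F. The budget appears here only;
    the loop bounds involve F and n alone.\<close>
  have BN: "B = 4 * F * (N * (N * N))" by (simp add: B N_def kk_def power3_eq_cube)
  have N1: "1 \<le> N" "n \<le> N" "kk + 1 \<le> N" "n + 1 \<le> N" by (auto simp: N_def n1)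
  have NNN: "1 * (1 * 1) \<le> N * (N * N)" "n * (n * n) \<le> N * (N * N)" "1 * (1 * n) \<le> N * (N * N)"
    "1 * ((n + 1) * (kk + 1)) \<le> N * (N * N)" "1 * (n * n) \<le> N * (N * N)" "1 * (1 * kk) \<le> N * (N * N)"
    using N1 by (intro mult_le_mono; simp)+
  have FN: "F * 1 \<le> F * (N * (N * N))" "16 * (N * (N * N)) \<le> F * (N * (N * N))"
    using F16 NNN(1) by (intro mult_le_mono order_refl; simp)+
  have ge: "16 \<le> B" "n * (n * n) \<le> B" "2 * F \<le> B" "n + (n + 1) * (kk + 1) \<le> B" "n * n < B" "n \<le> B" "kk \<le> B"
    using NNN FN F16 unfolding BN mult.assoc[of 4] by linarith+
  have inpp: "inp p = (let e = {p div n, p mod n} in if e \<in> S then 1 else if e \<in> T then 2 else 0)"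
    if "p < n * n" for p
    using that by (simp add: inp_def instance_state_def)
  interpret FGC_bounds U B W "n * n" inp n kk F
  proof unfold_locales
    show "U r \<le> B" for r using ge by (auto simp: U_def)
    show "inp p \<le> 2" if "p < n * n" for p using inpp[OF that] by (simp add: Let_def)
  qed (use ge n1 F16 in \<open>auto simp: U_def\<close>)
  have R0: "R0 0 = n" "R0 1 = kk" "R0 2 = of_bool (k < 0)" "\<And>r. 2 < r \<Longrightarrow> R0 r = 0"
    by (auto simp: R0_def instance_state_def kk_def)
  let ?R = "R0(70 := n * n)"
  have "com_result 71 FGC_com (\<lambda>v' a'. v' 0 = of_bool (unweighted_FGC {..<n} S T (int kk) \<and> R0 2 = 0)) ?R inp"
  proof (rule compile_correct[where v = R0 and a = "\<lambda>_ _. 0"])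
    show "wp FGC_com (\<lambda>v' a'. v' 0 = of_bool (unweighted_FGC {..<n} S T (int kk) \<and> R0 2 = 0)) R0 (\<lambda>_ _. 0)"
      by (rule FGC_com_correct[OF G]) (use R0 inpp in \<open>auto simp: F FGC_factor_def\<close>)
    show "bounded R0 (\<lambda>_ _. 0)"
      unfolding bounded_def
    proof (intro conjI allI impI)
      fix r :: nat
      consider "r = 0" | "r = 1" | "r = 2" | "2 < r" by linarith
      then show "R0 r \<le> U r" using R0 ge by cases (auto simp: U_def)
    qed simp
    show "rel_mem (\<lambda>_ _. 0) inp" unfolding rel_mem_def by (simp add: inp_def instance_state_def)
    have "B ^ deg FGC_com \<le> B ^ (deg FGC_com + 1)" by (rule pow_mono) simp
    then show "B ^ deg FGC_com \<le> W" using W by (rule le_trans)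
  qed (auto simp: wfc_FGC_com)
  then obtain t R M where ex: "exec W (compile 71 FGC_com) (?R, inp) t (R, M)" "t \<le> cost FGC_com"
    "R 0 = of_bool (unweighted_FGC {..<n} S T (int kk) \<and> R0 2 = 0)"
    unfolding com_result_def by fastforce
  have "B \<le> B ^ (deg FGC_com + 1)" by (rule B_le_pow)
  then have "n * n < W" using W ge(5) by linarith
  then have "exec W (Arith 70 Mul (Reg 0) (Reg 0)) (R0, inp) 1 (?R, inp)"
    by (intro exec.Arith) (simp_all add: R0(1))
  then have "exec W FGC_prog (instance_state n S T k) (1 + t) (R, M)"
    unfolding FGC_prog_def using ex(1) by (intro exec.Seq) (simp_all add: R0_def inp_def)
  moreover have "1 + t \<le> (F ^ factor_com FGC_com + 1) * n ^ 3"
  proof -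
    have "cost FGC_com \<le> F ^ factor_com FGC_com * n ^ order_com loop_order FGC_com"
    proof (rule cost_bound)
      fix r assume "r \<in> bounds FGC_com"
      then have r: "r \<in> {0, 3, 4, 5, 6, 7, 8, 9, 21}" by (simp add: bounds_FGC_com)
      show "U r \<le> F * n ^ loop_order r"
        using r F16 by (auto simp: U_def loop_order_def power2_eq_square power3_eq_cube)
    qed (use F16 n1 in auto)
    moreover have "1 \<le> n ^ 3" using n1 by simp
    ultimately show ?thesis using ex(2) unfolding order_FGC_com by (simp add: algebra_simps)
  qed
  moreover have "R 0 = (if unweighted_FGC {..<n} S T k then 1 else 0)"
  proof (cases "k < 0")
    case True
    then have "\<not> unweighted_FGC {..<n} S T k" by (auto simp: unweighted_FGC_def)
    then show ?thesis using ex(3) R0 True by simp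
  next
    case False
    then show ?thesis using ex(3) R0 by (simp add: kk_def)
  qed
  ultimately show ?thesis by blast
qed

lemma elementary_factor: "elementary FGC_factor"
proof -
  have c: "elementary (\<lambda>l. clique_bound (3 * l + 1))"
    unfolding clique_bound_def by (intro elementary_intros)
  have "elementary (\<lambda>l. kept_bound (3 * l + 1))"
    unfolding kept_bound_def by (intro elementary_intros c)
  then have k: "elementary (\<lambda>l. kernel_bound (3 * l + 1))"
    unfolding kernel_bound_def by (intro elementary_intros c)
  show ?thesis
    unfolding FGC_factor_def[abs_def] exhaustive_bound_def by (intro elementary_intros k)
qed

theorem theorem16:
  "\<exists>(P :: prog) (f :: nat \<Rightarrow> nat) (d :: nat). computable f \<and>
     (\<forall>(n :: nat) (S :: nat set set) (U :: nat set set) (k :: int).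
        n \<ge> 1 \<longrightarrow> su_graph {..<n} S U \<longrightarrow>
        (let l = cluster_distance {..<n} (S \<union> U) in
         \<exists>t R M. exec (f l * (n + nat \<bar>k\<bar> + 1) ^ d) P (instance_state n S U k) t (R, M) \<and>
                 t \<le> f l * n ^ 3 \<and>
                 R 0 = (if unweighted_FGC {..<n} S U k then 1 else 0)))"
proof -
  let ?D = "deg FGC_com + 1"
  \<comment> \<open>One function must dominate the factor of the word size and that of the time, so
    their sum is majorized by a \<open>tower\<close>. The exponent 3 * ?D arises because B contains
    a cube and enters with the power ?D.\<close>
  have "elementary (\<lambda>l. (4 * FGC_factor l) ^ ?D + (FGC_factor l ^ factor_com FGC_com + 1))"
    using elementary_factor by (intro elementary_intros)
  then obtain m where m: "\<And>l. (4 * FGC_factor l) ^ ?D + (FGC_factor l ^ factor_com FGC_com + 1) \<le> tower m (l + m)"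
    unfolding elementary_def by blast
  define f where "f l = tower m (l + m)" for l
  have "computable f" unfolding f_def[abs_def] by (rule computable_tower)
  moreover have "\<exists>t R M. exec (f l * (n + nat \<bar>k\<bar> + 1) ^ (3 * ?D)) FGC_prog (instance_state n S U k) t (R, M) \<and>
      t \<le> f l * n ^ 3 \<and> R 0 = (if unweighted_FGC {..<n} S U k then 1 else 0)"
    if n: "n \<ge> 1" and G: "su_graph {..<n} S U" and l: "l = cluster_distance {..<n} (S \<union> U)" for n S U k l
  proof -
    have b: "(4 * FGC_factor l) ^ ?D \<le> f l" "FGC_factor l ^ factor_com FGC_com + 1 \<le> f l"
      using m[of l] unfolding f_def by linarith+
    have "(4 * FGC_factor l * (n + nat \<bar>k\<bar> + 1) ^ 3) ^ ?D \<le> f l * (n + nat \<bar>k\<bar> + 1) ^ (3 * ?D)"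
      unfolding power_mult power_mult_distrib[of "4 * FGC_factor l"] by (rule mult_le_mono1[OF b(1)])
    from FGC_prog_exec[OF n G refl refl, of k, folded l, OF this]
    obtain t R M where *: "exec (f l * (n + nat \<bar>k\<bar> + 1) ^ (3 * ?D)) FGC_prog (instance_state n S U k) t (R, M)"
      "t \<le> (FGC_factor l ^ factor_com FGC_com + 1) * n ^ 3"
      "R 0 = (if unweighted_FGC {..<n} S U k then 1 else 0)" by blast
    have "t \<le> f l * n ^ 3" using *(2) mult_le_mono1[OF b(2)] by (rule le_trans)
    then show ?thesis using * by blast
  qed
  ultimately show ?thesis
    unfolding Let_def by (intro exI[of _ FGC_prog] exI[of _ f] exI[of _ "3 * ?D"]) blast
qed

end
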